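(* Let $n\in\mathbb{N}$ and let $V$ be an irreducible Harish-Chandra module over the truncated Virasoro algebra $\mathrm{Vir}\otimes(\mathbb{C}[t]/\langle t^n\rangle)$. Then $V$ is either a highest weight module, a lowest weight module, or, for some $a,b\in\mathbb{C}$, a module $V'(a,b)$ over the Virasoro algebra $\mathrm{Vir}=\mathrm{span}\{d_i,c : i\in\mathbb{Z}\}$ with $(\mathrm{Vir}\otimes t\mathbb{C}[t])V=0$.
   Context: $\mathbb{N}$ is the set of positive integers. The Virasoro algebra $\mathrm{Vir}$ is the complex Lie algebra with basis $\{c,d_i : i\in\mathbb{Z}\}$ and brackets $[d_m,d_n]=(n-m)d_{m+n}+\delta_{m,-n}\frac{m^3-m}{12}c$, $[d_m,c]=0$. For a commutative algebra $A$, $\mathrm{Vir}\otimes A$ has bracket $[x\otimes f,y\otimes g]=[x,y]\otimes fg$. The truncated Virasoro algebra is $\mathfrak{g}=\mathrm{Vir}\otimes(\mathbb{C}[t]/\langle t^n\rangle)$; write $d_i=d_i\otimes1$, $c=c\otimes 1$, so that $\mathrm{Vir}=\mathrm{Vir}\otimes1\subset\mathfrak{g}$; $\mathrm{Vir}\otimes t\mathbb{C}[t]$ acts through its image in $\mathfrak{g}$. Let $\mathfrak{g}_i=(\mathbb{C}d_i\oplus\delta_{i,0}\mathbb{C}c)\otimes(\mathbb{C}[t]/\langle t^n\rangle)$, $\mathfrak{g}_\pm=\bigoplus_{\pm i>0}\mathfrak{g}_i$. For a module $V$ and $\lambda\in\mathbb{C}$, the weight space is $V_\lambda=\{v\in V: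 d_0v=\lambda v\}$. $V$ is a weight module if it is the sum of its weight spaces; a Harish-Chandra module is a weight module all of whose weight spaces are finite-dimensional. For a linear map $\varphi:\mathfrak{g}_0\to\mathbb{C}$, let $\mathbb{C}v_0$ be the one-dimensional $(\mathfrak{g}_0+\mathfrak{g}_+)$-module with $\mathfrak{g}_+v_0=0$ and $xv_0=\varphi(x)v_0$ for $x\in\mathfrak{g}_0$, and let $V(\varphi)$ be the quotient of the induced module $U(\mathfrak{g})\otimes_{U(\mathfrak{g}_0+\mathfrak{g}_+)}\mathbb{C}v_0$ by its unique maximal proper submodule. An irreducible module is a highest weight module if it is isomorphic to some $V(\varphi)$; lowest weight modules are defined analogously, with $\mathfrak{g}_-$ in place of $\mathfrak{g}_+$. For $a,b\in\mathbb{C}$, $V(a,b)$ is the $\mathrm{Vir}$-module with basis $\{v_{a+k}: k\in\mathbb{Z}\}$, $c$ acting by zero, and $d_iv_{a+k}=(a+k+ib)v_{a+k+i}$. One sets $V'(a,b)=V(a,b)$ when $V(a,b)$ is irreducible, and $V'(0,0)=V(0,0)/\mathbb{C}v_0$. *)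

theory Defs
  imports Complex_Main
    "HOL-Library.Poly_Mapping"
    "HOL-Computational_Algebra.Polynomial"
begin

section \<open>Lie algebras and their modules\<close>

text \<open>
  The carrier of a Lie algebra is a subspace of an ambient additive group, whose addition is used.
\<close>

record 'g lie_alg =
  lcarrier :: "'g set"
  lscale :: "complex \<Rightarrow> 'g \<Rightarrow> 'g"
  lbracket :: "'g \<Rightarrow> 'g \<Rightarrow> 'g"

text \<open>
  Modules are records, so that quotient modules, whose elements are cosets, are again modules.
\<close>

record ('g, 'v) lmod =
  mcarrier :: "'v set"
  mzero :: "'v"
  madd :: "'v \<Rightarrow> 'v \<Rightarrow> 'v"
  mscale :: "complex \<Rightarrow> 'v \<Rightarrow> 'v"
  mact :: "'g \<Rightarrow> 'v \<Rightarrow> 'v"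

definition lie_module ::
    "'g::ab_group_add lie_alg \<Rightarrow> (complex \<Rightarrow> 'v::ab_group_add \<Rightarrow> 'v) \<Rightarrow> ('g \<Rightarrow> 'v \<Rightarrow> 'v) \<Rightarrow> bool" where
  "lie_module L scale act \<longleftrightarrow>
     vector_space scale \<and>
     (\<forall>x\<in>lcarrier L. Vector_Spaces.linear scale scale (act x)) \<and>
     (\<forall>x\<in>lcarrier L. \<forall>y\<in>lcarrier L. \<forall>v. act (x + y) v = act x v + act y v) \<and>
     (\<forall>a. \<forall>x\<in>lcarrier L. \<forall>v. act (lscale L a x) v = scale a (act x v)) \<and>
     (\<forall>x\<in>lcarrier L. \<forall>y\<in>lcarrier L. \<forall>v.
        act (lbracket L x y) v = act x (act y v) - act y (act x v))"

definition full_mod ::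
    "(complex \<Rightarrow> 'v::ab_group_add \<Rightarrow> 'v) \<Rightarrow> ('g \<Rightarrow> 'v \<Rightarrow> 'v) \<Rightarrow> ('g, 'v) lmod" where
  "full_mod scale act = \<lparr>mcarrier = UNIV, mzero = 0, madd = (+), mscale = scale, mact = act\<rparr>"

definition submod :: "'g lie_alg \<Rightarrow> ('g, 'v) lmod \<Rightarrow> 'v set \<Rightarrow> bool" where
  "submod L M N \<longleftrightarrow>
     N \<subseteq> mcarrier M \<and> mzero M \<in> N \<and>
     (\<forall>v\<in>N. \<forall>w\<in>N. madd M v w \<in> N) \<and>
     (\<forall>a. \<forall>v\<in>N. mscale M a v \<in> N) \<and>
     (\<forall>x\<in>lcarrier L. \<forall>v\<in>N. mact M x v \<in> N)"

definition irreducible_mod :: "'g lie_alg \<Rightarrow> ('g, 'v) lmod \<Rightarrow> bool" where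
  "irreducible_mod L M \<longleftrightarrow>
     mcarrier M \<noteq> {mzero M} \<and>
     (\<forall>N. submod L M N \<longrightarrow> N = {mzero M} \<or> N = mcarrier M)"

definition maximal_submod :: "'g lie_alg \<Rightarrow> ('g, 'v) lmod \<Rightarrow> 'v set \<Rightarrow> bool" where
  "maximal_submod L M P \<longleftrightarrow>
     submod L M P \<and> P \<noteq> mcarrier M \<and>
     (\<forall>Q. submod L M Q \<and> P \<subseteq> Q \<and> Q \<noteq> mcarrier M \<longrightarrow> Q = P)"

definition mod_coset :: "('g, 'v) lmod \<Rightarrow> 'v set \<Rightarrow> 'v \<Rightarrow> 'v set" where
  "mod_coset M N v = (\<lambda>w. madd M v w) ` N"

definition quotient_mod :: "('g, 'v) lmod \<Rightarrow> 'v set \<Rightarrow> ('g, 'v set) lmod" where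
  "quotient_mod M N =
     \<lparr>mcarrier = mod_coset M N ` mcarrier M,
      mzero = N,
      madd = (\<lambda>A B. \<Union>v\<in>A. \<Union>w\<in>B. mod_coset M N (madd M v w)),
      mscale = (\<lambda>a A. \<Union>v\<in>A. mod_coset M N (mscale M a v)),
      mact = (\<lambda>x A. \<Union>v\<in>A. mod_coset M N (mact M x v))\<rparr>"

definition iso_mod :: "'g lie_alg \<Rightarrow> ('g, 'v) lmod \<Rightarrow> ('g, 'w) lmod \<Rightarrow> bool" where
  "iso_mod L M M' \<longleftrightarrow>
     (\<exists>f. bij_betw f (mcarrier M) (mcarrier M') \<and>
        (\<forall>v\<in>mcarrier M. \<forall>w\<in>mcarrier M. f (madd M v w) = madd M' (f v) (f w)) \<and>
        (\<forall>a. \<forall>v\<in>mcarrier M. f (mscale M a v) = mscale M' a (f v)) \<and>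
        (\<forall>x\<in>lcarrier L. \<forall>v\<in>mcarrier M. f (mact M x v) = mact M' x (f v)))"


section \<open>Universal enveloping algebras and induced modules\<close>

text \<open>
  Words with concatenation form the free monoid, so \<open>'g word \<Rightarrow>\<^sub>0 complex\<close> with the convolution
  product is the free associative complex algebra on the set of letters \<open>'g\<close>.
\<close>

datatype 'g word = Word (letters: "'g list")

instantiation word :: (type) monoid_add
begin

definition zero_word :: "'g word" where
  "zero_word = Word []"

definition plus_word :: "'g word \<Rightarrow> 'g word \<Rightarrow> 'g word" where
  "plus_word u v = Word (letters u @ letters v)"

instance
  by standard (simp_all add: zero_word_def plus_word_def)

end

type_synonym 'g free_alg = "'g word \<Rightarrow>\<^sub>0 complex"

definition gen :: "'g \<Rightarrow> 'g free_alg" where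
  "gen x = Poly_Mapping.single (Word [x]) 1"

definition fscale :: "complex \<Rightarrow> ('k \<Rightarrow>\<^sub>0 complex) \<Rightarrow> ('k \<Rightarrow>\<^sub>0 complex)" where
  "fscale a p = Poly_Mapping.map (\<lambda>b. a * b) p"

definition free_carrier :: "'g lie_alg \<Rightarrow> 'g free_alg set" where
  "free_carrier L = {p. \<forall>w\<in>Poly_Mapping.keys p. set (letters w) \<subseteq> lcarrier L}"

definition env_relations :: "'g::ab_group_add lie_alg \<Rightarrow> 'g free_alg set" where
  "env_relations L =
     {gen (x + y) - gen x - gen y | x y. x \<in> lcarrier L \<and> y \<in> lcarrier L} \<union>
     {gen (lscale L a x) - fscale a (gen x) | a x. x \<in> lcarrier L} \<union>
     {gen x * gen y - gen y * gen x - gen (lbracket L x y) | x y. x \<in> lcarrier L \<and> y \<in> lcarrier L}"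

text \<open>
  \<open>free_mod L\<close> is the free algebra on the letters in \<open>L\<close>, with \<open>L\<close> acting by left multiplication;
  its quotient by the two-sided ideal spanned by the elements \<open>u * r * v\<close> below (\<open>r\<close> one of
  \<open>env_relations L\<close>) is the universal enveloping algebra \<open>U(L)\<close>.

  For a one-dimensional module \<open>\<complex>v\<^sub>0\<close> over a subalgebra \<open>B\<close>, \<open>x v\<^sub>0 = \<chi> x v\<^sub>0\<close>, the tensor product
  \<open>U(L) \<otimes> \<complex>v\<^sub>0\<close> over \<open>U(B)\<close> is the quotient of \<open>U(L)\<close> by the span of the elements
  \<open>u x - \<chi> x u\<close> for \<open>u\<close> in \<open>U(L)\<close> and \<open>x\<close> in \<open>B\<close>.
\<close>

definition free_mod :: "'g lie_alg \<Rightarrow> ('g, 'g free_alg) lmod" where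
  "free_mod L =
     \<lparr>mcarrier = free_carrier L, mzero = 0, madd = (+), mscale = fscale, mact = (\<lambda>x p. gen x * p)\<rparr>"

definition induced_mod ::
    "'g::ab_group_add lie_alg \<Rightarrow> 'g set \<Rightarrow> ('g \<Rightarrow> complex) \<Rightarrow> ('g, 'g free_alg set) lmod" where
  "induced_mod L B \<chi> =
     quotient_mod (free_mod L)
       (module.span fscale
          ({u * r * v | u r v. u \<in> free_carrier L \<and> r \<in> env_relations L \<and> v \<in> free_carrier L} \<union>
           {u * gen x - fscale (\<chi> x) u | u x. u \<in> free_carrier L \<and> x \<in> B}))"


section \<open>The Virasoro algebra and its truncations\<close>

datatype vir_basis = Cgen | Dgen int

type_synonym vir = "vir_basis \<Rightarrow>\<^sub>0 complex"

fun vir_basis_bracket :: "vir_basis \<Rightarrow> vir_basis \<Rightarrow> vir" where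
  "vir_basis_bracket (Dgen m) (Dgen n) =
     Poly_Mapping.single (Dgen (m + n)) (of_int (n - m)) +
     (if m = - n then Poly_Mapping.single Cgen (of_int (m ^ 3 - m) / 12) else 0)"
| "vir_basis_bracket Cgen _ = 0"
| "vir_basis_bracket _ Cgen = 0"

definition vir_bracket :: "vir \<Rightarrow> vir \<Rightarrow> vir" where
  "vir_bracket x y =
     (\<Sum>i\<in>Poly_Mapping.keys x. \<Sum>j\<in>Poly_Mapping.keys y.
        fscale (Poly_Mapping.lookup x i * Poly_Mapping.lookup y j) (vir_basis_bracket i j))"

definition Vir :: "vir lie_alg" where
  "Vir = \<lparr>lcarrier = UNIV, lscale = fscale, lbracket = vir_bracket\<rparr>"

text \<open>\<open>vir_poly\<close> is \<open>Vir \<otimes> \<complex>[t]\<close>: basis elements of \<open>Vir\<close> with polynomial coefficients.\<close>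

type_synonym vir_poly = "vir_basis \<Rightarrow>\<^sub>0 complex poly"

definition vtensor :: "vir \<Rightarrow> complex poly \<Rightarrow> vir_poly" where
  "vtensor x f = Poly_Mapping.map (\<lambda>a. smult a f) x"

definition vp_scale :: "complex \<Rightarrow> vir_poly \<Rightarrow> vir_poly" where
  "vp_scale a x = Poly_Mapping.map (smult a) x"

definition vp_bracket :: "vir_poly \<Rightarrow> vir_poly \<Rightarrow> vir_poly" where
  "vp_bracket x y =
     (\<Sum>i\<in>Poly_Mapping.keys x. \<Sum>j\<in>Poly_Mapping.keys y.
        vtensor (vir_basis_bracket i j) (Poly_Mapping.lookup x i * Poly_Mapping.lookup y j))"

text \<open>
  Classes modulo \<open>t\<^sup>n\<close> are represented by polynomials of degree below \<open>n\<close>; \<open>vp_trunc n\<close> is the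
  quotient map from \<open>Vir \<otimes> \<complex>[t]\<close> onto the truncated algebra. Intended for \<open>n \<ge> 1\<close>.
\<close>

definition vp_trunc :: "nat \<Rightarrow> vir_poly \<Rightarrow> vir_poly" where
  "vp_trunc n x = Poly_Mapping.map (\<lambda>p. p mod monom 1 n) x"

definition truncated_Vir :: "nat \<Rightarrow> vir_poly lie_alg" where
  "truncated_Vir n =
     \<lparr>lcarrier = {x. \<forall>i. Polynomial.degree (Poly_Mapping.lookup x i) < n},
      lscale = vp_scale,
      lbracket = (\<lambda>x y. vp_trunc n (vp_bracket x y))\<rparr>"

definition vir_incl :: "vir \<Rightarrow> vir_poly" where
  "vir_incl x = vtensor x 1"

fun vir_degree :: "vir_basis \<Rightarrow> int" where
  "vir_degree Cgen = 0"
| "vir_degree (Dgen i) = i"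

definition tv_zero :: "nat \<Rightarrow> vir_poly set" where
  "tv_zero n = {x \<in> lcarrier (truncated_Vir n). \<forall>i\<in>Poly_Mapping.keys x. vir_degree i = 0}"

definition tv_pos :: "nat \<Rightarrow> vir_poly set" where
  "tv_pos n = {x \<in> lcarrier (truncated_Vir n). \<forall>i\<in>Poly_Mapping.keys x. vir_degree i > 0}"

definition tv_neg :: "nat \<Rightarrow> vir_poly set" where
  "tv_neg n = {x \<in> lcarrier (truncated_Vir n). \<forall>i\<in>Poly_Mapping.keys x. vir_degree i < 0}"


section \<open>Harish-Chandra modules\<close>

definition weight_space ::
    "(complex \<Rightarrow> 'v \<Rightarrow> 'v) \<Rightarrow> (vir_poly \<Rightarrow> 'v \<Rightarrow> 'v) \<Rightarrow> complex \<Rightarrow> 'v set" where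
  "weight_space scale act \<mu> =
     {v. act (vir_incl (Poly_Mapping.single (Dgen 0) 1)) v = scale \<mu> v}"

definition weight_module ::
    "(complex \<Rightarrow> 'v::ab_group_add \<Rightarrow> 'v) \<Rightarrow> (vir_poly \<Rightarrow> 'v \<Rightarrow> 'v) \<Rightarrow> bool" where
  "weight_module scale act \<longleftrightarrow> module.span scale (\<Union>\<mu>. weight_space scale act \<mu>) = UNIV"

definition harish_chandra ::
    "(complex \<Rightarrow> 'v::ab_group_add \<Rightarrow> 'v) \<Rightarrow> (vir_poly \<Rightarrow> 'v \<Rightarrow> 'v) \<Rightarrow> bool" where
  "harish_chandra scale act \<longleftrightarrow>
     weight_module scale act \<and>
     (\<forall>\<mu>. \<exists>S. finite S \<and> module.span scale S = weight_space scale act \<mu>)"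


section \<open>Highest and lowest weight modules\<close>

definition linear_functional_on :: "vir_poly set \<Rightarrow> (vir_poly \<Rightarrow> complex) \<Rightarrow> bool" where
  "linear_functional_on S \<phi> \<longleftrightarrow>
     (\<forall>x\<in>S. \<forall>y\<in>S. \<phi> (x + y) = \<phi> x + \<phi> y) \<and> (\<forall>a. \<forall>x\<in>S. \<phi> (vp_scale a x) = a * \<phi> x)"

text \<open>
  The linear form on \<open>\<gg>\<^sub>0 + \<gg>\<^sub>+\<close> (or \<open>\<gg>\<^sub>0 + \<gg>\<^sub>-\<close>) by which it acts on \<open>\<complex>v\<^sub>0\<close>: \<open>\<phi>\<close> applied to the
  degree zero component.
\<close>

definition zero_part :: "vir_poly \<Rightarrow> vir_poly" where
  "zero_part x = (\<Sum>i | i \<in> Poly_Mapping.keys x \<and> vir_degree i = 0.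
                    Poly_Mapping.single i (Poly_Mapping.lookup x i))"

definition verma :: "nat \<Rightarrow> vir_poly set \<Rightarrow> (vir_poly \<Rightarrow> complex)
    \<Rightarrow> (vir_poly, vir_poly free_alg set) lmod" where
  "verma n P \<phi> =
     induced_mod (truncated_Vir n) {x + y | x y. x \<in> tv_zero n \<and> y \<in> P} (\<lambda>x. \<phi> (zero_part x))"

definition simple_quotient :: "'g lie_alg \<Rightarrow> ('g, 'v) lmod \<Rightarrow> ('g, 'v set) lmod" where
  "simple_quotient L M = quotient_mod M (THE P. maximal_submod L M P)"

definition highest_weight_module :: "nat \<Rightarrow> (vir_poly, 'v) lmod \<Rightarrow> bool" where
  "highest_weight_module n M \<longleftrightarrow>
     (\<exists>\<phi>. linear_functional_on (tv_zero n) \<phi> \<and>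
        iso_mod (truncated_Vir n) M (simple_quotient (truncated_Vir n) (verma n (tv_pos n) \<phi>)))"

definition lowest_weight_module :: "nat \<Rightarrow> (vir_poly, 'v) lmod \<Rightarrow> bool" where
  "lowest_weight_module n M \<longleftrightarrow>
     (\<exists>\<phi>. linear_functional_on (tv_zero n) \<phi> \<and>
        iso_mod (truncated_Vir n) M (simple_quotient (truncated_Vir n) (verma n (tv_neg n) \<phi>)))"


section \<open>Modules of the intermediate series\<close>

text \<open>The basis vector \<open>v\<^bsub>a+k\<^esub>\<close> of \<open>V(a,b)\<close> is \<open>Poly_Mapping.single k 1\<close>.\<close>

fun vab_basis_act :: "complex \<Rightarrow> complex \<Rightarrow> vir_basis \<Rightarrow> int \<Rightarrow> (int \<Rightarrow>\<^sub>0 complex)" where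
  "vab_basis_act a b (Dgen i) k = Poly_Mapping.single (k + i) (a + of_int k + of_int i * b)"
| "vab_basis_act a b Cgen k = 0"

definition vab_act :: "complex \<Rightarrow> complex \<Rightarrow> vir \<Rightarrow> (int \<Rightarrow>\<^sub>0 complex) \<Rightarrow> (int \<Rightarrow>\<^sub>0 complex)" where
  "vab_act a b x v =
     (\<Sum>i\<in>Poly_Mapping.keys x. \<Sum>k\<in>Poly_Mapping.keys v.
        fscale (Poly_Mapping.lookup x i * Poly_Mapping.lookup v k) (vab_basis_act a b i k))"

definition Vab :: "complex \<Rightarrow> complex \<Rightarrow> (vir, int \<Rightarrow>\<^sub>0 complex) lmod" where
  "Vab a b = full_mod fscale (vab_act a b)"

text \<open>
  \<open>M\<close> is isomorphic to \<open>V'(a,b)\<close>, which is only defined for irreducible \<open>V(a,b)\<close> and for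
  \<open>a = b = 0\<close>; in the latter case \<open>V(0,0)\<close> is reducible, so the two cases are disjoint.
\<close>

definition iso_Vab' :: "(vir, 'v) lmod \<Rightarrow> complex \<Rightarrow> complex \<Rightarrow> bool" where
  "iso_Vab' M a b \<longleftrightarrow>
     (irreducible_mod Vir (Vab a b) \<and> iso_mod Vir M (Vab a b)) \<or>
     (a = 0 \<and> b = 0 \<and>
      iso_mod Vir M (quotient_mod (Vab 0 0) (module.span fscale {Poly_Mapping.single 0 1})))"

definition t_part :: "vir_poly set" where
  "t_part = {x. \<forall>i. [:0, 1:] dvd Poly_Mapping.lookup x i}"

end

theory Submission
  imports Defs "HOL-Computational_Algebra.Fundamental_Theorem_Algebra"
    "HOL-Real_Asymp.Real_Asymp" "HOL-Analysis.Topology_Euclidean_Space"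
begin

text \<open>
  If a nonzero vector is killed by all \<open>d\<^sub>i \<otimes> t\<^sup>j\<close> with \<open>i\<close> large, then by irreducibility every vector
  is, and the least \<open>m\<close> such that some nonzero vector is killed for all \<open>i \<ge> m\<close> is at most 1: otherwise
  acting by \<open>d\<^bsub>-k(m-1)\<^esub>\<close> on such vectors would give vectors of one finite-dimensional weight space
  that are not killed from a common bound on. So there is a highest weight
  vector, and the module is the simple quotient of a Verma module, because every proper submodule
  of the latter misses the top weight space. Exchanging \<open>i\<close> and \<open>- i\<close> handles
  lowest weights. Otherwise the weight spaces have bounded dimension, the ideal
  \<open>Vir \<otimes> t\<complex>[t]\<close> acts nilpotently, hence by zero, and it remains to treat \<open>Vir\<close> itself.

  There \<open>d\<^sub>1\<close> is eventually bijective between consecutive weight spaces, since kernel vectors would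
  produce too many eigenvalues of the Casimir element of \<open>sl\<^sub>2\<close>. Normalising coordinates so that \<open>d\<^sub>1\<close>
  acts by the weight, the actions of \<open>d\<^sub>2\<close> and \<open>d\<^sub>-\<^sub>2\<close> agree with those of a \<open>V(a,b)\<close> up to \<open>O(1/j)\<close>, so
  the coordinates of \<open>d\<^bsub>j-m\<^esub> u\<close> vary slowly with \<open>j\<close>; a subsequence limit is a nonzero linear form \<open>f\<close>
  with \<open>f (d\<^sub>k u) = (\<mu> + k) f u - k f' u\<close>. The Casimir element gives a quadratic equation for
  \<open>f \<mapsto> f'\<close>, and an eigenvector of this operation embeds the module into some \<open>V(a,b)\<close>.
\<close>

section \<open>Operators on complex vector spaces\<close>

text \<open>The elements d_1, d_(-1), d_2, d_(-2) generate \<open>Vir\<close>, so the law of a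
  V(a,b) has to be established for these four only. For d_1 it holds by normalisation, for d_(-1) up
  to O(1/j) by the Casimir element. For d_2 and d_(-2) the proof rests on a contraction: passing
  from degree j to j + 1 multiplies their defect by about |x - 2| / |x| = 1 - 2/j and adds O(1/j^2).
  As 2 > 1, the defect decays like 1/j; the constants 7/4 and 3/2 below are this 2 with room for
  Casimir terms.

  Limits of the coordinates might vanish or fail to exist, so the coordinates are divided by their
  total size over a finite window of degrees. For large j this size is positive and changes by a
  factor 1 + O(1/j) per degree; so limits do not depend on shifts, and the normalised sizes add up
  to 1.

  On V(a,b) the Casimir element is b (1 - b), which does not distinguish b from 1 - b. An
  eigenvector of \<open>f \<mapsto> f'\<close> makes the choice, the eigenvalue being 1 - b.\<close>

locale complex_vector_space = vector_space scale
  for scale :: "complex \<Rightarrow> 'v::ab_group_add \<Rightarrow> 'v" (infixr \<open>\<cdot>\<close> 75)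
begin

abbreviation endo :: "('v \<Rightarrow> 'v) \<Rightarrow> bool" where
  "endo \<equiv> Vector_Spaces.linear scale scale"

text \<open>The vectors form an indexed family rather than a set: the powers of an operator applied
  to a vector may repeat, and a repetition has to count as a dependency.\<close>

lemma dependent_family:
  assumes S: "finite S" and f: "\<And>k. k \<le> card S \<Longrightarrow> f k \<in> span S"
  shows "\<exists>c. (\<exists>k\<le>card S. c k \<noteq> 0) \<and> (\<Sum>k\<le>card S. scale (c k) (f k)) = 0"
proof (cases "inj_on f {..card S}")
  case True
  have "dependent (f ` {..card S})"
    using independent_span_bound[OF S, of "f ` {..card S}"] f card_image[OF True] by fastforce
  then obtain u where u: "\<exists>v\<in>f ` {..card S}. u v \<noteq> 0" "(\<Sum>v\<in>f ` {..card S}. scale (u v) v) = 0"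
    using dependent_finite[of "f ` {..card S}"] by auto
  have "(\<Sum>k\<le>card S. scale (u (f k)) (f k)) = 0"
    using u(2) by (simp add: sum.reindex[OF True] o_def)
  then show ?thesis using u(1) by (intro exI[of _ "u \<circ> f"]) auto
next
  case False
  then obtain k l where kl: "k \<le> card S" "l \<le> card S" "k \<noteq> l" "f k = f l"
    by (auto simp: inj_on_def)
  define c where "c i = (if i = k then 1 else if i = l then - 1 else (0::complex))" for i
  have "(\<Sum>i\<le>card S. scale (c i) (f i)) = (\<Sum>i\<in>{k,l}. scale (c i) (f i))"
    by (rule sum.mono_neutral_right) (use kl in \<open>auto simp: c_def\<close>)
  also have "\<dots> = 0" using kl by (simp add: c_def)
  finally show ?thesis using kl(1) by (intro exI[of _ c]) (auto simp: c_def)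
qed

text \<open>Rank-nullity in an ambient space of unrestricted dimension: extend a basis
  \<open>B'\<close> of the kernel within \<open>span B\<close> to a basis \<open>B''\<close>.
  \<open>T\<close> is injective on the span of the added vectors, so there are at most
  \<open>card S\<close> of them.\<close>

lemma independent_kernel:
  assumes T: "endo T" and B: "finite B" "independent B"
    and S: "finite S" and TB: "T ` B \<subseteq> span S"
  shows "\<exists>B'. finite B' \<and> independent B' \<and> B' \<subseteq> span B \<and> (\<forall>v\<in>B'. T v = 0) \<and> card B \<le> card B' + card S"
proof -
  interpret T: Vector_Spaces.linear scale scale T by fact
  interpret vp: vector_space_pair scale scale ..
  define K where "K = span B \<inter> {v. T v = 0}"
  obtain B' where B': "B' \<subseteq> K" "independent B'" "K \<subseteq> span B'"
    using maximal_independent_subset[of K] by auto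
  have fB': "finite B'" using independent_span_bound[OF B(1) B'(2)] B'(1) by (auto simp: K_def)
  obtain B'' where B'': "B' \<subseteq> B''" "B'' \<subseteq> span B" "independent B''" "span B \<subseteq> span B''"
    using maximal_independent_subset_extend[of B' "span B"] B' by (auto simp: K_def)
  have fB'': "finite B''" using independent_span_bound[OF B(1) B''(3)] B''(2) by auto
  have cB'': "card B \<le> card B''"
    using independent_span_bound[OF fB'' B(2)] B''(4) span_superset by blast
  \<comment> \<open>A kernel vector in the complementary span also lies in \<open>span B'\<close>.
    Its two representations agree by uniqueness in \<open>B''\<close>, but their supports are
    disjoint.\<close>
  have "span (B'' - B') \<inter> {v. T v = 0} \<subseteq> {0}"
  proof
    fix v assume v: "v \<in> span (B'' - B') \<inter> {v. T v = 0}"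
    have "span (B'' - B') \<subseteq> span B" by (rule span_minimal) (use B'' in auto)
    then have vB': "v \<in> span B'" using v B'(3) by (auto simp: K_def)
    have r: "representation (B'' - B') v = representation B' v"
      using representation_extend[OF B''(3), of v B'] representation_extend[OF B''(3), of v "B'' - B'"]
        B''(1) v vB' by simp
    have "representation B' v b = 0" for b
      using representation_ne_zero[of B' v b] representation_ne_zero[of "B'' - B'" v b] r by auto
    then have "v = 0" using sum_nonzero_representation_eq[OF B'(2) vB'] by simp
    then show "v \<in> {0}" by simp
  qed
  then have inj: "inj_on T (span (B'' - B'))"
    unfolding T.inj_on_iff_eq_0[OF subspace_span] by blast
  have i2: "independent (T ` (B'' - B'))"
    by (rule T.independent_inj_on_image)
       (use independent_mono[OF B''(3)] inj in \<open>auto\<close>)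
  have "T ` span B \<subseteq> span S"
    using T.span_image TB span_minimal[OF TB] by auto
  then have "T ` (B'' - B') \<subseteq> span S" using B''(2) by blast
  from independent_span_bound[OF S i2 this] have "card (T ` (B'' - B')) \<le> card S" by simp
  moreover have "card (T ` (B'' - B')) = card (B'' - B')"
    by (rule card_image) (use inj span_superset inj_on_subset in blast)
  ultimately have "card B \<le> card B' + card S"
    using cB'' fB' fB'' B''(1) by (simp add: card_Diff_subset)
  then show ?thesis using fB' B' by (intro exI[of _ B']) (auto simp: K_def)
qed

lemma independent_common_kernel:
  fixes r :: nat
  assumes B: "finite B" "independent B"
    and "\<And>a. a < r \<Longrightarrow> endo (T a)" "\<And>a. a < r \<Longrightarrow> finite (S a)"
    and "\<And>a. a < r \<Longrightarrow> T a ` B \<subseteq> span (S a)"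
  shows "\<exists>B'. finite B' \<and> independent B' \<and> B' \<subseteq> span B \<and> (\<forall>a<r. \<forall>v\<in>B'. T a v = 0) \<and>
     card B \<le> card B' + (\<Sum>a<r. card (S a))"
  using assms(3-)
proof (induction r)
  case 0
  then show ?case using B span_superset by (intro exI[of _ B]) auto
next
  case (Suc r)
  obtain B' where B': "finite B'" "independent B'" "B' \<subseteq> span B" "\<forall>a<r. \<forall>v\<in>B'. T a v = 0"
     "card B \<le> card B' + (\<Sum>a<r. card (S a))"
    using Suc.IH Suc.prems by auto
  interpret T: Vector_Spaces.linear scale scale "T r" using Suc.prems(1) by simp
  have "T r ` span B \<subseteq> span (S r)"
    using T.span_image span_minimal[OF Suc.prems(3)] by auto
  then have "T r ` B' \<subseteq> span (S r)" using B'(3) by blast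
  then obtain B'' where B'': "finite B''" "independent B''" "B'' \<subseteq> span B'" "\<forall>v\<in>B''. T r v = 0"
      "card B' \<le> card B'' + card (S r)"
    using independent_kernel[OF Suc.prems(1)[of r] B'(1,2) Suc.prems(2)[of r]] by auto
  have sp: "span B' \<subseteq> span B" using B'(3) by (intro span_minimal) auto
  have "T a v = 0" if "a < r" "v \<in> B''" for a v
  proof -
    interpret T: Vector_Spaces.linear scale scale "T a" using Suc.prems(1) that by simp
    show ?thesis by (rule T.eq_0_on_span[of B']) (use B' B'' that in auto)
  qed
  then show ?case
    using B'' sp B' by (intro exI[of _ B'']) (auto simp: less_Suc_eq)
qed

text \<open>The number \<open>dim\<close> is 0 on infinite-dimensional spaces, so a bound on it
  would say nothing about them; hence the bound on all independent sets.\<close>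

definition dim_le :: "'v set \<Rightarrow> nat \<Rightarrow> bool" where
  "dim_le U N \<longleftrightarrow> (\<forall>B. independent B \<and> B \<subseteq> U \<longrightarrow> finite B \<and> card B \<le> N)"

lemma dim_le_span: "finite S \<Longrightarrow> U \<subseteq> span S \<Longrightarrow> dim_le U (card S)"
  unfolding dim_le_def using independent_span_bound by blast

lemma dim_le_mono: "dim_le U N \<Longrightarrow> N \<le> M \<Longrightarrow> dim_le U M"
  unfolding dim_le_def by force

text \<open>Passing to the kernel of \<open>T a\<close> costs an independent set at most
  \<open>card (S a)\<close> elements, and in the trivial common kernel none are left.\<close>

lemma dim_le_common_kernel:
  fixes r :: nat
  assumes T: "\<And>a. a < r \<Longrightarrow> endo (T a)" and S: "\<And>a. a < r \<Longrightarrow> finite (S a)"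
    and TU: "\<And>a. a < r \<Longrightarrow> T a ` U \<subseteq> span (S a)"
    and U: "subspace U" and ker: "\<And>v. v \<in> U \<Longrightarrow> \<forall>a<r. T a v = 0 \<Longrightarrow> v = 0"
  shows "dim_le U (\<Sum>a<r. card (S a))"
proof -
  have *: "card B \<le> (\<Sum>a<r. card (S a))" if B: "finite B" "independent B" "B \<subseteq> U" for B
  proof -
    obtain B' where B': "independent B'" "B' \<subseteq> span B" "\<forall>a<r. \<forall>v\<in>B'. T a v = 0"
       "card B \<le> card B' + (\<Sum>a<r. card (S a))"
      using independent_common_kernel[OF B(1,2), of r T S] T S TU B(3) by blast
    have "B' \<subseteq> {0}"
      using ker B' span_minimal[OF B(3) U] by blast
    then have "B' = {}" using B'(1) dependent_zero by (metis subset_singletonD insertI1)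
    then show ?thesis using B'(4) by simp
  qed
  have "finite B" if "independent B" "B \<subseteq> U" for B
  proof (rule ccontr)
    assume "infinite B"
    then obtain B1 where "B1 \<subseteq> B" "finite B1" "card B1 = Suc (\<Sum>a<r. card (S a))"
      using infinite_arbitrarily_large by blast
    then show False using *[of B1] independent_mono[OF that(1)] that(2) by auto
  qed
  then show ?thesis using * by (auto simp: dim_le_def)
qed

text \<open>If \<open>m\<close> is the first power that kills \<open>v\<close>, the vectors
  \<open>v\<close>, \<open>T v\<close>, ..., \<open>T^(m-1) v\<close> are independent in
  \<open>U\<close>, whence \<open>m \<le> N\<close>.\<close>

lemma nilpotent_dim_le:
  assumes T: "endo T" and U: "T ` U \<subseteq> U" "dim_le U N"
    and v: "v \<in> U" "(T ^^ k) v = 0"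
  shows "(T ^^ N) v = 0"
proof -
  interpret T: Vector_Spaces.linear scale scale T by fact
  define m where "m = (LEAST k. (T ^^ k) v = 0)"
  have m: "(T ^^ m) v = 0" unfolding m_def using v(2) by (rule LeastI)
  have ml: "(T ^^ l) v \<noteq> 0" if "l < m" for l using not_less_Least that unfolding m_def by blast
  have lin: "endo (T ^^ l)" for l
  proof (induction l)
    case 0 show ?case by (simp add: linear_id del: id_apply)
  next
    case (Suc l) show ?case using Vector_Spaces.linear_compose[OF Suc.IH T.linear_axioms] by (simp only: funpow.simps)
  qed
  have TU: "(T ^^ l) v \<in> U" for l using v U by (induction l) auto
  have up: "(T ^^ l) v = 0" if "m \<le> l" for l
  proof -
    interpret L: Vector_Spaces.linear scale scale "T ^^ (l - m)" by (rule lin)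
    have "(T ^^ l) v = (T ^^ (l - m)) ((T ^^ m) v)" using that
      by (metis comp_apply funpow_add le_add_diff_inverse2)
    also have "\<dots> = 0" using m L.zero by simp
    finally show ?thesis .
  qed
  have inj: "inj_on (\<lambda>l. (T ^^ l) v) {..<m}"
  proof (rule linorder_inj_onI)
    fix a b assume ab: "a < b" "a \<in> {..<m}" "b \<in> {..<m}"
    show "(T ^^ a) v \<noteq> (T ^^ b) v"
    proof
      assume eq: "(T ^^ a) v = (T ^^ b) v"
      have "(T ^^ (m - b)) ((T ^^ a) v) = (T ^^ (m - b)) ((T ^^ b) v)" using eq by simp
      then have "(T ^^ (m - b + a)) v = (T ^^ (m - b + b)) v"
        by (simp add: funpow_add del: funpow.simps)
      moreover have "m - b + b = m" using ab by simp
      ultimately have "(T ^^ (m - b + a)) v = 0" using m by (simp only:)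
      moreover have "m - b + a < m" using ab by auto
      ultimately show False using ml by blast
    qed
  qed auto
  have ind: "independent ((\<lambda>l. (T ^^ l) v) ` {..<m})"
  proof -
    have "c l = 0" if c: "(\<Sum>l<m. scale (c l) ((T ^^ l) v)) = 0" and l: "l < m" for c l
    proof (rule ccontr)
      assume "c l \<noteq> 0"
      define p where "p = (LEAST l. l < m \<and> c l \<noteq> 0)"
      have p: "p < m" "c p \<noteq> 0" using LeastI[of "\<lambda>l. l < m \<and> c l \<noteq> 0" l] l \<open>c l \<noteq> 0\<close> unfolding p_def by auto
      have pl: "c q = 0" if "q < p" for q using not_less_Least[of q "\<lambda>l. l < m \<and> c l \<noteq> 0"] that p unfolding p_def by auto
      \<comment> \<open>\<open>T^d\<close> sends the lowest term of the relation, of index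
        \<open>p\<close>, to a multiple of \<open>T^(m-1) v\<close>, and all later terms to
        0.\<close>
      define d where "d = m - 1 - p"
      have d: "d + p = m - 1" using p by (simp add: d_def)
      interpret L: Vector_Spaces.linear scale scale "T ^^ d" by (rule lin)
      have "0 = (T ^^ d) (\<Sum>l<m. scale (c l) ((T ^^ l) v))" using c by (simp add: L.zero)
      also have "\<dots> = (\<Sum>l<m. scale (c l) ((T ^^ (d + l)) v))"
        by (simp add: L.sum L.scale funpow_add)
      also have "\<dots> = (\<Sum>l\<in>{p}. scale (c l) ((T ^^ (d + l)) v))"
      proof (rule sum.mono_neutral_right)
        show "\<forall>i\<in>{..<m} - {p}. scale (c i) ((T ^^ (d + i)) v) = 0"
        proof
          fix i assume i: "i \<in> {..<m} - {p}"
          show "scale (c i) ((T ^^ (d + i)) v) = 0"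
          proof (cases "i < p")
            case False
            then have "m \<le> d + i" using i d p by auto
            then show ?thesis using up by simp
          qed (simp add: pl)
        qed
      qed (use p in auto)
      also have "\<dots> = scale (c p) ((T ^^ (m - 1)) v)" using d by simp
      finally show False using p ml[of "m - 1"] by simp
    qed
    then show ?thesis
      by (intro independent_if_scalars_zero) 
         (auto simp: sum.reindex[OF inj])
  qed
  have "m \<le> N" using U(2) ind TU card_image[OF inj] unfolding dim_le_def by (metis card_lessThan image_subsetI)
  then show ?thesis by (rule up)
qed


section \<open>Polynomials in an operator, eigenvectors\<close>

definition papp :: "('v \<Rightarrow> 'v) \<Rightarrow> complex poly \<Rightarrow> 'v \<Rightarrow> 'v" where
  "papp T p v = fold_coeffs (\<lambda>a w. a \<cdot> v + T w) p 0"

context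
  fixes T assumes T: "endo T"
begin

interpretation T: Vector_Spaces.linear scale scale T by (rule T)

lemma papp_0: "papp T 0 v = 0"
  by (simp add: papp_def)

lemma papp_pCons: "papp T (pCons a p) v = a \<cdot> v + T (papp T p v)"
  by (cases "p = 0 \<and> a = 0") (auto simp: papp_def)

lemma papp_add: "papp T (p + q) v = papp T p v + papp T q v"
proof (induction p arbitrary: q)
  case 0 then show ?case by (simp add: papp_0)
next
  case (pCons a p)
  show ?case
    by (cases q) (simp add: papp_pCons pCons.IH T.add scale_left_distrib)
qed

lemma papp_smult: "papp T (smult c p) v = c \<cdot> papp T p v"
  by (induction p) (simp_all add: papp_pCons papp_0 T.scale scale_right_distrib)

lemma papp_linear_factor: "papp T ([:- \<kappa>, 1:] * q) v = T (papp T q v) - \<kappa> \<cdot> papp T q v"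
  by (simp add: papp_add papp_smult papp_pCons papp_0 flip: smult_minus_left)

lemma papp_in: "subspace U \<Longrightarrow> T ` U \<subseteq> U \<Longrightarrow> v \<in> U \<Longrightarrow> papp T p v \<in> U"
  by (induction p) (auto simp: papp_pCons papp_0 subspace_0 subspace_add subspace_scale image_subset_iff)

lemma papp_monom_sum: "papp T (\<Sum>k\<le>N. monom (c k) k) v = (\<Sum>k\<le>N. c k \<cdot> (T ^^ k) v)"
proof -
  have m: "papp T (monom a k) v = a \<cdot> (T ^^ k) v" for a k
    by (induction k) (simp_all add: monom_0 monom_Suc papp_pCons papp_0 T.scale)
  show ?thesis
    by (induction N) (simp_all add: m papp_add)
qed

text \<open>Take a polynomial of least degree with p(T) v = 0 and split off a root: the cofactor
  does not annihilate \<open>v\<close> and yields the eigenvector. Working with one vector avoids a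
  minimal polynomial of \<open>T\<close>, which need not exist on the whole space.\<close>

lemma eigenvector_exists:
  assumes S: "finite S" and U: "subspace U" "U \<subseteq> span S" "T ` U \<subseteq> U" and v: "v \<in> U" "v \<noteq> 0"
  shows "\<exists>\<kappa> w. w \<in> U \<and> w \<noteq> 0 \<and> T w = \<kappa> \<cdot> w"
proof -
  have "(T ^^ k) v \<in> U" for k using U v by (induction k) auto
  then obtain c where c: "\<exists>k\<le>card S. c k \<noteq> 0" "(\<Sum>k\<le>card S. c k \<cdot> (T ^^ k) v) = 0"
    using dependent_family[OF S, of "\<lambda>k. (T ^^ k) v"] U(2) by blast
  define P where "P p \<longleftrightarrow> p \<noteq> 0 \<and> papp T p v = 0" for p
  have "\<exists>p. P p"
  proof -
    have "coeff (\<Sum>k\<le>card S. monom (c k) k) k = (if k \<le> card S then c k else 0)" for k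
      by (auto simp: coeff_sum)
    then have "(\<Sum>k\<le>card S. monom (c k) k) \<noteq> 0" using c(1) by (metis coeff_0)
    then show ?thesis unfolding P_def using papp_monom_sum[of c "card S" v] c(2) by auto
  qed
  then obtain p where p: "P p" "\<And>q. P q \<Longrightarrow> degree p \<le> degree q"
    using arg_min_natI[of P _ degree] arg_min_nat_le[of P _ degree] by blast
  have "degree p \<noteq> 0"
  proof
    assume "degree p = 0"
    then obtain a where "p = [:a:]" by (rule degree_eq_zeroE)
    then show False using p(1) v(2) by (auto simp: P_def papp_pCons papp_0)
  qed
  then obtain \<kappa> where "poly p \<kappa> = 0"
    using fundamental_theorem_of_algebra[of p] by (auto simp: constant_degree)
  then obtain q where q: "p = [:- \<kappa>, 1:] * q" by (auto simp: poly_eq_0_iff_dvd dvd_def)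
  have q0: "q \<noteq> 0" using p(1) q by (auto simp: P_def)
  have "degree p = Suc (degree q)" unfolding q by (subst degree_mult_eq) (use q0 in auto)
  then have "papp T q v \<noteq> 0" using p(2)[of q] q0 by (auto simp: P_def)
  moreover have "T (papp T q v) = \<kappa> \<cdot> papp T q v"
    using p(1) by (simp add: P_def q papp_linear_factor del: mult_pCons_left)
  ultimately show ?thesis using papp_in[OF U(1,3) v(1), of q] by blast
qed

end

text \<open>The eigenspaces in \<open>U\<close> of the first operator are stable under the others,
  because they commute.\<close>

lemma common_eigenvector:
  assumes S: "finite S" and "subspace U" "U \<subseteq> span S" "v \<in> U" "v \<noteq> 0"
    and "\<And>T. T \<in> set Ts \<Longrightarrow> endo T" "\<And>T. T \<in> set Ts \<Longrightarrow> T ` U \<subseteq> U"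
    and comm: "\<And>T T' u. T \<in> set Ts \<Longrightarrow> T' \<in> set Ts \<Longrightarrow> T (T' u) = T' (T u)"
  shows "\<exists>w\<in>U. w \<noteq> 0 \<and> (\<forall>T\<in>set Ts. \<exists>\<kappa>. T w = \<kappa> \<cdot> w)"
  using assms(2-)
proof (induction Ts arbitrary: U v)
  case Nil
  then show ?case by auto
next
  case (Cons T Ts)
  interpret T: Vector_Spaces.linear scale scale T using Cons.prems(5) by simp
  obtain \<kappa> w where w: "w \<in> U" "w \<noteq> 0" "T w = \<kappa> \<cdot> w"
    using eigenvector_exists[OF T.linear_axioms S Cons.prems(1,2) _ Cons.prems(3,4)] Cons.prems(6)[of T] by auto
  let ?U = "{u \<in> U. T u = \<kappa> \<cdot> u}"
  have "subspace ?U"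
    using Cons.prems(1) by (auto simp: subspace_def T.add T.scale scale_right_distrib mult.commute)
  moreover have "T' ` ?U \<subseteq> ?U" if "T' \<in> set Ts" for T'
  proof -
    interpret T': Vector_Spaces.linear scale scale T' using Cons.prems(5) that by simp
    show ?thesis using Cons.prems(6)[of T'] Cons.prems(7)[of T T'] that
      by (auto simp: T'.scale)
  qed
  ultimately obtain w' where "w' \<in> ?U" "w' \<noteq> 0" "\<forall>T\<in>set Ts. \<exists>\<kappa>. T w' = \<kappa> \<cdot> w'"
    using Cons.IH[of ?U w] w Cons.prems(2,5,7) by fastforce
  then show ?case by auto
qed

end

section \<open>Modules over the truncated algebra\<close>

lemma (in complex_vector_space) span_UN_sum:
  assumes S: "\<And>i. i \<in> I \<Longrightarrow> subspace (S i)" and v: "v \<in> span (\<Union>i\<in>I. S i)"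
  shows "\<exists>F s. finite F \<and> F \<subseteq> I \<and> (\<forall>i\<in>F. s i \<in> S i) \<and> v = sum s F"
  using v
proof (induction rule: span_induct_alt)
  case base
  then show ?case by (intro exI[of _ "{}"]) auto
next
  case (step c x y)
  then obtain i F s where i: "i \<in> I" "x \<in> S i"
    and F: "finite F" "F \<subseteq> I" "\<forall>i\<in>F. s i \<in> S i" "y = sum s F" by auto
  show ?case
  proof (cases "i \<in> F")
    case True
    have "sum (s(i := c \<cdot> x + s i)) F = c \<cdot> x + s i + sum s (F - {i})"
      using F(1) True by (subst sum.remove[of F i]) (auto intro!: sum.cong)
    also have "\<dots> = c \<cdot> x + sum s F" using F(1) True by (simp add: sum.remove[of F i])
    finally show ?thesis
      using F i True S by (intro exI[of _ F] exI[of _ "s(i := c \<cdot> x + s i)"]) (auto simp: subspace_add subspace_scale)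
  next
    case False
    then have "sum (s(i := c \<cdot> x)) (insert i F) = c \<cdot> x + sum s F"
      using F(1) by (subst sum.insert) (auto intro!: sum.cong)
    then show ?thesis
      using F i S by (intro exI[of _ "insert i F"] exI[of _ "s(i := c \<cdot> x)"]) (auto simp: subspace_scale)
  qed
qed

text \<open>Applying \<open>T - \<nu>\<close> removes the summand with eigenvalue
  \<open>\<nu>\<close> and multiplies the others by nonzero factors.\<close>

lemma (in complex_vector_space) eigen_sum_zero:
  assumes T: "endo T"
    and "finite F" "\<And>\<kappa>. \<kappa> \<in> F \<Longrightarrow> T (w \<kappa>) = \<kappa> \<cdot> w \<kappa>" "sum w F = 0" "\<kappa> \<in> F"
  shows "w \<kappa> = 0"
  using assms(2-)
proof (induction F arbitrary: w \<kappa> rule: finite_induct)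
  case (insert \<nu> F)
  interpret T: Vector_Spaces.linear scale scale T by (rule T)
  define w' where "w' \<kappa> = (\<kappa> - \<nu>) \<cdot> w \<kappa>" for \<kappa>
  have "sum w' F = T (sum w F) - \<nu> \<cdot> sum w F"
    using insert.prems(1) by (simp add: w'_def T.sum scale_sum_right sum_subtractf scale_left_diff_distrib)
  also have "sum w F = - w \<nu>" using insert by (simp add: add_eq_0_iff)
  also have "T (- w \<nu>) - \<nu> \<cdot> - w \<nu> = 0" using insert.prems(1)[of \<nu>] by (simp add: T.neg)
  finally have "sum w' F = 0" .
  then have "w' x = 0" if "x \<in> F" for x
    using insert.IH[of w' x] insert.prems(1) that by (simp add: w'_def T.scale mult.commute)
  then have 0: "w x = 0" if "x \<in> F" for x using that insert.hyps by (force simp: w'_def)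
  then have "w \<nu> = 0" using insert.prems(2) insert.hyps by simp
  then show ?case using 0 insert.prems(3) by auto
qed simp

text \<open>\<open>D i j\<close> and \<open>Z j\<close> stand for the actions of \<open>d\<^sub>i \<otimes> t\<^sup>j\<close> and \<open>c \<otimes> t\<^sup>j\<close>.\<close>

locale tvir_rep = complex_vector_space scale
  for scale :: "complex \<Rightarrow> 'v::ab_group_add \<Rightarrow> 'v" (infixr \<open>\<cdot>\<close> 75) +
  fixes n :: nat and D :: "int \<Rightarrow> nat \<Rightarrow> 'v \<Rightarrow> 'v" and Z :: "nat \<Rightarrow> 'v \<Rightarrow> 'v"
  assumes D_endo: "\<And>i j. endo (D i j)" and Z_endo: "\<And>j. endo (Z j)"
    and D_bracket: "\<And>i j k l v. D i j (D k l v) - D k l (D i j v) =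
      of_int (k - i) \<cdot> D (i + k) (j + l) v +
      (if i = - k then (of_int (i ^ 3 - i) / 12) \<cdot> Z (j + l) v else 0)"
    and Z_D: "\<And>j k l v. Z j (D k l v) = D k l (Z j v)"
    and Z_Z: "\<And>j k v. Z j (Z k v) = Z k (Z j v)"
    and D_trunc: "\<And>i j v. n \<le> j \<Longrightarrow> D i j v = 0" and Z_trunc: "\<And>j v. n \<le> j \<Longrightarrow> Z j v = 0"
begin

interpretation D: Vector_Spaces.linear scale scale "D i j" for i j by (rule D_endo)
interpretation Z: Vector_Spaces.linear scale scale "Z j" for j by (rule Z_endo)

lemmas D_add = D.add and D_scale = D.scale and D_zero = D.zero and D_diff = D.diff
  and D_sum = D.sum and D_neg = D.neg
lemmas Z_add = Z.add and Z_scale = Z.scale and Z_zero = Z.zero and Z_diff = Z.diff and Z_neg = Z.neg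

lemma D_D: "D i j (D k l v) = D k l (D i j v) + of_int (k - i) \<cdot> D (i + k) (j + l) v +
      (if i = - k then (of_int (i ^ 3 - i) / 12) \<cdot> Z (j + l) v else 0)"
  using D_bracket[of i j k l v] by (simp add: algebra_simps)

lemma D_D': "i \<noteq> - k \<Longrightarrow> D i j (D k l v) = D k l (D i j v) + of_int (k - i) \<cdot> D (i + k) (j + l) v"
  by (simp add: D_D[of i])

definition W :: "complex \<Rightarrow> 'v set" where
  "W \<mu> = {v. D 0 0 v = \<mu> \<cdot> v}"

lemma subspace_W: "subspace (W \<mu>)"
  by (auto simp: subspace_def W_def D_zero D_add D_scale scale_right_distrib mult.commute)

lemmas W_add = subspace_add[OF subspace_W] and W_scale = subspace_scale[OF subspace_W]
  and W_diff = subspace_diff[OF subspace_W] and W_zero = subspace_0[OF subspace_W]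
  and W_neg = subspace_neg[OF subspace_W] and W_sum = subspace_sum[OF subspace_W]

lemma W_D: "v \<in> W \<mu> \<Longrightarrow> D i j v \<in> W (\<mu> + of_int i)"
  by (auto simp: W_def D_D[of 0] D_scale scale_left_distrib)

lemma W_Z: "v \<in> W \<mu> \<Longrightarrow> Z j v \<in> W \<mu>"
  by (simp add: W_def Z_D[symmetric] Z_scale)

lemma weight_sum_zero:
  assumes "finite F" "\<And>\<mu>. \<mu> \<in> F \<Longrightarrow> w \<mu> \<in> W \<mu>" "sum w F = 0" "\<mu> \<in> F"
  shows "w \<mu> = 0"
  by (rule eigen_sum_zero[OF D_endo assms(1) _ assms(3,4)]) (use assms(2) in \<open>auto simp: W_def\<close>)

lemma weight_sum_in:
  assumes "finite F" "\<And>\<mu>. \<mu> \<in> F \<Longrightarrow> w \<mu> \<in> W \<mu>" and v: "sum w F \<in> W \<nu>"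
  shows "sum w F = (if \<nu> \<in> F then w \<nu> else 0)"
proof -
  \<comment> \<open>The total is entered with a minus sign in weight \<open>\<nu>\<close>, so that
    all components add up to 0.\<close>
  define w' where "w' \<mu> = (if \<mu> \<in> F then w \<mu> else 0) - (if \<mu> = \<nu> then sum w F else 0)" for \<mu>
  have "sum w' (insert \<nu> F) = 0"
    using assms(1) by (simp add: w'_def sum_subtractf sum.insert_if sum.If_cases insert_absorb)
       (auto simp: Int_absorb1 subset_insertI intro!: sum.cong)
  then have "w' \<nu> = 0"
    by (rule weight_sum_zero[of "insert \<nu> F", rotated 2])
       (use assms W_diff W_zero in \<open>auto simp: w'_def\<close>)
  then show ?thesis by (auto simp: w'_def)
qed

text \<open>Induction on the number of weight components: \<open>D 0 0 - \<nu>\<close> removes one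
  of them and stays inside \<open>U\<close>. If the result is 0, the vector itself already has
  weight \<open>\<nu>\<close>.\<close>

lemma weight_in_subspace:
  assumes U: "subspace U" "D 0 0 ` U \<subseteq> U" and v: "v \<in> U" "v \<noteq> 0" "v \<in> span (\<Union>\<mu>. W \<mu>)"
  shows "\<exists>\<mu> w. w \<in> U \<and> w \<in> W \<mu> \<and> w \<noteq> 0"
proof -
  have *: "\<exists>\<mu> w. w \<in> U \<and> w \<in> W \<mu> \<and> w \<noteq> 0"
    if "finite F" "\<And>\<mu>. \<mu> \<in> F \<Longrightarrow> w \<mu> \<in> W \<mu>" "sum w F \<in> U" "sum w F \<noteq> 0" for w and F :: "complex set"
    using that
  proof (induction F arbitrary: w rule: finite_induct)
    case (insert \<nu> F)
    define w' where "w' \<mu> = (\<mu> - \<nu>) \<cdot> w \<mu>" for \<mu>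
    have D: "D 0 0 (w x) = x \<cdot> w x" if "x \<in> insert \<nu> F" for x
      using insert.prems(1)[of x] that by (simp add: W_def)
    have eq: "sum w' F = D 0 0 (sum w (insert \<nu> F)) - \<nu> \<cdot> sum w (insert \<nu> F)"
      using insert.hyps D
      by (simp add: w'_def D_add D_sum scale_sum_right sum_subtractf scale_left_diff_distrib scale_right_distrib)
    have inU: "sum w' F \<in> U" unfolding eq using U insert.prems(2) by (auto intro: subspace_diff subspace_scale)
    show ?case
    proof (cases "sum w' F = 0")
      case True
      then have "sum w (insert \<nu> F) \<in> W \<nu>" using eq by (simp add: W_def)
      then show ?thesis using insert.prems by blast
    next
      case False
      show ?thesis by (rule insert.IH[of w']) (use insert.prems(1) W_scale inU False in \<open>auto simp: w'_def\<close>)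
    qed
  qed simp
  obtain F s where "finite F" "\<forall>i\<in>F. s i \<in> W i" "v = sum s F"
    using span_UN_sum[of UNIV W v] v(3) subspace_W by auto
  then show ?thesis using *[of F s] v by auto
qed

section \<open>Vectors annihilated in all large degrees\<close>

definition killed :: "int \<Rightarrow> 'v \<Rightarrow> bool" where
  "killed m v \<longleftrightarrow> (\<forall>i\<ge>m. \<forall>j. D i j v = 0)"

lemma killed_mono: "killed m v \<Longrightarrow> m \<le> m' \<Longrightarrow> killed m' v"
  by (auto simp: killed_def)

lemma subspace_killed: "subspace {v. killed m v}"
  by (auto simp: subspace_def killed_def D_zero D_add D_scale)

lemma killed_D: "killed m v \<Longrightarrow> 0 \<le> k \<Longrightarrow> 1 \<le> m \<Longrightarrow> killed m (D k l v)"
  by (auto simp: killed_def D_D D_zero)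

text \<open>Above this threshold \<open>i + k\<close> is at least \<open>m\<close> and positive, so
  the bracket term dies and no central term occurs.\<close>

lemma killed_D': "killed m v \<Longrightarrow> killed (max m 0 + \<bar>k\<bar> + 1) (D k l v)"
  by (auto simp: killed_def D_D D_zero)

lemma killed_Z: "killed m v \<Longrightarrow> killed m (Z l v)"
  by (simp add: killed_def Z_D[symmetric] Z_zero)

text \<open>The degrees k and k + 1 generate all large degrees under addition. But brackets of equal
  degrees vanish, so r summands produce \<open>r * k + s\<close> only for 0 < s < r, which is what
  the induction tracks. From the stated threshold on, every degree has this form with s at most k
  and r at least k + 1.\<close>

lemma killed_from_two:
  assumes k: "k \<ge> 1" and v: "\<And>j. D k j v = 0" "\<And>j. D (k + 1) j v = 0"
  shows "killed ((k + 1) * k + 1) v"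
proof -
  define K where "K = {i. \<forall>j. D i j v = 0}"
  have K: "i + i' \<in> K" if "i \<in> K" "i' \<in> K" "i \<noteq> i'" "i + i' \<noteq> 0" for i i'
  proof -
    have "D (i + i') j v = 0" for j
      using D_bracket[of i 0 i' j v] that by (auto simp: K_def D_zero)
    then show ?thesis by (simp add: K_def)
  qed
  have kK: "k \<in> K" "k + 1 \<in> K" using v by (auto simp: K_def)
  have *: "\<forall>s. 1 \<le> s \<and> s < int r \<longrightarrow> int r * k + s \<in> K" if "r \<ge> 2" for r
    using that
  proof (induction r rule: dec_induct)
    case base
    have "k + (k + 1) \<in> K" using k by (intro K kK) auto
    moreover have "s = 1" if "1 \<le> s \<and> s < int 2" for s using that by simp
    ultimately have "int 2 * k + s \<in> K" if "1 \<le> s \<and> s < int 2" for s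
      using that by (metis add.assoc add.commute mult_2 of_nat_numeral)
    then show ?case by blast
  next
    case (step r)
    show ?case
    proof (intro allI impI)
      fix s assume s: "1 \<le> s \<and> s < int (Suc r)"
      have rk: "int r * k \<ge> 2 * k" using step(1) k by (intro mult_right_mono) auto
      show "int (Suc r) * k + s \<in> K"
      proof (cases "s < int r")
        case True
        have "k + (int r * k + s) \<in> K"
        proof (rule K[OF kK(1)])
          show "int r * k + s \<in> K" using step.IH True s by blast
          show "k \<noteq> int r * k + s" "k + (int r * k + s) \<noteq> 0" using rk k s by linarith+
        qed
        then show ?thesis by (simp add: algebra_simps)
      next
        case False
        then have sr: "s = int r" using s by simp
        have "(k + 1) + (int r * k + (int r - 1)) \<in> K"
        proof (rule K[OF kK(2)])
          show "int r * k + (int r - 1) \<in> K" using step.IH step(1) by auto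
          show "k + 1 \<noteq> int r * k + (int r - 1)" "k + 1 + (int r * k + (int r - 1)) \<noteq> 0"
            using rk k step(1) by linarith+
        qed
        then show ?thesis by (simp add: algebra_simps sr)
      qed
    qed
  qed
  have "i \<in> K" if i: "i \<ge> (k + 1) * k + 1" for i
  proof -
    \<comment> \<open>Dividing \<open>i - 1\<close> instead of \<open>i\<close> makes the rest
      \<open>s\<close> run through 1..k, so that \<open>s \<le> k < r\<close>.\<close>
    define r where "r = nat ((i - 1) div k)"
    have "(k + 1) * k div k \<le> (i - 1) div k" using k i by (intro zdiv_mono1) auto
    then have r: "int r = (i - 1) div k" "int r \<ge> k + 1" using k by (auto simp: r_def)
    have "0 \<le> (i - 1) mod k" "(i - 1) mod k < k" using k by simp_all
    then have "1 \<le> (i - 1) mod k + 1 \<and> (i - 1) mod k + 1 < int r" "r \<ge> 2" using r(2) k by linarith+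
    then have "int r * k + ((i - 1) mod k + 1) \<in> K" using * by blast
    also have "int r * k + ((i - 1) mod k + 1) = i"
      using div_mult_mod_eq[of "i - 1" k] unfolding r(1) by linarith
    finally show ?thesis .
  qed
  then show ?thesis by (auto simp: killed_def K_def)
qed

end

section \<open>Irreducible modules: extremal vectors, weights, bounded dimensions\<close>

locale tvir_irr = tvir_rep scale n D Z
  for scale :: "complex \<Rightarrow> 'v::ab_group_add \<Rightarrow> 'v" (infixr \<open>\<cdot>\<close> 75) and n D Z +
  assumes nontrivial: "\<exists>v::'v. v \<noteq> 0"
    and irreducible: "\<And>S v. subspace S \<Longrightarrow> (\<And>i j v. v \<in> S \<Longrightarrow> D i j v \<in> S) \<Longrightarrow> (\<And>j v. v \<in> S \<Longrightarrow> Z j v \<in> S)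
      \<Longrightarrow> v \<in> S \<Longrightarrow> v \<noteq> 0 \<Longrightarrow> S = UNIV"
    and weights: "span (\<Union>\<mu>. W \<mu>) = UNIV"
    and weight_fin: "\<And>\<mu>. \<exists>S. finite S \<and> W \<mu> \<subseteq> span S"
begin

text \<open>The vectors killed from some degree on form a submodule, as a bracket only moves the
  threshold.\<close>

lemma killed_irreducible:
  assumes v: "v \<noteq> 0" "killed m v"
  shows "\<exists>m. killed m u"
proof -
  have "{v. \<exists>m. killed m v} = UNIV"
  proof (rule irreducible[of _ v])
    show "subspace {v. \<exists>m. killed m v}"
    proof (rule subspaceI)
      show "0 \<in> {v. \<exists>m. killed m v}" using subspace_0[OF subspace_killed] by auto
      show "c \<cdot> x \<in> {v. \<exists>m. killed m v}" if "x \<in> {v. \<exists>m. killed m v}" for c x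
        using that subspace_scale[OF subspace_killed] by fastforce
      fix x y assume "x \<in> {v. \<exists>m. killed m v}" "y \<in> {v. \<exists>m. killed m v}"
      then obtain m m' where "killed m x" "killed m' y" by auto
      then have "killed (max m m') x" "killed (max m m') y" by (auto elim: killed_mono)
      then show "x + y \<in> {v. \<exists>m. killed m v}" using subspace_add[OF subspace_killed] by fastforce
    qed
  qed (use v killed_D' killed_Z in blast)+
  then show ?thesis by blast
qed

lemma killed_weight_space:
  assumes v: "v \<noteq> 0" "killed m v"
  shows "\<exists>M. \<forall>u\<in>W \<mu>. killed M u"
proof -
  obtain S where S: "finite S" "W \<mu> \<subseteq> span S" using weight_fin by blast
  have "\<forall>s. \<exists>m. killed m s" using killed_irreducible[OF v] by blast
  then obtain f where f: "\<And>s. killed (f s) s" by metis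
  have "killed (Max (f ` S)) s" if "s \<in> S" for s
    using f[of s] S(1) that by (elim killed_mono) auto
  then have "span S \<subseteq> {v. killed (Max (f ` S)) v}"
    by (intro span_minimal subspace_killed) auto
  then show ?thesis using S(2) by blast
qed

lemma killed_minimal:
  assumes v: "v \<noteq> 0" "killed m v"
  shows "\<exists>w. w \<noteq> 0 \<and> killed 1 w"
proof -
  define P where "P q \<longleftrightarrow> (\<exists>w. w \<noteq> 0 \<and> killed (int q + 1) w)" for q :: nat
  have "P (nat m)" using v killed_mono[of m v "int (nat m) + 1"] by (auto simp: P_def)
  define p where "p = (LEAST q. P q)"
  have Pp: "P p" unfolding p_def using \<open>P (nat m)\<close> by (rule LeastI)
  have np: "\<not> P q" if "q < p" for q using not_less_Least that unfolding p_def by blast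
  have "p = 0"
  proof (rule ccontr)
    assume p0: "p \<noteq> 0"
    \<comment> \<open>By minimality of \<open>p\<close>, a nonzero vector that is killed from
      \<open>p + 1\<close> on is not killed in degree \<open>p\<close>.\<close>
    have ex: "\<exists>j. D (int p) j w \<noteq> 0" if "w \<noteq> 0" "killed (int p + 1) w" for w
    proof (rule ccontr)
      assume "\<not> ?thesis"
      then have "killed (int p) w"
        using that(2) unfolding killed_def by (metis order_le_less zless_imp_add1_zle)
      then have "P (p - 1)" using that(1) p0 by (auto simp: P_def of_nat_diff)
      then show False using np[of "p - 1"] p0 by simp
    qed
    obtain w where w: "w \<noteq> 0" "killed (int p + 1) w" using Pp by (auto simp: P_def)
    have "D 0 0 ` {v. killed (int p + 1) v} \<subseteq> {v. killed (int p + 1) v}"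
      using killed_D by auto
    then obtain \<mu> w0 where w0: "killed (int p + 1) w0" "w0 \<in> W \<mu>" "w0 \<noteq> 0"
      using weight_in_subspace[OF subspace_killed, of "int p + 1" w] w weights by auto
    \<comment> \<open>Raising repeatedly in degree \<open>p\<close> yields nonzero vectors of
      arbitrarily high weight that are still killed from \<open>p + 1\<close> on.\<close>
    have chain: "\<exists>w. w \<noteq> 0 \<and> w \<in> W (\<mu> + of_int (int k * int p)) \<and> killed (int p + 1) w" for k
    proof (induction k)
      case 0 then show ?case using w0 by auto
    next
      case (Suc k)
      then obtain w where w: "w \<noteq> 0" "w \<in> W (\<mu> + of_int (int k * int p))" "killed (int p + 1) w" by auto
      obtain j where "D (int p) j w \<noteq> 0" using ex[OF w(1,3)] by auto
      moreover have "killed (int p + 1) (D (int p) j w)" using w(3) by (intro killed_D) auto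
      moreover have "D (int p) j w \<in> W (\<mu> + of_int (int (Suc k) * int p))"
        using W_D[OF w(2), of "int p" j] by (simp add: algebra_simps)
      ultimately show ?case by blast
    qed
    obtain M where M: "\<And>u. u \<in> W \<mu> \<Longrightarrow> killed M u" using killed_weight_space[OF v] by blast
    define k where "k = nat \<bar>M\<bar> + 1"
    obtain w where w: "w \<noteq> 0" "w \<in> W (\<mu> + of_int (int k * int p))" "killed (int p + 1) w"
      using chain by blast
    obtain j where j: "D (int p) j w \<noteq> 0" using ex[OF w(1,3)] by auto
    \<comment> \<open>Chosen so that the degrees \<open>i\<close> and \<open>- k p\<close> add up to
      \<open>p\<close>, where \<open>w\<close> survives, while \<open>i \<ge> M\<close> and
      \<open>i > p\<close>.\<close>
    define i where "i = int (k + 1) * int p"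
    have "int (k + 1) * 1 \<le> int (k + 1) * int p" using p0 by (intro mult_left_mono) auto
    then have "i \<ge> int (k + 1)" by (simp only: i_def mult_1_right)
    then have iM: "i \<ge> M" by (simp add: k_def)
    have "int k * int p \<ge> 1 * 1" using p0 by (intro mult_mono) (auto simp: k_def)
    then have ip: "i \<ge> int p + 1" by (simp add: i_def algebra_simps)
    have ik: "i + - (int k * int p) = int p" by (simp add: i_def algebra_simps)
    have "D (- (int k * int p)) 0 w \<in> W \<mu>"
      using W_D[OF w(2), of "- (int k * int p)" 0] by simp
    then have "0 = D i j (D (- (int k * int p)) 0 w)" using M iM by (auto simp: killed_def)
    also have "\<dots> = of_int (- (int k * int p) - i) \<cdot> D (int p) j w"
      using w(3) ip ik p0 by (subst D_D') (auto simp: killed_def D_zero)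
    finally have "of_int (- (int k * int p) - i) = (0 :: complex)" using j by (metis scale_eq_0_iff)
    then have "- (int k * int p) - i = 0" by (simp only: of_int_eq_0_iff)
    then show False using ip \<open>int k * int p \<ge> 1 * 1\<close> by linarith
  qed
  then show ?thesis using Pp by (simp add: P_def)
qed

text \<open>On the finite-dimensional space of vectors of one weight that are killed from degree 1
  on, the operators \<open>D 0 j\<close> and \<open>Z j\<close> commute, so they have a common
  eigenvector. Only \<open>j < n\<close> gives operators to consider; the others are 0.\<close>

lemma highest_vector:
  assumes v: "v \<noteq> 0" "killed m v"
  shows "\<exists>w. w \<noteq> 0 \<and> killed 1 w \<and> (\<forall>j. \<exists>\<kappa>. D 0 j w = \<kappa> \<cdot> w) \<and> (\<forall>j. \<exists>\<kappa>. Z j w = \<kappa> \<cdot> w)"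
proof -
  obtain w where w: "w \<noteq> 0" "killed 1 w" using killed_minimal[OF v] by blast
  have "D 0 0 ` {v. killed 1 v} \<subseteq> {v. killed 1 v}"
    using killed_D by auto
  then obtain \<mu> w0 where w0: "killed 1 w0" "w0 \<in> W \<mu>" "w0 \<noteq> 0"
    using weight_in_subspace[OF subspace_killed, of 1 w] w weights by auto
  obtain S where S: "finite S" "W \<mu> \<subseteq> span S" using weight_fin by blast
  let ?U = "{v. killed 1 v} \<inter> W \<mu>"
  let ?Ts = "map (D 0) [0..<n] @ map Z [0..<n]"
  have "\<exists>w\<in>?U. w \<noteq> 0 \<and> (\<forall>T\<in>set ?Ts. \<exists>\<kappa>. T w = \<kappa> \<cdot> w)"
  proof (rule common_eigenvector[OF S(1)])
    show "subspace ?U" by (intro subspace_inter subspace_killed subspace_W)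
    show "T ` ?U \<subseteq> ?U" if "T \<in> set ?Ts" for T
      using that W_D[of _ \<mu> 0] W_Z[of _ \<mu>] killed_D[of 1 _ 0] killed_Z[of 1] by auto
    have "D 0 a (D 0 b u) = D 0 b (D 0 a u)" for a b u
      using D_bracket[of 0 a 0 b u] by simp
    then show "T (T' u) = T' (T u)" if "T \<in> set ?Ts" "T' \<in> set ?Ts" for T T' u
      using that Z_D Z_Z by auto
  qed (use S w0 D_endo Z_endo in auto)
  then obtain w1 where w1: "w1 \<in> ?U" "w1 \<noteq> 0" "\<forall>T\<in>set ?Ts. \<exists>\<kappa>. T w1 = \<kappa> \<cdot> w1" by blast
  have "\<exists>\<kappa>. D 0 j w1 = \<kappa> \<cdot> w1" for j
    using w1(3) D_trunc[of j 0 w1] scale_zero_left by (cases "j < n") (force, metis not_less)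
  moreover have "\<exists>\<kappa>. Z j w1 = \<kappa> \<cdot> w1" for j
    using w1(3) Z_trunc[of j w1] scale_zero_left by (cases "j < n") (force, metis not_less)
  ultimately show ?thesis using w1 by blast
qed

text \<open>The span of the family is a nonzero submodule, hence everything; comparing weight
  components then shows that no \<open>S k\<close> is smaller than its weight space.\<close>

lemma graded_irreducible:
  fixes S :: "int \<Rightarrow> 'v set"
  assumes S: "\<And>m. subspace (S m)" "\<And>m. S m \<subseteq> W (\<mu> + of_int m)"
    and DS: "\<And>m i j v. v \<in> S m \<Longrightarrow> D i j v \<in> S (m + i)" and ZS: "\<And>m j v. v \<in> S m \<Longrightarrow> Z j v \<in> S m"
    and v: "v \<in> S m" "v \<noteq> 0"
  shows "S k = W (\<mu> + of_int k)" and "span (\<Union>m. S m) = UNIV"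
proof -
  show U: "span (\<Union>m. S m) = UNIV"
  proof (rule irreducible)
    fix i j u assume "u \<in> span (\<Union>m. S m)"
    then show "D i j u \<in> span (\<Union>m. S m)"
      by (induction rule: span_induct_alt)
         (auto simp: D_zero D_add D_scale span_zero intro!: span_add span_scale, meson DS UN_I UNIV_I span_base)
  next
    fix j u assume "u \<in> span (\<Union>m. S m)"
    then show "Z j u \<in> span (\<Union>m. S m)"
      by (induction rule: span_induct_alt)
         (auto simp: Z_zero Z_add Z_scale span_zero intro!: span_add span_scale, meson ZS UN_I UNIV_I span_base)
  qed (use v in \<open>auto intro: span_base\<close>)
  show "S k = W (\<mu> + of_int k)"
  proof
    show "W (\<mu> + of_int k) \<subseteq> S k"
    proof
      fix u assume u: "u \<in> W (\<mu> + of_int k)"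
      obtain F s where F: "finite F" "\<forall>i\<in>F. s i \<in> S i" "u = sum s F"
        using span_UN_sum[of UNIV S u] U S(1) by auto
      \<comment> \<open>Reindexes the summands by weight, since uniqueness of weight components is
        stated for families indexed by weights.\<close>
      define w where "w x = s (THE i. x = \<mu> + of_int i)" for x
      have ws: "w (\<mu> + of_int i) = s i" for i by (simp add: w_def)
      have sW: "s i \<in> W (\<mu> + of_int i)" if "i \<in> F" for i using F(2) S(2) that by blast
      have inj: "inj_on (\<lambda>i. \<mu> + of_int i) F" by (auto simp: inj_on_def)
      have u': "u = sum w ((\<lambda>i. \<mu> + of_int i) ` F)"
        by (simp add: F(3) sum.reindex[OF inj] ws)
      have "u = (if \<mu> + of_int k \<in> (\<lambda>i. \<mu> + of_int i) ` F then w (\<mu> + of_int k) else 0)"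
        unfolding u' by (rule weight_sum_in) (use F(1) sW ws u u' in auto)
      then show "u \<in> S k" using F(2) ws subspace_0[OF S(1)] by (auto split: if_splits)
    qed
  qed (rule S(2))
qed

text \<open>The action shifts weights by integers only. Shifting \<open>\<mu>\<close> so that its
  real part is at least 1 gives |\<mu> + j| \<ge> j + 1 for j \<ge> 0, which later allows division
  by weights.\<close>

lemma coset_exists:
  "\<exists>\<mu>. Re \<mu> \<ge> 1 \<and> span (\<Union>m. W (\<mu> + of_int m)) = UNIV"
proof -
  obtain v :: 'v where v: "v \<noteq> 0" using nontrivial by blast
  obtain \<nu> w where w: "w \<in> W \<nu>" "w \<noteq> 0"
    using weight_in_subspace[OF subspace_UNIV, of v] weights v by auto
  define N where "N = \<lceil>1 - Re \<nu>\<rceil>"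
  define \<mu> where "\<mu> = \<nu> + of_int N"
  have "w \<in> W (\<mu> + of_int (- N))" using w by (simp add: \<mu>_def)
  then have "span (\<Union>m. W (\<mu> + of_int m)) = UNIV"
    using W_D[of _ "\<mu> + of_int _"] W_Z w(2)
    by (intro graded_irreducible(2)[of "\<lambda>m. W (\<mu> + of_int m)" \<mu> w "- N"] subspace_W)
       (auto simp: add.assoc)
  moreover have "Re \<mu> \<ge> 1" unfolding \<mu>_def N_def by (simp) linarith
  ultimately show ?thesis by blast
qed

text \<open>The automorphism d_i t^j -> - d_(-i) t^j, c t^j -> - c t^j of the algebra changes the
  sign of all weights, so every result about large degrees has a counterpart for very negative
  ones.\<close>

lemma twist: "tvir_irr scale n (\<lambda>i j v. - D (- i) j v) (\<lambda>j v. - Z j v)"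
proof -
  have W': "{v. - D (- 0) 0 v = \<mu> \<cdot> v} = W (- \<mu>)" for \<mu>
    by (auto simp: W_def minus_equation_iff[of "D 0 0 _"])
  interpret t: tvir_rep scale n "\<lambda>i j v. - D (- i) j v" "\<lambda>j v. - Z j v"
  proof
    fix i j k l v
    show "- D (- i) j (- D (- k) l v) - - D (- k) l (- D (- i) j v) =
       of_int (k - i) \<cdot> - D (- (i + k)) (j + l) v +
       (if i = - k then (of_int (i ^ 3 - i) / 12) \<cdot> - Z (j + l) v else 0)"
      using D_bracket[of "- i" j "- k" l v]
      by (auto simp: D_neg power3_eq_cube scale_left_diff_distrib diff_divide_distrib algebra_simps)
  qed (auto simp: D_add D_scale Z_add Z_scale D_neg Z_neg Z_D Z_Z D_trunc Z_trunc)
  have tW: "t.W \<mu> = W (- \<mu>)" for \<mu> using W'[of \<mu>] by (simp add: t.W_def)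
  show ?thesis
  proof
    show "\<exists>v::'v. v \<noteq> 0" by (rule nontrivial)
  next
    fix S v assume S: "subspace S" "\<And>i j v. v \<in> S \<Longrightarrow> - D (- i) j v \<in> S" "\<And>j v. v \<in> S \<Longrightarrow> - Z j v \<in> S"
      and v: "v \<in> S" "v \<noteq> 0"
    show "S = UNIV"
    proof (rule irreducible[OF S(1)])
      show "D i j v \<in> S" if "v \<in> S" for i j v
        using subspace_neg[OF S(1) S(2)[OF that, of "- i" j]] by simp
      show "Z j v \<in> S" if "v \<in> S" for j v
        using subspace_neg[OF S(1) S(3)[OF that, of j]] by simp
    qed (use v in auto)
  next
    have "(\<Union>\<mu>. t.W \<mu>) = (\<Union>\<mu>. W \<mu>)" by (simp add: tW) (metis (no_types) minus_minus surj_def surj_uminus image_image)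
    then show "span (\<Union>\<mu>. t.W \<mu>) = UNIV" by (simp add: weights)
    show "\<exists>S. finite S \<and> t.W \<mu> \<subseteq> span S" for \<mu> using weight_fin by (simp add: tW)
  qed
qed

text \<open>The operators of degrees k and k + 1 send \<open>W (\<mu> - k)\<close> into
  \<open>n\<close> copies each of \<open>W \<mu>\<close> and \<open>W (\<mu> + 1)\<close>. A vector
  in their common kernel is killed from some degree on by \<open>killed_from_two\<close>, hence is
  0. The target does not depend on k.\<close>

lemma dim_bound_below:
  assumes nk: "\<And>v m. killed m v \<Longrightarrow> v = 0"
  shows "\<exists>N. \<forall>k::nat. k \<ge> 1 \<longrightarrow> dim_le (W (\<mu> - of_nat k)) N"
proof -
  obtain S where S: "\<And>\<nu>. finite (S \<nu>)" "\<And>\<nu>. W \<nu> \<subseteq> span (S \<nu>)" using weight_fin by metis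
  define N where "N = n * card (S \<mu>) + n * card (S (\<mu> + 1))"
  have "dim_le (W (\<mu> - of_nat k)) N" if k: "k \<ge> 1" for k
  proof -
    define T where "T a = (if a < n then D (int k) a else D (int k + 1) (a - n))" for a
    define R where "R a = (if a < n then S \<mu> else S (\<mu> + 1))" for a
    have "dim_le (W (\<mu> - of_nat k)) (\<Sum>a<n+n. card (R a))"
    proof (rule dim_le_common_kernel[of "n + n" T R])
      show "endo (T a)" for a by (simp add: T_def D_endo)
      show "finite (R a)" for a by (simp add: R_def S)
      show "T a ` W (\<mu> - of_nat k) \<subseteq> span (R a)" for a
        using W_D[of _ "\<mu> - of_nat k" "int k"] W_D[of _ "\<mu> - of_nat k" "int k + 1"] S(2)
        by (fastforce simp: T_def R_def)
      fix v assume v: "\<forall>a<n + n. T a v = 0"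
      have "D (int k) j v = 0" for j
        using v[rule_format, of j] D_trunc[of j] by (cases "j < n") (auto simp: T_def)
      moreover have "D (int k + 1) j v = 0" for j
        using v[rule_format, of "n + j"] D_trunc[of j] by (cases "j < n") (auto simp: T_def)
      ultimately show "v = 0" using nk[OF killed_from_two[of "int k" v]] k by auto
    qed (rule subspace_W)
    also have "(\<Sum>a<n+n. card (R a)) = N"
    proof -
      have "{..<n + n} = {..<n} \<union> {n..<n + n}" by auto
      then show ?thesis by (simp add: sum.union_disjoint ivl_disj_int R_def N_def)
    qed
    finally show ?thesis .
  qed
  then show ?thesis by blast
qed

lemma dim_bound:
  assumes nk: "\<And>v m. killed m v \<Longrightarrow> v = 0"
    and nk': "\<And>v m. \<forall>i\<le>m. \<forall>j. D i j v = 0 \<Longrightarrow> v = 0"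
  shows "\<exists>N. \<forall>k::int. dim_le (W (\<mu> + of_int k)) N"
proof -
  interpret t: tvir_irr scale n "\<lambda>i j v. - D (- i) j v" "\<lambda>j v. - Z j v" by (rule twist)
  have tW: "t.W \<nu> = W (- \<nu>)" for \<nu>
    by (auto simp: t.W_def W_def minus_equation_iff[of "D 0 0 _"])
  obtain N where N: "\<And>k::nat. k \<ge> 1 \<Longrightarrow> dim_le (W (\<mu> - of_nat k)) N"
    using dim_bound_below[of \<mu>] nk by blast
  have "v = 0" if "t.killed m v" for m v
  proof (rule nk')
    show "\<forall>i\<le>- m. \<forall>j. D i j v = 0"
      using that unfolding t.killed_def by (metis minus_le_iff neg_equal_0_iff_equal minus_minus)
  qed
  then obtain N' where N': "\<And>k::nat. k \<ge> 1 \<Longrightarrow> dim_le (t.W (- \<mu> - of_nat k)) N'"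
    using t.dim_bound_below[of "- \<mu>"] by blast
  obtain S where S: "finite S" "W \<mu> \<subseteq> span S" using weight_fin by blast
  have "dim_le (W (\<mu> + of_int k)) (N + N' + card S)" for k
  proof (cases k "0 :: int" rule: linorder_cases)
    case less
    then have "\<mu> + of_int k = \<mu> - of_nat (nat (- k))" "nat (- k) \<ge> 1" by (simp_all add: of_nat_nat)
    then show ?thesis using dim_le_mono[OF N, of "nat (- k)" "N + N' + card S"] by simp
  next
    case equal
    then show ?thesis using dim_le_mono[OF dim_le_span[OF S]] by simp
  next
    case greater
    then have "\<mu> + of_int k = \<mu> + of_nat (nat k)" "nat k \<ge> 1" by (simp_all add: of_nat_nat)
    then show ?thesis using dim_le_mono[OF N', of "nat k" "N + N' + card S"] by (simp add: tW add.commute)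
  qed
  then show ?thesis by blast
qed

end

section \<open>Vanishing of the nilpotent part\<close>

context complex_vector_space
begin

text \<open>\<open>A\<close> is the commutator of \<open>X\<close> and \<open>T\<close>; as it
  commutes with \<open>T\<close>, bracketing with \<open>X\<close> acts on powers of
  \<open>T\<close> like a derivative.\<close>

lemma commutator_funpow:
  assumes T: "endo T" and XT: "\<And>v. X (T v) = T (X v) + A v" and AT: "\<And>v. A (T v) = T (A v)"
  shows "X ((T ^^ s) v) = (T ^^ s) (X v) + of_nat s \<cdot> A ((T ^^ (s - 1)) v)"
proof (induction s)
  case (Suc s)
  interpret T: Vector_Spaces.linear scale scale T by fact
  have "T (of_nat s \<cdot> A ((T ^^ (s - 1)) v)) = of_nat s \<cdot> A ((T ^^ s) v)"
    by (cases s) (simp_all add: T.scale AT)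
  then show ?case
    by (simp add: XT Suc.IH T.add scale_left_distrib algebra_simps)
qed simp

lemma endo_funpow: "endo T \<Longrightarrow> endo (T ^^ s)"
proof (induction s)
  case 0 show ?case by (simp add: linear_id del: id_apply)
next
  case (Suc s) show ?case using Vector_Spaces.linear_compose[OF Suc.IH[OF Suc.prems] Suc.prems] by (simp only: funpow.simps)
qed

lemma funpow_commute: "(\<And>v. X (T v) = T (X v)) \<Longrightarrow> X ((T ^^ s) v) = (T ^^ s) (X v)"
  by (induction s) simp_all

text \<open>The only eigenvalue \<open>T\<close> can have at \<open>v\<close> is
  \<open>\<zeta>\<close>, so \<open>c T + d\<close> can kill \<open>v\<close> only if
  \<open>c \<zeta> + d = 0\<close>.\<close>

lemma nilpotent_shift_inj:
  assumes nil: "((\<lambda>v. T v - \<zeta> \<cdot> v) ^^ N) v = 0" and T: "endo T"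
    and y: "c \<cdot> T v + d \<cdot> v = 0" and c: "c \<noteq> 0" "c * \<zeta> + d \<noteq> 0"
  shows "v = 0"
proof -
  interpret T: Vector_Spaces.linear scale scale T by fact
  define S where "S v = T v - \<zeta> \<cdot> v" for v
  define e where "e = - ((c * \<zeta> + d) / c)"
  have "c \<cdot> T v = - (d \<cdot> v)" using y by (simp add: eq_neg_iff_add_eq_0)
  then have "(1 / c) \<cdot> c \<cdot> T v = (1 / c) \<cdot> (- (d \<cdot> v))" by simp
  then have "T v = (- (d / c)) \<cdot> v" using c by simp
  then have "S v = e \<cdot> v"
    using c by (simp add: S_def e_def field_simps flip: scale_left_diff_distrib scale_minus_left)
  moreover have "S (x \<cdot> v) = x \<cdot> S v" for x
    by (simp add: S_def T.scale scale_right_diff_distrib mult.commute)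
  ultimately have "(S ^^ k) v = e ^ k \<cdot> v" for k by (induction k) (simp_all add: mult.commute)
  then have "e ^ N \<cdot> v = 0" using nil by (simp add: S_def[abs_def])
  moreover have "e \<noteq> 0" using c by (simp add: e_def)
  ultimately show ?thesis by simp
qed

end

context tvir_irr
begin

section \<open>The highest power of t that may still act nontrivially\<close>

context
  fixes \<mu> N and j :: nat
  assumes coset: "span (\<Union>m. W (\<mu> + of_int m)) = UNIV"
    and bound: "\<And>m. dim_le (W (\<mu> + of_int m)) N"
    and j: "j \<ge> 1" and top: "\<And>i k v. k > j \<Longrightarrow> D i k v = 0" "\<And>k v. k > j \<Longrightarrow> Z k v = 0"
begin

lemma nonzero_weight: "\<exists>m v. v \<in> W (\<mu> + of_int m) \<and> v \<noteq> 0"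
proof (rule ccontr)
  assume "\<not> ?thesis"
  then have "(\<Union>m. W (\<mu> + of_int m)) \<subseteq> {0}" by auto
  then have "span (\<Union>m. W (\<mu> + of_int m)) \<subseteq> {0}" by (rule span_minimal) simp
  then show False using coset nontrivial by auto
qed

text \<open>The bracket lies in the layer of t^(2j), and 2j > j.\<close>

lemma top_commute: "D i j (D k j v) = D k j (D i j v)"
  using D_bracket[of i j k j v] top j by (simp split: if_splits)

text \<open>Schur's lemma: a finite-dimensional weight space contains an eigenvector, and
  eigenspaces of a central operator are submodules.\<close>

lemma Z_scalar: "\<exists>\<gamma>. \<forall>v. Z k v = \<gamma> \<cdot> v"
proof -
  obtain m v where v: "v \<in> W (\<mu> + of_int m)" "v \<noteq> 0" using nonzero_weight by blast
  obtain S where S: "finite S" "W (\<mu> + of_int m) \<subseteq> span S" using weight_fin by blast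
  have "Z k ` W (\<mu> + of_int m) \<subseteq> W (\<mu> + of_int m)" using W_Z by blast
  then obtain \<gamma> w where w: "w \<noteq> 0" "Z k w = \<gamma> \<cdot> w"
    using eigenvector_exists[OF Z_endo S(1) subspace_W S(2) _ v] by blast
  have "{v. Z k v = \<gamma> \<cdot> v} = UNIV"
  proof (rule irreducible[of _ w])
    show "subspace {v. Z k v = \<gamma> \<cdot> v}"
      by (auto simp: subspace_def Z_zero Z_add Z_scale scale_right_distrib mult.commute)
  qed (use w in \<open>auto simp: Z_D Z_Z[of k] D_scale Z_scale\<close>)
  then show ?thesis by blast
qed

text \<open>The generalised eigenvectors form a submodule: the commutator of \<open>D k l\<close>
  with \<open>D 0 j\<close> lies in layer \<open>l + j\<close> and commutes with
  \<open>D 0 j\<close>, so one further power suffices. The exponent can be taken as \<open>N\<close>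
  because \<open>D 0 j\<close> preserves each weight space.\<close>

lemma top_generalized_eigenvalue: "\<exists>\<zeta>. \<forall>v. ((\<lambda>v. D 0 j v - \<zeta> \<cdot> v) ^^ N) v = 0"
proof -
  obtain m v where v: "v \<in> W (\<mu> + of_int m)" "v \<noteq> 0" using nonzero_weight by blast
  obtain S where S: "finite S" "W (\<mu> + of_int m) \<subseteq> span S" using weight_fin by blast
  have zW: "D 0 j w \<in> W (\<mu> + of_int m)" if "w \<in> W (\<mu> + of_int m)" for m w
    using W_D[OF that, of 0 j] by simp
  have "D 0 j ` W (\<mu> + of_int m) \<subseteq> W (\<mu> + of_int m)" using zW by (rule image_subsetI)
  from eigenvector_exists[OF D_endo S(1) subspace_W S(2) this v] obtain \<zeta> w
    where "w \<in> W (\<mu> + of_int m) \<and> w \<noteq> 0 \<and> D 0 j w = \<zeta> \<cdot> w" by (elim exE)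
  then have w: "w \<noteq> 0" "D 0 j w = \<zeta> \<cdot> w" by simp_all
  define T where "T v = D 0 j v - \<zeta> \<cdot> v" for v
  have T: "endo T" unfolding T_def[abs_def]
    by (auto simp: Vector_Spaces.linear_iff D_add D_scale algebra_simps intro!: vector_space_axioms)
  interpret T: Vector_Spaces.linear scale scale T by (rule T)
  have inv: "(T ^^ Suc s) (D k l v) = 0" if "(T ^^ s) v = 0" for s k l v
  proof -
    let ?A = "\<lambda>v. of_int (- k) \<cdot> D k (l + j) v"
    have "D k l (T v) = T (D k l v) + ?A v" for v
      using D_D[of k l 0 j v] by (simp add: T_def D_diff D_scale algebra_simps)
    moreover have "?A (T v) = T (?A v)" for v
      using D_D[of k "l + j" 0 j v] top j by (simp add: T_def D_diff D_scale D_neg D_zero algebra_simps)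
    ultimately have "D k l ((T ^^ Suc s) v) = (T ^^ Suc s) (D k l v) + of_nat (Suc s) \<cdot> ?A ((T ^^ (Suc s - 1)) v)"
      by (intro commutator_funpow T)
    then show ?thesis using that by (simp add: T.zero D_zero)
  qed
  have up: "(T ^^ s') v = 0" if "(T ^^ s) v = 0" "s \<le> s'" for s s' v
    using that(2)
  proof (induction s' rule: dec_induct)
    case base then show ?case using that by simp
  qed (simp add: T.zero)
  have "{v. \<exists>s. (T ^^ s) v = 0} = UNIV"
  proof (rule irreducible[of _ w])
    show "subspace {v. \<exists>s. (T ^^ s) v = 0}"
    proof (rule subspaceI)
      show "0 \<in> {v. \<exists>s. (T ^^ s) v = 0}" by (auto intro: exI[of _ 0])
      interpret s: Vector_Spaces.linear scale scale "T ^^ s" for s by (intro endo_funpow T)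
      show "c \<cdot> x \<in> {v. \<exists>s. (T ^^ s) v = 0}" if "x \<in> {v. \<exists>s. (T ^^ s) v = 0}" for c x
        using that by (auto simp: s.scale)
      fix x y assume "x \<in> {v. \<exists>s. (T ^^ s) v = 0}" "y \<in> {v. \<exists>s. (T ^^ s) v = 0}"
      then obtain s t where "(T ^^ s) x = 0" "(T ^^ t) y = 0" by auto
      then have "(T ^^ (max s t)) x = 0" "(T ^^ (max s t)) y = 0" by (auto intro: up)
      then show "x + y \<in> {v. \<exists>s. (T ^^ s) v = 0}" using s.add[of "max s t" x y] by auto
    qed
    show "D i k v \<in> {v. \<exists>s. (T ^^ s) v = 0}" if "v \<in> {v. \<exists>s. (T ^^ s) v = 0}" for i k v
      using that inv by blast
    show "Z k v \<in> {v. \<exists>s. (T ^^ s) v = 0}" if v: "v \<in> {v. \<exists>s. (T ^^ s) v = 0}" for k v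
    proof -
      obtain s where "(T ^^ s) v = 0" using v by blast
      moreover have "Z k ((T ^^ s) v) = (T ^^ s) (Z k v)"
        by (rule funpow_commute) (simp add: T_def Z_diff Z_D Z_scale)
      ultimately show ?thesis by (auto simp: Z_zero intro!: exI[of _ s])
    qed
    show "w \<in> {v. \<exists>s. (T ^^ s) v = 0}" using w by (auto simp: T_def intro!: exI[of _ 1])
  qed (rule w)
  then have nil: "\<exists>s. (T ^^ s) v = 0" for v by blast
  have TW: "T ` W (\<mu> + of_int m) \<subseteq> W (\<mu> + of_int m)" for m
    using zW by (auto simp: T_def intro!: W_diff W_scale)
  have "(T ^^ N) v = 0" if "v \<in> W (\<mu> + of_int m)" for v m
    using nilpotent_dim_le[OF T TW bound that] nil[of v] by blast
  then have "(\<Union>m. W (\<mu> + of_int m)) \<subseteq> {v. (T ^^ N) v = 0}" by blast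
  moreover have "subspace {v. (T ^^ N) v = 0}"
  proof -
    interpret s: Vector_Spaces.linear scale scale "T ^^ N" by (intro endo_funpow T)
    show ?thesis by (rule s.subspace_kernel)
  qed
  ultimately have "span (\<Union>m. W (\<mu> + of_int m)) \<subseteq> {v. (T ^^ N) v = 0}" by (rule span_minimal)
  then show ?thesis using coset by (auto simp: T_def[abs_def])
qed

text \<open>Commuting with d_k turns factors \<open>D 0 j - \<zeta>\<close> into factors
  \<open>a = D k j\<close>, so \<open>a\<close> is nilpotent. For the least r with
  \<open>a^r = 0\<close>, the commutator of d_(-k) with \<open>a^r\<close> is r times the bracket of
  d_(-k) and \<open>a\<close>, applied after \<open>a^(r-1)\<close>. The number in the claim is the
  only possible eigenvalue of this bracket, so if it were nonzero, \<open>a^(r-1)\<close> would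
  vanish as well.\<close>

lemma top_commutator_nilpotent:
  assumes \<zeta>: "\<And>v. ((\<lambda>v. D 0 j v - \<zeta> \<cdot> v) ^^ N) v = 0" and \<gamma>: "\<And>v. Z j v = \<gamma> \<cdot> v" and k: "k \<noteq> 0"
  shows "of_int (2 * k) * \<zeta> + of_int (k - k ^ 3) / 12 * \<gamma> = 0"
proof (rule ccontr)
  assume ne: "\<not> ?thesis"
  define T where "T v = D 0 j v - \<zeta> \<cdot> v" for v
  have T: "endo T" unfolding T_def[abs_def]
    by (auto simp: Vector_Spaces.linear_iff D_add D_scale algebra_simps intro!: vector_space_axioms)
  define a where "a = D k j"
  have a: "endo a" by (simp add: a_def D_endo)
  interpret a: Vector_Spaces.linear scale scale a by (rule a)
  interpret ar: Vector_Spaces.linear scale scale "a ^^ r" for r by (intro endo_funpow a)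
  \<comment> \<open>Each step exchanges a factor \<open>T\<close> for a factor \<open>a\<close>,
    until at \<open>r = N\<close> only \<open>a\<close> is left.\<close>
  have "\<forall>v. (a ^^ r) ((T ^^ (N - r)) v) = 0" if "r \<le> N" for r
    using that
  proof (induction r)
    case 0 then show ?case using \<zeta> by (simp add: T_def[abs_def])
  next
    case (Suc r)
    show ?case
    proof
      fix v
      let ?A = "\<lambda>v. of_int (- k) \<cdot> a v"
      have *: "D k 0 ((T ^^ (N - r)) v) = (T ^^ (N - r)) (D k 0 v) + of_nat (N - r) \<cdot> ?A ((T ^^ (N - r - 1)) v)"
        using D_D[of k 0 0 j] top_commute[of k 0]
        by (intro commutator_funpow T) (simp_all add: T_def a_def D_diff D_scale D_neg algebra_simps)
      have "0 = D k 0 ((a ^^ r) ((T ^^ (N - r)) v))" using Suc by (simp add: D_zero)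
      also have "\<dots> = (a ^^ r) (D k 0 ((T ^^ (N - r)) v))"
        by (rule funpow_commute) (use k D_D[of k 0 k j] in \<open>simp add: a_def\<close>)
      also have "\<dots> = of_nat (N - r) \<cdot> of_int (- k) \<cdot> (a ^^ r) (a ((T ^^ (N - r - 1)) v))"
        unfolding * using Suc by (simp add: ar.add ar.diff ar.scale ar.neg)
      finally show "(a ^^ Suc r) ((T ^^ (N - Suc r)) v) = 0"
        using Suc.prems k by (simp add: funpow_swap1)
    qed
  qed
  from this[of N] have aN: "\<forall>v. (a ^^ N) v = 0" by simp
  define r where "r = (LEAST r. \<forall>v. (a ^^ r) v = 0)"
  have r: "\<forall>v. (a ^^ r) v = 0" unfolding r_def using aN by (rule LeastI)
  have r0: "r \<noteq> 0" using r nontrivial by (intro notI) simp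
  have "\<not> (\<forall>v. (a ^^ (r - 1)) v = 0)"
    using not_less_Least[of "r - 1" "\<lambda>r. \<forall>v. (a ^^ r) v = 0"] r0 by (simp add: r_def)
  then obtain v where v: "(a ^^ (r - 1)) v \<noteq> 0" by blast
  let ?y = "\<lambda>v. of_int (2 * k) \<cdot> D 0 j v + (of_int (k - k ^ 3) / 12 * \<gamma>) \<cdot> v"
  have "D (- k) 0 ((a ^^ r) v) = (a ^^ r) (D (- k) 0 v) + of_nat r \<cdot> ?y ((a ^^ (r - 1)) v)"
  proof (rule commutator_funpow[OF a])
    show "D (- k) 0 (a v) = a (D (- k) 0 v) + ?y v" for v
      using D_D[of "- k" 0 k j v] \<gamma> by (simp add: a_def)
    show "?y (a v) = a (?y v)" for v
      using top_commute[of 0 k v] by (simp add: a_def D_add D_scale)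
  qed
  then have "?y ((a ^^ (r - 1)) v) = 0" using r r0 by (simp add: D_zero)
  then have "(a ^^ (r - 1)) v = 0"
    by (rule nilpotent_shift_inj[OF \<zeta> D_endo]) (use k ne in auto)
  then show False using v by simp
qed

lemma top_zero: "D i j v = 0" "Z j v = 0"
proof -
  obtain \<zeta> where \<zeta>: "\<And>v. ((\<lambda>v. D 0 j v - \<zeta> \<cdot> v) ^^ N) v = 0" using top_generalized_eigenvalue by blast
  obtain \<gamma> where \<gamma>: "\<And>v. Z j v = \<gamma> \<cdot> v" using Z_scalar by blast
  \<comment> \<open>For \<open>k = 1\<close> the cubic coefficient is 0, which isolates
    \<open>\<zeta>\<close>; then \<open>k = 2\<close> isolates \<open>\<gamma>\<close>.\<close>
  have z0: "\<zeta> = 0" using top_commutator_nilpotent[OF \<zeta> \<gamma>, of 1] by simp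
  have "\<gamma> = 0" using top_commutator_nilpotent[OF \<zeta> \<gamma>, of 2] z0 by simp
  then have Z0: "Z j v = 0" for v using \<gamma> by simp
  then show "Z j v = 0" .
  define z where "z = D 0 j"
  have z: "endo z" by (simp add: z_def D_endo)
  have zN: "(z ^^ N) v = 0" for v using \<zeta> z0 by (simp add: z_def)
  define P where "P is w = foldr (\<lambda>i. D i j) is w" for "is" and w :: 'v
  have P_endo: "endo (P is)" for "is"
  proof (induction "is")
    case Nil show ?case by (simp add: P_def[abs_def] linear_ident)
  next
    case (Cons i "is")
    show ?case using Vector_Spaces.linear_compose[OF Cons.IH D_endo[of i j]] by (simp add: P_def[abs_def] o_def)
  qed
  interpret P: Vector_Spaces.linear scale scale "P is" for "is" by (rule P_endo)
  have P_comm: "P is (D k j w) = D k j (P is w)" for "is" k w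
    by (induction "is") (simp_all add: P_def top_commute[of _ k])
  \<comment> \<open>Moving d_k through a product changes one index at a time, so the error is
    spanned by products of the same length, and the induction below covers all of these at
    once.\<close>
  have P_X: "D k 0 (P is w) - P is (D k 0 w) \<in> span {P is' w | is'. length is' = length is}" for k "is" w
  proof (induction "is")
    case Nil show ?case by (simp add: P_def span_zero)
  next
    case (Cons i "is")
    have "D i j ` span {P is' w | is'. length is' = length is} \<subseteq> span {P is' w | is'. length is' = length (i # is)}"
    proof -
      interpret d: Vector_Spaces.linear scale scale "D i j" by (rule D_endo)
      have "D i j ` {P is' w | is'. length is' = length is} \<subseteq> {P is' w | is'. length is' = length (i # is)}"
      proof clarify
        fix is' :: "int list" assume "length is' = length is"
        then show "\<exists>is''. D i j (P is' w) = P is'' w \<and> length is'' = length (i # is)"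
          by (intro exI[of _ "i # is'"]) (simp add: P_def)
      qed
      then show ?thesis using span_mono by (simp flip: d.span_image)
    qed
    then have "D i j (D k 0 (P is w) - P is (D k 0 w)) \<in> span {P is' w | is'. length is' = length (i # is)}"
      using Cons.IH by blast
    moreover have "P ((i + k) # is) w \<in> span {P is' w | is'. length is' = length (i # is)}"
      by (intro span_base CollectI exI[of _ "(i + k) # is"]) auto
    then have "of_int (i - k) \<cdot> P ((i + k) # is) w \<in> span {P is' w | is'. length is' = length (i # is)}"
      by (rule span_scale)
    ultimately have "D i j (D k 0 (P is w) - P is (D k 0 w)) + of_int (i - k) \<cdot> P ((i + k) # is) w
      \<in> span {P is' w | is'. length is' = length (i # is)}" by (rule span_add)
    moreover have "D i j (D k 0 (P is w) - P is (D k 0 w)) + of_int (i - k) \<cdot> P ((i + k) # is) w =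
       D k 0 (P (i # is) w) - P (i # is) (D k 0 w)"
      using D_D[of k 0 i j "P is w"] Z0 by (simp add: P_def D_diff add.commute)
    ultimately show ?case by simp
  qed
  \<comment> \<open>The same exchange as for a single \<open>D k j\<close>, now with arbitrary
    indices: factors \<open>z\<close> are traded one by one for factors of the layer.\<close>
  have main: "\<forall>is v. length is = r \<longrightarrow> P is ((z ^^ (N - r)) v) = 0" if "r \<le> N" for r
    using that
  proof (induction r)
    case 0 then show ?case using zN by (simp add: P_def)
  next
    case (Suc r)
    have IH: "P is ((z ^^ (N - r)) v) = 0" if "length is = r" for "is" v using Suc that by simp
    show ?case
    proof (intro allI impI)
      fix "is" :: "int list" and v assume "length is = Suc r"
      then obtain k is' where is': "is = k # is'" "length is' = r" by (auto simp: length_Suc_conv)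
      have Nr: "N - r = Suc (N - Suc r)" using Suc.prems by simp
      have "P is' (D k j ((z ^^ (N - Suc r)) v)) = 0"
      proof (cases "k = 0")
        case True
        then show ?thesis using IH[OF is'(2), of v] by (simp add: Nr flip: z_def)
      next
        case False
        let ?A = "\<lambda>v. of_int (- k) \<cdot> D k j v" and ?w = "(z ^^ (N - r)) v"
        have X: "D k 0 ?w = (z ^^ (N - r)) (D k 0 v) + of_nat (N - r) \<cdot> ?A ((z ^^ (N - r - 1)) v)"
          using D_D[of k 0 0 j] top_commute[of k 0]
          by (intro commutator_funpow z) (simp_all add: z_def D_scale D_neg)
        have "span {P is'' ?w | is''. length is'' = length is'} \<subseteq> {0}"
          using IH is'(2) by (intro span_minimal) auto
        then have "D k 0 (P is' ?w) - P is' (D k 0 ?w) = 0" using P_X[of k is' ?w] by blast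
        then have "P is' (D k 0 ?w) = 0" using IH[OF is'(2)] by (simp add: D_zero)
        then have "of_nat (N - r) \<cdot> of_int (- k) \<cdot> P is' (D k j ((z ^^ (N - r - 1)) v)) = 0"
          unfolding X using IH[OF is'(2)] by (simp add: P.add P.diff P.scale P.neg)
        then show ?thesis using False Suc.prems by auto
      qed
      then show "P is ((z ^^ (N - Suc r)) v) = 0" using is' P_comm by (simp add: P_def)
    qed
  qed
  from main[of N] have PN: "P is v = 0" if "length is = N" for "is" v using that by simp
  \<comment> \<open>A nonzero product of maximal length has values killed by the whole layer. The
    vectors killed by the layer form a submodule because the layer is an ideal.\<close>
  define Q where "Q r \<longleftrightarrow> (\<exists>is v. length is = r \<and> P is v \<noteq> 0)" for r
  have "Q 0" using nontrivial by (auto simp: Q_def P_def)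
  moreover have "\<not> Q N" using PN by (auto simp: Q_def)
  ultimately obtain r where r: "Q r" "\<not> Q (Suc r)"
    using inc_induct[of 0 N "\<lambda>r. \<not> Q r"] by blast
  then obtain "is" w where w: "length is = r" "P is w \<noteq> 0" by (auto simp: Q_def)
  have "D i j (P is w) = 0" for i
    using r(2) w(1) unfolding Q_def by (auto simp: P_def dest!: spec[of _ "i # is"])
  then have "{v. \<forall>i. D i j v = 0} = UNIV"
  proof (intro irreducible[of _ "P is w"])
    show "subspace {v. \<forall>i. D i j v = 0}" by (auto simp: subspace_def D_zero D_add D_scale)
    show "D k l v \<in> {v. \<forall>i. D i j v = 0}" if "v \<in> {v. \<forall>i. D i j v = 0}" for k l v
      using that Z0 top(1)[of "j + l"] top(2)[of "j + l"] by (cases "l = 0") (auto simp: D_D[of _ j] D_zero)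
    show "Z l v \<in> {v. \<forall>i. D i j v = 0}" if "v \<in> {v. \<forall>i. D i j v = 0}" for l v
      using that by (simp flip: Z_D add: Z_zero)
  qed (use w in auto)
  then show "D i j v = 0" by blast
qed

end

text \<open>Descending induction on the power of t, starting where truncation makes the action
  vanish.\<close>

lemma t_part_zero:
  assumes coset: "span (\<Union>m. W (\<mu> + of_int m)) = UNIV"
    and bound: "\<And>m. dim_le (W (\<mu> + of_int m)) N" and "j \<ge> 1"
  shows "D i j v = 0 \<and> Z j v = 0"
proof -
  have "\<forall>j\<ge>Suc q. (\<forall>i v. D i j v = 0) \<and> (\<forall>v. Z j v = 0)" for q
  proof (cases "q \<le> n")
    case True
    then show ?thesis
    proof (induction q rule: inc_induct)
      case base then show ?case by (simp add: D_trunc Z_trunc)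
    next
      case (step q)
      have "D i (Suc q) v = 0" "Z (Suc q) v = 0" for i v
        using top_zero[OF coset bound, of "Suc q"] step.IH by auto
      then show ?case using step.IH by (metis Suc_leI order_le_less)
    qed
  next
    case False
    then show ?thesis by (simp add: D_trunc Z_trunc)
  qed
  from this[of 0] show ?thesis using assms(3) by auto
qed

end

section \<open>The Casimir element\<close>

context complex_vector_space
begin

lemma eigenvalues_finite:
  assumes T: "endo T" and S: "finite S" "U \<subseteq> span S"
    and A: "\<And>\<kappa>. \<kappa> \<in> A \<Longrightarrow> \<exists>u\<in>U. u \<noteq> 0 \<and> T u = \<kappa> \<cdot> u"
  shows "finite A"
proof (rule ccontr)
  assume "infinite A"
  then obtain F where F: "F \<subseteq> A" "finite F" "card F = Suc (card S)"
    using infinite_arbitrarily_large by blast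
  obtain u where u: "\<And>\<kappa>. \<kappa> \<in> A \<Longrightarrow> u \<kappa> \<in> U \<and> u \<kappa> \<noteq> 0 \<and> T (u \<kappa>) = \<kappa> \<cdot> u \<kappa>"
    using A by metis
  interpret T: Vector_Spaces.linear scale scale T by (rule T)
  have inj: "inj_on u F"
  proof (rule inj_onI)
    fix a b assume "a \<in> F" "b \<in> F" "u a = u b"
    then have "a \<cdot> u a = b \<cdot> u a" "u a \<noteq> 0" using u F(1) by (metis subsetD)+
    then show "a = b" by simp
  qed
  have "independent (u ` F)"
  proof (rule independent_if_scalars_zero)
    fix f x assume f: "(\<Sum>x\<in>u ` F. f x \<cdot> x) = 0" "x \<in> u ` F"
    then obtain \<kappa> where \<kappa>: "\<kappa> \<in> F" "x = u \<kappa>" by auto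
    have "f (u \<kappa>) \<cdot> u \<kappa> = 0"
      by (rule eigen_sum_zero[OF T F(2), of "\<lambda>\<kappa>. f (u \<kappa>) \<cdot> u \<kappa>"])
         (use u F(1) f(1) \<kappa>(1) in \<open>auto simp: T.scale sum.reindex[OF inj] mult.commute\<close>)
    then show "f x = 0" using u F(1) \<kappa> by auto
  qed (use F in auto)
  moreover have "u ` F \<subseteq> span S" using u F(1) S(2) by blast
  ultimately show False using independent_span_bound[OF S(1)] card_image[OF inj] F(3) by fastforce
qed

lemma inj_dim_le:
  assumes T: "endo T" and S: "finite S" "V \<subseteq> span S" and V: "T ` U \<subseteq> V"
    and U: "subspace U" and inj: "\<And>v. v \<in> U \<Longrightarrow> T v = 0 \<Longrightarrow> v = 0"
  shows "dim U \<le> dim V" and "subspace V \<Longrightarrow> dim U = dim V \<Longrightarrow> T ` U = V"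
proof -
  interpret T: Vector_Spaces.linear scale scale T by (rule T)
  obtain B where B: "B \<subseteq> U" "independent B" "U \<subseteq> span B" using maximal_independent_subset[of U] by auto
  have sB: "span B = U" using B U by (simp add: span_minimal subset_antisym)
  have injT: "inj_on T (span B)" unfolding T.inj_on_iff_eq_0[OF subspace_span] using inj sB by blast
  have ind: "independent (T ` B)" by (rule T.independent_inj_on_image[OF B(2) injT])
  have injB: "inj_on T B" by (rule inj_on_subset[OF injT span_superset])
  have TB: "T ` B \<subseteq> V" using B(1) V by blast
  obtain C where C: "T ` B \<subseteq> C" "C \<subseteq> V" "independent C" "V \<subseteq> span C"
    using maximal_independent_subset_extend[OF TB ind] by auto
  have fC: "finite C" using independent_span_bound[OF S(1) C(3)] C(2) S(2) by blast
  have dU: "dim U = card (T ` B)" using basis_card_eq_dim[OF B(1,3,2)] card_image[OF injB] by simp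
  have dV: "dim V = card C" using basis_card_eq_dim[OF C(2,4,3)] by simp
  show "dim U \<le> dim V" using dU dV card_mono[OF fC C(1)] by simp
  show "T ` U = V" if "subspace V" "dim U = dim V"
  proof -
    have "T ` B = C" using card_subset_eq[OF fC C(1)] dU dV that by simp
    then have "T ` span B = span C" by (simp flip: T.span_image)
    then show ?thesis using sB C(2,4) that(1) by (simp add: span_minimal subset_antisym)
  qed
qed

end

lemma nat_mono_bounded_eventually_const:
  fixes f :: "nat \<Rightarrow> nat"
  assumes "\<And>n. f n \<le> f (Suc n)" "\<And>n. f n \<le> N"
  shows "\<exists>K. \<forall>n\<ge>K. f n = f K"
proof -
  have "finite (range f)" by (rule finite_subset[of _ "{..N}"]) (use assms(2) in auto)
  then have "Max (range f) \<in> range f" by (intro Max_in) auto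
  then obtain K where K: "f K = Max (range f)" by (metis imageE)
  have "f n = f K" if "n \<ge> K" for n
    using lift_Suc_mono_le[of f, OF assms(1) that] K Max_ge[OF \<open>finite (range f)\<close>, of "f n"] by auto
  then show ?thesis by blast
qed

context tvir_rep
begin

abbreviation d :: "int \<Rightarrow> 'v \<Rightarrow> 'v" where
  "d i \<equiv> D i 0"

text \<open>Normalised so that it acts on V(a,b) by the scalar b (1 - b).\<close>

definition Cas :: "'v \<Rightarrow> 'v" where
  "Cas v = d 1 (d (- 1) v) - d 0 (d 0 v) + d 0 v"

lemma d_lower_raise: "d (- 1) (d 1 v) = d 1 (d (- 1) v) + 2 \<cdot> d 0 v"
  using D_D[of "- 1" 0 1 0 v] by simp

lemma Cas_endo: "endo Cas"
  by (auto simp: Vector_Spaces.linear_iff Cas_def D_add D_scale algebra_simps intro!: vector_space_axioms)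

lemma Cas_d: "Cas (d 1 v) = d 1 (Cas v)" "Cas (d (- 1) v) = d (- 1) (Cas v)"
proof -
  have 1: "d 0 (d 1 w) = d 1 (d 0 w) + d 1 w" for w using D_D[of 0 0 1 0 w] by simp
  have 2: "d 0 (d (- 1) w) = d (- 1) (d 0 w) - d (- 1) w" for w using D_D[of 0 0 "- 1" 0 w] by simp
  have two: "2 \<cdot> w = w + w" for w using scale_left_distrib[of 1 1 w] by simp
  show "Cas (d 1 v) = d 1 (Cas v)"
    by (simp add: Cas_def d_lower_raise 1 D_add D_diff D_scale two)
  show "Cas (d (- 1) v) = d (- 1) (Cas v)"
    by (simp add: Cas_def d_lower_raise 2 D_add D_diff D_scale two)
qed

lemma W_Cas: "v \<in> W \<mu> \<Longrightarrow> Cas v \<in> W \<mu>"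
proof -
  assume v: "v \<in> W \<mu>"
  have "d 1 (d (- 1) v) \<in> W \<mu>" using W_D[OF W_D[OF v, of "- 1" 0], of 1 0] by simp
  moreover have "d 0 w \<in> W \<mu>" if "w \<in> W \<mu>" for w using W_D[OF that, of 0 0] by simp
  ultimately show ?thesis using v by (simp add: Cas_def W_add W_diff)
qed

lemma raise_lower: "v \<in> W \<mu> \<Longrightarrow> d 1 (d (- 1) v) = Cas v + (\<mu>\<^sup>2 - \<mu>) \<cdot> v"
  by (auto simp: Cas_def W_def D_scale power2_eq_square scale_left_diff_distrib)

lemma lower_raise: "v \<in> W \<mu> \<Longrightarrow> d (- 1) (d 1 v) = Cas v + (\<mu>\<^sup>2 + \<mu>) \<cdot> v"
proof -
  assume v: "v \<in> W \<mu>"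
  then have "d 0 v = \<mu> \<cdot> v" by (simp add: W_def)
  then show ?thesis
    by (simp add: d_lower_raise raise_lower[OF v] flip: scale_left_distrib add.assoc)
qed

end

context tvir_irr
begin

text \<open>A vector of weight x = \<mu> + m killed by d_1 has Casimir eigenvalue -(x^2 + x).
  Lowering it m times keeps the eigenvalue and never gives 0, so all these eigenvalues, which differ
  for different m, occur in the single finite-dimensional space \<open>W \<mu>\<close>.\<close>

lemma d1_inj_eventually:
  assumes \<mu>: "Re \<mu> \<ge> 1"
  shows "\<exists>K. \<forall>m\<ge>K. \<forall>v\<in>W (\<mu> + of_nat m). d 1 v = 0 \<longrightarrow> v = 0"
proof -
  define Bad where "Bad = {m::nat. \<exists>v\<in>W (\<mu> + of_nat m). v \<noteq> 0 \<and> d 1 v = 0}"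
  define ev where "ev m = - ((\<mu> + of_nat m)\<^sup>2 + (\<mu> + of_nat m))" for m :: nat
  obtain S where S: "finite S" "W \<mu> \<subseteq> span S" using weight_fin by blast
  have "\<exists>u\<in>W \<mu>. u \<noteq> 0 \<and> Cas u = ev m \<cdot> u" if "m \<in> Bad" for m
  proof -
    obtain v where v: "v \<in> W (\<mu> + of_nat m)" "v \<noteq> 0" "d 1 v = 0" using \<open>m \<in> Bad\<close> by (auto simp: Bad_def)
    have *: "(d (- 1) ^^ k) v \<in> W (\<mu> + of_nat m - of_nat k) \<and> (d (- 1) ^^ k) v \<noteq> 0 \<and>
        Cas ((d (- 1) ^^ k) v) = ev m \<cdot> (d (- 1) ^^ k) v" if "k \<le> m" for k
      using that
    proof (induction k)
      case 0
      have "Cas v = - (((\<mu> + of_nat m)\<^sup>2 + (\<mu> + of_nat m)) \<cdot> v)"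
        using lower_raise[OF v(1)] v(3) by (simp only: D_zero eq_neg_iff_add_eq_0)
      then have "Cas v = ev m \<cdot> v" by (simp only: ev_def scale_minus_left)
      then show ?case using v by simp
    next
      case (Suc k)
      let ?w = "(d (- 1) ^^ k) v"
      have w: "?w \<in> W (\<mu> + of_nat m - of_nat k)" "?w \<noteq> 0" "Cas ?w = ev m \<cdot> ?w" using Suc by auto
      let ?x = "\<mu> + of_nat m - of_nat k"
      have "d 1 (d (- 1) ?w) = (ev m + (?x\<^sup>2 - ?x)) \<cdot> ?w"
        using raise_lower[OF w(1)] w(3) by (simp add: scale_left_distrib)
      \<comment> \<open>The coefficient factors, and the second factor has positive real part
        because \<open>Re \<mu> \<ge> 1\<close> and \<open>k < m\<close>.\<close>
      also have "ev m + (?x\<^sup>2 - ?x) = - (of_nat k + 1) * (2 * \<mu> + 2 * of_nat m - of_nat k)"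
        by (simp add: ev_def power2_eq_square algebra_simps)
      finally have eq: "d 1 (d (- 1) ?w) = (- (of_nat k + 1) * (2 * \<mu> + 2 * of_nat m - of_nat k)) \<cdot> ?w" .
      have "- (of_nat k + 1) \<noteq> (0 :: complex)"
        by (metis neg_equal_0_iff_equal Suc_eq_plus1 of_nat_1 of_nat_add of_nat_neq_0)
      moreover have "Re (2 * \<mu> + 2 * of_nat m - of_nat k) > 0" using \<mu> Suc.prems by simp
      then have "2 * \<mu> + 2 * of_nat m - of_nat k \<noteq> 0" by (metis order_less_irrefl zero_complex.sel(1))
      ultimately have "d 1 (d (- 1) ?w) \<noteq> 0" unfolding eq using w(2) by (simp only: scale_eq_0_iff mult_eq_0_iff simp_thms)
      then have "d (- 1) ?w \<noteq> 0" by (metis D_zero)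
      moreover have "d (- 1) ?w \<in> W (\<mu> + of_nat m - of_nat (Suc k))"
        using W_D[OF w(1), of "- 1" 0] by (simp add: algebra_simps)
      moreover have "Cas (d (- 1) ?w) = ev m \<cdot> d (- 1) ?w" by (simp add: Cas_d w(3) D_scale)
      ultimately show ?case by simp
    qed
    show ?thesis using *[of m] by auto
  qed
  then have "finite (ev ` Bad)"
    by (intro eigenvalues_finite[OF Cas_endo S]) auto
  moreover have "inj_on ev Bad"
  proof (rule inj_onI)
    fix a b assume ab: "ev a = ev b"
    have "(of_nat a - of_nat b) * (2 * \<mu> + of_nat a + of_nat b + 1) = 0"
      using ab by (simp add: ev_def power2_eq_square algebra_simps)
    moreover have "Re (2 * \<mu> + of_nat a + of_nat b + 1) > 0" using \<mu> by simp
    then have "2 * \<mu> + of_nat a + of_nat b + 1 \<noteq> 0" by (metis order_less_irrefl zero_complex.sel(1))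
    ultimately show "a = b" by simp
  qed
  ultimately have "finite Bad" by (rule finite_imageD)
  then obtain K where "\<forall>m\<in>Bad. m < K" using finite_nat_set_iff_bounded by auto
  then show ?thesis by (intro exI[of _ K]) (auto simp: Bad_def not_less[symmetric])
qed

text \<open>Once \<open>d 1\<close> is injective, the dimensions of the weight spaces are
  nondecreasing; being bounded they stabilise, and from then on injectivity implies
  surjectivity.\<close>

lemma d1_bij_eventually:
  assumes bound: "\<And>m::int. dim_le (W (\<mu> + of_int m)) N"
  shows "\<exists>K. \<forall>m::int. m \<ge> K \<longrightarrow> (\<forall>v\<in>W (\<mu> + of_int m). d 1 v = 0 \<longrightarrow> v = 0) \<and>
     d 1 ` W (\<mu> + of_int m) = W (\<mu> + of_int (m + 1))"
proof -
  define s where "s = \<lceil>1 - Re \<mu>\<rceil>"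
  have "Re (\<mu> + of_int s) \<ge> 1" unfolding s_def by simp linarith
  then obtain K where K: "\<And>m v. m \<ge> K \<Longrightarrow> v \<in> W (\<mu> + of_int s + of_nat m) \<Longrightarrow> d 1 v = 0 \<Longrightarrow> v = 0"
    using d1_inj_eventually by blast
  define U where "U m = W (\<mu> + of_int s + of_nat (K + m))" for m
  have dU: "d 1 ` U m \<subseteq> U (Suc m)" for m
    using W_D[of _ "\<mu> + of_int s + of_nat (K + m)" 1 0] by (auto simp: U_def add_ac)
  have injU: "v = 0" if "v \<in> U m" "d 1 v = 0" for m v
    using K[of "K + m" v] that by (simp add: U_def)
  have "\<forall>m. \<exists>S. finite S \<and> U m \<subseteq> span S" by (simp add: U_def weight_fin)
  then obtain S where S: "\<And>m. finite (S m)" "\<And>m. U m \<subseteq> span (S m)" by metis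
  have sU: "subspace (U m)" for m by (simp add: U_def subspace_W)
  have mono: "dim (U m) \<le> dim (U (Suc m))" for m
    by (rule inj_dim_le(1)[OF D_endo S dU sU injU])
  have "dim (U m) \<le> N" for m
  proof -
    obtain B where "B \<subseteq> U m" "independent B" "card B = dim (U m)" using basis_exists by metis
    moreover have "U m = W (\<mu> + of_int (s + int (K + m)))" by (simp add: U_def add_ac)
    ultimately show ?thesis using bound[of "s + int (K + m)"] unfolding dim_le_def by metis
  qed
  then obtain L where L: "\<And>m. m \<ge> L \<Longrightarrow> dim (U m) = dim (U L)"
    using nat_mono_bounded_eventually_const[of "\<lambda>m. dim (U m)", OF mono] by blast
  have surj: "d 1 ` U m = U (Suc m)" if "m \<ge> L" for m
  proof -
    have "dim (U m) = dim (U (Suc m))" using L[OF that] L[of "Suc m"] that by simp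
    then show ?thesis using injU by (intro inj_dim_le(2)[OF D_endo S dU sU _ sU]) auto
  qed
  show ?thesis
  proof (intro exI[of _ "s + int K + int L"] allI impI)
    fix m assume m: "m \<ge> s + int K + int L"
    define q where "q = nat (m - s - int K)"
    have q: "q \<ge> L" "m = s + int (K + q)" using m by (auto simp: q_def)
    have "\<mu> + of_int s + of_nat (K + q) = \<mu> + of_int m"
       "\<mu> + of_int s + of_nat (K + Suc q) = \<mu> + of_int (m + 1)"
      by (simp_all add: q(2))
    then have "U q = W (\<mu> + of_int m)" "U (Suc q) = W (\<mu> + of_int (m + 1))" by (simp_all only: U_def)
    then show "(\<forall>v\<in>W (\<mu> + of_int m). d 1 v = 0 \<longrightarrow> v = 0) \<and>
     d 1 ` W (\<mu> + of_int m) = W (\<mu> + of_int (m + 1))"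
      using injU[of _ q] surj[OF q(1)] by auto
  qed
qed

lemma d_minus1_surj_eventually:
  assumes bound: "\<And>m::int. dim_le (W (\<mu> + of_int m)) N"
  shows "\<exists>K. \<forall>m::int. m \<le> K \<longrightarrow> d (- 1) ` W (\<mu> + of_int m) = W (\<mu> + of_int (m - 1))"
proof -
  interpret t: tvir_irr scale n "\<lambda>i j v. - D (- i) j v" "\<lambda>j v. - Z j v" by (rule twist)
  have tW: "t.W \<nu> = W (- \<nu>)" for \<nu>
    by (auto simp: t.W_def W_def minus_equation_iff[of "D 0 0 _"])
  have "dim_le (t.W (- \<mu> + of_int m)) N" for m
    using bound[of "- m"] by (simp add: tW)
  then have "\<exists>K. \<forall>m\<ge>K. (\<forall>v\<in>t.W (- \<mu> + of_int m). - D (- 1) 0 v = 0 \<longrightarrow> v = 0) \<and>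
      (\<lambda>v. - D (- 1) 0 v) ` t.W (- \<mu> + of_int m) = t.W (- \<mu> + of_int (m + 1))"
    by (rule t.d1_bij_eventually)
  then obtain K where K': "\<forall>m\<ge>K. (\<forall>v\<in>t.W (- \<mu> + of_int m). - D (- 1) 0 v = 0 \<longrightarrow> v = 0) \<and>
      (\<lambda>v. - D (- 1) 0 v) ` t.W (- \<mu> + of_int m) = t.W (- \<mu> + of_int (m + 1))" ..
  have K: "(\<lambda>v. - D (- 1) 0 v) ` t.W (- \<mu> + of_int m) = t.W (- \<mu> + of_int (m + 1))" if "m \<ge> K" for m
    using K'[rule_format, OF that] by (rule conjunct2)
  have "d (- 1) ` W (\<mu> + of_int m) = W (\<mu> + of_int (m - 1))" if "m \<le> - K" for m
  proof -
    have eq: "- (- \<mu> + of_int (- m)) = \<mu> + of_int m" "- (- \<mu> + of_int (- m + 1)) = \<mu> + of_int (m - 1)"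
      by simp_all
    have "- m \<ge> K" using that by simp
    from K[OF this] have *: "(\<lambda>v. - D (- 1) 0 v) ` W (\<mu> + of_int m) = W (\<mu> + of_int (m - 1))"
      unfolding tW eq .
    have "uminus ` W \<nu> = W \<nu>" for \<nu> using W_neg by force
    then have "uminus ` (\<lambda>v. - D (- 1) 0 v) ` W (\<mu> + of_int m) = W (\<mu> + of_int (m - 1))"
      by (simp only: *)
    then show ?thesis by (simp add: image_image)
  qed
  then show ?thesis by (intro exI[of _ "- K"]) simp
qed

end

section \<open>A contracting recursion\<close>

lemma cmod_shift_ratio:
  "\<exists>J\<ge>2. \<forall>j::int. j \<ge> J \<longrightarrow> cmod (\<mu> + of_int j - 2) \<le> (1 - 7 / (4 * of_int j)) * cmod (\<mu> + of_int j)"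
proof -
  define p q where "p = Re \<mu>" and "q = Im \<mu>"
  have "eventually (\<lambda>t::real. 2 * t * (4 * (p + t) - 4) \<ge> 7 * ((p + t)\<^sup>2 + q\<^sup>2)) at_top"
    by real_asymp
  then obtain T where T: "\<And>t. t \<ge> T \<Longrightarrow> 2 * t * (4 * (p + t) - 4) \<ge> 7 * ((p + t)\<^sup>2 + q\<^sup>2)"
    by (auto simp: eventually_at_top_linorder)
  show ?thesis
  proof (intro exI[of _ "max 2 \<lceil>T\<rceil>"] conjI allI impI)
    fix j :: int assume "j \<ge> max 2 \<lceil>T\<rceil>"
    then have j: "j \<ge> 2" "of_int j \<ge> T" by (auto simp: ceiling_le_iff)
    define t where "t = real_of_int j"
    have t: "t \<ge> 2" "t \<ge> T" using j by (auto simp: t_def)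
    have sq: "(cmod (\<mu> + of_int j - 2))\<^sup>2 = (p + t)\<^sup>2 + q\<^sup>2 - (4 * (p + t) - 4)" "(cmod (\<mu> + of_int j))\<^sup>2 = (p + t)\<^sup>2 + q\<^sup>2"
      unfolding cmod_power2 by (simp_all add: p_def q_def t_def power2_eq_square algebra_simps)
    have "7 / (2 * t) * ((p + t)\<^sup>2 + q\<^sup>2) \<le> 4 * (p + t) - 4"
      using T[OF t(2)] t(1) by (simp add: divide_le_eq mult.commute)
    then have "(p + t)\<^sup>2 + q\<^sup>2 - (4 * (p + t) - 4) \<le> (1 - 7 / (2 * t)) * ((p + t)\<^sup>2 + q\<^sup>2)"
      by (simp add: algebra_simps)
    also have "\<dots> \<le> (1 - 7 / (4 * t))\<^sup>2 * ((p + t)\<^sup>2 + q\<^sup>2)"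
    proof (rule mult_right_mono)
      have "(1 - 7 / (4 * t))\<^sup>2 = 1 - 7 / (2 * t) + (7 / (4 * t))\<^sup>2"
        by (simp add: power2_eq_square algebra_simps)
      then show "1 - 7 / (2 * t) \<le> (1 - 7 / (4 * t))\<^sup>2" by simp
    qed simp
    finally have "(cmod (\<mu> + of_int j - 2))\<^sup>2 \<le> ((1 - 7 / (4 * t)) * cmod (\<mu> + of_int j))\<^sup>2"
      unfolding power_mult_distrib sq .
    moreover have "(1 - 7 / (4 * t)) * cmod (\<mu> + of_int j) \<ge> 0"
      using t(1) by (intro mult_nonneg_nonneg) (simp_all add: field_simps)
    ultimately show "cmod (\<mu> + of_int j - 2) \<le> (1 - 7 / (4 * of_int j)) * cmod (\<mu> + of_int j)"
      unfolding t_def by (rule power2_le_imp_le)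
  qed simp
qed

text \<open>A factor 1 - c/j with c > 1 absorbs an error of order 1/j^2 and forces decay like 1/j.
  The quantity enters through a predicate because \<open>h\<close> stands for an arbitrary upper
  bound of it.\<close>

lemma decay_iterate:
  fixes P :: "int \<Rightarrow> real \<Rightarrow> bool"
  assumes mono: "\<And>j h h'. P j h \<Longrightarrow> h \<le> h' \<Longrightarrow> P j h'" and J: "J \<ge> 2" and base: "P J h0"
    and step: "\<And>j h. j \<ge> J \<Longrightarrow> h \<ge> 0 \<Longrightarrow> P j h \<Longrightarrow> P (j + 1) ((1 - 3 / (2 * of_int j)) * h + E / of_int j ^ 2)"
  shows "\<exists>\<kappa>\<ge>0. \<forall>j\<ge>J. P j (\<kappa> / of_int j)"
proof -
  \<comment> \<open>The first entry bounds \<open>E\<close> by half of \<open>\<kappa>\<close>,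
    which lowers the 3/2 of the contraction to 1, just enough for
    \<open>1/t - 1/t^2 \<le> 1/(t + 1)\<close>. The second entry covers the start
    \<open>J\<close>.\<close>
  define \<kappa> where "\<kappa> = max (2 * \<bar>E\<bar>) (\<bar>h0\<bar> * of_int J)"
  have \<kappa>: "\<kappa> \<ge> 2 * \<bar>E\<bar>" "\<kappa> \<ge> \<bar>h0\<bar> * of_int J" "\<kappa> \<ge> 0" by (auto simp: \<kappa>_def le_max_iff_disj)
  have "P j (\<kappa> / of_int j)" if "j \<ge> J" for j
    using that
  proof (induction j rule: int_ge_induct)
    case base
    have "h0 \<le> \<kappa> / of_int J" using \<kappa>(2) J by (simp add: pos_le_divide_eq) (smt (verit) mult_right_mono of_int_0_le_iff)
    then show ?case using mono assms(3) by blast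
  next
    case (step j)
    define t where "t = real_of_int j"
    have t: "t \<ge> 2" using step.hyps J by (simp add: t_def)
    have "P (j + 1) ((1 - 3 / (2 * t)) * (\<kappa> / t) + E / t ^ 2)"
      using assms(4)[OF step.hyps _ step.IH] \<kappa>(3) t by (simp add: t_def)
    moreover have "(1 - 3 / (2 * t)) * (\<kappa> / t) + E / t ^ 2 \<le> \<kappa> / (t + 1)"
    proof -
      have "E / t ^ 2 \<le> (\<kappa> / 2) / t ^ 2" using \<kappa>(1) by (intro divide_right_mono) auto
      moreover have "\<kappa> * (1 / t - 1 / t ^ 2) \<le> \<kappa> * (1 / (t + 1))"
        using t \<kappa>(3) by (intro mult_left_mono) (simp_all add: field_simps power2_eq_square)
      moreover have "(1 - 3 / (2 * t)) * (\<kappa> / t) + (\<kappa> / 2) / t ^ 2 = \<kappa> * (1 / t - 1 / t ^ 2)"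
        using t by (simp add: field_simps power2_eq_square)
      ultimately show ?thesis by simp
    qed
    ultimately show ?case using mono by (simp add: t_def)
  qed
  then show ?thesis using \<kappa>(3) by blast
qed

section \<open>Coordinates in which d_1 acts by the weight\<close>

locale vir_cuspidal = tvir_irr scale n D Z
  for scale :: "complex \<Rightarrow> 'v::ab_group_add \<Rightarrow> 'v" (infixr \<open>\<cdot>\<close> 75) and n D Z +
  fixes \<mu> :: complex and N :: nat
  assumes Re_\<mu>: "Re \<mu> \<ge> 1" and coset: "span (\<Union>m. W (\<mu> + of_int m)) = UNIV"
    and bound: "\<And>m::int. dim_le (W (\<mu> + of_int m)) N"
    and nk: "\<And>v m. \<forall>i\<ge>m. d i v = 0 \<Longrightarrow> v = 0"
    and t_zero: "\<And>i j v. j \<ge> 1 \<Longrightarrow> D i j v = 0" "\<And>j v. j \<ge> 1 \<Longrightarrow> Z j v = 0"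
begin

definition x :: "int \<Rightarrow> complex" where "x j = \<mu> + of_int j"

abbreviation wt :: "int \<Rightarrow> 'v set" where "wt j \<equiv> W (x j)"

lemma x_add: "x (j + k) = x j + of_int k"
  by (simp add: x_def)

lemma wt_d: "v \<in> wt j \<Longrightarrow> d i v \<in> wt (j + i)"
  using W_D[of v "x j" i 0] by (simp add: x_add)

lemma x_bound: "j \<ge> 0 \<Longrightarrow> cmod (x j) \<ge> of_int j + 1" 
  using complex_Re_le_cmod[of "x j"] Re_\<mu> by (simp add: x_def)

lemma x_nz: "j \<ge> 0 \<Longrightarrow> x j \<noteq> 0"
  using x_bound[of j] by auto

end

text \<open>\<open>\<eta> b j\<close>, \<open>b \<in> B\<close>, are coordinates on the \<open>j\<close>-th weight space, normalised so that \<open>d 1\<close>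
  multiplies them by the weight, as in the basis of some \<open>V(a,b)\<close>.\<close>

locale vir_gauge = vir_cuspidal scale n D Z \<mu> N
  for scale :: "complex \<Rightarrow> 'v::ab_group_add \<Rightarrow> 'v" (infixr \<open>\<cdot>\<close> 75) and n D Z \<mu> N +
  fixes B :: "'v set" and \<eta> :: "'v \<Rightarrow> int \<Rightarrow> 'v \<Rightarrow> complex" and K :: int and C :: real
  assumes finB: "finite B" and K1: "K \<ge> 1" and C0: "C \<ge> 0"
    and \<eta>_add: "\<And>j v w b. j \<ge> K \<Longrightarrow> v \<in> wt j \<Longrightarrow> w \<in> wt j \<Longrightarrow> \<eta> b j (v + w) = \<eta> b j v + \<eta> b j w"
    and \<eta>_scale: "\<And>j v a b. j \<ge> K \<Longrightarrow> v \<in> wt j \<Longrightarrow> \<eta> b j (a \<cdot> v) = a * \<eta> b j v"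
    and \<eta>_d1: "\<And>j v b. j \<ge> K \<Longrightarrow> v \<in> wt j \<Longrightarrow> \<eta> b (j + 1) (d 1 v) = x j * \<eta> b j v"
    and \<eta>_sep: "\<And>j v. j \<ge> K \<Longrightarrow> v \<in> wt j \<Longrightarrow> \<forall>b\<in>B. \<eta> b j v = 0 \<Longrightarrow> v = 0"
    and d1_surj: "\<And>j. j \<ge> K \<Longrightarrow> d 1 ` wt j = wt (j + 1)"
    and Cas_bd: "\<And>j v. j \<ge> K \<Longrightarrow> v \<in> wt j \<Longrightarrow> (\<Sum>b\<in>B. cmod (\<eta> b j (Cas v))) \<le> C * (\<Sum>b\<in>B. cmod (\<eta> b j v))"
    and d_bd: "\<And>j k. j \<ge> K \<Longrightarrow> j + k \<ge> K \<Longrightarrow>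
        \<exists>h. \<forall>v\<in>wt j. (\<Sum>b\<in>B. cmod (\<eta> b (j + k) (d k v))) \<le> h * (\<Sum>b\<in>B. cmod (\<eta> b j v))"
begin

definition nrm :: "int \<Rightarrow> 'v \<Rightarrow> real" where "nrm j v = (\<Sum>b\<in>B. cmod (\<eta> b j v))"

lemma nrm_nonneg: "nrm j v \<ge> 0"
  by (auto simp: nrm_def intro: sum_nonneg)

lemma nrm_component: "b \<in> B \<Longrightarrow> cmod (\<eta> b j v) \<le> nrm j v"
  unfolding nrm_def using finB by (auto intro!: member_le_sum)

lemma nrm_add: "j \<ge> K \<Longrightarrow> v \<in> wt j \<Longrightarrow> w \<in> wt j \<Longrightarrow> nrm j (v + w) \<le> nrm j v + nrm j w"
  by (simp add: nrm_def \<eta>_add sum.distrib[symmetric] sum_mono norm_triangle_ineq)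

lemma nrm_scale: "j \<ge> K \<Longrightarrow> v \<in> wt j \<Longrightarrow> nrm j (a \<cdot> v) = cmod a * nrm j v"
  by (simp add: nrm_def \<eta>_scale norm_mult sum_distrib_left)

lemma nrm_d1: "j \<ge> K \<Longrightarrow> v \<in> wt j \<Longrightarrow> nrm (j + 1) (d 1 v) = cmod (x j) * nrm j v"
  by (simp add: nrm_def \<eta>_d1 norm_mult sum_distrib_left)

lemma nrm_Cas: "j \<ge> K \<Longrightarrow> v \<in> wt j \<Longrightarrow> nrm j (Cas v) \<le> C * nrm j v"
  using Cas_bd by (simp add: nrm_def)

lemma \<eta>_diff: "j \<ge> K \<Longrightarrow> v \<in> wt j \<Longrightarrow> w \<in> wt j \<Longrightarrow> \<eta> b j (v - w) = \<eta> b j v - \<eta> b j w"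
  using \<eta>_add[of j v "- w" b] \<eta>_scale[of j w b "- 1"] by (simp add: W_neg)

text \<open>Apply \<open>d 1\<close>, use that d_1 d_(-1) is \<open>Cas\<close> plus x (x - 1) in
  weight x, and divide by \<open>x (j - 1)\<close>. Since the Casimir element is bounded in these
  coordinates, d_(-1) acts by the weight up to an error of relative size O(1/j).\<close>

lemma \<eta>_dm1:
  assumes j: "j \<ge> K + 1" and v: "v \<in> wt j"
  shows "\<eta> b (j - 1) (d (- 1) v) = x j * \<eta> b j v + \<eta> b j (Cas v) / x (j - 1)"
proof -
  have x: "x (j - 1) = x j - 1" "x (j - 1) \<noteq> 0" using x_nz[of "j - 1"] j K1 by (auto simp: x_def)
  have "x (j - 1) * \<eta> b (j - 1) (d (- 1) v) = \<eta> b j (d 1 (d (- 1) v))"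
    using \<eta>_d1[of "j - 1" "d (- 1) v" b] wt_d[OF v, of "- 1"] j by simp
  also have "\<dots> = \<eta> b j (Cas v) + ((x j)\<^sup>2 - x j) * \<eta> b j v"
    using raise_lower[OF v] j v W_Cas[OF v] by (simp add: \<eta>_add \<eta>_scale W_scale)
  also have "(x j)\<^sup>2 - x j = x (j - 1) * x j" by (simp add: x power2_eq_square algebra_simps)
  finally show ?thesis using x(2) by (simp add: field_simps)
qed

text \<open>The coordinates in which \<open>d 1\<close> acts by the weight are asymptotically adapted to \<open>d (- 2)\<close>
  and \<open>d 2\<close> as well.\<close>

definition dev :: "int \<Rightarrow> int \<Rightarrow> 'v \<Rightarrow> real" where
  "dev k j v = (\<Sum>b\<in>B. cmod (\<eta> b (j + k) (d k v) - x j * \<eta> b j v))"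

lemma dev_component: "b \<in> B \<Longrightarrow> cmod (\<eta> b (j + k) (d k v) - x j * \<eta> b j v) \<le> dev k j v"
  unfolding dev_def using finB by (intro member_le_sum[of b B "\<lambda>b. cmod (\<eta> b (j + k) (d k v) - x j * \<eta> b j v)"]) auto

text \<open>Supplies the starting value of the recursions below; the bound may depend on
  \<open>j\<close>.\<close>

lemma dev_initial:
  assumes j: "j \<ge> K" "j + k \<ge> K"
  shows "\<exists>h. \<forall>v\<in>wt j. dev k j v \<le> h * nrm j v"
proof -
  obtain h where h: "\<And>v. v \<in> wt j \<Longrightarrow> nrm (j + k) (d k v) \<le> h * nrm j v"
    using d_bd[OF j] by (auto simp: nrm_def)
  have "dev k j v \<le> (h + cmod (x j)) * nrm j v" if "v \<in> wt j" for v
  proof -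
    have "dev k j v \<le> (\<Sum>b\<in>B. cmod (\<eta> b (j + k) (d k v)) + cmod (x j) * cmod (\<eta> b j v))"
      unfolding dev_def by (intro sum_mono) (metis norm_mult norm_triangle_ineq4)
    also have "\<dots> = nrm (j + k) (d k v) + cmod (x j) * nrm j v"
      by (simp add: nrm_def sum.distrib sum_distrib_left)
    finally show ?thesis using h[OF that] by (simp add: algebra_simps)
  qed
  then show ?thesis by blast
qed

text \<open>By [d_(-2), d_1] = 3 d_(-1), the defect at \<open>d 1 v\<close> is
  \<open>x (j - 2)\<close> times the defect at \<open>v\<close> plus a Casimir term, whereas
  \<open>d 1\<close> multiplies the norm of \<open>v\<close> by |x_j|. The quotient of the two
  factors is the contraction.\<close>

lemma dev_minus2: "\<exists>\<kappa>\<ge>0. \<exists>J\<ge>K. \<forall>j\<ge>J. \<forall>v\<in>wt j. dev (- 2) j v \<le> \<kappa> / of_int j * nrm j v"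
proof -
  obtain J0 where J0: "J0 \<ge> 2" "\<And>j. j \<ge> J0 \<Longrightarrow> cmod (x j - 2) \<le> (1 - 7 / (4 * of_int j)) * cmod (x j)"
    using cmod_shift_ratio[of \<mu>] by (auto simp: x_def)
  define J where "J = max J0 (K + 2)"
  have J: "J \<ge> 2" "J \<ge> J0" "J \<ge> K + 2" using J0 by (auto simp: J_def)
  define P where "P j h \<longleftrightarrow> (\<forall>v\<in>wt j. dev (- 2) j v \<le> h * nrm j v)" for j h
  obtain h0 where h0: "P J h0" using dev_initial[of J "- 2"] J unfolding P_def by auto
  have "\<exists>\<kappa>\<ge>0. \<forall>j\<ge>J. P j (\<kappa> / of_int j)"
  proof (rule decay_iterate[where P = P and J = J and ?h0.0 = h0 and E = "3 * C"])
    fix j h h' show "P j h \<Longrightarrow> h \<le> h' \<Longrightarrow> P j h'"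
      unfolding P_def using nrm_nonneg by (meson mult_right_mono order_trans)
  next
    fix j h assume j: "j \<ge> J" and h: "h \<ge> 0" and P: "P j h"
    show "P (j + 1) ((1 - 3 / (2 * of_int j)) * h + 3 * C / of_int j ^ 2)"
      unfolding P_def
    proof
      fix v' assume "v' \<in> wt (j + 1)"
      then obtain v where v: "v \<in> wt j" "v' = d 1 v" using d1_surj[of j] j J by auto
      have jK: "j \<ge> K" "j - 1 \<ge> K" "j - 2 \<ge> K" "j \<ge> 2" using j J by auto
      have xj: "cmod (x j) \<ge> of_int j" "cmod (x (j - 1)) \<ge> of_int j" 
        using x_bound[of j] x_bound[of "j - 1"] jK by auto
      have xp: "0 < cmod (x (j - 1)) * of_int j" using xj(2) jK by (intro mult_pos_pos) auto
      have dm2: "d (- 2) v \<in> wt (j - 2)" and dm1: "d (- 1) v \<in> wt (j - 1)" and d1: "d 1 v \<in> wt (j + 1)"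
        using wt_d[OF v(1), of "- 2"] wt_d[OF v(1), of "- 1"] wt_d[OF v(1), of 1] by auto
      have x1: "x (j + 1) = x j + 1" and x2: "x (j - 2) = x j - 2" and x3: "x (j - 1) = x j - 1" by (auto simp: x_def)
      \<comment> \<open>The main terms cancel because
        \<open>x (j - 2) + 3 = x (j + 1)\<close>.\<close>
      have eq: "\<eta> b (j + 1 + - 2) (d (- 2) v') - x (j + 1) * \<eta> b (j + 1) v' =
          x (j - 2) * (\<eta> b (j + - 2) (d (- 2) v) - x j * \<eta> b j v) + 3 * \<eta> b j (Cas v) / x (j - 1)" for b
      proof -
        have "d (- 2) v' = d 1 (d (- 2) v) + 3 \<cdot> d (- 1) v"
          using D_D[of "- 2" 0 1 0 v] v(2) by simp
        moreover have "d 1 (d (- 2) v) \<in> wt (j - 1)" using wt_d[OF dm2, of 1] by simp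
        ultimately have "\<eta> b (j - 1) (d (- 2) v') = \<eta> b (j - 1) (d 1 (d (- 2) v)) + 3 * \<eta> b (j - 1) (d (- 1) v)"
          using jK dm1 by (simp add: \<eta>_add \<eta>_scale W_scale)
        also have "\<eta> b (j - 1) (d 1 (d (- 2) v)) = x (j - 2) * \<eta> b (j - 2) (d (- 2) v)"
          using \<eta>_d1[OF jK(3) dm2, of b] by simp
        finally have A: "\<eta> b (j - 1) (d (- 2) v') = x (j - 2) * \<eta> b (j - 2) (d (- 2) v) + 3 * \<eta> b (j - 1) (d (- 1) v)" .
        have E: "\<eta> b (j + 1) v' = x j * \<eta> b j v" using \<eta>_d1[OF jK(1) v(1), of b] v(2) by simp
        have M: "\<eta> b (j - 1) (d (- 1) v) = x j * \<eta> b j v + \<eta> b j (Cas v) / x (j - 1)"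
          by (rule \<eta>_dm1) (use j J v in auto)
        have i: "j + 1 + - 2 = j - 1" "j + - 2 = j - 2" by simp_all
        show ?thesis unfolding i A E M x1 x2 by (simp add: algebra_simps)
      qed
      have n': "nrm (j + 1) v' = cmod (x j) * nrm j v" using nrm_d1[OF jK(1) v(1)] v(2) by simp
      have "dev (- 2) (j + 1) v' \<le> (\<Sum>b\<in>B. cmod (x (j - 2)) * cmod (\<eta> b (j + - 2) (d (- 2) v) - x j * \<eta> b j v)
           + 3 / cmod (x (j - 1)) * cmod (\<eta> b j (Cas v)))"
        unfolding dev_def eq
        by (intro sum_mono order_trans[OF norm_triangle_ineq]) (simp add: norm_mult norm_divide)
      also have "\<dots> = cmod (x (j - 2)) * dev (- 2) j v + 3 / cmod (x (j - 1)) * nrm j (Cas v)"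
        by (simp add: dev_def nrm_def sum.distrib sum_distrib_left)
      also have "\<dots> \<le> ((1 - 7 / (4 * of_int j)) * cmod (x j)) * (h * nrm j v) + 3 / of_int j * (C * nrm j v)"
        using P v(1) J0(2)[of j] j J xj xp jK h C0 nrm_Cas[OF jK(1) v(1)] nrm_nonneg
        by (intro add_mono mult_mono divide_left_mono) (auto simp: P_def x2 dev_def sum_nonneg)
      also have "((1 - 7 / (4 * of_int j)) * cmod (x j)) * (h * nrm j v) = (1 - 7 / (4 * of_int j)) * h * nrm (j + 1) v'"
        by (simp add: n')
      also have "\<dots> \<le> (1 - 3 / (2 * of_int j)) * h * nrm (j + 1) v'"
        using jK h nrm_nonneg by (intro mult_right_mono) (auto simp: field_simps)
      also have "3 / of_int j * (C * nrm j v) \<le> 3 * C / of_int j ^ 2 * nrm (j + 1) v'"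
      proof -
        have "of_int j * nrm j v \<le> nrm (j + 1) v'" using xj(1) nrm_nonneg by (simp add: n' mult_right_mono)
        then have "3 * C / of_int j ^ 2 * (of_int j * nrm j v) \<le> 3 * C / of_int j ^ 2 * nrm (j + 1) v'"
          using C0 by (intro mult_left_mono) auto
        then show ?thesis using jK by (simp add: power2_eq_square)
      qed
      finally show "dev (- 2) (j + 1) v' \<le> ((1 - 3 / (2 * of_int j)) * h + 3 * C / of_int j ^ 2) * nrm (j + 1) v'"
        by (simp add: algebra_simps)
    qed
  qed (use J h0 in auto)
  then obtain \<kappa> where "\<kappa> \<ge> 0" "\<And>j. j \<ge> J \<Longrightarrow> P j (\<kappa> / of_int j)" by blast
  then show ?thesis using J(3) unfolding P_def by (intro exI[of _ \<kappa>] conjI exI[of _ J]) auto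
qed

lemma dev_plus2: "\<exists>\<kappa>\<ge>0. \<exists>J\<ge>K. \<forall>j\<ge>J. \<forall>v\<in>wt j. dev 2 j v \<le> \<kappa> / of_int j * nrm j v"
proof -
  obtain J0 where J0: "J0 \<ge> 2" "\<And>j. j \<ge> J0 \<Longrightarrow> cmod (x (j + 1)) \<le> (1 - 7 / (4 * of_int j)) * cmod (x (j + 3))"
    using cmod_shift_ratio[of "\<mu> + 3"] by (auto simp: x_def algebra_simps)
  \<comment> \<open>From \<open>16 * C + 2\<close> on, the Casimir terms cost at most 1/(4 j), which
    is the gap between 7/4 and 3/2.\<close>
  define J where "J = max (max J0 K) \<lceil>16 * C + 2\<rceil>"
  have J: "J \<ge> 2" "J \<ge> J0" "J \<ge> K" using J0 by (auto simp: J_def)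
  have "\<lceil>16 * C + 2\<rceil> \<le> J" unfolding J_def by (rule max.cobounded2)
  then have J': "of_int J \<ge> 16 * C + 2" by (simp only: ceiling_le_iff)
  define P where "P j h \<longleftrightarrow> (\<forall>v\<in>wt j. dev 2 j v \<le> h * nrm j v)" for j h
  \<comment> \<open>The defect as a vector of the module: in coordinates it is exactly the
    deviation, and as a vector it is subject to the Casimir bound.\<close>
  define H where "H j v = d 2 v - (1 / x (j + 1)) \<cdot> d 1 (d 1 v)" for j v
  have dd: "d 1 (d 1 v) \<in> wt (j + 2)" if "v \<in> wt j" for j v
    using wt_d[OF wt_d[OF that, of 1], of 1] by (simp add: add.assoc)
  have H_wt: "H j v \<in> wt (j + 2)" if "v \<in> wt j" for j v
    using dd[OF that] wt_d[OF that, of 2] by (simp add: H_def W_diff W_scale)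
  have H_nrm: "nrm (j + 2) (H j v) = dev 2 j v" if j: "j \<ge> K" and v: "v \<in> wt j" for j v
  proof -
    have "\<eta> b (j + 2) (d 1 (d 1 v)) = x (j + 1) * (x j * \<eta> b j v)" for b
      using \<eta>_d1[OF _ wt_d[OF v, of 1], of b] \<eta>_d1[OF j v, of b] j by (simp add: add.assoc)
    moreover have "x (j + 1) \<noteq> 0" using x_nz[of "j + 1"] j K1 by auto
    ultimately have "\<eta> b (j + 2) (H j v) = \<eta> b (j + 2) (d 2 v) - x j * \<eta> b j v" for b
      using dd[OF v] wt_d[OF v, of 2] j by (simp add: H_def \<eta>_diff \<eta>_scale W_scale)
    then show ?thesis by (simp add: nrm_def dev_def)
  qed
  obtain h0 where h0: "P J h0" using dev_initial[of J 2] J unfolding P_def by auto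
  have "\<exists>\<kappa>\<ge>0. \<forall>j\<ge>J. P j (\<kappa> / of_int j)"
  proof (rule decay_iterate[where P = P and J = J and ?h0.0 = h0 and E = "2 * C"])
    fix j h h' show "P j h \<Longrightarrow> h \<le> h' \<Longrightarrow> P j h'"
      unfolding P_def using nrm_nonneg by (meson mult_right_mono order_trans)
  next
    fix j h assume j: "j \<ge> J" and h: "h \<ge> 0" and P: "P j h"
    show "P (j + 1) ((1 - 3 / (2 * of_int j)) * h + 2 * C / of_int j ^ 2)"
      unfolding P_def
    proof
      fix v assume "v \<in> wt (j + 1)"
      then obtain w where w: "w \<in> wt j" "v = d 1 w" using d1_surj[of j] j J by auto
      have v: "v \<in> wt (j + 1)" using wt_d[OF w(1), of 1] w(2) by simp
      have jK: "j \<ge> K" "j \<ge> 2" "j \<ge> J0" "real_of_int j \<ge> 16 * C + 2"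
        using j J J' by (auto intro: order_trans)
      define X Y where "X = x (j + 1)" and "Y = x j"
      have xs: "x (j + 1) = X" "x j = Y" "x (j + 2) = X + 1" "x (j + 3) = X + 2" and XY: "X = Y + 1"
        by (simp_all add: X_def Y_def x_def)
      have nz: "X \<noteq> 0" "X + 1 \<noteq> 0" "Y \<noteq> 0" using x_nz[of j] x_nz[of "j + 1"] x_nz[of "j + 2"] jK xs by auto
      have big: "cmod Y \<ge> of_int j + 1" "cmod (X + 1) \<ge> of_int j" "cmod (X + 2) \<ge> of_int j"
        using x_bound[of j] x_bound[of "j + 2"] x_bound[of "j + 3"] jK xs by auto
      define q where "q = d 1 (d 1 v)"
      define Hv Hw Hc where "Hv = H (j + 1) v" and "Hw = H j w" and "Hc = H j (Cas w)"
      have cw: "Cas w \<in> wt j" using W_Cas[OF w(1)] .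
      have mem: "Hv \<in> wt (j + 3)" "Hw \<in> wt (j + 2)" "Hc \<in> wt (j + 2)" "q \<in> wt (j + 3)"
        "d 1 Hw \<in> wt (j + 3)" "d 1 Hc \<in> wt (j + 3)"
        using H_wt[OF v] H_wt[OF w(1)] H_wt[OF cw] dd[OF v]
          wt_d[OF H_wt[OF w(1)], of 1] wt_d[OF H_wt[OF cw], of 1]
        by (auto simp: Hv_def Hw_def Hc_def q_def add.assoc)
      have v2: "d 2 v = Hv + (1 / (X + 1)) \<cdot> q"
        using xs by (simp add: Hv_def H_def q_def add.assoc)
      have w2: "d 2 w = Hw + (1 / X) \<cdot> d 1 v" using xs w(2) by (simp add: Hw_def H_def)
      have c2: "d 2 (Cas w) = Hc + (1 / X) \<cdot> Cas (d 1 v)" using xs w(2) by (simp add: Hc_def H_def Cas_d)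
      have "d (- 1) (d 2 v) = d 2 (d (- 1) v) + 3 \<cdot> d 1 v"
        using D_D[of "- 1" 0 2 0 v] by simp
      then have "d 1 (d (- 1) (d 2 v)) = d 1 (d 2 (d (- 1) v)) + 3 \<cdot> q"
        by (simp add: D_add D_scale q_def)
      moreover have "d 1 (d (- 1) (d 2 v)) = Cas (d 2 v) + ((X + 2)\<^sup>2 - (X + 2)) \<cdot> d 2 v"
        using raise_lower[OF wt_d[OF v, of 2]] xs by (simp add: add.assoc)
      moreover have "d (- 1) v = Cas w + (Y\<^sup>2 + Y) \<cdot> w"
        using lower_raise[OF w(1)] w(2) xs by simp
      ultimately have "Cas (d 2 v) + ((X + 2)\<^sup>2 - (X + 2)) \<cdot> d 2 v =
          d 1 (d 2 (Cas w)) + (Y\<^sup>2 + Y) \<cdot> d 1 (d 2 w) + 3 \<cdot> q"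
        by (simp add: D_add D_scale)
      moreover have "Cas (d 2 v) = Cas Hv + (1 / (X + 1)) \<cdot> Cas q"
        unfolding v2 using Cas_endo by (simp add: Vector_Spaces.linear_iff)
      moreover have "d 1 (d 2 (Cas w)) = d 1 Hc + (1 / X) \<cdot> Cas q"
        by (simp add: c2 D_add D_scale q_def Cas_d)
      moreover have "d 1 (d 2 w) = d 1 Hw + (1 / X) \<cdot> q"
        by (simp add: w2 D_add D_scale q_def)
      ultimately have "Cas Hv + (1 / (X + 1)) \<cdot> Cas q + ((X + 2)\<^sup>2 - (X + 2)) \<cdot> (Hv + (1 / (X + 1)) \<cdot> q) =
          d 1 Hc + (1 / X) \<cdot> Cas q + (Y\<^sup>2 + Y) \<cdot> (d 1 Hw + (1 / X) \<cdot> q) + 3 \<cdot> q"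
        by (simp add: v2)
      then have "\<eta> b (j + 3) (Cas Hv + (1 / (X + 1)) \<cdot> Cas q + ((X + 2)\<^sup>2 - (X + 2)) \<cdot> (Hv + (1 / (X + 1)) \<cdot> q)) =
          \<eta> b (j + 3) (d 1 Hc + (1 / X) \<cdot> Cas q + (Y\<^sup>2 + Y) \<cdot> (d 1 Hw + (1 / X) \<cdot> q) + 3 \<cdot> q)" for b
        by simp
      then have eta: "\<eta> b (j + 3) (Cas Hv) + (1 / (X + 1)) * \<eta> b (j + 3) (Cas q) +
            ((X + 2)\<^sup>2 - (X + 2)) * (\<eta> b (j + 3) Hv + (1 / (X + 1)) * \<eta> b (j + 3) q) =
          \<eta> b (j + 3) (d 1 Hc) + (1 / X) * \<eta> b (j + 3) (Cas q) +
            (Y\<^sup>2 + Y) * (\<eta> b (j + 3) (d 1 Hw) + (1 / X) * \<eta> b (j + 3) q) + 3 * \<eta> b (j + 3) q" for b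
        using mem W_Cas jK by (simp add: \<eta>_add \<eta>_scale W_add W_scale)
      \<comment> \<open>The leading terms in \<open>q\<close> cancel since
        \<open>X + 2 = Y + 3\<close>; what remains of \<open>q\<close> carries the small factor 1 /
        (X (X + 1)).\<close>
      have comp: "(X + 2) * (X + 1) * \<eta> b (j + 3) Hv = - \<eta> b (j + 3) (Cas Hv) + 1 / (X * (X + 1)) * \<eta> b (j + 3) (Cas q) +
          \<eta> b (j + 3) (d 1 Hc) + X * Y * \<eta> b (j + 3) (d 1 Hw)" for b
      proof -
        have "(X + 2)\<^sup>2 - (X + 2) = (X + 2) * (X + 1)" "Y\<^sup>2 + Y = X * Y"
          by (simp_all add: XY power2_eq_square algebra_simps)
        then have "\<eta> b (j + 3) (Cas Hv) + (1 / (X + 1)) * \<eta> b (j + 3) (Cas q) +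
            (X + 2) * (X + 1) * \<eta> b (j + 3) Hv + (X + 2) * \<eta> b (j + 3) q =
          \<eta> b (j + 3) (d 1 Hc) + (1 / X) * \<eta> b (j + 3) (Cas q) +
            X * Y * \<eta> b (j + 3) (d 1 Hw) + Y * \<eta> b (j + 3) q + 3 * \<eta> b (j + 3) q"
        proof -
          have "((X + 2) * (X + 1)) * (u + (1 / (X + 1)) * v) = (X + 2) * (X + 1) * u + (X + 2) * v"
            "(X * Y) * (u + (1 / X) * v) = X * Y * u + Y * v" for u v
            using nz by (simp_all add: field_simps)
          with eta[of b] show ?thesis using \<open>(X + 2)\<^sup>2 - (X + 2) = (X + 2) * (X + 1)\<close> \<open>Y\<^sup>2 + Y = X * Y\<close>
            by (simp only: add.assoc)
        qed
        moreover have "(X + 2) * \<eta> b (j + 3) q = Y * \<eta> b (j + 3) q + 3 * \<eta> b (j + 3) q"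
          by (simp add: XY algebra_simps)
        moreover have "1 / (X * (X + 1)) * \<eta> b (j + 3) (Cas q) =
            (1 / X) * \<eta> b (j + 3) (Cas q) - (1 / (X + 1)) * \<eta> b (j + 3) (Cas q)"
          using nz by (simp add: divide_simps) (simp add: algebra_simps)
        moreover have "G = - A + R + P + F" if "A + B + G + S = P + Q + F + Y' + T" "S = Y' + T" "R = Q - B"
          for A B F G P Q R S T Y' :: complex
        proof -
          have "Q = R + B" using that(3) by simp
          then show ?thesis using that(1,2) by (simp add: algebra_simps)
        qed
        ultimately show ?thesis by blast
      qed
      let ?nv = "nrm (j + 1) v"
      have nv: "?nv = cmod Y * nrm j w" using nrm_d1[OF jK(1) w(1)] w(2) xs by simp
      have nq: "nrm (j + 3) q = cmod X * cmod (X + 1) * ?nv"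
        using nrm_d1[OF _ v] nrm_d1[OF _ wt_d[OF v, of 1]] jK(1) xs by (simp add: q_def add.assoc)
      have nHw: "nrm (j + 3) (d 1 Hw) \<le> cmod (X + 1) * (h * nrm j w)"
        using nrm_d1[OF _ mem(2)] H_nrm[OF jK(1) w(1)] P w(1) jK(1) xs
        by (auto simp: add.assoc Hw_def P_def intro!: mult_left_mono)
      have "dev 2 j (Cas w) \<le> h * nrm j (Cas w)" using P cw by (simp add: P_def)
      also have "\<dots> \<le> h * (C * nrm j w)" using nrm_Cas[OF jK(1) w(1)] h by (intro mult_left_mono)
      finally have nHc: "nrm (j + 3) (d 1 Hc) \<le> cmod (X + 1) * (h * (C * nrm j w))"
        using nrm_d1[OF _ mem(3)] H_nrm[OF jK(1) cw] jK(1) xs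
        by (auto simp: add.assoc Hc_def intro!: mult_left_mono)
      have "cmod (X + 2) * cmod (X + 1) * nrm (j + 3) Hv = (\<Sum>b\<in>B. cmod ((X + 2) * (X + 1) * \<eta> b (j + 3) Hv))"
        by (simp add: nrm_def norm_mult sum_distrib_left)
      also have "\<dots> \<le> (\<Sum>b\<in>B. cmod (\<eta> b (j + 3) (Cas Hv)) + 1 / (cmod X * cmod (X + 1)) * cmod (\<eta> b (j + 3) (Cas q)) +
          cmod (\<eta> b (j + 3) (d 1 Hc)) + cmod X * cmod Y * cmod (\<eta> b (j + 3) (d 1 Hw)))"
        unfolding comp
        by (intro sum_mono order_trans[OF norm_triangle_ineq] add_mono)
           (simp_all add: norm_mult norm_divide)
      also have "\<dots> = nrm (j + 3) (Cas Hv) + 1 / (cmod X * cmod (X + 1)) * nrm (j + 3) (Cas q) +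
          nrm (j + 3) (d 1 Hc) + cmod X * cmod Y * nrm (j + 3) (d 1 Hw)"
        by (simp add: nrm_def sum.distrib sum_distrib_left)
      also have "\<dots> \<le> C * nrm (j + 3) Hv + 1 / (cmod X * cmod (X + 1)) * (C * nrm (j + 3) q) +
          cmod (X + 1) * (h * (C * nrm j w)) + cmod X * cmod Y * (cmod (X + 1) * (h * nrm j w))"
        using nrm_Cas[OF _ mem(1)] nrm_Cas[OF _ mem(4)] nHw nHc jK(1)
        by (intro add_mono mult_left_mono) auto
      also have "1 / (cmod X * cmod (X + 1)) * (C * nrm (j + 3) q) = C * ?nv"
        using nz by (simp add: nq)
      also have "nrm j w = ?nv / cmod Y" using nv nz by simp
      finally have main: "(cmod (X + 2) * cmod (X + 1) - C) * nrm (j + 3) Hv \<le>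
          (C + cmod (X + 1) * (C / cmod Y + cmod X) * h) * ?nv"
        using nz by (simp add: algebra_simps)
      let ?M = "cmod (X + 2) * cmod (X + 1) - C" and ?t = "real_of_int j"
      have t: "?t \<ge> 2" using jK by simp
      have prod: "cmod (X + 2) * cmod (X + 1) \<ge> ?t * ?t" using big t by (intro mult_mono) auto
      have "2 * C \<le> 1 * ?t" using jK(4) C0 by simp
      also have "\<dots> \<le> ?t * ?t" using t by (intro mult_right_mono) auto
      finally have M: "?M \<ge> ?t\<^sup>2 / 2" using prod unfolding power2_eq_square by linarith
      then have M0: "?M > 0" using t by (smt (verit) half_gt_zero zero_less_power)
      \<comment> \<open>The Casimir contributions, at most \<open>3 * C\<close> from the left-hand
        side and \<open>C\<close> from \<open>?M\<close>, are paid for by a share 1/(4 j) of the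
        product of the two moduli.\<close>
      have ratio: "cmod (X + 1) * (C / cmod Y + cmod X) \<le> (1 - 3 / (2 * ?t)) * ?M"
      proof -
        have "cmod (X + 1) \<le> cmod Y + 2" using norm_triangle_ineq[of Y 2] by (simp add: XY add.assoc)
        also have "\<dots> \<le> 3 * cmod Y" using big(1) t by linarith
        finally have "cmod (X + 1) * C / cmod Y \<le> 3 * cmod Y * C / cmod Y"
          using C0 by (intro divide_right_mono mult_right_mono) auto
        then have 1: "cmod (X + 1) * C / cmod Y \<le> 3 * C" using nz by simp
        have "cmod (X + 1) * cmod X \<le> cmod (X + 1) * ((1 - 7 / (4 * ?t)) * cmod (X + 2))"
          using J0(2)[OF jK(3)] xs by (intro mult_left_mono) auto
        then have 2: "cmod (X + 1) * cmod X \<le> (1 - 3 / (2 * ?t)) * (cmod (X + 2) * cmod (X + 1)) - 1 / (4 * ?t) * (cmod (X + 2) * cmod (X + 1))"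
        proof -
          have eq: "a * ((1 - 7 / (4 * ?t)) * b) = (1 - 3 / (2 * ?t)) * (b * a) - 1 / (4 * ?t) * (b * a)" for a b
            using t by (simp add: field_simps)
          show ?thesis
            using \<open>cmod (X + 1) * cmod X \<le> cmod (X + 1) * ((1 - 7 / (4 * ?t)) * cmod (X + 2))\<close> unfolding eq .
        qed
        have "4 * C \<le> 1 / (4 * ?t) * (?t * ?t)" using jK(4) t by simp
        also have "\<dots> \<le> 1 / (4 * ?t) * (cmod (X + 2) * cmod (X + 1))" using prod t by (intro mult_left_mono) auto
        finally have 3: "4 * C \<le> 1 / (4 * ?t) * (cmod (X + 2) * cmod (X + 1))" .
        have "(1 - 3 / (2 * ?t)) * C \<le> 1 * C" using C0 t by (intro mult_right_mono) auto
        then have "(1 - 3 / (2 * ?t)) * ?M \<ge> (1 - 3 / (2 * ?t)) * (cmod (X + 2) * cmod (X + 1)) - C"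
          by (simp only: right_diff_distrib)
        then show ?thesis using 1 2 3 by (simp add: distrib_left)
      qed
      have CM: "C \<le> 2 * C / ?t\<^sup>2 * ?M"
      proof -
        have "C = 2 * C / ?t\<^sup>2 * (?t\<^sup>2 / 2)" using t by simp
        also have "\<dots> \<le> 2 * C / ?t\<^sup>2 * ?M" using M C0 by (intro mult_left_mono) auto
        finally show ?thesis .
      qed
      have idn: "(e * m + s * m * u) * r = m * ((s * u + e) * r)" for e m s u r :: real
        by (simp add: algebra_simps)
      note main
      also have "(C + cmod (X + 1) * (C / cmod Y + cmod X) * h) * ?nv \<le>
          (2 * C / ?t\<^sup>2 * ?M + (1 - 3 / (2 * ?t)) * ?M * h) * ?nv"
        using CM ratio h nrm_nonneg by (intro mult_right_mono add_mono) auto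
      also have "\<dots> = ?M * (((1 - 3 / (2 * ?t)) * h + 2 * C / ?t\<^sup>2) * ?nv)" by (rule idn)
      finally have "?M * nrm (j + 3) Hv \<le> ?M * (((1 - 3 / (2 * ?t)) * h + 2 * C / ?t\<^sup>2) * ?nv)" .
      then have "nrm (j + 3) Hv \<le> ((1 - 3 / (2 * ?t)) * h + 2 * C / ?t\<^sup>2) * ?nv"
        using M0 by simp
      then show "dev 2 (j + 1) v \<le> ((1 - 3 / (2 * of_int j)) * h + 2 * C / of_int j ^ 2) * nrm (j + 1) v"
        using H_nrm[OF _ v] jK(1) by (simp add: Hv_def add.assoc)
    qed
  qed (use J h0 in auto)
  then obtain \<kappa> where "\<kappa> \<ge> 0" "\<And>j. j \<ge> J \<Longrightarrow> P j (\<kappa> / of_int j)" by blast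
  then show ?thesis using J(3) unfolding P_def by (intro exI[of _ \<kappa>] conjI exI[of _ J]) auto
qed

end

section \<open>Existence of the coordinates\<close>

context vir_cuspidal
begin

text \<open>A basis of one weight space \<open>wt K\<close> is carried upwards by \<open>d 1\<close>
  divided by the weight; the coordinates of a vector are those of its preimage in
  \<open>wt K\<close>.\<close>

lemma gauge_exists: "\<exists>B \<eta> K C. vir_gauge scale n D Z \<mu> N B \<eta> K C"
proof -
  have "\<exists>K. \<forall>m\<ge>K. (\<forall>v\<in>wt m. d 1 v = 0 \<longrightarrow> v = 0) \<and> d 1 ` wt m = wt (m + 1)"
    using d1_bij_eventually[of \<mu> N, OF bound] by (simp only: x_def)
  then obtain K0 where "\<forall>m\<ge>K0. (\<forall>v\<in>wt m. d 1 v = 0 \<longrightarrow> v = 0) \<and> d 1 ` wt m = wt (m + 1)" ..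
  then have K0: "\<And>m v. m \<ge> K0 \<Longrightarrow> v \<in> wt m \<Longrightarrow> d 1 v = 0 \<Longrightarrow> v = 0"
      "\<And>m. m \<ge> K0 \<Longrightarrow> d 1 ` wt m = wt (m + 1)" by simp_all
  define K where "K = max K0 1"
  have K: "K \<ge> 1" "K \<ge> K0" by (auto simp: K_def)
  obtain B where B: "B \<subseteq> wt K" "independent B" "wt K \<subseteq> span B"
    using maximal_independent_subset[of "wt K"] by auto
  have fB: "finite B" using bound[of K] B(1,2) unfolding dim_le_def x_def by blast
  have sB: "span B = wt K" using B subspace_W by (simp add: span_minimal subset_antisym)
  define tr where "tr = rec_nat id (\<lambda>k f v. (1 / x (K + int k)) \<cdot> d 1 (f v))"
  have tr0: "tr 0 v = v" and trS: "tr (Suc k) v = (1 / x (K + int k)) \<cdot> d 1 (tr k v)" for k v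
    by (simp_all add: tr_def)
  have xnz: "x (K + int k) \<noteq> 0" for k using x_nz[of "K + int k"] K by simp
  have tr_add: "tr k (v + w) = tr k v + tr k w" and tr_scale: "tr k (a \<cdot> v) = a \<cdot> tr k v" for k v w a
    by (induction k) (simp_all add: tr0 trS D_add D_scale scale_right_distrib mult.commute)
  have tr_wt: "tr k ` wt K = wt (K + int k)" for k
  proof (induction k)
    case 0 then show ?case by (simp add: tr0)
  next
    case (Suc k)
    have "tr (Suc k) ` wt K = (\<lambda>v. (1 / x (K + int k)) \<cdot> v) ` d 1 ` tr k ` wt K"
      by (simp add: trS image_image)
    also have "d 1 ` tr k ` wt K = wt (K + int (Suc k))"
      unfolding Suc.IH using K0(2)[of "K + int k"] K by (simp add: add_ac)
    also have "(\<lambda>v. (1 / x (K + int k)) \<cdot> v) ` wt (K + int (Suc k)) = wt (K + int (Suc k))"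
    proof
      show "wt (K + int (Suc k)) \<subseteq> (\<lambda>v. (1 / x (K + int k)) \<cdot> v) ` wt (K + int (Suc k))"
      proof
        fix v assume "v \<in> wt (K + int (Suc k))"
        then show "v \<in> (\<lambda>v. (1 / x (K + int k)) \<cdot> v) ` wt (K + int (Suc k))"
          using xnz[of k] by (intro image_eqI[of _ _ "x (K + int k) \<cdot> v"]) (auto simp: W_scale)
      qed
    qed (auto simp: W_scale)
    finally show ?case .
  qed
  have tr_inj: "v = 0" if "v \<in> wt K" "tr k v = 0" for k v
    using that(2)
  proof (induction k)
    case 0 then show ?case by (simp add: tr0)
  next
    case (Suc k)
    have "tr k v \<in> tr k ` wt K" using that(1) by simp
    then have "tr k v \<in> wt (K + int k)" by (simp only: tr_wt)
    moreover have "d 1 (tr k v) = 0" using Suc.prems xnz[of k] by (simp add: trS)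
    ultimately have "tr k v = 0" using K0(1)[of "K + int k"] K by simp
    then show ?case by (rule Suc.IH)
  qed
  have tr_diff: "tr k (v - w) = tr k v - tr k w" for k v w
    using tr_add[of k "v - w" w] by simp
  have tr_eq: "v = w" if "v \<in> wt K" "w \<in> wt K" "tr k v = tr k w" for k v w
    using tr_inj[of "v - w" k] that by (simp add: W_diff tr_diff)
  have Cas_scale: "Cas (a \<cdot> v) = a \<cdot> Cas v" for a v
    using Cas_endo by (simp add: Vector_Spaces.linear_iff)
  have tr_Cas: "Cas (tr k v) = tr k (Cas v)" for k v
    by (induction k) (simp_all add: tr0 trS Cas_scale Cas_d)
  define g where "g k w = (SOME u. u \<in> wt K \<and> tr k u = w)" for k w
  have g: "g k w \<in> wt K" "tr k (g k w) = w" if "w \<in> wt (K + int k)" for k w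
  proof -
    from that have "w \<in> tr k ` wt K" by (simp only: tr_wt)
    then have "\<exists>u. u \<in> wt K \<and> tr k u = w" by auto
    from someI_ex[OF this] show "g k w \<in> wt K" "tr k (g k w) = w" by (simp_all add: g_def)
  qed
  have gI: "g k (tr k u) = u" if "u \<in> wt K" for k u
  proof -
    have "tr k u \<in> tr k ` wt K" using that by simp
    then have "tr k u \<in> wt (K + int k)" by (simp only: tr_wt)
    from tr_eq[OF g(1)[OF this] that g(2)[OF this]] show ?thesis .
  qed
  define \<eta> where "\<eta> b j v = representation B (g (nat (j - K)) v) b" for b j v
  have eta_tr: "\<eta> b (K + int k) (tr k u) = representation B u b" if "u \<in> wt K" for b k u
    using gI[OF that] by (simp add: \<eta>_def)
  have ex: "\<exists>u\<in>wt K. v = tr (nat (j - K)) u" if "v \<in> wt j" "j \<ge> K" for j v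
    using tr_wt[of "nat (j - K)"] that by (auto simp: image_iff)
  \<comment> \<open>A linear functional on \<open>wt K\<close> is bounded by the sum norm of the
    coordinates times its values on the basis. Both norm estimates of the locale come from
    this.\<close>
  have func: "cmod (\<phi> u) \<le> (\<Sum>b\<in>B. cmod (representation B u b)) * (\<Sum>b\<in>B. cmod (\<phi> b))"
    if u: "u \<in> wt K" and add: "\<And>v w. v \<in> wt K \<Longrightarrow> w \<in> wt K \<Longrightarrow> \<phi> (v + w) = \<phi> v + \<phi> w"
     and sc: "\<And>a v. v \<in> wt K \<Longrightarrow> \<phi> (a \<cdot> v) = a * \<phi> v" for \<phi> u
  proof -
    have z: "\<phi> 0 = 0" using sc[of 0 0] W_zero by simp
    have "\<phi> (\<Sum>b\<in>F. c b \<cdot> b) = (\<Sum>b\<in>F. c b * \<phi> b)" if "F \<subseteq> B" for F c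
      using finite_subset[OF that fB] that
    proof (induction F rule: finite_induct)
      case empty then show ?case by (simp add: z)
    next
      case (insert b F)
      have "(\<Sum>b\<in>F. c b \<cdot> b) \<in> wt K" using insert.prems B(1) by (intro W_sum W_scale) auto
      then show ?case using insert B(1) by (simp add: add sc W_scale subset_iff)
    qed
    moreover have "u = (\<Sum>b\<in>B. representation B u b \<cdot> b)"
      using sum_representation_eq[OF B(2) _ fB] u sB by (metis order_refl)
    ultimately have "\<phi> u = (\<Sum>b\<in>B. representation B u b * \<phi> b)" by (metis order_refl)
    also have "cmod \<dots> \<le> (\<Sum>b\<in>B. cmod (representation B u b) * cmod (\<phi> b))"
      by (intro sum_norm_le) (simp add: norm_mult)
    also have "\<dots> \<le> (\<Sum>b\<in>B. cmod (representation B u b) * (\<Sum>b\<in>B. cmod (\<phi> b)))"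
      using fB by (intro sum_mono mult_left_mono member_le_sum) auto
    finally show ?thesis by (simp add: sum_distrib_right)
  qed
  have rep_add: "representation B (v + w) b = representation B v b + representation B w b"
    and rep_scale: "representation B (a \<cdot> v) b = a * representation B v b"
    if "v \<in> wt K" "w \<in> wt K" for v w a b
    using that sB by (simp_all add: representation_add[OF B(2)] representation_scale[OF B(2)])
  \<comment> \<open>The Casimir element commutes with \<open>tr\<close>, so its matrix in these
    coordinates is the same in every degree; this is why one \<open>C\<close> serves for all of
    them.\<close>
  define C where "C = (\<Sum>b\<in>B. \<Sum>b'\<in>B. cmod (representation B (Cas b') b))"
  have "vir_gauge scale n D Z \<mu> N B \<eta> K C"
  proof
    show "finite B" "K \<ge> 1" by fact+
    show "C \<ge> 0" by (auto simp: C_def intro!: sum_nonneg)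
    fix j assume j: "j \<ge> K"
    then obtain k where k: "j = K + int k" by (metis zle_iff_zadd)
    have ex': "\<exists>u\<in>wt K. v = tr k u" if "v \<in> wt j" for v using tr_wt[of k] that k by auto
    show add: "\<eta> b j (v + w) = \<eta> b j v + \<eta> b j w" if "v \<in> wt j" "w \<in> wt j" for v w b
    proof -
      obtain u u' where "u \<in> wt K" "u' \<in> wt K" "v = tr k u" "w = tr k u'"
        using ex'[OF \<open>v \<in> wt j\<close>] ex'[OF \<open>w \<in> wt j\<close>] by blast
      then show ?thesis using eta_tr[of "u + u'" b k] by (simp add: k eta_tr rep_add tr_add W_add)
    qed
    show scale: "\<eta> b j (a \<cdot> v) = a * \<eta> b j v" if "v \<in> wt j" for v a b
    proof -
      obtain u where "u \<in> wt K" "v = tr k u" using ex'[OF \<open>v \<in> wt j\<close>] by blast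
      then show ?thesis using eta_tr[of "a \<cdot> u" b k] by (simp add: k eta_tr rep_scale tr_scale W_scale)
    qed
    show "\<eta> b (j + 1) (d 1 v) = x j * \<eta> b j v" if "v \<in> wt j" for v b
    proof -
      obtain u where u: "u \<in> wt K" "v = tr k u" using ex'[OF \<open>v \<in> wt j\<close>] by blast
      have "d 1 v = tr (Suc k) (x j \<cdot> u)"
        using xnz[of k] u by (simp add: trS tr_scale D_scale k)
      then have "\<eta> b (j + 1) (d 1 v) = representation B (x j \<cdot> u) b"
        using eta_tr[of "x j \<cdot> u" b "Suc k"] u W_scale k by (simp add: add_ac)
      then show ?thesis using u eta_tr[of u b k] k by (simp add: rep_scale)
    qed
    show "v = 0" if "v \<in> wt j" "\<forall>b\<in>B. \<eta> b j v = 0" for v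
    proof -
      obtain u where u: "u \<in> wt K" "v = tr k u" using ex'[OF \<open>v \<in> wt j\<close>] by blast
      have "representation B u b = 0" if "b \<in> B" for b
        using that \<open>\<forall>b\<in>B. \<eta> b j v = 0\<close> eta_tr[of u b k] u k by simp
      then have "u = 0" using sum_representation_eq[OF B(2) _ fB, of u] u sB by simp
      then show ?thesis using u tr_scale[of k 0 0] by simp
    qed
    show "d 1 ` wt j = wt (j + 1)" using K0(2) j K by simp
    show "(\<Sum>b\<in>B. cmod (\<eta> b j (Cas v))) \<le> C * (\<Sum>b\<in>B. cmod (\<eta> b j v))" if "v \<in> wt j" for v
    proof -
      obtain u where u: "u \<in> wt K" "v = tr k u" using ex'[OF \<open>v \<in> wt j\<close>] by blast
      have "cmod (representation B (Cas u) b) \<le> (\<Sum>b\<in>B. cmod (representation B u b)) * (\<Sum>b'\<in>B. cmod (representation B (Cas b') b))" for b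
        using Cas_endo by (intro func u) (auto simp: Vector_Spaces.linear_iff rep_add rep_scale W_Cas)
      then have "(\<Sum>b\<in>B. cmod (representation B (Cas u) b)) \<le> (\<Sum>b\<in>B. cmod (representation B u b)) * C"
        unfolding C_def sum_distrib_left by (intro sum_mono)
      then show ?thesis using u W_Cas k by (simp add: tr_Cas eta_tr mult.commute)
    qed
    fix i assume ji: "j + i \<ge> K"
    then obtain k' where k': "j + i = K + int k'" by (metis zle_iff_zadd)
    show "\<exists>h. \<forall>v\<in>wt j. (\<Sum>b\<in>B. cmod (\<eta> b (j + i) (d i v))) \<le> h * (\<Sum>b\<in>B. cmod (\<eta> b j v))"
    proof (intro exI ballI)
      fix v assume "v \<in> wt j"
      then obtain u where u: "u \<in> wt K" "v = tr k u" using ex' by blast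
      define \<phi> where "\<phi> b u = \<eta> b (j + i) (d i (tr k u))" for b u
      have mem: "d i (tr k u) \<in> wt (j + i)" if "u \<in> wt K" for u
      proof -
        have "tr k u \<in> tr k ` wt K" using that by simp
        then show ?thesis using wt_d[of "tr k u" j i] k by (simp only: tr_wt)
      qed
      have "\<exists>u'\<in>wt K. d i (tr k u) = tr k' u'" if "u \<in> wt K" for u
        using mem[OF that] tr_wt[of k'] k' by auto
      then obtain p where p: "\<And>u. u \<in> wt K \<Longrightarrow> p u \<in> wt K \<and> d i (tr k u) = tr k' (p u)" by metis
      have phi: "\<phi> b u = representation B (p u) b" if "u \<in> wt K" for b u
        using p[OF that] eta_tr[of "p u" b k'] k' by (simp add: \<phi>_def)
      have p_add: "p (u + w) = p u + p w" if "u \<in> wt K" "w \<in> wt K" for u w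
      proof (rule tr_eq)
        have uw: "u + w \<in> wt K" using that by (rule W_add)
        have "tr k' (p (u + w)) = d i (tr k u) + d i (tr k w)"
          unfolding p[OF uw, THEN conjunct2, symmetric] by (simp add: tr_add D_add)
        also have "\<dots> = tr k' (p u + p w)" using p[OF that(1)] p[OF that(2)] by (simp add: tr_add)
        finally show "tr k' (p (u + w)) = tr k' (p u + p w)" .
        show "p (u + w) \<in> wt K" using p[OF uw] by simp
        show "p u + p w \<in> wt K" using p[OF that(1)] p[OF that(2)] by (simp add: W_add)
      qed
      have p_scale: "p (a \<cdot> u) = a \<cdot> p u" if "u \<in> wt K" for a u
      proof (rule tr_eq)
        have au: "a \<cdot> u \<in> wt K" using that by (rule W_scale)
        have "tr k' (p (a \<cdot> u)) = a \<cdot> d i (tr k u)"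
          unfolding p[OF au, THEN conjunct2, symmetric] by (simp add: tr_scale D_scale)
        also have "\<dots> = tr k' (a \<cdot> p u)" using p[OF that] by (simp add: tr_scale)
        finally show "tr k' (p (a \<cdot> u)) = tr k' (a \<cdot> p u)" .
        show "p (a \<cdot> u) \<in> wt K" using p[OF au] by simp
        show "a \<cdot> p u \<in> wt K" using p[OF that] by (simp add: W_scale)
      qed
      have "cmod (\<phi> b u) \<le> (\<Sum>b\<in>B. cmod (representation B u b)) * (\<Sum>b'\<in>B. cmod (\<phi> b b'))" for b
        by (rule func[OF u(1)]) (simp_all add: phi W_add W_scale p_add p_scale rep_add rep_scale p)
      then have "(\<Sum>b\<in>B. cmod (\<phi> b u)) \<le> (\<Sum>b\<in>B. cmod (representation B u b)) * (\<Sum>b\<in>B. \<Sum>b'\<in>B. cmod (\<phi> b b'))"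
        unfolding sum_distrib_left[of "\<Sum>b\<in>B. cmod (representation B u b)"] by (intro sum_mono)
      then show "(\<Sum>b\<in>B. cmod (\<eta> b (j + i) (d i v))) \<le>
         (\<Sum>b\<in>B. \<Sum>b'\<in>B. cmod (\<eta> b (j + i) (d i (tr k b')))) * (\<Sum>b\<in>B. cmod (\<eta> b j v))"
        using u k by (simp add: \<phi>_def eta_tr mult.commute)
    qed
  qed
  then show ?thesis by blast
qed

end

lemma common_convergent_subsequence:
  fixes f :: "'i \<Rightarrow> nat \<Rightarrow> complex"
  assumes "finite I" "\<And>i. i \<in> I \<Longrightarrow> bounded (range (f i))"
  shows "\<exists>r :: nat \<Rightarrow> nat. strict_mono r \<and> (\<forall>i\<in>I. convergent (\<lambda>k. f i (r k)))"
  using assms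
proof (induction I rule: finite_induct)
  case empty
  show ?case by (intro exI[of _ id]) (simp add: strict_mono_def)
next
  case (insert i I)
  then obtain r :: "nat \<Rightarrow> nat" where r: "strict_mono r" "\<forall>i\<in>I. convergent (\<lambda>k. f i (r k))" by auto
  have "bounded (range (\<lambda>k. f i (r k)))"
    by (rule bounded_subset[of "range (f i)"]) (use insert.prems in auto)
  then obtain l s where s: "strict_mono s" "((\<lambda>k. f i (r k)) \<circ> s) \<longlonglongrightarrow> l"
    using bounded_imp_convergent_subsequence by blast
  have "convergent (\<lambda>k. f i' (r (s k)))" if "i' \<in> insert i I" for i'
  proof (cases "i' = i")
    case True then show ?thesis using s(2) by (auto simp: convergent_def o_def)
  next
    case False
    then have "convergent (\<lambda>k. f i' (r k))" using r(2) that by auto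
    then show ?thesis using LIMSEQ_subseq_LIMSEQ[OF _ s(1)] by (auto simp: convergent_def o_def)
  qed
  moreover have "strict_mono (\<lambda>k. r (s k))" using r(1) s(1) by (simp add: strict_mono_def)
  ultimately show ?case by (intro exI[of _ "\<lambda>k. r (s k)"]) auto
qed

section \<open>Coordinates of the images of a fixed vector\<close>

context vir_gauge
begin

definition Y :: "'v \<Rightarrow> int \<Rightarrow> 'v \<Rightarrow> int \<Rightarrow> complex" where
  "Y b m u j = \<eta> b j (d (j - m) u)"

definition NY :: "int \<Rightarrow> 'v \<Rightarrow> int \<Rightarrow> real" where
  "NY m u j = nrm j (d (j - m) u)"

lemma Y_mem: "u \<in> wt m \<Longrightarrow> d (j - m) u \<in> wt j"
  using wt_d[of u m "j - m"] by simp

lemma Y_add: "u \<in> wt m \<Longrightarrow> w \<in> wt m \<Longrightarrow> j \<ge> K \<Longrightarrow> Y b m (u + w) j = Y b m u j + Y b m w j"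
  by (simp add: Y_def D_add \<eta>_add Y_mem)

lemma Y_scale: "u \<in> wt m \<Longrightarrow> j \<ge> K \<Longrightarrow> Y b m (a \<cdot> u) j = a * Y b m u j"
  by (simp add: Y_def D_scale \<eta>_scale Y_mem)

lemma NY_eq: "NY m u j = (\<Sum>b\<in>B. cmod (Y b m u j))"
  by (simp add: NY_def Y_def nrm_def)

lemma Y_le_NY: "b \<in> B \<Longrightarrow> cmod (Y b m u j) \<le> NY m u j"
  by (simp add: NY_def Y_def nrm_component)

lemma NY_nonneg: "NY m u j \<ge> 0"
  by (simp add: NY_def nrm_nonneg)

lemma NY_add: "u \<in> wt m \<Longrightarrow> w \<in> wt m \<Longrightarrow> j \<ge> K \<Longrightarrow> NY m (u + w) j \<le> NY m u j + NY m w j"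
  by (simp add: NY_def D_add nrm_add Y_mem)

lemma NY_scale: "u \<in> wt m \<Longrightarrow> j \<ge> K \<Longrightarrow> NY m (a \<cdot> u) j = cmod a * NY m u j"
  by (simp add: NY_def D_scale nrm_scale Y_mem)

definition \<Delta> :: "'v \<Rightarrow> int \<Rightarrow> 'v \<Rightarrow> int \<Rightarrow> complex" where
  "\<Delta> b m u j = Y b m u j - Y b m u (j - 1)"

text \<open>To be read as a formula for \<open>x (j - 1) * \<Delta>\<close>: it makes the
  differences O(1/j), and its limit is the second functional. No central term appears, since i^3 - i
  vanishes for i = -1.\<close>

lemma Y_raise:
  assumes u: "u \<in> wt m" and j: "j \<ge> K + 1"
  shows "Y b (m + 1) (d 1 u) j = (x m + 1) * Y b m u j - x (j - 1) * \<Delta> b m u j"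
proof -
  have "d (j - (m + 1)) (d 1 u) = d 1 (d (j - 1 - m) u) + of_int (2 + m - j) \<cdot> d (j - m) u"
    using D_D[of "j - 1 - m" 0 1 0 u] by (auto simp: algebra_simps split: if_splits)
  moreover have "d 1 (d (j - 1 - m) u) \<in> wt j" using wt_d[OF Y_mem[OF u, of "j - 1"], of 1] by simp
  ultimately have "Y b (m + 1) (d 1 u) j = \<eta> b j (d 1 (d (j - 1 - m) u)) + of_int (2 + m - j) * Y b m u j"
    using j Y_mem[OF u, of j] by (simp add: Y_def \<eta>_add \<eta>_scale W_scale)
  also have "\<eta> b j (d 1 (d (j - 1 - m) u)) = x (j - 1) * Y b m u (j - 1)"
    using \<eta>_d1[OF _ Y_mem[OF u, of "j - 1"], of b] j by (simp add: Y_def)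
  finally show ?thesis by (simp add: \<Delta>_def x_def algebra_simps)
qed

definition \<epsilon> :: "'v \<Rightarrow> int \<Rightarrow> 'v \<Rightarrow> int \<Rightarrow> complex" where
  "\<epsilon> b m u j = \<eta> b j (Cas (d (j - m) u)) / x (j - 1)"

text \<open>The counterpart of \<open>Y_raise\<close>, where the Casimir element leaves an error
  \<open>\<epsilon>\<close> of relative size O(1/j).\<close>

lemma Y_lower:
  assumes u: "u \<in> wt m" and j: "j \<ge> K + 1"
  shows "Y b (m - 1) (d (- 1) u) (j - 1) = (x m - 1) * Y b m u (j - 1) + x j * \<Delta> b m u j + \<epsilon> b m u j"
proof -
  have "d (j - 1 - (m - 1)) (d (- 1) u) = d (- 1) (d (j - m) u) + of_int (m - j - 1) \<cdot> d (j - 1 - m) u"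
    using D_D[of "j - m" 0 "- 1" 0 u] by (auto simp: algebra_simps split: if_splits)
  moreover have "d (- 1) (d (j - m) u) \<in> wt (j - 1)" using wt_d[OF Y_mem[OF u, of j], of "- 1"] by simp
  ultimately have "Y b (m - 1) (d (- 1) u) (j - 1) = \<eta> b (j - 1) (d (- 1) (d (j - m) u)) + of_int (m - j - 1) * Y b m u (j - 1)"
    using j Y_mem[OF u, of "j - 1"] by (simp add: Y_def \<eta>_add \<eta>_scale W_scale)
  also have "\<eta> b (j - 1) (d (- 1) (d (j - m) u)) = x j * Y b m u j + \<epsilon> b m u j"
    using \<eta>_dm1[OF j Y_mem[OF u], of b] by (simp add: Y_def \<epsilon>_def)
  finally show ?thesis by (simp add: \<Delta>_def x_def algebra_simps)
qed

lemma \<epsilon>_bound: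
  assumes u: "u \<in> wt m" and j: "j \<ge> K" and b: "b \<in> B"
  shows "cmod (\<epsilon> b m u j) \<le> C / of_int j * NY m u j"
proof -
  have "cmod (\<eta> b j (Cas (d (j - m) u))) \<le> C * NY m u j"
    using nrm_component[OF b] nrm_Cas[OF j Y_mem[OF u]] unfolding NY_def by (rule order_trans)
  moreover have "cmod (x (j - 1)) \<ge> of_int j" using x_bound[of "j - 1"] j K1 by simp
  moreover have "real_of_int j > 0" using j K1 by simp
  ultimately have "cmod (\<eta> b j (Cas (d (j - m) u))) / cmod (x (j - 1)) \<le> C * NY m u j / of_int j"
    using C0 NY_nonneg by (intro frac_le) auto
  then show ?thesis by (simp add: \<epsilon>_def norm_divide)
qed

text \<open>For k other than 1 and -1 the central term need not vanish by itself, hence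
  \<open>j \<noteq> m\<close>. The last summand is the defect of d_k in degree
  \<open>j - k\<close>.\<close>

lemma Y_dev:
  assumes u: "u \<in> wt m" and j: "j \<ge> K" "j - k \<ge> K" and jm: "j \<noteq> m"
  shows "Y b (m + k) (d k u) j = (x m + of_int k) * Y b m u j - x (j - k) * (Y b m u j - Y b m u (j - k)) +
     (\<eta> b j (d k (d (j - k - m) u)) - x (j - k) * Y b m u (j - k))"
proof -
  have "d (j - (m + k)) (d k u) = d k (d (j - k - m) u) + of_int (2 * k + m - j) \<cdot> d (j - m) u"
    using D_D'[of "j - (m + k)" k 0 0 u] jm by (simp add: algebra_simps)
  moreover have "d k (d (j - k - m) u) \<in> wt j" using wt_d[OF Y_mem[OF u, of "j - k"], of k] by simp
  ultimately have "Y b (m + k) (d k u) j = \<eta> b j (d k (d (j - k - m) u)) + of_int (2 * k + m - j) * Y b m u j"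
    using j Y_mem[OF u, of j] by (simp add: Y_def \<eta>_add \<eta>_scale W_scale)
  then show ?thesis by (simp add: x_def algebra_simps)
qed

lemma dev_small:
  assumes k: "k = 2 \<or> k = - 2"
  shows "\<exists>\<kappa> J. \<kappa> \<ge> 0 \<and> J \<ge> K \<and> (\<forall>m. \<forall>u\<in>wt m. \<forall>j\<ge>J. \<forall>b\<in>B.
     cmod (\<eta> b (j + k) (d k (d (j - m) u)) - x j * Y b m u j) \<le> \<kappa> / of_int j * NY m u j)"
proof -
  obtain \<kappa> J where "\<kappa> \<ge> 0" "J \<ge> K" "\<And>j v. j \<ge> J \<Longrightarrow> v \<in> wt j \<Longrightarrow> dev k j v \<le> \<kappa> / of_int j * nrm j v"
    using k dev_plus2 dev_minus2 by blast
  then show ?thesis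
    using Y_mem by (intro exI[of _ \<kappa>] exI[of _ J])
      (auto simp: Y_def NY_def intro!: order_trans[OF dev_component])
qed

end

text \<open>A finite window of weights from which the module is generated by \<open>d 1\<close> and \<open>d (- 1)\<close>,
  together with a basis of each of its weight spaces.\<close>

locale vir_window = vir_gauge scale n D Z \<mu> N B \<eta> K C
  for scale :: "complex \<Rightarrow> 'v::ab_group_add \<Rightarrow> 'v" (infixr \<open>\<cdot>\<close> 75) and n D Z \<mu> N B \<eta> K C +
  fixes L :: int and Bs :: "int \<Rightarrow> 'v set"
  assumes L1: "L \<ge> 1" and up: "\<And>m. m \<ge> L \<Longrightarrow> d 1 ` wt m = wt (m + 1)"
    and down: "\<And>m. m \<le> - L \<Longrightarrow> d (- 1) ` wt m = wt (m - 1)"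
    and Bs: "\<And>m. finite (Bs m)" "\<And>m. Bs m \<subseteq> wt m" "\<And>m. wt m \<subseteq> span (Bs m)"
    and window_nz: "\<exists>m\<in>{-L..L}. \<exists>v\<in>wt m. v \<noteq> 0"
begin

definition S :: "(int \<times> 'v) set" where "S = (SIGMA m:{-L..L}. Bs m)"

text \<open>The scale by which coordinates are divided before passing to the limit. As it sums all
  sizes over the window, the normalised sizes add up to 1, and their limits cannot all be 0.\<close>

definition g :: "int \<Rightarrow> real" where "g j = (\<Sum>(m, u)\<in>S. NY m u j)"

lemma finS: "finite S"
  unfolding S_def using Bs(1) by auto

lemma g_nonneg: "g j \<ge> 0"
  by (auto simp: g_def NY_nonneg intro: sum_nonneg)

lemma S_wt: "(m, u) \<in> S \<Longrightarrow> u \<in> wt m" "(m, u) \<in> S \<Longrightarrow> - L \<le> m \<and> m \<le> L"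
  using Bs(2) by (auto simp: S_def)

lemma NY_le_g: "(m, u) \<in> S \<Longrightarrow> NY m u j \<le> g j"
  unfolding g_def using finS member_le_sum[of "(m, u)" S "\<lambda>(m, u). NY m u j"] by (auto simp: NY_nonneg)

lemma NY_bounded:
  assumes m: "- L \<le> m" "m \<le> L" and u: "u \<in> wt m"
  shows "\<exists>c\<ge>0. \<forall>j\<ge>K. NY m u j \<le> c * g j"
proof -
  have "u \<in> span (Bs m)" using Bs(3) u by blast
  then have "u \<in> wt m \<and> (\<exists>c\<ge>0. \<forall>j\<ge>K. NY m u j \<le> c * g j)"
  proof (induction rule: span_induct_alt)
    case base
    have "NY m 0 j = 0" if "j \<ge> K" for j using NY_scale[OF W_zero that, of m 0] by simp
    then show ?case using W_zero by (auto intro!: exI[of _ 0])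
  next
    case (step a w y)
    then obtain c where c: "c \<ge> 0" "\<And>j. j \<ge> K \<Longrightarrow> NY m y j \<le> c * g j" and y: "y \<in> wt m" by auto
    have w: "w \<in> wt m" "(m, w) \<in> S" using step(1) Bs(2) m by (auto simp: S_def)
    have "NY m (a \<cdot> w + y) j \<le> (cmod a + c) * g j" if "j \<ge> K" for j
    proof -
      have "NY m (a \<cdot> w + y) j \<le> cmod a * NY m w j + NY m y j"
        using NY_add[OF W_scale[OF w(1)] y that, of a] NY_scale[OF w(1) that, of a] by simp
      also have "\<dots> \<le> cmod a * g j + c * g j"
        using NY_le_g[OF w(2)] c(2)[OF that] by (intro add_mono mult_left_mono) auto
      finally show ?thesis by (simp add: algebra_simps)
    qed
    then show ?case using c(1) w y by (auto intro!: exI[of _ "cmod a + c"] W_add W_scale)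
  qed
  then show ?thesis by blast
qed

text \<open>Below the upper end of the window \<open>d 1 u\<close> is controlled by
  \<open>g\<close>. At the end itself \<open>d (- 1) u\<close> takes its place, which brings in
  \<open>g (j - 1)\<close>.\<close>

lemma \<Delta>_bound:
  assumes mu: "(m, u) \<in> S"
  shows "\<exists>c\<ge>0. \<forall>j\<ge>K+1. \<forall>b\<in>B. cmod (\<Delta> b m u j) \<le> c / of_int j * (g j + g (j - 1))"
proof (cases "m < L")
  case True
  have u: "u \<in> wt m" and m: "- L \<le> m" using S_wt mu by auto
  obtain c where c: "c \<ge> 0" "\<And>j. j \<ge> K \<Longrightarrow> NY (m + 1) (d 1 u) j \<le> c * g j"
    using NY_bounded[of "m + 1" "d 1 u"] wt_d[OF u, of 1] m True by auto
  have "cmod (\<Delta> b m u j) \<le> (cmod (x m + 1) + c) / of_int j * (g j + g (j - 1))" if j: "j \<ge> K + 1" and b: "b \<in> B" for j b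
  proof -
    have xj: "cmod (x (j - 1)) \<ge> of_int j" "real_of_int j > 0" using x_bound[of "j - 1"] j K1 by auto
    have "of_int j * cmod (\<Delta> b m u j) \<le> cmod (x (j - 1) * \<Delta> b m u j)"
      using xj by (auto simp: norm_mult intro!: mult_right_mono)
    also have "x (j - 1) * \<Delta> b m u j = (x m + 1) * Y b m u j - Y b (m + 1) (d 1 u) j"
      using Y_raise[OF u j, of b] by simp
    also have "cmod \<dots> \<le> cmod (x m + 1) * cmod (Y b m u j) + cmod (Y b (m + 1) (d 1 u) j)"
      by (metis norm_mult norm_triangle_ineq4)
    also have "\<dots> \<le> cmod (x m + 1) * g j + c * g j"
      using order_trans[OF Y_le_NY[OF b] NY_le_g[OF mu]] order_trans[OF Y_le_NY[OF b] c(2)] j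
      by (intro add_mono mult_left_mono) auto
    also have "\<dots> \<le> (cmod (x m + 1) + c) * (g j + g (j - 1))"
      using c(1) g_nonneg[of "j - 1"] by (simp add: algebra_simps)
    finally show ?thesis using xj(2) by (simp add: field_simps)
  qed
  then show ?thesis using c(1) by (intro exI[of _ "cmod (x m + 1) + c"]) auto
next
  case False
  have u: "u \<in> wt m" and m: "- L \<le> m" "m \<le> L" using S_wt mu by auto
  then have mL: "m = L" using False by simp
  obtain c where c: "c \<ge> 0" "\<And>j. j \<ge> K \<Longrightarrow> NY (m - 1) (d (- 1) u) j \<le> c * g j"
    using NY_bounded[of "m - 1" "d (- 1) u"] wt_d[OF u, of "- 1"] mL L1 by auto
  have "cmod (\<Delta> b m u j) \<le> (c + cmod (x m - 1) + C) / of_int j * (g j + g (j - 1))" if j: "j \<ge> K + 1" and b: "b \<in> B" for j b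
  proof -
    have xj: "cmod (x j) \<ge> of_int j" "real_of_int j \<ge> 1" using x_bound[of j] j K1 by auto
    have "of_int j * cmod (\<Delta> b m u j) \<le> cmod (x j * \<Delta> b m u j)"
      using xj by (auto simp: norm_mult intro!: mult_right_mono)
    also have "x j * \<Delta> b m u j = Y b (m - 1) (d (- 1) u) (j - 1) - (x m - 1) * Y b m u (j - 1) - \<epsilon> b m u j"
      using Y_lower[OF u j, of b] by simp
    also have "cmod \<dots> \<le> cmod (Y b (m - 1) (d (- 1) u) (j - 1)) + cmod (x m - 1) * cmod (Y b m u (j - 1)) + cmod (\<epsilon> b m u j)"
      by (intro order_trans[OF norm_triangle_ineq4] add_mono) (simp_all add: norm_mult)
    also have "\<dots> \<le> c * g (j - 1) + cmod (x m - 1) * g (j - 1) + C * g j"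
    proof -
      have "cmod (\<epsilon> b m u j) \<le> C / of_int j * NY m u j" using \<epsilon>_bound[OF u _ b] j by simp
      also have "\<dots> \<le> C * g j"
        using C0 xj(2) NY_le_g[OF mu] NY_nonneg
        by (intro mult_mono) (auto simp: divide_le_eq mult_le_cancel_left1)
      finally show ?thesis
        using order_trans[OF Y_le_NY[OF b] NY_le_g[OF mu]] order_trans[OF Y_le_NY[OF b] c(2)] j
        by (intro add_mono mult_left_mono) auto
    qed
    also have "\<dots> \<le> (c + cmod (x m - 1) + C) * (g j + g (j - 1))"
      using c(1) C0 g_nonneg[of j] g_nonneg[of "j - 1"] by (simp add: algebra_simps)
    finally show ?thesis using xj(2) by (simp add: field_simps)
  qed
  then show ?thesis using c(1) C0 by (intro exI[of _ "c + cmod (x m - 1) + C"]) auto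
qed

lemma \<Delta>_uniform: "\<exists>c\<ge>0. \<forall>(m, u)\<in>S. \<forall>j\<ge>K+1. \<forall>b\<in>B. cmod (\<Delta> b m u j) \<le> c / of_int j * (g j + g (j - 1))"
proof -
  obtain c where c: "\<And>m u. (m, u) \<in> S \<Longrightarrow> c (m, u) \<ge> 0 \<and> (\<forall>j\<ge>K+1. \<forall>b\<in>B. cmod (\<Delta> b m u j) \<le> c (m, u) / of_int j * (g j + g (j - 1)))"
    using bchoice[of S "\<lambda>p c. c \<ge> 0 \<and> (\<forall>j\<ge>K+1. \<forall>b\<in>B. cmod (\<Delta> b (fst p) (snd p) j) \<le> c / of_int j * (g j + g (j - 1)))"]
      \<Delta>_bound by fastforce
  define c' where "c' = sum c S"
  have c': "c p \<le> c'" if "p \<in> S" for p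
    unfolding c'_def using finS that c by (intro member_le_sum) auto
  have "c' \<ge> 0" unfolding c'_def using c by (intro sum_nonneg) auto
  moreover have "cmod (\<Delta> b m u j) \<le> c' / of_int j * (g j + g (j - 1))"
    if "(m, u) \<in> S" "j \<ge> K + 1" "b \<in> B" for m u j b
  proof -
    have "cmod (\<Delta> b m u j) \<le> c (m, u) / of_int j * (g j + g (j - 1))" using c that by blast
    also have "\<dots> \<le> c' / of_int j * (g j + g (j - 1))"
      using c'[OF that(1)] that(2) K1 g_nonneg by (intro mult_right_mono divide_right_mono) auto
    finally show ?thesis .
  qed
  ultimately show ?thesis by auto
qed

lemma g_variation: "\<exists>c\<ge>0. \<forall>j\<ge>K+1. \<bar>g j - g (j - 1)\<bar> \<le> c / of_int j * (g j + g (j - 1))"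
proof -
  obtain c where c: "c \<ge> 0" "\<And>m u j b. (m, u) \<in> S \<Longrightarrow> j \<ge> K+1 \<Longrightarrow> b \<in> B \<Longrightarrow>
      cmod (\<Delta> b m u j) \<le> c / of_int j * (g j + g (j - 1))" using \<Delta>_uniform by blast
  have "\<bar>g j - g (j - 1)\<bar> \<le> (of_nat (card S) * of_nat (card B) * c) / of_int j * (g j + g (j - 1))" if j: "j \<ge> K + 1" for j
  proof -
    have "\<bar>NY m u j - NY m u (j - 1)\<bar> \<le> of_nat (card B) * (c / of_int j * (g j + g (j - 1)))" if "(m, u) \<in> S" for m u
    proof -
      have "\<bar>NY m u j - NY m u (j - 1)\<bar> = \<bar>\<Sum>b\<in>B. cmod (Y b m u j) - cmod (Y b m u (j - 1))\<bar>"
        by (simp add: NY_eq sum_subtractf)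
      also have "\<dots> \<le> (\<Sum>b\<in>B. \<bar>cmod (Y b m u j) - cmod (Y b m u (j - 1))\<bar>)" by (rule sum_abs)
      also have "\<dots> \<le> (\<Sum>b\<in>B. c / of_int j * (g j + g (j - 1)))"
        using c(2)[OF that j] by (intro sum_mono order_trans[OF norm_triangle_ineq3]) (auto simp: \<Delta>_def)
      finally show ?thesis by simp
    qed
    then have "(\<Sum>(m, u)\<in>S. \<bar>NY m u j - NY m u (j - 1)\<bar>) \<le> of_nat (card S) * (of_nat (card B) * (c / of_int j * (g j + g (j - 1))))"
      by (intro sum_bounded_above) auto
    moreover have "\<bar>g j - g (j - 1)\<bar> \<le> (\<Sum>(m, u)\<in>S. \<bar>NY m u j - NY m u (j - 1)\<bar>)"
      unfolding g_def by (simp add: sum_subtractf[symmetric] case_prod_unfold sum_abs)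
    ultimately show ?thesis by (simp add: mult.assoc)
  qed
  then show ?thesis using c(1) by (intro exI[of _ "of_nat (card S) * of_nat (card B) * c"]) auto
qed

text \<open>By the variation estimate a zero of \<open>g\<close> in a large degree persists in all
  higher degrees; then a nonzero vector of the window is annihilated in all large degrees, against
  \<open>nk\<close>.\<close>

lemma g_pos: "\<exists>J\<ge>K. \<forall>j\<ge>J. g j > 0"
proof -
  obtain c where c: "c \<ge> 0" "\<And>j. j \<ge> K+1 \<Longrightarrow> \<bar>g j - g (j - 1)\<bar> \<le> c / of_int j * (g j + g (j - 1))"
    using g_variation by blast
  \<comment> \<open>Beyond \<open>2 * c\<close> the estimate reads
    \<open>g (i + 1) \<le> g (i + 1) / 2\<close> whenever \<open>g i = 0\<close>.\<close>
  define J where "J = max (K + 1) (\<lceil>2 * c\<rceil> + 1)"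
  have J: "J \<ge> K + 1" "of_int J > 2 * c" unfolding J_def by (simp_all add: less_max_iff_disj) linarith
  have "g j > 0" if "j \<ge> J" for j
  proof (rule ccontr)
    assume "\<not> g j > 0"
    then have gj: "g j = 0" using g_nonneg[of j] by simp
    have g0: "g i = 0" if "i \<ge> j" for i
      using that
    proof (induction i rule: int_ge_induct)
      case (step i)
      have i: "of_int (i + 1) > 2 * c" "real_of_int (i + 1) > 0" "i + 1 \<ge> K + 1"
        using J step.hyps \<open>j \<ge> J\<close> c(1) by auto
      have "g (i + 1) \<le> c / of_int (i + 1) * g (i + 1)"
        using c(2)[OF i(3)] step.IH by simp
      also have "\<dots> \<le> 1 / 2 * g (i + 1)"
        using i g_nonneg by (intro mult_right_mono) (auto simp: field_simps)
      finally show ?case using g_nonneg[of "i + 1"] by simp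
    qed (rule gj)
    obtain m v where m: "- L \<le> m" "m \<le> L" and v: "v \<in> wt m" "v \<noteq> 0" using window_nz by auto
    obtain c' where c': "\<And>j. j \<ge> K \<Longrightarrow> NY m v j \<le> c' * g j" using NY_bounded[OF m v(1)] by blast
    have "d i v = 0" if "i \<ge> j - m" for i
    proof -
      have i: "i + m \<ge> j" "i + m \<ge> K" using that \<open>j \<ge> J\<close> J by auto
      then have "NY m v (i + m) \<le> 0" using c'[of "i + m"] g0[of "i + m"] by simp
      have "\<eta> b (i + m) (d i v) = 0" if "b \<in> B" for b
      proof -
        have "cmod (Y b m v (i + m)) \<le> 0"
          using Y_le_NY[OF that, of m v "i + m"] \<open>NY m v (i + m) \<le> 0\<close> by linarith
        then show ?thesis by (simp add: Y_def)
      qed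
      then show ?thesis using \<eta>_sep[OF i(2), of "d i v"] Y_mem[OF v(1), of "i + m"] by simp
    qed
    then show False using nk v(2) by blast
  qed
  then show ?thesis using J(1) by (intro exI[of _ J]) auto
qed

end

section \<open>Normalised coordinates and a convergent subsequence\<close>

lemma filterlim_real_of_int: "filterlim real_of_int at_top at_top"
  unfolding filterlim_at_top
proof
  fix Z :: real
  show "eventually (\<lambda>j. Z \<le> real_of_int j) at_top"
    unfolding eventually_at_top_linorder by (intro exI[of _ "\<lceil>Z\<rceil>"]) (simp add: ceiling_le_iff)
qed

lemma tendsto_const_over_int: "((\<lambda>j::int. c / real_of_int j) \<longlongrightarrow> 0) at_top"
  by (intro tendsto_divide_0[OF tendsto_const] filterlim_at_top_imp_at_infinity filterlim_real_of_int)

lemma eventually_int_ge: "eventually (\<lambda>j::int. j \<ge> J) at_top"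
  by (rule eventually_ge_at_top)

lemma filterlim_int_shift: "filterlim (\<lambda>j::int. j + s) at_top at_top"
  unfolding filterlim_at_top
proof
  fix Z :: int
  show "eventually (\<lambda>j. Z \<le> j + s) at_top"
    unfolding eventually_at_top_linorder by (intro exI[of _ "Z - s"]) simp
qed

context vir_window
begin

lemma x_inverse: "((\<lambda>j. 1 / x (j + t)) \<longlongrightarrow> 0) at_top"
proof (rule Lim_null_comparison)
  show "((\<lambda>j. 1 / real_of_int (j + t)) \<longlongrightarrow> 0) at_top"
    by (rule filterlim_compose[OF tendsto_const_over_int filterlim_int_shift])
  show "eventually (\<lambda>j. cmod (1 / x (j + t)) \<le> 1 / real_of_int (j + t)) at_top"
    using eventually_int_ge[of "1 - t"]
  proof eventually_elim
    case (elim j)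
    then have "cmod (x (j + t)) \<ge> of_int (j + t)" "real_of_int (j + t) \<ge> 1"
      using x_bound[of "j + t"] by auto
    then show ?case by (simp add: norm_divide frac_le)
  qed
qed

lemma x_ratio: "((\<lambda>j. x (j + s) / x (j + t)) \<longlongrightarrow> 1) at_top"
proof -
  have "((\<lambda>j. 1 + of_int (s - t) * (1 / x (j + t))) \<longlongrightarrow> 1 + of_int (s - t) * 0) at_top"
    by (intro tendsto_intros x_inverse)
  moreover have "eventually (\<lambda>j. 1 + of_int (s - t) * (1 / x (j + t)) = x (j + s) / x (j + t)) at_top"
    using eventually_int_ge[of "- t"]
  proof eventually_elim
    case (elim j)
    then have "x (j + t) \<noteq> 0" by (intro x_nz) simp
    then show ?case by (simp add: field_simps) (simp add: x_def)
  qed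
  ultimately show ?thesis by (simp cong: filterlim_cong add: tendsto_cong)
qed

lemma g_ratio1: "((\<lambda>j. g (j + 1) / g j) \<longlongrightarrow> 1) at_top"
proof -
  obtain c where c: "c \<ge> 0" "\<And>j. j \<ge> K+1 \<Longrightarrow> \<bar>g j - g (j - 1)\<bar> \<le> c / of_int j * (g j + g (j - 1))"
    using g_variation by blast
  obtain J where J: "J \<ge> K" "\<And>j. j \<ge> J \<Longrightarrow> g j > 0" using g_pos by blast
  have "((\<lambda>j. g (j + 1) / g j - 1) \<longlongrightarrow> 0) at_top"
  proof (rule Lim_null_comparison)
    show "((\<lambda>j. 4 * c / real_of_int (j + 1)) \<longlongrightarrow> 0) at_top"
      by (rule filterlim_compose[OF tendsto_const_over_int filterlim_int_shift])
    show "eventually (\<lambda>j. norm (g (j + 1) / g j - 1) \<le> 4 * c / real_of_int (j + 1)) at_top"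
      using eventually_int_ge[of "max J \<lceil>2 * c\<rceil>"]
    proof eventually_elim
      case (elim j)
      then have j: "j \<ge> J" "of_int j \<ge> 2 * c" by (auto simp: ceiling_le_iff)
      define q where "q = g (j + 1) / g j"
      have gp: "g j > 0" "g (j + 1) > 0" using J j by auto
      have t: "real_of_int (j + 1) > 0" "real_of_int (j + 1) \<ge> 2 * c" using j J(1) K1 by auto
      have e: "c / of_int (j + 1) \<le> 1 / 2" using t by (simp add: field_simps)
      have "\<bar>g (j + 1) - g j\<bar> \<le> c / of_int (j + 1) * (g (j + 1) + g j)"
        using c(2)[of "j + 1"] j J(1) by simp
      then have "\<bar>g (j + 1) - g j\<bar> / g j \<le> c / of_int (j + 1) * (g (j + 1) + g j) / g j"
        using gp by (intro divide_right_mono) auto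
      moreover have "\<bar>g (j + 1) - g j\<bar> / g j = \<bar>q - 1\<bar>"
      proof -
        have "q - 1 = (g (j + 1) - g j) / g j" using gp by (simp add: q_def diff_divide_distrib)
        then show ?thesis using gp by (simp add: abs_divide)
      qed
      moreover have "c / of_int (j + 1) * (g (j + 1) + g j) / g j = c / of_int (j + 1) * (q + 1)"
        using gp by (simp add: q_def field_simps)
      ultimately have q: "\<bar>q - 1\<bar> \<le> c / of_int (j + 1) * (q + 1)" by simp
      \<comment> \<open>The bound for \<open>q - 1\<close> still contains \<open>q\<close>, so a
        crude estimate \<open>q \<le> 3\<close> comes first.\<close>
      also have "\<dots> \<le> 1 / 2 * (q + 1)" using e gp by (intro mult_right_mono) (auto simp: q_def)
      finally have "q - 1 \<le> 1 / 2 * (q + 1)" by (rule order_trans[OF abs_ge_self])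
      then have "q \<le> 3" by (simp add: field_simps)
      then have "c / of_int (j + 1) * (q + 1) \<le> c / of_int (j + 1) * 4" using c(1) t by (intro mult_left_mono) auto
      with q have "\<bar>q - 1\<bar> \<le> 4 * c / of_int (j + 1)" by simp
      then show ?case by (simp add: q_def)
    qed
  qed
  then show ?thesis by (simp add: LIM_zero_iff)
qed

lemma g_ratio: "((\<lambda>j. g (j + s) / g j) \<longlongrightarrow> 1) at_top"
proof -
  obtain J where J: "\<And>j. j \<ge> J \<Longrightarrow> g j > 0" using g_pos by blast
  have nat: "((\<lambda>j. g (j + int k) / g j) \<longlongrightarrow> 1) at_top" for k
  proof (induction k)
    case 0
    have "eventually (\<lambda>j. 1 = g (j + int 0) / g j) at_top"
      using eventually_int_ge[of J] by eventually_elim (use J in force)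
    then show ?case by (rule tendsto_eventually[OF eventually_mono]) simp
  next
    case (Suc k)
    have 1: "((\<lambda>j. g (j + int k + 1) / g (j + int k) * (g (j + int k) / g j)) \<longlongrightarrow> 1 * 1) at_top"
      by (intro tendsto_mult Suc.IH filterlim_compose[OF g_ratio1 filterlim_int_shift])
    have 2: "eventually (\<lambda>j. g (j + int k + 1) / g (j + int k) * (g (j + int k) / g j) = g (j + int (Suc k)) / g j) at_top"
      using eventually_int_ge[of J]
    proof eventually_elim
      case (elim j)
      then have "g (j + int k) > 0" using J[of "j + int k"] by simp
      then show ?case by (simp add: add_ac)
    qed
    show ?case using Lim_transform_eventually[OF 1 2] by (simp only: mult_1)
  qed
  show ?thesis
  proof (cases "s \<ge> 0")
    case True
    then show ?thesis using nat[of "nat s"] by simp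
  next
    case False
    have "((\<lambda>j. inverse (g (j + s + int (nat (- s))) / g (j + s))) \<longlongrightarrow> inverse 1) at_top"
      by (intro tendsto_inverse filterlim_compose[OF nat filterlim_int_shift]) simp
    then show ?thesis using False by (simp add: inverse_eq_divide)
  qed
qed

definition w :: "'v \<Rightarrow> int \<Rightarrow> 'v \<Rightarrow> int \<Rightarrow> complex" where
  "w b m u j = Y b m u j / of_real (g j)"

lemma w_step:
  assumes mu: "(m, u) \<in> S" and b: "b \<in> B"
  shows "((\<lambda>j. w b m u j - w b m u (j - 1)) \<longlongrightarrow> 0) at_top"
proof -
  obtain c where c: "c \<ge> 0" "\<And>j. j \<ge> K+1 \<Longrightarrow> \<bar>g j - g (j - 1)\<bar> \<le> c / of_int j * (g j + g (j - 1))"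
    using g_variation by blast
  obtain c' where c': "c' \<ge> 0" "\<And>j. j \<ge> K+1 \<Longrightarrow> cmod (\<Delta> b m u j) \<le> c' / of_int j * (g j + g (j - 1))"
    using \<Delta>_bound[OF mu] b by blast
  obtain J where J: "J \<ge> K" "\<And>j. j \<ge> J \<Longrightarrow> g j > 0" using g_pos by blast
  show ?thesis
  proof (rule Lim_null_comparison)
    have "((\<lambda>j. (c + c') / real_of_int j * (1 + g (j + (- 1)) / g j)) \<longlongrightarrow> 0 * (1 + 1)) at_top"
      by (intro tendsto_mult tendsto_const_over_int tendsto_add tendsto_const g_ratio)
    then show "((\<lambda>j. (c + c') / real_of_int j * (1 + g (j - 1) / g j)) \<longlongrightarrow> 0) at_top" by simp
    show "eventually (\<lambda>j. cmod (w b m u j - w b m u (j - 1)) \<le> (c + c') / real_of_int j * (1 + g (j - 1) / g j)) at_top"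
      using eventually_int_ge[of "J + 1"]
    proof eventually_elim
      case (elim j)
      have gp: "g j > 0" "g (j - 1) > 0" and jK: "j \<ge> K + 1" using J elim by auto
      have Yg: "cmod (Y b m u (j - 1)) \<le> g (j - 1)"
        using Y_le_NY[OF b] NY_le_g[OF mu] by (rule order_trans)
      \<comment> \<open>Splits the step into the change of the coordinate and the change of the
        scale.\<close>
      have eq: "w b m u j - w b m u (j - 1) = \<Delta> b m u j / of_real (g j) +
          Y b m u (j - 1) / of_real (g (j - 1)) * of_real ((g (j - 1) - g j) / g j)"
        using gp by (simp add: w_def \<Delta>_def field_simps)
      have n1: "cmod (\<Delta> b m u j / of_real (g j)) = cmod (\<Delta> b m u j) / g j"
        using gp by (simp add: norm_divide)
      have n2: "cmod (Y b m u (j - 1) / of_real (g (j - 1)) * of_real ((g (j - 1) - g j) / g j)) =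
          cmod (Y b m u (j - 1)) / g (j - 1) * (\<bar>g (j - 1) - g j\<bar> / g j)"
        unfolding norm_mult norm_divide norm_of_real abs_divide using gp by simp
      have "cmod (w b m u j - w b m u (j - 1)) \<le> cmod (\<Delta> b m u j) / g j + cmod (Y b m u (j - 1)) / g (j - 1) * (\<bar>g (j - 1) - g j\<bar> / g j)"
        unfolding eq n1[symmetric] n2[symmetric] by (rule norm_triangle_ineq)
      also have "\<dots> \<le> (c' / of_int j * (g j + g (j - 1))) / g j + 1 * ((c / of_int j * (g j + g (j - 1))) / g j)"
      proof -
        have 1: "cmod (\<Delta> b m u j) / g j \<le> (c' / of_int j * (g j + g (j - 1))) / g j"
          by (rule divide_right_mono[OF c'(2)[OF jK]]) (use gp in simp)
        have 2: "cmod (Y b m u (j - 1)) / g (j - 1) \<le> 1" using Yg gp by simp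
        have 3: "\<bar>g (j - 1) - g j\<bar> / g j \<le> (c / of_int j * (g j + g (j - 1))) / g j"
          by (rule divide_right_mono[OF c(2)[OF jK, unfolded abs_minus_commute[of "g j"]]]) (use gp in simp)
        show ?thesis by (rule add_mono[OF 1 mult_mono[OF 2 3]]) (use gp in auto)
      qed
      also have "\<dots> = (c + c') / real_of_int j * (1 + g (j - 1) / g j)"
      proof -
        have q: "(a / of_int j * (g j + g (j - 1))) / g j = a / of_int j * (1 + g (j - 1) / g j)" for a :: real
        proof -
          have "(g j + g (j - 1)) / g j = 1 + g (j - 1) / g j" using gp by (simp add: add_divide_distrib)
          then show ?thesis by (metis times_divide_eq_right)
        qed
        show ?thesis unfolding q mult_1 add_divide_distrib[of c c'] distrib_right by (rule add.commute)
      qed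
      finally show ?case .
    qed
  qed
qed

lemma subsequence_exists:
  "\<exists>r :: nat \<Rightarrow> nat. strict_mono r \<and> (\<forall>(m, u)\<in>S. \<forall>b\<in>B. convergent (\<lambda>k. w b m u (int (r k))))"
proof -
  have "\<exists>r :: nat \<Rightarrow> nat. strict_mono r \<and> (\<forall>i\<in>S \<times> B. convergent (\<lambda>k. w (snd i) (fst (fst i)) (snd (fst i)) (int (r k))))"
  proof (rule common_convergent_subsequence)
    show "finite (S \<times> B)" using finS finB by simp
    fix i assume i: "i \<in> S \<times> B"
    obtain m u b where mu: "i = ((m, u), b)" by (metis prod.exhaust)
    have "cmod (w b m u (int k)) \<le> 1" for k
      using order_trans[OF Y_le_NY[of b m u] NY_le_g[of m u]] i mu g_nonneg[of "int k"]
      by (auto simp: w_def norm_divide divide_le_eq_1)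
    then show "bounded (range (\<lambda>k. w (snd i) (fst (fst i)) (snd (fst i)) (int k)))"
      unfolding bounded_iff mu by auto
  qed
  then show ?thesis by fastforce
qed

end

section \<open>Limits along the subsequence\<close>

locale vir_limit = vir_window scale n D Z \<mu> N B \<eta> K C L Bs
  for scale :: "complex \<Rightarrow> 'v::ab_group_add \<Rightarrow> 'v" (infixr \<open>\<cdot>\<close> 75) and n D Z \<mu> N B \<eta> K C L Bs +
  fixes r :: "nat \<Rightarrow> nat"
  assumes r: "strict_mono r"
    and conv: "\<And>m u b. (m, u) \<in> S \<Longrightarrow> b \<in> B \<Longrightarrow> convergent (\<lambda>k. w b m u (int (r k)))"
begin

text \<open>Quantifying over all shifts \<open>s\<close> makes the notion invariant under
  translation of \<open>j\<close>, although \<open>r\<close> picks out a possibly sparse set of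
  degrees. The recursions relate neighbouring degrees, so this is indispensable.\<close>

definition Lim :: "(int \<Rightarrow> complex) \<Rightarrow> complex \<Rightarrow> bool" where
  "Lim z l \<longleftrightarrow> (\<forall>s. (\<lambda>k. z (int (r k) + s) / of_real (g (int (r k) + s))) \<longlonglongrightarrow> l)"

lemma r_at_top: "filterlim (\<lambda>k. int (r k) + s) at_top sequentially"
  by (rule filterlim_compose[OF filterlim_int_shift])
     (rule filterlim_compose[OF filterlim_int_sequentially filterlim_subseq[OF r]])

lemma Lim_add: "Lim z l \<Longrightarrow> Lim z' l' \<Longrightarrow> Lim (\<lambda>j. z j + z' j) (l + l')"
  unfolding Lim_def by (simp add: add_divide_distrib tendsto_add)

lemma Lim_mult:
  assumes "(\<kappa> \<longlongrightarrow> a) at_top" "Lim z l"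
  shows "Lim (\<lambda>j. \<kappa> j * z j) (a * l)"
  unfolding Lim_def
proof
  fix s
  have "(\<lambda>k. \<kappa> (int (r k) + s) * (z (int (r k) + s) / of_real (g (int (r k) + s)))) \<longlonglongrightarrow> a * l"
    using assms(2) by (intro tendsto_mult filterlim_compose[OF assms(1) r_at_top]) (simp add: Lim_def)
  then show "(\<lambda>k. \<kappa> (int (r k) + s) * z (int (r k) + s) / of_real (g (int (r k) + s))) \<longlonglongrightarrow> a * l"
    by simp
qed

lemma Lim_cmult: "Lim z l \<Longrightarrow> Lim (\<lambda>j. a * z j) (a * l)"
  by (rule Lim_mult[OF tendsto_const])

lemma Lim_diff: "Lim z l \<Longrightarrow> Lim z' l' \<Longrightarrow> Lim (\<lambda>j. z j - z' j) (l - l')"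
  using Lim_add[of z l "\<lambda>j. - 1 * z' j" "- 1 * l'"] Lim_cmult[of z' l' "- 1"] by simp

lemma Lim_cong:
  assumes "Lim z l" "\<And>j. j \<ge> J \<Longrightarrow> z j = z' j"
  shows "Lim z' l"
  unfolding Lim_def
proof
  fix s
  have "eventually (\<lambda>k. z (int (r k) + s) / of_real (g (int (r k) + s)) = z' (int (r k) + s) / of_real (g (int (r k) + s))) sequentially"
    using r_at_top[of s] eventually_int_ge[of J] unfolding filterlim_at_top
    by (auto elim!: allE[of _ J] eventually_mono simp: assms(2))
  moreover have "(\<lambda>k. z (int (r k) + s) / of_real (g (int (r k) + s))) \<longlonglongrightarrow> l" using assms(1) by (simp add: Lim_def)
  ultimately show "(\<lambda>k. z' (int (r k) + s) / of_real (g (int (r k) + s))) \<longlonglongrightarrow> l"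
    by (rule Lim_transform_eventually[rotated])
qed

lemma Lim_shift:
  assumes "Lim z l"
  shows "Lim (\<lambda>j. z (j + t)) l"
  unfolding Lim_def
proof
  fix s
  obtain J where J: "\<And>j. j \<ge> J \<Longrightarrow> g j > 0" using g_pos by blast
  have 1: "(\<lambda>k. z (int (r k) + (s + t)) / of_real (g (int (r k) + (s + t))) *
      of_real (g (int (r k) + s + t) / g (int (r k) + s))) \<longlonglongrightarrow> l * of_real 1"
    using assms by (intro tendsto_mult tendsto_of_real filterlim_compose[OF g_ratio r_at_top]) (simp add: Lim_def)
  have 2: "eventually (\<lambda>k. z (int (r k) + (s + t)) / of_real (g (int (r k) + (s + t))) *
      of_real (g (int (r k) + s + t) / g (int (r k) + s)) = z (int (r k) + s + t) / of_real (g (int (r k) + s))) sequentially"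
  proof -
    have "eventually (\<lambda>k. int (r k) + (s + t) \<ge> J) sequentially" 
      using r_at_top[of "s + t"] unfolding filterlim_at_top by blast
    then show ?thesis
    proof eventually_elim
      case (elim k)
      then have "g (int (r k) + (s + t)) > 0" by (rule J)
      then show ?case by (simp add: add.assoc)
    qed
  qed
  show "(\<lambda>k. z (int (r k) + s + t) / of_real (g (int (r k) + s))) \<longlonglongrightarrow> l"
    using Lim_transform_eventually[OF 1 2] by (simp only: of_real_1 mult_1_right)
qed

lemma Lim_unique: "Lim z l \<Longrightarrow> Lim z l' \<Longrightarrow> l = l'"
  unfolding Lim_def by (metis LIMSEQ_unique)

lemma Lim_small:
  assumes Y: "\<And>b. b \<in> B \<Longrightarrow> \<exists>l. Lim (Y b m u) l" and z: "\<And>j. j \<ge> J \<Longrightarrow> cmod (z j) \<le> \<kappa> / of_int j * NY m u j"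
  shows "Lim z 0"
  unfolding Lim_def
proof
  fix s
  obtain l where l: "\<And>b. b \<in> B \<Longrightarrow> Lim (Y b m u) (l b)" using Y by metis
  obtain J' where J': "\<And>j. j \<ge> J' \<Longrightarrow> g j > 0" using g_pos by blast
  show "(\<lambda>k. z (int (r k) + s) / of_real (g (int (r k) + s))) \<longlonglongrightarrow> 0"
  proof (rule Lim_null_comparison)
    have "(\<lambda>k. \<kappa> / of_int (int (r k) + s) * (\<Sum>b\<in>B. cmod (Y b m u (int (r k) + s) / of_real (g (int (r k) + s))))) \<longlonglongrightarrow> 0 * (\<Sum>b\<in>B. cmod (l b))"
      using l by (intro tendsto_mult tendsto_sum tendsto_norm filterlim_compose[OF tendsto_const_over_int r_at_top]) (simp add: Lim_def)
    then show "(\<lambda>k. \<kappa> / of_int (int (r k) + s) * (\<Sum>b\<in>B. cmod (Y b m u (int (r k) + s) / of_real (g (int (r k) + s))))) \<longlonglongrightarrow> 0"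
      by simp
    have "eventually (\<lambda>k. int (r k) + s \<ge> max J J') sequentially"
      using r_at_top[of s] unfolding filterlim_at_top by blast
    then show "eventually (\<lambda>k. cmod (z (int (r k) + s) / of_real (g (int (r k) + s))) \<le>
        \<kappa> / of_int (int (r k) + s) * (\<Sum>b\<in>B. cmod (Y b m u (int (r k) + s) / of_real (g (int (r k) + s))))) sequentially"
    proof eventually_elim
      case (elim k)
      let ?j = "int (r k) + s"
      have gj: "g ?j > 0" using J' elim by simp
      have "cmod (z ?j / of_real (g ?j)) = cmod (z ?j) / g ?j" using gj by (simp add: norm_divide)
      also have "\<dots> \<le> (\<kappa> / of_int ?j * NY m u ?j) / g ?j" using z[of ?j] elim gj by (intro divide_right_mono) auto
      also have "\<dots> = \<kappa> / of_int ?j * (\<Sum>b\<in>B. cmod (Y b m u ?j / of_real (g ?j)))"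
        using gj by (simp add: NY_eq norm_divide sum_divide_distrib[symmetric])
      finally show ?case .
    qed
  qed
qed

text \<open>Ratios of weights at bounded distance tend to 1, so it does not matter at which
  neighbouring degrees the two factors are taken.\<close>

lemma Lim_x\<Delta>:
  assumes "Lim (\<lambda>j. x (j + s) * \<Delta> b m u j) p"
  shows "Lim (\<lambda>j. x (j + s') * \<Delta> b m u (j + t)) p"
proof -
  have "Lim (\<lambda>j. x (j + t + s) * \<Delta> b m u (j + t)) p" using Lim_shift[OF assms, of t] by simp
  then have "Lim (\<lambda>j. x (j + s') / x (j + (t + s)) * (x (j + t + s) * \<Delta> b m u (j + t))) (1 * p)"
    by (intro Lim_mult x_ratio)
  then have "Lim (\<lambda>j. x (j + s') / x (j + (t + s)) * (x (j + t + s) * \<Delta> b m u (j + t))) p" by simp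
  then show ?thesis
  proof (rule Lim_cong[of _ _ "- (t + s)"])
    fix j assume "j \<ge> - (t + s)"
    then have "x (j + (t + s)) \<noteq> 0" by (intro x_nz) simp
    then show "x (j + s') / x (j + (t + s)) * (x (j + t + s) * \<Delta> b m u (j + t)) = x (j + s') * \<Delta> b m u (j + t)"
      by (simp add: add.assoc)
  qed
qed

definition E :: "int \<Rightarrow> bool" where
  "E m \<longleftrightarrow> (\<forall>u\<in>wt m. \<forall>b\<in>B. \<exists>l. Lim (Y b m u) l)"

text \<open>Convergence along \<open>r\<close> extends to every shift, because consecutive
  normalised coordinates differ by o(1).\<close>

lemma Lim_basis:
  assumes mu: "(m, u) \<in> S" and b: "b \<in> B"
  shows "\<exists>l. Lim (Y b m u) l"
proof -
  obtain l where l: "(\<lambda>k. w b m u (int (r k))) \<longlonglongrightarrow> l" using conv[OF assms] by (auto simp: convergent_def)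
  have "(\<lambda>k. w b m u (int (r k) + s)) \<longlonglongrightarrow> l" for s
  proof (induction s rule: int_induct[where k = 0])
    case base then show ?case using l by simp
  next
    case (step1 s)
    have "(\<lambda>k. w b m u (int (r k) + s) + (w b m u (int (r k) + (s + 1)) - w b m u (int (r k) + (s + 1) - 1))) \<longlonglongrightarrow> l + 0"
      by (intro tendsto_add step1 filterlim_compose[OF w_step[OF assms] r_at_top])
    then show ?case by (simp add: algebra_simps)
  next
    case (step2 s)
    have "(\<lambda>k. w b m u (int (r k) + s) - (w b m u (int (r k) + s) - w b m u (int (r k) + s - 1))) \<longlonglongrightarrow> l - 0"
      by (intro tendsto_diff step2 filterlim_compose[OF w_step[OF assms] r_at_top])
    then show ?case by (simp add: algebra_simps)
  qed
  then show ?thesis by (auto simp: Lim_def w_def)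
qed

lemma E_window: assumes m: "- L \<le> m" "m \<le> L" shows "E m"
  unfolding E_def
proof (intro ballI)
  fix u b assume u: "u \<in> wt m" and b: "b \<in> B"
  have "u \<in> span (Bs m)" using Bs(3) u by blast
  then have "u \<in> wt m \<and> (\<exists>l. Lim (Y b m u) l)"
  proof (induction rule: span_induct_alt)
    case base
    have Y0: "Y b m 0 j = 0" if "j \<ge> K" for j using Y_scale[OF W_zero that, where m = m and b = b and a = 0] by simp
    have "Lim (\<lambda>j. 0) 0" by (simp add: Lim_def)
    then have "Lim (Y b m 0) 0" by (rule Lim_cong[of _ _ K]) (simp add: Y0)
    then show ?case using W_zero by blast
  next
    case (step a v y)
    have v: "v \<in> wt m" "(m, v) \<in> S" using step(1) Bs(2) m by (auto simp: S_def)
    obtain l where l: "Lim (Y b m y) l" and y: "y \<in> wt m" using step by blast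
    obtain l' where l': "Lim (Y b m v) l'" using Lim_basis[OF v(2) b] by blast
    have "Lim (Y b m (a \<cdot> v + y)) (a * l' + l)"
      by (rule Lim_cong[OF Lim_add[OF Lim_cmult[OF l', of a] l], of K])
         (use v(1) y in \<open>simp add: Y_add Y_scale W_scale\<close>)
    then show ?case using v(1) y by (auto intro!: W_add W_scale)
  qed
  then show "\<exists>l. Lim (Y b m u) l" by blast
qed

lemma \<epsilon>_Lim: "E m \<Longrightarrow> u \<in> wt m \<Longrightarrow> b \<in> B \<Longrightarrow> Lim (\<epsilon> b m u) 0"
  using \<epsilon>_bound by (intro Lim_small[where m = m and u = u and J = K and \<kappa> = C]) (auto simp: E_def)

text \<open>By \<open>Y_raise\<close>, the limit at \<open>d 1 u\<close> and that of
  \<open>x * \<Delta>\<close> at \<open>u\<close> determine each other. With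
  \<open>lower_Lim\<close> for \<open>d (- 1) u\<close>, existence passes from one neighbouring
  degree of \<open>u\<close> to the other.\<close>

lemma raise_Lim:
  assumes u: "u \<in> wt m" and l: "Lim (Y b m u) l"
  shows "Lim (Y b (m + 1) (d 1 u)) l' \<longleftrightarrow> Lim (\<lambda>j. x (j + 0) * \<Delta> b m u j) ((x m + 1) * l - l')"
proof
  assume "Lim (Y b (m + 1) (d 1 u)) l'"
  then have "Lim (\<lambda>j. (x m + 1) * Y b m u j - Y b (m + 1) (d 1 u) j) ((x m + 1) * l - l')"
    by (intro Lim_diff Lim_cmult l)
  then have "Lim (\<lambda>j. x (j + (- 1)) * \<Delta> b m u j) ((x m + 1) * l - l')"
    by (rule Lim_cong[of _ _ "K + 1"]) (simp add: Y_raise[OF u])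
  from Lim_x\<Delta>[OF this, of 0 0] show "Lim (\<lambda>j. x (j + 0) * \<Delta> b m u j) ((x m + 1) * l - l')" by simp
next
  assume "Lim (\<lambda>j. x (j + 0) * \<Delta> b m u j) ((x m + 1) * l - l')"
  from Lim_x\<Delta>[OF this, of "- 1" 0] have "Lim (\<lambda>j. x (j - 1) * \<Delta> b m u j) ((x m + 1) * l - l')" by simp
  then have "Lim (\<lambda>j. (x m + 1) * Y b m u j - x (j - 1) * \<Delta> b m u j) ((x m + 1) * l - ((x m + 1) * l - l'))"
    by (intro Lim_diff Lim_cmult l)
  then have "Lim (\<lambda>j. (x m + 1) * Y b m u j - x (j - 1) * \<Delta> b m u j) l'" by (simp only: diff_diff_eq2 add_diff_cancel_left')
  then show "Lim (Y b (m + 1) (d 1 u)) l'"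
    by (rule Lim_cong[of _ _ "K + 1"]) (simp add: Y_raise[OF u])
qed

lemma lower_Lim:
  assumes u: "u \<in> wt m" and E: "E m" and b: "b \<in> B" and l: "Lim (Y b m u) l"
  shows "Lim (Y b (m - 1) (d (- 1) u)) l' \<longleftrightarrow> Lim (\<lambda>j. x (j + 0) * \<Delta> b m u j) (l' - (x m - 1) * l)"
proof
  assume "Lim (Y b (m - 1) (d (- 1) u)) l'"
  then have "Lim (\<lambda>j. Y b (m - 1) (d (- 1) u) (j + (- 1)) - (x m - 1) * Y b m u (j + (- 1)) - \<epsilon> b m u j) (l' - (x m - 1) * l - 0)"
    by (intro Lim_diff Lim_cmult Lim_shift l \<epsilon>_Lim E u b)
  then have "Lim (\<lambda>j. Y b (m - 1) (d (- 1) u) (j + (- 1)) - (x m - 1) * Y b m u (j + (- 1)) - \<epsilon> b m u j) (l' - (x m - 1) * l)"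
    by (simp only: diff_0_right)
  then show "Lim (\<lambda>j. x (j + 0) * \<Delta> b m u j) (l' - (x m - 1) * l)"
    by (rule Lim_cong[of _ _ "K + 1"]) (simp add: Y_lower[OF u])
next
  assume *: "Lim (\<lambda>j. x (j + 0) * \<Delta> b m u j) (l' - (x m - 1) * l)"
  have "Lim (\<lambda>j. (x m - 1) * Y b m u (j + (- 1)) + x (j + 0) * \<Delta> b m u j + \<epsilon> b m u j) ((x m - 1) * l + (l' - (x m - 1) * l) + 0)"
    by (intro Lim_add Lim_cmult Lim_shift l \<epsilon>_Lim E u b *)
  then have "Lim (\<lambda>j. (x m - 1) * Y b m u (j + (- 1)) + x (j + 0) * \<Delta> b m u j + \<epsilon> b m u j) l'"
    by (simp only: add_0_right add.commute[of _ "l' - _"] diff_add_cancel)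
  then have "Lim (\<lambda>j. Y b (m - 1) (d (- 1) u) (j + (- 1))) l'"
    by (rule Lim_cong[of _ _ "K + 1"]) (simp add: Y_lower[OF u])
  from Lim_shift[OF this, of 1] show "Lim (Y b (m - 1) (d (- 1) u)) l'" by simp
qed

text \<open>Every vector of degree \<open>m + 1\<close> is some \<open>d 1 u\<close>. The limit at
  \<open>d (- 1) u\<close> gives the limit of \<open>x * \<Delta>\<close> at \<open>u\<close>, and
  that one gives the limit at \<open>d 1 u\<close>.\<close>

lemma E_up: assumes m: "m \<ge> L" and E: "E m" "E (m - 1)" shows "E (m + 1)"
  unfolding E_def
proof (intro ballI)
  fix u' b assume "u' \<in> wt (m + 1)" and b: "b \<in> B"
  then obtain u where u: "u \<in> wt m" "u' = d 1 u" using up[OF m] by auto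
  obtain l where l: "Lim (Y b m u) l" using E(1) u b by (auto simp: E_def)
  obtain l' where l': "Lim (Y b (m - 1) (d (- 1) u)) l'"
    using E(2) wt_d[OF u(1), of "- 1"] b by (auto simp: E_def)
  have "Lim (\<lambda>j. x (j + 0) * \<Delta> b m u j) (l' - (x m - 1) * l)"
    using lower_Lim[OF u(1) E(1) b l] l' by blast
  then have "Lim (Y b (m + 1) (d 1 u)) ((x m + 1) * l - (l' - (x m - 1) * l))"
    using raise_Lim[OF u(1) l, of "(x m + 1) * l - (l' - (x m - 1) * l)"] by simp
  then show "\<exists>l. Lim (Y b (m + 1) u') l" using u(2) by blast
qed

lemma E_down: assumes m: "m \<le> - L" and E: "E m" "E (m + 1)" shows "E (m - 1)"
  unfolding E_def
proof (intro ballI)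
  fix u' b assume "u' \<in> wt (m - 1)" and b: "b \<in> B"
  then obtain u where u: "u \<in> wt m" "u' = d (- 1) u" using down[OF m] by auto
  obtain l where l: "Lim (Y b m u) l" using E(1) u b by (auto simp: E_def)
  obtain l' where l': "Lim (Y b (m + 1) (d 1 u)) l'"
    using E(2) wt_d[OF u(1), of 1] b by (auto simp: E_def)
  have "Lim (\<lambda>j. x (j + 0) * \<Delta> b m u j) ((x m + 1) * l - l')"
    using raise_Lim[OF u(1) l] l' by blast
  then have "Lim (Y b (m - 1) (d (- 1) u)) ((x m + 1) * l - l' + (x m - 1) * l)"
    using lower_Lim[OF u(1) E(1) b l, of "(x m + 1) * l - l' + (x m - 1) * l"] by simp
  then show "\<exists>l. Lim (Y b (m - 1) u') l" using u(2) by blast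
qed

lemma E_all: "E m"
proof -
  have "E m \<and> E (m - 1)" if "m \<ge> L" for m
    using that
  proof (induction m rule: int_ge_induct)
    case base then show ?case using E_window L1 by simp
  next
    case (step m) then show ?case using E_up by simp
  qed
  moreover have "E m \<and> E (m + 1)" if "m \<le> - L" for m
    using that
  proof (induction m rule: int_le_induct)
    case base then show ?case using E_window L1 by simp
  next
    case (step m) then show ?case using E_down by simp
  qed
  ultimately show ?thesis using E_window[of m] by (meson linear)
qed

lemma limit_functional:
  "\<exists>f p. (\<forall>m. \<forall>u\<in>wt m. \<forall>v\<in>wt m. f m (u + v) = f m u + f m v) \<and>
     (\<forall>m a. \<forall>u\<in>wt m. f m (a \<cdot> u) = a * f m u) \<and>
     (\<forall>m. \<forall>u\<in>wt m. \<forall>k\<in>{1, - 1, 2, - 2}. f (m + k) (d k u) = (x m + of_int k) * f m u - of_int k * p m u) \<and>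
     (\<exists>m u. u \<in> wt m \<and> f m u \<noteq> (0::complex))"
proof -
  define F where "F b m u = (THE l. Lim (Y b m u) l)" for b m u
  have F: "Lim (Y b m u) (F b m u)" if "u \<in> wt m" "b \<in> B" for b m u
  proof -
    have "\<exists>l. Lim (Y b m u) l" using E_all that by (auto simp: E_def)
    then have "\<exists>!l. Lim (Y b m u) l" using Lim_unique by blast
    then show ?thesis unfolding F_def by (rule theI')
  qed
  have FI: "F b m u = l" if "Lim (Y b m u) l" for b m u l
    unfolding F_def using that Lim_unique by blast
  \<comment> \<open>If all limits vanished, so would the limit of the sum of the normalised sizes
    over the window, but this sum is 1.\<close>
  have "\<exists>b\<in>B. \<exists>m. \<exists>u\<in>wt m. F b m u \<noteq> 0"
  proof (rule ccontr)
    assume "\<not> ?thesis"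
    then have L0: "Lim (Y b m u) 0" if "u \<in> wt m" "b \<in> B" for b m u using F[OF that] that by force
    obtain J where J: "\<And>j. j \<ge> J \<Longrightarrow> g j > 0" using g_pos by blast
    have L0': "(\<lambda>k. Y b m u (int (r k)) / of_real (g (int (r k)))) \<longlonglongrightarrow> 0" if "(m, u) \<in> S" "b \<in> B" for b m u
      using L0[OF S_wt(1)[OF that(1)] that(2)] unfolding Lim_def by (auto dest: spec[of _ 0])
    have "(\<lambda>k. \<Sum>(m, u)\<in>S. \<Sum>b\<in>B. cmod (Y b m u (int (r k)) / of_real (g (int (r k))))) \<longlonglongrightarrow> (\<Sum>(m, u)\<in>S. \<Sum>b\<in>B. cmod 0)"
      unfolding case_prod_unfold
      by (intro tendsto_sum tendsto_norm L0') auto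
    then have lim0: "(\<lambda>k. \<Sum>(m, u)\<in>S. \<Sum>b\<in>B. cmod (Y b m u (int (r k)) / of_real (g (int (r k))))) \<longlonglongrightarrow> 0" by (simp add: case_prod_unfold)
    have "eventually (\<lambda>k. int (r k) + 0 \<ge> J) sequentially" using r_at_top[of 0] by (simp only: filterlim_at_top)
    then have "eventually (\<lambda>k. (\<Sum>(m, u)\<in>S. \<Sum>b\<in>B. cmod (Y b m u (int (r k)) / of_real (g (int (r k))))) = 1) sequentially"
    proof eventually_elim
      case (elim k)
      then have gk: "g (int (r k)) > 0" using J by simp
      define G where "G = g (int (r k))"
      have "(\<Sum>(m, u)\<in>S. \<Sum>b\<in>B. cmod (Y b m u (int (r k)) / of_real G)) = (\<Sum>(m, u)\<in>S. NY m u (int (r k))) / G"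
        using gk by (simp add: G_def[symmetric] norm_divide case_prod_unfold NY_eq sum_divide_distrib)
      also have "(\<Sum>(m, u)\<in>S. NY m u (int (r k))) = G" by (simp add: G_def g_def)
      finally have "(\<Sum>(m, u)\<in>S. \<Sum>b\<in>B. cmod (Y b m u (int (r k)) / of_real G)) = G / G" .
      then show ?case using gk by (simp add: G_def)
    qed
    then have "(\<lambda>k. \<Sum>(m, u)\<in>S. \<Sum>b\<in>B. cmod (Y b m u (int (r k)) / of_real (g (int (r k))))) \<longlonglongrightarrow> 1"
      by (rule tendsto_eventually)
    from LIMSEQ_unique[OF this lim0] show False by simp
  qed
  then obtain b m0 u0 where b: "b \<in> B" and nz: "u0 \<in> wt m0" "F b m0 u0 \<noteq> 0" by blast
  \<comment> \<open>This is the limit of \<open>x * \<Delta>\<close>; for a V(a,b) it is 1 - b times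
    the first functional.\<close>
  define p where "p m u = (x m + 1) * F b m u - F b (m + 1) (d 1 u)" for m u
  have pL: "Lim (\<lambda>j. x (j + 0) * \<Delta> b m u j) (p m u)" if u: "u \<in> wt m" for m u
    using raise_Lim[OF u F[OF u b], of "F b (m + 1) (d 1 u)"] F[OF wt_d[OF u, of 1] b] by (simp add: p_def)
  have k1: "F b (m + 1) (d 1 u) = (x m + 1) * F b m u - p m u" for m u by (simp add: p_def)
  have km1: "F b (m - 1) (d (- 1) u) = (x m - 1) * F b m u + p m u" if u: "u \<in> wt m" for m u
    using lower_Lim[OF u E_all b F[OF u b], of "(x m - 1) * F b m u + p m u"] pL[OF u] by (intro FI) simp
  have k2: "F b (m + k) (d k u) = (x m + of_int k) * F b m u - of_int k * p m u"
    if k: "k = 2 \<or> k = - 2" and u: "u \<in> wt m" for m k u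
  proof (rule FI)
    obtain \<kappa> J where J: "J \<ge> K" and small: "\<And>j. j \<ge> J \<Longrightarrow>
       cmod (\<eta> b (j + k) (d k (d (j - m) u)) - x j * Y b m u j) \<le> \<kappa> / of_int j * NY m u j"
      using dev_small[OF k] u b by blast
    have "Lim (\<lambda>j. \<eta> b (j + k) (d k (d (j - m) u)) - x j * Y b m u j) 0"
      using E_all[of m] u by (intro Lim_small[OF _ small]) (auto simp: E_def)
    from Lim_shift[OF this, of "- k"]
    have 1: "Lim (\<lambda>j. \<eta> b j (d k (d (j - k - m) u)) - x (j - k) * Y b m u (j - k)) 0" by simp
    \<comment> \<open>Over two degrees the increment is the sum of two consecutive differences, each
      contributing \<open>p\<close>, with the sign of \<open>k\<close>.\<close>
    have 2: "Lim (\<lambda>j. x (j - k) * (Y b m u j - Y b m u (j - k))) (of_int k * p m u)"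
      using k
    proof
      assume k: "k = 2"
      have "Lim (\<lambda>j. x (j + (- 2)) * \<Delta> b m u (j + 0) + x (j + (- 2)) * \<Delta> b m u (j + (- 1))) (p m u + p m u)"
        by (intro Lim_add Lim_x\<Delta>[OF pL[OF u]])
      then show ?thesis by (simp add: k \<Delta>_def algebra_simps)
    next
      assume k: "k = - 2"
      have "Lim (\<lambda>j. - 1 * (x (j + 2) * \<Delta> b m u (j + 2) + x (j + 2) * \<Delta> b m u (j + 1))) (- 1 * (p m u + p m u))"
        by (intro Lim_cmult Lim_add Lim_x\<Delta>[OF pL[OF u]])
      then show ?thesis by (simp add: k \<Delta>_def algebra_simps)
    qed
    have "Lim (\<lambda>j. (x m + of_int k) * Y b m u j - x (j - k) * (Y b m u j - Y b m u (j - k)) +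
       (\<eta> b j (d k (d (j - k - m) u)) - x (j - k) * Y b m u (j - k))) ((x m + of_int k) * F b m u - of_int k * p m u + 0)"
      by (intro Lim_add Lim_diff Lim_cmult F[OF u b] 1 2)
    then have "Lim (Y b (m + k) (d k u)) ((x m + of_int k) * F b m u - of_int k * p m u + 0)"
    proof (rule Lim_cong)
      \<comment> \<open>\<open>K + 2\<close> keeps \<open>j - k\<close> at or above \<open>K\<close>
        for both signs of \<open>k\<close>, and \<open>m + 1\<close> excludes
        \<open>j = m\<close>.\<close>
      fix j assume "j \<ge> max (K + 2) (m + 1)"
      then have "j \<ge> K" "j - k \<ge> K" "j \<noteq> m" using k by auto
      from Y_dev[OF u this, of b]
      show "(x m + of_int k) * Y b m u j - x (j - k) * (Y b m u j - Y b m u (j - k)) +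
       (\<eta> b j (d k (d (j - k - m) u)) - x (j - k) * Y b m u (j - k)) = Y b (m + k) (d k u) j" by simp
    qed
    then show "Lim (Y b (m + k) (d k u)) ((x m + of_int k) * F b m u - of_int k * p m u)" by simp
  qed
  show ?thesis
  proof (intro exI conjI allI ballI)
    show "F b m (u + v) = F b m u + F b m v" if "u \<in> wt m" "v \<in> wt m" for m u v
      by (rule FI, rule Lim_cong[OF Lim_add[OF F[OF that(1) b] F[OF that(2) b]], of K]) (simp add: Y_add that)
    show "F b m (a \<cdot> u) = a * F b m u" if "u \<in> wt m" for m a u
      by (rule FI, rule Lim_cong[OF Lim_cmult[OF F[OF that b]], of K]) (simp add: Y_scale that)
    show "F b (m + k) (d k u) = (x m + of_int k) * F b m u - of_int k * p m u"
      if "u \<in> wt m" "k \<in> {1, - 1, 2, - 2}" for m u k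
      using that k1[of m u] km1[OF that(1)] k2[OF _ that(1), of k] by auto
    show "u0 \<in> wt m0" "F b m0 u0 \<noteq> 0" by (rule nz)+
  qed
qed

end

section \<open>The quadratic equation for limit functionals\<close>

context vir_cuspidal
begin

lemma D_D1: "d i (d k v) = d k (d i v) + of_int (k - i) \<cdot> d (i + k) v" if "i \<noteq> - k"
  using D_D'[OF that, of 0 0 v] by simp

lemma d0_wt: "u \<in> wt m \<Longrightarrow> d 0 u = x m \<cdot> u"
  by (simp add: W_def)

text \<open>The excluded pairs are those whose bracket vanishes or has a central term. Degree 0 is
  therefore a hypothesis; the remaining degrees are reached from 2 and -2 by steps of 1 and
  -1.\<close>

lemma generated_index:
  assumes base: "1 \<in> I" "- 1 \<in> I" "2 \<in> I" "- 2 \<in> I" "0 \<in> I"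
    and step: "\<And>i k. i \<in> I \<Longrightarrow> k \<in> I \<Longrightarrow> i \<noteq> k \<Longrightarrow> i \<noteq> - k \<Longrightarrow> i + k \<in> I"
  shows "(i::int) \<in> I"
proof -
  have "i \<in> I" if "i \<ge> 2" for i
    using that
  proof (induction i rule: int_ge_induct)
    case (step i)
    have "i + 1 \<in> I" by (rule assms(6)[OF step.IH base(1)]) (use step.hyps in auto)
    then show ?case .
  qed (rule base)
  moreover have "i \<in> I" if "i \<le> - 2" for i
    using that
  proof (induction i rule: int_le_induct)
    case (step i)
    have "i + - 1 \<in> I" by (rule assms(6)[OF step.IH base(2)]) (use step.hyps in auto)
    then show ?case by simp
  qed (rule base)
  ultimately have "i \<in> I" if "i \<ge> 2 \<or> i \<le> - 2" for i using that by blast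
  moreover have "i = - 1 \<or> i = 0 \<or> i = 1" if "\<not> (i \<ge> 2 \<or> i \<le> - 2)" using that by linarith
  ultimately show ?thesis using base by blast
qed

text \<open>Closure under four generators suffices: \<open>d 0\<close> acts by scalars on weight
  vectors, and the bracket of \<open>d 2\<close> and \<open>d (- 2)\<close> contains the central
  element with coefficient (8 - 2)/12.\<close>

lemma generated_irreducible:
  assumes S: "\<And>m. subspace (S m)" "\<And>m. S m \<subseteq> wt m"
    and cl: "\<And>m k v. v \<in> S m \<Longrightarrow> k \<in> {1, - 1, 2, - 2} \<Longrightarrow> d k v \<in> S (m + k)"
    and v: "v \<in> S m" "v \<noteq> 0"
  shows "S k = wt k"
proof -
  have d: "\<forall>m. \<forall>v\<in>S m. d i v \<in> S (m + i)" for i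
  proof -
    have "i \<in> {i. \<forall>m. \<forall>v\<in>S m. d i v \<in> S (m + i)}"
    proof (rule generated_index)
      have "d 0 v \<in> S m" if "v \<in> S m" for m v
      proof -
        have "v \<in> wt m" using that S(2) by blast
        then show ?thesis using d0_wt subspace_scale[OF S(1) that] by simp
      qed
      then show "0 \<in> {i. \<forall>m. \<forall>v\<in>S m. d i v \<in> S (m + i)}" by simp
      fix i k assume i: "i \<in> {i. \<forall>m. \<forall>v\<in>S m. d i v \<in> S (m + i)}" and k: "k \<in> {i. \<forall>m. \<forall>v\<in>S m. d i v \<in> S (m + i)}"
        and ne: "i \<noteq> k" "i \<noteq> - k"
      have "d (i + k) v \<in> S (m + (i + k))" if v: "v \<in> S m" for m v
      proof -
        have "d i (d k v) \<in> S (m + k + i)" "d k (d i v) \<in> S (m + i + k)" using i k v by blast+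
        then have "d i (d k v) - d k (d i v) \<in> S (m + (i + k))"
          by (intro subspace_diff S(1)) (simp_all add: add_ac)
        then have "(1 / of_int (k - i)) \<cdot> (d i (d k v) - d k (d i v)) \<in> S (m + (i + k))"
          by (rule subspace_scale[OF S(1)])
        then show ?thesis using D_D1[OF ne(2), of v] ne(1) by simp
      qed
      then show "i + k \<in> {i. \<forall>m. \<forall>v\<in>S m. d i v \<in> S (m + i)}" by blast
    qed (use cl in \<open>blast+\<close>)
    then show ?thesis by blast
  qed
  have z0: "0 \<in> S m" for m by (rule subspace_0[OF S(1)])
  have "Z 0 v \<in> S m" if v: "v \<in> S m" for m v
  proof -
    have "d 2 (d (- 2) v) \<in> S (m + - 2 + 2)" "d (- 2) (d 2 v) \<in> S (m + 2 + - 2)" "d 0 v \<in> S (m + 0)" using d v by blast+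
    then have "2 \<cdot> (d 2 (d (- 2) v) - d (- 2) (d 2 v) + 4 \<cdot> d 0 v) \<in> S m"
      by (intro subspace_scale subspace_add subspace_diff S(1)) simp_all
    moreover have "d 2 (d (- 2) v) - d (- 2) (d 2 v) + 4 \<cdot> d 0 v = (1 / 2) \<cdot> Z 0 v"
      using D_bracket[of 2 0 "- 2" 0 v] by simp
    ultimately show ?thesis by simp
  qed
  then have Z: "Z j v \<in> S m" if "v \<in> S m" for j m v using that z0 t_zero(2)[of j v] by (cases "j = 0") auto
  have D: "D i j v \<in> S (m + i)" if "v \<in> S m" for i j m v
    using that d z0 t_zero(1)[of j i v] by (cases "j = 0") auto
  show ?thesis unfolding x_def
    by (rule graded_irreducible(1)[of S \<mu>, OF S(1) _ D Z v]) (use S(2) in \<open>auto simp: x_def\<close>)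
qed

lemma functional_exists:
  "\<exists>f p. (\<forall>m. \<forall>u\<in>wt m. \<forall>v\<in>wt m. f m (u + v) = f m u + f m v) \<and>
     (\<forall>m a. \<forall>u\<in>wt m. f m (a \<cdot> u) = a * f m u) \<and>
     (\<forall>m. \<forall>u\<in>wt m. \<forall>k\<in>{1, - 1, 2, - 2}. f (m + k) (d k u) = (x m + of_int k) * f m u - of_int k * p m u) \<and>
     (\<exists>m u. u \<in> wt m \<and> f m u \<noteq> (0::complex))"
proof -
  obtain B \<eta> K C where "vir_gauge scale n D Z \<mu> N B \<eta> K C" using gauge_exists by blast
  then interpret g: vir_gauge scale n D Z \<mu> N B \<eta> K C .
  have "\<exists>K1. \<forall>m\<ge>K1. (\<forall>v\<in>wt m. d 1 v = 0 \<longrightarrow> v = 0) \<and> d 1 ` wt m = wt (m + 1)"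
    unfolding x_def by (rule d1_bij_eventually[OF bound])
  then obtain K1 where K1: "\<forall>m\<ge>K1. (\<forall>v\<in>wt m. d 1 v = 0 \<longrightarrow> v = 0) \<and> d 1 ` wt m = wt (m + 1)" ..
  have "\<exists>K2. \<forall>m\<le>K2. d (- 1) ` wt m = wt (m - 1)"
    unfolding x_def by (rule d_minus1_surj_eventually[OF bound])
  then obtain K2 where K2: "\<forall>m\<le>K2. d (- 1) ` wt m = wt (m - 1)" ..
  have "\<exists>m v. v \<in> wt m \<and> v \<noteq> 0"
  proof (rule ccontr)
    assume "\<not> ?thesis"
    then have "(\<Union>m. W (\<mu> + of_int m)) \<subseteq> {0}" by (auto simp: x_def)
    then have "span (\<Union>m. W (\<mu> + of_int m)) \<subseteq> {0}" by (rule span_minimal) simp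
    then show False using coset nontrivial by auto
  qed
  then obtain m0 v0 where v0: "v0 \<in> wt m0" "v0 \<noteq> 0" by blast
  define L where "L = max 1 (max K1 (max (- K2) \<bar>m0\<bar>))"
  have L: "L \<ge> 1" "L \<ge> K1" "L \<ge> - K2" "- L \<le> m0" "m0 \<le> L" by (auto simp: L_def)
  have "\<exists>B. finite B \<and> B \<subseteq> wt m \<and> wt m \<subseteq> span B" for m
  proof -
    obtain B where "B \<subseteq> wt m" "independent B" "wt m \<subseteq> span B"
      using maximal_independent_subset[of "wt m"] by auto
    moreover have "finite B" using bound[of m] calculation(1,2) unfolding dim_le_def x_def by blast
    ultimately show ?thesis by blast
  qed
  then obtain Bs where Bs: "\<And>m. finite (Bs m) \<and> Bs m \<subseteq> wt m \<and> wt m \<subseteq> span (Bs m)" by metis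
  interpret w: vir_window scale n D Z \<mu> N B \<eta> K C L Bs
  proof
    show "d 1 ` wt m = wt (m + 1)" if "m \<ge> L" for m using K1 L that by simp
    show "d (- 1) ` wt m = wt (m - 1)" if "m \<le> - L" for m using K2 L that by simp
    show "\<exists>m\<in>{- L..L}. \<exists>v\<in>wt m. v \<noteq> 0" using v0 L by auto
  qed (use Bs L in auto)
  obtain r where r: "strict_mono r" "\<And>m u b. (m, u) \<in> w.S \<Longrightarrow> b \<in> B \<Longrightarrow> convergent (\<lambda>k. w.w b m u (int (r k)))"
    using w.subsequence_exists by blast
  interpret l: vir_limit scale n D Z \<mu> N B \<eta> K C L Bs r
    by unfold_locales (use r in auto)
  show ?thesis by (rule l.limit_functional)
qed

text \<open>The second functional, recovered from \<open>f\<close> through \<open>d 1\<close>. For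
  the coordinate functional of V(a,b) it is (1 - b) f.\<close>

definition \<Theta> :: "(int \<Rightarrow> 'v \<Rightarrow> complex) \<Rightarrow> int \<Rightarrow> 'v \<Rightarrow> complex" where
  "\<Theta> f m u = (x m + 1) * f m u - f (m + 1) (d 1 u)"

text \<open>The degree 1 is missing in the last clause because there the identity is the definition
  of \<open>\<Theta>\<close>.\<close>

definition admissible :: "(int \<Rightarrow> 'v \<Rightarrow> complex) \<Rightarrow> bool" where
  "admissible f \<longleftrightarrow> (\<forall>m. \<forall>u\<in>wt m. \<forall>v\<in>wt m. f m (u + v) = f m u + f m v) \<and>
     (\<forall>m a. \<forall>u\<in>wt m. f m (a \<cdot> u) = a * f m u) \<and>
     (\<forall>m. \<forall>u\<in>wt m. \<forall>k\<in>{- 1, 2, - 2}. f (m + k) (d k u) = (x m + of_int k) * f m u - of_int k * \<Theta> f m u)"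

lemma admissible_add: "admissible f \<Longrightarrow> u \<in> wt m \<Longrightarrow> v \<in> wt m \<Longrightarrow> f m (u + v) = f m u + f m v"
  and admissible_scale: "admissible f \<Longrightarrow> u \<in> wt m \<Longrightarrow> f m (a \<cdot> u) = a * f m u"
  by (auto simp: admissible_def)

lemma admissible_d:
  assumes "admissible f" "u \<in> wt m" "k \<in> {1, - 1, 2, - 2}"
  shows "f (m + k) (d k u) = (x m + of_int k) * f m u - of_int k * \<Theta> f m u"
  using assms by (auto simp: admissible_def \<Theta>_def)

text \<open>Apply \<open>f\<close> to the brackets of d_(-1) with d_1, of d_(-1) with d_2, and of
  d_(-2) with d_1. The resulting linear equations express \<open>\<Theta> f\<close> at the other
  three images of \<open>u\<close> through its values at \<open>u\<close> and \<open>d 1 u\<close>;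
  this makes \<open>\<Theta> f\<close> admissible again.\<close>

lemma \<Theta>_eqs:
  assumes f: "admissible f" and u: "u \<in> wt m"
  shows "\<Theta> f (m - 1) (d (- 1) u) + \<Theta> f (m + 1) (d 1 u) = 2 * x m * \<Theta> f m u"
    and "\<Theta> f (m + 2) (d 2 u) + 2 * \<Theta> f (m - 1) (d (- 1) u) = 3 * x m * \<Theta> f m u"
    and "\<Theta> f (m - 2) (d (- 2) u) + 2 * \<Theta> f (m + 1) (d 1 u) = 3 * x m * \<Theta> f m u"
proof -
  note d = admissible_d[OF f]
  have mem: "d 1 u \<in> wt (m + 1)" "d (- 1) u \<in> wt (m - 1)" "d 2 u \<in> wt (m + 2)" "d (- 2) u \<in> wt (m - 2)"
    using wt_d[OF u, of 1] wt_d[OF u, of "- 1"] wt_d[OF u, of 2] wt_d[OF u, of "- 2"] by simp_all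
  have x: "x (m + 1) = x m + 1" "x (m - 1) = x m - 1" "x (m + 2) = x m + 2" "x (m - 2) = x m - 2" by (auto simp: x_def)
  have f1: "f (m + 1) (d 1 u) = (x m + 1) * f m u - \<Theta> f m u"
    and f_1: "f (m - 1) (d (- 1) u) = (x m - 1) * f m u + \<Theta> f m u"
    and f2: "f (m + 2) (d 2 u) = (x m + 2) * f m u - 2 * \<Theta> f m u"
    and f_2: "f (m - 2) (d (- 2) u) = (x m - 2) * f m u + 2 * \<Theta> f m u"
    using d[OF u, of 1] d[OF u, of "- 1"] d[OF u, of 2] d[OF u, of "- 2"] by simp_all
  have mem0: "d (- 1) (d 1 u) \<in> wt m" using wt_d[OF mem(1), of "- 1"] by simp
  have "d 1 (d (- 1) u) = d (- 1) (d 1 u) + (- 2 * x m) \<cdot> u"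
    using d_lower_raise[of u] d0_wt[OF u] by simp
  then have "f m (d 1 (d (- 1) u)) = f m (d (- 1) (d 1 u)) + (- 2 * x m) * f m u"
    using f u mem0 by (simp add: admissible_add admissible_scale W_scale W_neg del: mult_minus_left scale_minus_left)
  moreover have "f m (d 1 (d (- 1) u)) = x m * f (m - 1) (d (- 1) u) - \<Theta> f (m - 1) (d (- 1) u)"
    using d[OF mem(2), of 1] by (simp add: x)
  moreover have "f m (d (- 1) (d 1 u)) = x m * f (m + 1) (d 1 u) + \<Theta> f (m + 1) (d 1 u)"
    using d[OF mem(1), of "- 1"] by (simp add: x)
  ultimately show "\<Theta> f (m - 1) (d (- 1) u) + \<Theta> f (m + 1) (d 1 u) = 2 * x m * \<Theta> f m u"
    unfolding f1 f_1 by (simp add: algebra_simps)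
  have mem1: "d 2 (d (- 1) u) \<in> wt (m + 1)" using wt_d[OF mem(2), of 2] by (simp add: add.commute)
  have "d (- 1) (d 2 u) = d 2 (d (- 1) u) + 3 \<cdot> d 1 u" using D_D1[of "- 1" 2 u] by simp
  then have e: "f (m + 1) (d (- 1) (d 2 u)) = f (m + 1) (d 2 (d (- 1) u)) + 3 * f (m + 1) (d 1 u)"
    using f mem mem1 by (simp add: admissible_add admissible_scale W_scale)
  have t: "2 * \<Theta> f (m - 1) (d (- 1) u) = (x m + 1) * f (m - 1) (d (- 1) u) - f (m + 1) (d 2 (d (- 1) u))"
    using d[OF mem(2), of 2] by (simp add: x add.commute)
  have s: "\<Theta> f (m + 2) (d 2 u) = f (m + 1) (d (- 1) (d 2 u)) - (x m + 1) * f (m + 2) (d 2 u)"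
    using d[OF mem(3), of "- 1"] by (simp add: x add.commute)
  show "\<Theta> f (m + 2) (d 2 u) + 2 * \<Theta> f (m - 1) (d (- 1) u) = 3 * x m * \<Theta> f m u"
    unfolding s t e f1 f_1 f2 by (simp add: algebra_simps)
  have mem2: "d 1 (d (- 2) u) \<in> wt (m - 1)" using wt_d[OF mem(4), of 1] by simp
  have "d (- 2) (d 1 u) = d 1 (d (- 2) u) + 3 \<cdot> d (- 1) u" using D_D1[of "- 2" 1 u] by simp
  then have e: "f (m - 1) (d (- 2) (d 1 u)) = f (m - 1) (d 1 (d (- 2) u)) + 3 * f (m - 1) (d (- 1) u)"
    using f mem mem2 by (simp add: admissible_add admissible_scale W_scale)
  have t: "2 * \<Theta> f (m + 1) (d 1 u) = f (m - 1) (d (- 2) (d 1 u)) - (x m - 1) * f (m + 1) (d 1 u)"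
    using d[OF mem(1), of "- 2"] by (simp add: x)
  have s: "\<Theta> f (m - 2) (d (- 2) u) = (x m - 1) * f (m - 2) (d (- 2) u) - f (m - 1) (d 1 (d (- 2) u))"
    using d[OF mem(4), of 1] by (simp add: x)
  show "\<Theta> f (m - 2) (d (- 2) u) + 2 * \<Theta> f (m + 1) (d 1 u) = 3 * x m * \<Theta> f m u"
    unfolding s t e f1 f_1 f_2 by (simp add: algebra_simps)
qed

lemma admissible_\<Theta>: assumes f: "admissible f" shows "admissible (\<Theta> f)"
  unfolding admissible_def
proof (intro conjI allI ballI)
  show "\<Theta> f m (u + v) = \<Theta> f m u + \<Theta> f m v" if "u \<in> wt m" "v \<in> wt m" for m u v
    using f that wt_d[OF that(1), of 1] wt_d[OF that(2), of 1]
    by (simp add: \<Theta>_def D_add admissible_add algebra_simps)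
  show "\<Theta> f m (a \<cdot> u) = a * \<Theta> f m u" if "u \<in> wt m" for m a u
    using f that wt_d[OF that, of 1] by (simp add: \<Theta>_def D_scale admissible_scale algebra_simps)
  show "\<Theta> f (m + k) (d k u) = (x m + of_int k) * \<Theta> f m u - of_int k * \<Theta> (\<Theta> f) m u"
    if u: "u \<in> wt m" and k: "k \<in> {- 1, 2, - 2}" for m u k
  proof -
    have s: "\<Theta> f (m + 1) (d 1 u) = (x m + 1) * \<Theta> f m u - \<Theta> (\<Theta> f) m u" by (simp add: \<Theta>_def[of "\<Theta> f"])
    have e1: "\<Theta> f (m - 1) (d (- 1) u) = (x m - 1) * \<Theta> f m u + \<Theta> (\<Theta> f) m u"
      using \<Theta>_eqs(1)[OF f u] unfolding s by (simp add: algebra_simps)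
    have e2: "\<Theta> f (m + 2) (d 2 u) = (x m + 2) * \<Theta> f m u - 2 * \<Theta> (\<Theta> f) m u"
      using \<Theta>_eqs(2)[OF f u] unfolding e1 by (simp add: algebra_simps)
    have e3: "\<Theta> f (m - 2) (d (- 2) u) = (x m - 2) * \<Theta> f m u + 2 * \<Theta> (\<Theta> f) m u"
      using \<Theta>_eqs(3)[OF f u] unfolding s by (simp add: algebra_simps)
    show ?thesis using k e1 e2 e3 by auto
  qed
qed

text \<open>Mirrors the Casimir eigenvalue of V(a,b): b (1 - b) = (1 - b) - (1 - b)^2.\<close>

lemma admissible_Cas:
  assumes f: "admissible f" and u: "u \<in> wt m"
  shows "f m (Cas u) = \<Theta> f m u - \<Theta> (\<Theta> f) m u"
proof -
  have mem: "d (- 1) u \<in> wt (m - 1)" using wt_d[OF u, of "- 1"] by simp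
  have mem1: "d 1 (d (- 1) u) \<in> wt m" using wt_d[OF mem, of 1] by simp
  have "Cas u = d 1 (d (- 1) u) + (x m - (x m)\<^sup>2) \<cdot> u"
    using raise_lower[OF u] by (simp add: algebra_simps scale_left_diff_distrib)
  then have "f m (Cas u) = f m (d 1 (d (- 1) u)) + (x m - (x m)\<^sup>2) * f m u"
    using f u mem1 by (simp add: admissible_add admissible_scale W_scale)
  moreover have "f m (d 1 (d (- 1) u)) = x m * f (m - 1) (d (- 1) u) - \<Theta> f (m - 1) (d (- 1) u)"
    using admissible_d[OF f mem, of 1] by (simp add: x_def)
  moreover have "f (m - 1) (d (- 1) u) = (x m - 1) * f m u + \<Theta> f m u"
    "\<Theta> f (m - 1) (d (- 1) u) = (x m - 1) * \<Theta> f m u + \<Theta> (\<Theta> f) m u"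
    using admissible_d[OF f u, of "- 1"] admissible_d[OF admissible_\<Theta>[OF f] u, of "- 1"] by simp_all
  ultimately show ?thesis by (simp add: power2_eq_square algebra_simps)
qed

lemma admissible_comb:
  assumes f: "admissible f" and g: "admissible g"
  shows "admissible (\<lambda>m u. f m u + a * g m u)" "\<Theta> (\<lambda>m u. f m u + a * g m u) m u = \<Theta> f m u + a * \<Theta> g m u"
proof -
  show T: "\<Theta> (\<lambda>m u. f m u + a * g m u) m u = \<Theta> f m u + a * \<Theta> g m u" for m u
    by (simp add: \<Theta>_def algebra_simps)
  have 2: "h (m + k) (d k u) = (x m + of_int k) * h m u - of_int k * \<Theta> h m u"
    if "admissible h" "u \<in> wt m" "k \<in> {- 1, 2, - 2}" for h m u k
    using that unfolding admissible_def by blast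
  show "admissible (\<lambda>m u. f m u + a * g m u)"
    unfolding admissible_def
  proof (intro conjI allI ballI)
    show "f (m + k) (d k u) + a * g (m + k) (d k u) = (x m + of_int k) * (f m u + a * g m u) -
        of_int k * \<Theta> (\<lambda>m u. f m u + a * g m u) m u" if "u \<in> wt m" "k \<in> {- 1, 2, - 2}" for m u k
      unfolding T 2[OF f that] 2[OF g that] by (simp add: algebra_simps)
  qed (simp_all add: admissible_add[OF f] admissible_add[OF g] admissible_scale[OF f] admissible_scale[OF g] algebra_simps)
qed

lemma subspace_admissible_kernel:
  assumes "\<And>i. admissible (h i)"
  shows "subspace {u \<in> wt m. \<forall>i. h i m u = 0}"
proof (rule subspaceI)
  show "0 \<in> {u \<in> wt m. \<forall>i. h i m u = 0}"
    using admissible_scale[OF assms W_zero, of _ m 0] W_zero by simp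
qed (use assms in \<open>auto simp: admissible_add admissible_scale W_add W_scale\<close>)

text \<open>The Casimir element acts on functionals of this kind as a quadratic polynomial in \<open>\<Theta>\<close>,
  so an eigenvector of it yields an eigenvector of \<open>\<Theta>\<close>.\<close>

lemma eigenfunctional_exists:
  "\<exists>F \<rho>. admissible F \<and> (\<forall>m. \<forall>u\<in>wt m. \<Theta> F m u = \<rho> * F m u) \<and> (\<exists>m u. u \<in> wt m \<and> F m u \<noteq> 0)"
proof -
  obtain f p where fp: "\<And>m u v. u \<in> wt m \<Longrightarrow> v \<in> wt m \<Longrightarrow> f m (u + v) = f m u + f m v"
     "\<And>m a u. u \<in> wt m \<Longrightarrow> f m (a \<cdot> u) = a * f m u"
     "\<And>m u k. u \<in> wt m \<Longrightarrow> k \<in> {1, - 1, 2, - 2} \<Longrightarrow> f (m + k) (d k u) = (x m + of_int k) * f m u - of_int k * p m u"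
     and nz: "\<exists>m u. u \<in> wt m \<and> f m u \<noteq> 0"
    using functional_exists by blast
  have "\<Theta> f m u = p m u" if "u \<in> wt m" for m u
    using fp(3)[OF that, of 1] by (simp add: \<Theta>_def)
  then have f: "admissible f" using fp by (auto simp: admissible_def)
  obtain m0 v0 where v0: "v0 \<in> wt m0" "f m0 v0 \<noteq> 0" using nz by blast
  have v00: "v0 \<noteq> 0" using fp(2)[OF W_zero, of m0 0] v0(2) by auto
  obtain S where S: "finite S" "wt m0 \<subseteq> span S" using weight_fin by blast
  have "Cas ` wt m0 \<subseteq> wt m0" using W_Cas by blast
  then obtain u0 \<kappa> where u0: "u0 \<in> wt m0" "u0 \<noteq> 0" "Cas u0 = \<kappa> \<cdot> u0"
    using eigenvector_exists[OF Cas_endo S(1) subspace_W S(2) _ v0(1) v00] by blast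
  define fn where "fn i = (\<Theta> ^^ i) f" for i
  have fn: "admissible (fn i)" for i unfolding fn_def by (induction i) (simp_all add: f admissible_\<Theta>)
  have fnS: "\<Theta> (fn i) = fn (Suc i)" for i by (simp add: fn_def)
  \<comment> \<open>The operator \<open>\<Theta>^2 - \<Theta> + \<kappa>\<close> applied to
    \<open>\<Theta>^i f\<close>. The whole sequence is taken since the value of \<open>h i\<close>
    at \<open>d k v\<close> involves \<open>h (Suc i)\<close> at \<open>v\<close>, so only the
    common kernel is a submodule.\<close>
  define h where "h i m u = fn (Suc (Suc i)) m u + - 1 * (fn (Suc i) m u + - \<kappa> * fn i m u)" for i m u
  have h: "admissible (h i)" for i
    unfolding h_def[abs_def] by (rule admissible_comb(1)[OF fn admissible_comb(1)[OF fn fn]])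
  have h\<Theta>: "\<Theta> (h i) m u = h (Suc i) m u" for i m u
  proof -
    have "\<Theta> (h i) m u = \<Theta> (fn (Suc (Suc i))) m u + - 1 * \<Theta> (\<lambda>m u. fn (Suc i) m u + - \<kappa> * fn i m u) m u"
      unfolding h_def[abs_def] by (rule admissible_comb(2)[OF fn admissible_comb(1)[OF fn fn]])
    also have "\<Theta> (\<lambda>m u. fn (Suc i) m u + - \<kappa> * fn i m u) m u = \<Theta> (fn (Suc i)) m u + - \<kappa> * \<Theta> (fn i) m u"
      by (rule admissible_comb(2)[OF fn fn])
    finally show ?thesis unfolding fnS h_def .
  qed
  have "{u \<in> wt k. \<forall>i. h i k u = 0} = wt k" for k
  proof (rule generated_irreducible[of _ u0 m0])
    show "subspace {u \<in> wt m. \<forall>i. h i m u = 0}" for m by (rule subspace_admissible_kernel[OF h])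
    show "d k v \<in> {u \<in> wt (m + k). \<forall>i. h i (m + k) u = 0}"
      if "v \<in> {u \<in> wt m. \<forall>i. h i m u = 0}" "k \<in> {1, - 1, 2, - 2}" for m k v
      using that wt_d[of v m k] admissible_d[OF h, of v m k] h\<Theta> by simp
    have "h i m0 u0 = 0" for i
    proof -
      have "\<kappa> * fn i m0 u0 = fn (Suc i) m0 u0 - fn (Suc (Suc i)) m0 u0"
        using admissible_Cas[OF fn[of i] u0(1)] u0(3) admissible_scale[OF fn u0(1)] by (simp add: fnS)
      then show ?thesis by (simp add: h_def)
    qed
    then show "u0 \<in> {u \<in> wt m0. \<forall>i. h i m0 u = 0}" using u0 by simp
  qed (use u0 in auto)
  then have h0: "h 0 m u = 0" if "u \<in> wt m" for m u using that by blast
  \<comment> \<open>\<open>\<rho>\<close> and \<open>\<rho>'\<close> are the roots of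
    \<open>t^2 - t + \<kappa>\<close>.\<close>
  define s where "s = csqrt (1 - 4 * \<kappa>)"
  define \<rho> \<rho>' where "\<rho> = (1 + s) / 2" and "\<rho>' = (1 - s) / 2"
  have "s * s = 1 - 4 * \<kappa>" using power2_csqrt[of "1 - 4 * \<kappa>"] by (simp add: s_def power2_eq_square)
  then have \<rho>: "\<rho> + \<rho>' = 1" "\<rho> * \<rho>' = \<kappa>" by (simp_all add: \<rho>_def \<rho>'_def field_simps)
  define G where "G m u = \<Theta> f m u + - \<rho>' * f m u" for m u
  have G: "admissible G" unfolding G_def[abs_def] by (rule admissible_comb(1)[OF admissible_\<Theta>[OF f] f])
  show ?thesis
  \<comment> \<open>Either \<open>(\<Theta> - \<rho>') f\<close> is a nonzero eigenvector for
    \<open>\<rho>\<close>, or \<open>f\<close> itself is an eigenvector for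
    \<open>\<rho>'\<close>.\<close>
  proof (cases "\<exists>m u. u \<in> wt m \<and> G m u \<noteq> 0")
    case True
    have "\<Theta> G m u = \<rho> * G m u" if "u \<in> wt m" for m u
    proof -
      have "\<Theta> G m u = \<Theta> (\<Theta> f) m u + - \<rho>' * \<Theta> f m u"
        unfolding G_def[abs_def] by (rule admissible_comb(2)[OF admissible_\<Theta>[OF f] f])
      moreover have "\<Theta> (\<Theta> f) m u = (\<rho> + \<rho>') * \<Theta> f m u - \<rho> * \<rho>' * f m u"
        using h0[OF that] \<rho> by (simp add: h_def fn_def algebra_simps)
      ultimately show ?thesis by (simp add: G_def algebra_simps)
    qed
    then show ?thesis using G True by blast
  next
    case False
    then have "\<Theta> f m u = \<rho>' * f m u" if "u \<in> wt m" for m u using that by (force simp: G_def)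
    then show ?thesis using f nz by blast
  qed
qed

text \<open>With b = 1 - \<rho> the four generators act as in V(a,b), and brackets extend this to
  all degrees. The zeros of \<open>F\<close> form a graded submodule other than the whole module, so
  \<open>F\<close> is injective; the central element acts by 0 because the operators of V(a,b)
  satisfy the bracket of \<open>d 2\<close> and \<open>d (- 2)\<close> without it.\<close>

lemma embedding:
  "\<exists>F b. admissible F \<and> (\<forall>m k. \<forall>u\<in>wt m. F (m + k) (d k u) = (x m + of_int k * b) * F m u) \<and>
     (\<forall>m. \<forall>u\<in>wt m. F m u = 0 \<longrightarrow> u = 0) \<and> (\<forall>m. \<forall>u\<in>wt m. Z 0 u = 0)"
proof -
  obtain F \<rho> m0 u0 where F: "admissible F" and ev: "\<And>m u. u \<in> wt m \<Longrightarrow> \<Theta> F m u = \<rho> * F m u"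
    and nz: "u0 \<in> wt m0" "F m0 u0 \<noteq> 0" using eigenfunctional_exists by blast
  define b where "b = 1 - \<rho>"
  have inj: "u = 0" if u: "u \<in> wt m" "F m u = 0" for m u
  proof (rule ccontr)
    assume "u \<noteq> 0"
    have "{u \<in> wt k. \<forall>i::nat. F k u = 0} = wt k" for k
    proof (rule generated_irreducible[of _ u m])
      show "subspace {u \<in> wt m. \<forall>i::nat. F m u = 0}" for m
        by (rule subspace_admissible_kernel[of "\<lambda>i. F"]) (rule F)
      show "d k v \<in> {u \<in> wt (m + k). \<forall>i::nat. F (m + k) u = 0}"
        if "v \<in> {u \<in> wt m. \<forall>i::nat. F m u = 0}" "k \<in> {1, - 1, 2, - 2}" for m k v
        using that wt_d[of v m k] admissible_d[OF F, of v m k] ev by simp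
    qed (use u \<open>u \<noteq> 0\<close> in auto)
    then show False using nz by blast
  qed
  have *: "i \<in> {k. \<forall>m. \<forall>u\<in>wt m. F (m + k) (d k u) = (x m + of_int k * b) * F m u}" for i
  proof (rule generated_index)
    have "F (m + k) (d k u) = (x m + of_int k * b) * F m u" if "u \<in> wt m" "k \<in> {1, - 1, 2, - 2}" for m u k
      using admissible_d[OF F that] ev[OF that(1)] by (simp add: b_def algebra_simps)
    then show "1 \<in> {k. \<forall>m. \<forall>u\<in>wt m. F (m + k) (d k u) = (x m + of_int k * b) * F m u}"
      "- 1 \<in> {k. \<forall>m. \<forall>u\<in>wt m. F (m + k) (d k u) = (x m + of_int k * b) * F m u}"
      "2 \<in> {k. \<forall>m. \<forall>u\<in>wt m. F (m + k) (d k u) = (x m + of_int k * b) * F m u}"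
      "- 2 \<in> {k. \<forall>m. \<forall>u\<in>wt m. F (m + k) (d k u) = (x m + of_int k * b) * F m u}" by blast+
    show "0 \<in> {k. \<forall>m. \<forall>u\<in>wt m. F (m + k) (d k u) = (x m + of_int k * b) * F m u}"
      using d0_wt admissible_scale[OF F] by simp
    fix i k
    assume i: "i \<in> {k. \<forall>m. \<forall>u\<in>wt m. F (m + k) (d k u) = (x m + of_int k * b) * F m u}"
      and k: "k \<in> {k. \<forall>m. \<forall>u\<in>wt m. F (m + k) (d k u) = (x m + of_int k * b) * F m u}"
      and ne: "i \<noteq> k" "i \<noteq> - k"
    have "F (m + (i + k)) (d (i + k) u) = (x m + of_int (i + k) * b) * F m u" if u: "u \<in> wt m" for m u
    proof -
      have mem: "d k (d i u) \<in> wt (m + (i + k))" "d (i + k) u \<in> wt (m + (i + k))"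
        using wt_d[OF wt_d[OF u, of i], of k] wt_d[OF u, of "i + k"] by (simp_all add: add_ac)
      have "F (m + (i + k)) (d i (d k u)) = F (m + (i + k)) (d k (d i u)) + of_int (k - i) * F (m + (i + k)) (d (i + k) u)"
        unfolding D_D1[OF ne(2)] using mem F by (simp add: admissible_add admissible_scale W_scale)
      moreover have "F (m + (i + k)) (d i (d k u)) = (x m + of_int k + of_int i * b) * ((x m + of_int k * b) * F m u)"
      proof -
        have "F (m + k + i) (d i (d k u)) = (x (m + k) + of_int i * b) * F (m + k) (d k u)"
          using i wt_d[OF u, of k] by blast
        moreover have "F (m + k) (d k u) = (x m + of_int k * b) * F m u" using k u by blast
        moreover have "m + k + i = m + (i + k)" by simp
        ultimately show ?thesis by (simp only: x_add)
      qed
      moreover have "F (m + (i + k)) (d k (d i u)) = (x m + of_int i + of_int k * b) * ((x m + of_int i * b) * F m u)"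
      proof -
        have "F (m + i + k) (d k (d i u)) = (x (m + i) + of_int k * b) * F (m + i) (d i u)"
          using k wt_d[OF u, of i] by blast
        moreover have "F (m + i) (d i u) = (x m + of_int i * b) * F m u" using i u by blast
        moreover have "m + i + k = m + (i + k)" by simp
        ultimately show ?thesis by (simp only: x_add)
      qed
      ultimately have "of_int (k - i) * F (m + (i + k)) (d (i + k) u) = of_int (k - i) * ((x m + of_int (i + k) * b) * F m u)"
        by (simp add: algebra_simps)
      then show ?thesis using ne(1) by (simp only: mult_cancel_left of_int_eq_0_iff) simp
    qed
    then show "i + k \<in> {k. \<forall>m. \<forall>u\<in>wt m. F (m + k) (d k u) = (x m + of_int k * b) * F m u}" by blast
  qed
  then have Fd: "F (m + k) (d k u) = (x m + of_int k * b) * F m u" if "u \<in> wt m" for m k u using that by blast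
  have "Z 0 u = 0" if u: "u \<in> wt m" for m u
  proof (rule inj)
    show Zu: "Z 0 u \<in> wt m" using u by (rule W_Z)
    have mem: "d (- 2) (d 2 u) \<in> wt m" "d 0 u \<in> wt m"
      using wt_d[OF wt_d[OF u, of 2], of "- 2"] wt_d[OF u, of 0] by simp_all
    have "d 2 (d (- 2) u) = d (- 2) (d 2 u) + ((- 4) \<cdot> d 0 u + (1 / 2) \<cdot> Z 0 u)"
      using D_D[of 2 0 "- 2" 0 u] by simp
    moreover have "(- 4) \<cdot> d 0 u + (1 / 2) \<cdot> Z 0 u \<in> wt m" using mem Zu by (intro W_add W_scale)
    ultimately have "F m (d 2 (d (- 2) u)) = F m (d (- 2) (d 2 u)) + ((- 4) * F m (d 0 u) + (1 / 2) * F m (Z 0 u))"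
      using mem Zu F by (simp only: admissible_add admissible_scale W_scale)
    moreover have "F m (d 2 (d (- 2) u)) = (x m - 2 + 2 * b) * ((x m - 2 * b) * F m u)"
      using Fd[OF wt_d[OF u, of "- 2"], of 2] Fd[OF u, of "- 2"] x_add[of m "- 2"] by simp
    moreover have "F m (d (- 2) (d 2 u)) = (x m + 2 - 2 * b) * ((x m + 2 * b) * F m u)"
      using Fd[OF wt_d[OF u, of 2], of "- 2"] Fd[OF u, of 2] x_add[of m 2] by simp
    moreover have "F m (d 0 u) = x m * F m u" using Fd[OF u, of 0] by simp
    ultimately show "F m (Z 0 u) = 0" by (simp add: algebra_simps)
  qed
  then show ?thesis using F Fd inj by blast
qed

text \<open>\<open>S\<close> collects the degrees with a nonzero weight space. A missing degree m0
  forces the coefficients \<open>x m + (m0 - m) b\<close> leading into it to vanish; two degrees m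
  in \<open>S\<close> then determine b = 1 and m0 = - \<mu>, so at most one degree is
  missing.\<close>

lemma intermediate_series:
  "\<exists>b e S. (\<forall>m\<in>S. e m \<in> wt m \<and> e m \<noteq> 0) \<and> (\<forall>m. m \<notin> S \<longrightarrow> wt m = {0}) \<and>
     (\<forall>m\<in>S. \<forall>u\<in>wt m. \<exists>a. u = a \<cdot> e m) \<and>
     (\<forall>m\<in>S. \<forall>k. d k (e m) = (if m + k \<in> S then (x m + of_int k * b) \<cdot> e (m + k) else 0)) \<and>
     (\<forall>v. Z 0 v = 0) \<and> (S = UNIV \<or> (\<exists>m0. S = - {m0} \<and> b = 1 \<and> \<mu> = - of_int m0))"
proof -
  from embedding obtain F b where E: "admissible F \<and> (\<forall>m k. \<forall>u\<in>wt m. F (m + k) (d k u) = (x m + of_int k * b) * F m u) \<and>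
     (\<forall>m. \<forall>u\<in>wt m. F m u = 0 \<longrightarrow> u = 0) \<and> (\<forall>m. \<forall>u\<in>wt m. Z 0 u = 0)"
    by (elim exE) (rule that)
  then have F: "admissible F" and Fd: "\<And>m k u. u \<in> wt m \<Longrightarrow> F (m + k) (d k u) = (x m + of_int k * b) * F m u"
    and inj: "\<And>m u. u \<in> wt m \<Longrightarrow> F m u = 0 \<Longrightarrow> u = 0" and Z0: "\<And>m u. u \<in> wt m \<Longrightarrow> Z 0 u = 0"
    by simp_all
  define S where "S = {m. \<exists>u\<in>wt m. u \<noteq> 0}"
  have "\<exists>u\<in>wt m. F m u = 1" if m: "m \<in> S" for m
  proof -
    obtain u where u: "u \<in> wt m" "u \<noteq> 0" using m by (auto simp: S_def)
    then have "F m u \<noteq> 0" using inj by blast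
    then show ?thesis using u admissible_scale[OF F u(1), of "1 / F m u"]
      by (intro bexI[of _ "(1 / F m u) \<cdot> u"]) (auto simp: W_scale)
  qed
  then obtain e where e: "\<And>m. m \<in> S \<Longrightarrow> e m \<in> wt m" "\<And>m. m \<in> S \<Longrightarrow> F m (e m) = 1" by metis
  have F0: "F m 0 = 0" for m using admissible_scale[OF F W_zero, of m 0] by simp
  have ue: "u = F m u \<cdot> e m" if "m \<in> S" "u \<in> wt m" for m u
  proof -
    have "F m (u + (- F m u) \<cdot> e m) = 0"
      using that e[OF that(1)] F by (simp add: admissible_add admissible_scale W_scale del: scale_minus_left)
    then have "u + (- F m u) \<cdot> e m = 0"
      using that e[OF that(1)] by (intro inj[of _ m] W_add W_scale)
    then show ?thesis by simp
  qed
  have nS: "wt m = {0}" if "m \<notin> S" for m using that W_zero by (auto simp: S_def)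
  have de: "d k (e m) = (if m + k \<in> S then (x m + of_int k * b) \<cdot> e (m + k) else 0)" if "m \<in> S" for m k
  proof (cases "m + k \<in> S")
    case True
    show ?thesis using ue[OF True wt_d[OF e(1)[OF that], of k]] Fd[OF e(1)[OF that], of k] e(2)[OF that] True by simp
  next
    case False
    then show ?thesis using wt_d[OF e(1)[OF that], of k] nS by simp
  qed
  have coef: "x m + of_int k * b = 0" if "m \<in> S" "m + k \<notin> S" for m k
    using Fd[OF e(1)[OF that(1)], of k] e(2)[OF that(1)] de[OF that(1), of k] that(2) F0 by simp
  \<comment> \<open>A module living in one degree would be annihilated by all \<open>d k\<close>
    with \<open>k \<ge> 1\<close>, against \<open>nk\<close>.\<close>
  have "\<exists>m\<in>S. m \<noteq> m1" if "m1 \<in> S" for m1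
  proof (rule ccontr)
    assume "\<not> ?thesis"
    then have "m1 + k \<notin> S" if "k \<ge> 1" for k using that by force
    then have "d k (e m1) = 0" if "k \<ge> 1" for k using de[OF \<open>m1 \<in> S\<close>, of k] that by simp
    then have "e m1 = 0" using nk by blast
    then show False using e(2)[OF that] F0 by simp
  qed
  moreover have "S \<noteq> {}"
  proof
    assume "S = {}"
    then have "(\<Union>m. W (\<mu> + of_int m)) \<subseteq> {0}" using nS by (auto simp: x_def)
    then have "span (\<Union>m. W (\<mu> + of_int m)) \<subseteq> {0}" by (rule span_minimal) simp
    then show False using coset nontrivial by auto
  qed
  ultimately obtain m1 m2 where m12: "m1 \<in> S" "m2 \<in> S" "m1 \<noteq> m2" by blast
  have miss: "b = 1 \<and> \<mu> = - of_int m0" if "m0 \<notin> S" for m0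
  proof -
    have 1: "x m1 + of_int (m0 - m1) * b = 0" "x m2 + of_int (m0 - m2) * b = 0"
      using coef[OF m12(1), of "m0 - m1"] coef[OF m12(2), of "m0 - m2"] that by auto
    moreover have "of_int (m1 - m2) * (1 - b) = (x m1 + of_int (m0 - m1) * b) - (x m2 + of_int (m0 - m2) * b)"
      by (simp add: x_def algebra_simps)
    ultimately have "of_int (m1 - m2) * (1 - b) = 0" by simp
    then have "b = 1" using m12(3) by simp
    then show ?thesis using 1(1) by (simp add: x_def eq_neg_iff_add_eq_0)
  qed
  have "S = UNIV \<or> (\<exists>m0. S = - {m0} \<and> b = 1 \<and> \<mu> = - of_int m0)"
  proof (cases "S = UNIV")
    case False
    then obtain m0 where m0: "m0 \<notin> S" by blast
    have "m = m0" if "m \<notin> S" for m using miss[OF that] miss[OF m0] by simp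
    then have "S = - {m0}" using m0 by blast
    then show ?thesis using miss[OF m0] by blast
  qed simp
  moreover have "Z 0 v = 0" for v
  proof -
    have "span (\<Union>m. W (\<mu> + of_int m)) \<subseteq> {v. Z 0 v = 0}"
      using Z0 by (intro span_minimal) (auto simp: subspace_def x_def Z_zero Z_add Z_scale)
    then show ?thesis using coset by blast
  qed
  moreover have "e m \<noteq> 0" if "m \<in> S" for m using e(2)[OF that] F0 by auto
  ultimately show ?thesis
  proof (intro exI[of _ b] exI[of _ e] exI[of _ S] conjI)
    show "\<forall>m\<in>S. \<forall>u\<in>wt m. \<exists>a. u = a \<cdot> e m" using ue by blast
    show "\<forall>m\<in>S. \<forall>k. d k (e m) = (if m + k \<in> S then (x m + of_int k * b) \<cdot> e (m + k) else 0)" using de by blast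
  qed (use e(1) nS in auto)
qed

end

context tvir_irr
begin

text \<open>In the third alternative the missing degree, if there is one, is that of weight 0, which
  is how the exceptional V'(0,0) arises.\<close>

theorem classification:
  "(\<exists>v m. v \<noteq> 0 \<and> (\<forall>i\<ge>m. \<forall>j. D i j v = 0)) \<or> (\<exists>v m. v \<noteq> 0 \<and> (\<forall>i\<le>m. \<forall>j. D i j v = 0)) \<or>
   (\<exists>\<mu> b e S. span (\<Union>m::int. W (\<mu> + of_int m)) = UNIV \<and> (\<forall>m\<in>S. e m \<in> W (\<mu> + of_int m) \<and> e m \<noteq> 0) \<and>
     (\<forall>m. m \<notin> S \<longrightarrow> W (\<mu> + of_int m) = {0}) \<and> (\<forall>m\<in>S. \<forall>u\<in>W (\<mu> + of_int m). \<exists>a. u = a \<cdot> e m) \<and>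
     (\<forall>m\<in>S. \<forall>k. D k 0 (e m) = (if m + k \<in> S then (\<mu> + of_int m + of_int k * b) \<cdot> e (m + k) else 0)) \<and>
     (\<forall>i j v. j \<ge> 1 \<longrightarrow> D i j v = 0) \<and> (\<forall>j v. Z j v = 0) \<and>
     (S = UNIV \<or> (\<exists>m0. S = - {m0} \<and> b = 1 \<and> \<mu> = - of_int m0)))"
proof (cases "(\<exists>v m. v \<noteq> 0 \<and> (\<forall>i\<ge>m. \<forall>j. D i j v = 0)) \<or> (\<exists>v m. v \<noteq> 0 \<and> (\<forall>i\<le>m. \<forall>j. D i j v = 0))")
  case False
  then have nk: "v = 0" if "\<forall>i\<ge>m. \<forall>j. D i j v = 0" for v m using that by blast
  have nk': "v = 0" if "\<forall>i\<le>m. \<forall>j. D i j v = 0" for v m using False that by blast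
  obtain \<mu> where \<mu>: "Re \<mu> \<ge> 1" "span (\<Union>m. W (\<mu> + of_int m)) = UNIV" using coset_exists by blast
  obtain N where N: "\<And>k::int. dim_le (W (\<mu> + of_int k)) N"
    using dim_bound[of \<mu>] nk nk' unfolding killed_def by blast
  have t0: "D i j v = 0 \<and> Z j v = 0" if "j \<ge> 1" for i j v
    using t_part_zero[OF \<mu>(2) N that] .
  interpret c: vir_cuspidal scale n D Z \<mu> N
  proof
    show "v = 0" if "\<forall>i\<ge>m. d i v = 0" for v m
    proof (rule nk)
      show "\<forall>i\<ge>m. \<forall>j. D i j v = 0"
      proof (intro allI impI)
        fix i j assume "m \<le> i"
        then show "D i j v = 0" using that t0[of j i v] by (cases "j = 0") auto
      qed
    qed
  qed (use \<mu> N t0 in auto)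
  from c.intermediate_series obtain b e S where *: "(\<forall>m\<in>S. e m \<in> W (c.x m) \<and> e m \<noteq> 0) \<and> (\<forall>m. m \<notin> S \<longrightarrow> W (c.x m) = {0}) \<and>
     (\<forall>m\<in>S. \<forall>u\<in>W (c.x m). \<exists>a. u = a \<cdot> e m) \<and>
     (\<forall>m\<in>S. \<forall>k. d k (e m) = (if m + k \<in> S then (c.x m + of_int k * b) \<cdot> e (m + k) else 0)) \<and>
     (\<forall>v. Z 0 v = 0) \<and> (S = UNIV \<or> (\<exists>m0. S = - {m0} \<and> b = 1 \<and> \<mu> = - of_int m0))"
    by (elim exE) (rule that)
  have "Z j v = 0" for j v using * t0[of j 0 v] by (cases "j = 0") auto
  then have "span (\<Union>m::int. W (\<mu> + of_int m)) = UNIV \<and> (\<forall>m\<in>S. e m \<in> W (\<mu> + of_int m) \<and> e m \<noteq> 0) \<and>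
     (\<forall>m. m \<notin> S \<longrightarrow> W (\<mu> + of_int m) = {0}) \<and> (\<forall>m\<in>S. \<forall>u\<in>W (\<mu> + of_int m). \<exists>a. u = a \<cdot> e m) \<and>
     (\<forall>m\<in>S. \<forall>k. D k 0 (e m) = (if m + k \<in> S then (\<mu> + of_int m + of_int k * b) \<cdot> e (m + k) else 0)) \<and>
     (\<forall>i j v. j \<ge> 1 \<longrightarrow> D i j v = 0) \<and> (\<forall>j v. Z j v = 0) \<and>
     (S = UNIV \<or> (\<exists>m0. S = - {m0} \<and> b = 1 \<and> \<mu> = - of_int m0))"
    using * \<mu>(2) t0 unfolding c.x_def by simp
  then show ?thesis by (intro disjI2 exI[of _ \<mu>] exI[of _ b] exI[of _ e] exI[of _ S])
qed blast

end

section \<open>The intermediate series\<close>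

abbreviation "lookup \<equiv> Poly_Mapping.lookup"
abbreviation "keys \<equiv> Poly_Mapping.keys"

lemma lookup_map_zero: "f 0 = 0 \<Longrightarrow> lookup (Poly_Mapping.map f p) k = f (lookup p k)"
  by (simp add: Poly_Mapping.map.rep_eq when_def)

lemma lookup_fscale: "lookup (fscale a p) k = a * lookup p k"
  by (simp add: fscale_def lookup_map_zero)

lemma lookup_vp_scale: "lookup (vp_scale a x) b = smult a (lookup x b)"
  by (simp add: vp_scale_def lookup_map_zero)

lemma lookup_vtensor: "lookup (vtensor x f) b = smult (lookup x b) f"
  by (simp add: vtensor_def lookup_map_zero)

lemma lookup_vp_trunc: "lookup (vp_trunc n x) b = lookup x b mod monom 1 n"
  by (simp add: vp_trunc_def lookup_map_zero)

lemma fscale_vector_space: "complex_vector_space (fscale :: complex \<Rightarrow> ('k \<Rightarrow>\<^sub>0 complex) \<Rightarrow> _)"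
  by unfold_locales (rule poly_mapping_eqI; simp add: lookup_fscale lookup_add algebra_simps)+

lemma fscale_single: "fscale a (Poly_Mapping.single k c) = Poly_Mapping.single k (a * c)"
  by (rule poly_mapping_eqI) (simp add: lookup_fscale lookup_single when_def)

context complex_vector_space
begin

definition lext :: "('k \<Rightarrow> 'v) \<Rightarrow> ('k \<Rightarrow>\<^sub>0 complex) \<Rightarrow> 'v" where
  "lext F p = (\<Sum>k\<in>keys p. lookup p k \<cdot> F k)"

lemma lext_superset:
  "finite A \<Longrightarrow> keys p \<subseteq> A \<Longrightarrow> lext F p = (\<Sum>k\<in>A. lookup p k \<cdot> F k)"
  unfolding lext_def by (rule sum.mono_neutral_left) (auto simp: in_keys_iff)

lemma lext_add: "lext F (p + q) = lext F p + lext F q"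
proof -
  let ?A = "keys p \<union> keys q"
  have "lext F (p + q) = (\<Sum>k\<in>?A. lookup (p + q) k \<cdot> F k)"
    by (rule lext_superset) (simp_all add: keys_add)
  also have "\<dots> = lext F p + lext F q"
    by (simp add: lookup_add scale_left_distrib sum.distrib lext_superset[of ?A])
  finally show ?thesis .
qed

lemma lext_fscale: "lext F (fscale a p) = a \<cdot> lext F p"
proof -
  have "lext F (fscale a p) = (\<Sum>k\<in>keys p. lookup (fscale a p) k \<cdot> F k)"
    by (rule lext_superset) (auto simp: in_keys_iff lookup_fscale)
  then show ?thesis by (simp add: lookup_fscale lext_def scale_sum_right)
qed

lemma lext_zero: "lext F 0 = 0"
  by (simp add: lext_def)

lemma lext_single: "lext F (Poly_Mapping.single k c) = c \<cdot> F k"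
  by (cases "c = 0") (simp_all add: lext_def)

lemma lext_diff: "lext F (p - q) = lext F p - lext F q"
  using lext_add[of F "p - q" q] by simp

lemma lext_sum: "lext F (sum f A) = (\<Sum>i\<in>A. lext F (f i))"
  by (induction A rule: infinite_finite_induct) (simp_all add: lext_zero lext_add)

end

lemma sum_singles: "(p :: 'k \<Rightarrow>\<^sub>0 'a::comm_monoid_add) = (\<Sum>k\<in>keys p. Poly_Mapping.single k (lookup p k))"
  by (rule poly_mapping_eqI) (simp add: lookup_sum lookup_single when_def in_keys_iff)

definition el :: "vir_basis \<Rightarrow> nat \<Rightarrow> vir_poly" where
  "el b j = Poly_Mapping.single b (monom 1 j)"

lemma vp_bracket_single:
  "vp_bracket (Poly_Mapping.single i p) (Poly_Mapping.single k q) = vtensor (vir_basis_bracket i k) (p * q)"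
proof (cases "p = 0 \<or> q = 0")
  case True
  have "vtensor x 0 = 0" for x by (rule poly_mapping_eqI) (simp add: lookup_vtensor)
  then show ?thesis using True by (auto simp: vp_bracket_def)
qed (simp add: vp_bracket_def)

lemma vtensor_add: "vtensor (x + y) f = vtensor x f + vtensor y f"
  by (rule poly_mapping_eqI) (simp add: lookup_vtensor lookup_add smult_add_left)

lemma vtensor_single: "vtensor (Poly_Mapping.single b a) f = Poly_Mapping.single b (smult a f)"
  by (rule poly_mapping_eqI) (simp add: lookup_vtensor lookup_single when_def)

lemma vtensor_zero: "vtensor 0 f = 0"
  by (rule poly_mapping_eqI) (simp add: lookup_vtensor)

lemma vp_trunc_add: "vp_trunc n (x + y) = vp_trunc n x + vp_trunc n y"
  by (rule poly_mapping_eqI) (simp add: lookup_vp_trunc lookup_add poly_mod_add_left)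

lemma monom_mod: "smult a (monom 1 k) mod monom 1 n = (if k < n then smult a (monom 1 k) else (0::complex poly))"
proof (cases "k < n")
  case True
  have "degree (smult a (monom (1::complex) k)) < degree (monom (1::complex) n)"
    using True le_less_trans[OF degree_monom_le[of a k]] by (simp add: smult_monom degree_monom_eq)
  then show ?thesis using True by (simp add: mod_poly_less)
next
  case False
  then have "monom (1::complex) n dvd monom 1 k"
    using mult_monom[of "1::complex" n 1 "k - n"] by (metis dvd_triv_left le_add_diff_inverse mult_1 not_less)
  then show ?thesis using False by (simp add: dvd_smult)
qed

lemma vp_trunc_el: "vp_trunc n (Poly_Mapping.single b (smult a (monom 1 k))) = (if k < n then vp_scale a (el b k) else 0)"
  by (rule poly_mapping_eqI)
     (simp add: lookup_vp_trunc el_def lookup_vp_scale lookup_single when_def monom_mod)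

lemma coeff_mod_monom: "k < n \<Longrightarrow> coeff (p mod monom (1::complex) n) k = coeff p k"
proof -
  assume k: "k < n"
  have "coeff p k = coeff (monom 1 n * (p div monom 1 n) + p mod monom 1 n) k" by simp
  also have "\<dots> = coeff (p mod monom 1 n) k" using k by (simp only: coeff_add coeff_monom_mult) simp
  finally show ?thesis by simp
qed

section \<open>From modules over the truncated algebra to the operators D and Z\<close>

locale tv_module = complex_vector_space scale
  for scale :: "complex \<Rightarrow> 'v::ab_group_add \<Rightarrow> 'v" (infixr \<open>\<cdot>\<close> 75) +
  fixes n :: nat and act :: "vir_poly \<Rightarrow> 'v \<Rightarrow> 'v"
  assumes n1: "n \<ge> 1" and mod: "lie_module (truncated_Vir n) scale act"
begin

abbreviation \<gg> :: "vir_poly set" where "\<gg> \<equiv> lcarrier (truncated_Vir n)"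

lemma carrier_iff: "x \<in> \<gg> \<longleftrightarrow> (\<forall>i. degree (lookup x i) < n)"
  by (simp add: truncated_Vir_def)

lemma carrier_zero: "0 \<in> \<gg>"
  using n1 by (simp add: carrier_iff)

lemma carrier_add: "x \<in> \<gg> \<Longrightarrow> y \<in> \<gg> \<Longrightarrow> x + y \<in> \<gg>"
  by (simp add: carrier_iff lookup_add degree_add_less)

lemma carrier_scale: "x \<in> \<gg> \<Longrightarrow> vp_scale a x \<in> \<gg>"
  by (auto simp: carrier_iff lookup_vp_scale intro: le_less_trans[OF degree_smult_le])

lemma carrier_trunc: "vp_trunc n x \<in> \<gg>"
proof -
  have "degree (p mod monom 1 n) < n" for p :: "complex poly"
    using degree_mod_less[of "monom (1::complex) n" p] n1 by (auto simp: degree_monom_eq)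
  then show ?thesis by (simp add: carrier_iff lookup_vp_trunc)
qed

lemma carrier_single: "degree p < n \<Longrightarrow> Poly_Mapping.single b p \<in> \<gg>"
  using n1 by (simp add: carrier_iff lookup_single when_def)

lemma carrier_el: "j < n \<Longrightarrow> el b j \<in> \<gg>"
  unfolding el_def by (rule carrier_single) (simp add: degree_monom_eq)

lemma carrier_bracket: "lbracket (truncated_Vir n) x y \<in> \<gg>"
  using carrier_trunc by (simp add: truncated_Vir_def)

lemma act_endo: "x \<in> \<gg> \<Longrightarrow> endo (act x)"
  using mod by (auto simp: lie_module_def)

lemma act_add: "x \<in> \<gg> \<Longrightarrow> y \<in> \<gg> \<Longrightarrow> act (x + y) v = act x v + act y v"
  using mod by (auto simp: lie_module_def)

lemma act_scale: "x \<in> \<gg> \<Longrightarrow> act (vp_scale a x) v = a \<cdot> act x v"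
  using mod by (auto simp: lie_module_def truncated_Vir_def)

lemma act_bracket: "x \<in> \<gg> \<Longrightarrow> y \<in> \<gg> \<Longrightarrow> act (vp_trunc n (vp_bracket x y)) v = act x (act y v) - act y (act x v)"
  using mod by (auto simp: lie_module_def truncated_Vir_def)

lemma act_zero: "act 0 v = 0"
  using act_add[OF carrier_zero carrier_zero, of v] by simp

lemma carrier_sum: "(\<And>i. i \<in> A \<Longrightarrow> f i \<in> \<gg>) \<Longrightarrow> sum f A \<in> \<gg>"
  by (induction A rule: infinite_finite_induct) (auto intro: carrier_zero carrier_add)

lemma act_sum: "(\<And>i. i \<in> A \<Longrightarrow> f i \<in> \<gg>) \<Longrightarrow> act (sum f A) v = (\<Sum>i\<in>A. act (f i) v)"
  by (induction A rule: infinite_finite_induct) (auto simp: act_zero act_add carrier_sum)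

lemma decomposition:
  assumes x: "x \<in> \<gg>"
  shows "x = (\<Sum>b\<in>keys x. \<Sum>j<n. vp_scale (coeff (lookup x b) j) (el b j))"
proof (rule poly_mapping_eqI)
  fix c
  have p: "p = (\<Sum>j<n. smult (coeff p j) (monom 1 j))" if "degree p < n" for p :: "complex poly"
    by (rule poly_eqI) (use that in \<open>auto simp: coeff_sum smult_monom coeff_eq_0\<close>)
  have "lookup (\<Sum>b\<in>keys x. \<Sum>j<n. vp_scale (coeff (lookup x b) j) (el b j)) c =
      (\<Sum>b\<in>keys x. if b = c then \<Sum>j<n. smult (coeff (lookup x b) j) (monom 1 j) else 0)"
    by (unfold lookup_sum, rule sum.cong[OF refl]) (simp add: lookup_sum lookup_vp_scale el_def lookup_single when_def)
  also have "\<dots> = (if c \<in> keys x then \<Sum>j<n. smult (coeff (lookup x c) j) (monom 1 j) else 0)"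
    by simp
  also have "\<dots> = lookup x c" using p[of "lookup x c"] x by (auto simp: carrier_iff in_keys_iff)
  finally show "lookup x c = lookup (\<Sum>b\<in>keys x. \<Sum>j<n. vp_scale (coeff (lookup x b) j) (el b j)) c" by simp
qed

lemma act_decomposition:
  assumes x: "x \<in> \<gg>"
  shows "act x v = (\<Sum>b\<in>keys x. \<Sum>j<n. coeff (lookup x b) j \<cdot> act (el b j) v)"
proof -
  have "act x v = act (\<Sum>b\<in>keys x. \<Sum>j<n. vp_scale (coeff (lookup x b) j) (el b j)) v"
    using decomposition[OF x] by simp
  also have "\<dots> = (\<Sum>b\<in>keys x. \<Sum>j<n. coeff (lookup x b) j \<cdot> act (el b j) v)"
    by (subst act_sum, fastforce intro: carrier_sum carrier_scale carrier_el, rule sum.cong[OF refl],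
        subst act_sum, fastforce intro: carrier_scale carrier_el, rule sum.cong[OF refl])
      (simp add: carrier_el act_scale)
  finally show ?thesis .
qed

text \<open>For \<open>j \<ge> n\<close> the element \<open>el\<close> lies outside the carrier,
  where the module axioms do not constrain \<open>act\<close>. The value 0 is the action of the
  class of t^j, and makes the bracket formula hold for all exponents.\<close>

definition D :: "int \<Rightarrow> nat \<Rightarrow> 'v \<Rightarrow> 'v" where
  "D i j v = (if j < n then act (el (Dgen i) j) v else 0)"

definition Z :: "nat \<Rightarrow> 'v \<Rightarrow> 'v" where
  "Z j v = (if j < n then act (el Cgen j) v else 0)"

lemma act_el_bracket:
  assumes "j < n" "l < n"
  shows "act (el a j) (act (el b l) v) - act (el b l) (act (el a j) v) =
    act (vp_trunc n (vtensor (vir_basis_bracket a b) (monom 1 (j + l)))) v"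
  using act_bracket[OF carrier_el[OF assms(1)] carrier_el[OF assms(2)], of a b v]
  by (simp add: el_def vp_bracket_single mult_monom)

lemma vp_trunc_zero: "vp_trunc n 0 = 0"
  by (rule poly_mapping_eqI) (simp add: lookup_vp_trunc)

sublocale tvir_rep scale n D Z
proof (rule tvir_rep.intro[OF complex_vector_space_axioms tvir_rep_axioms.intro])
  fix i j k l v
  have e0: "endo (\<lambda>v. 0)" by (simp add: Vector_Spaces.linear_iff vector_space_axioms)
  show "endo (D i j)"
    by (cases "j < n") (simp_all add: D_def[abs_def] act_endo[OF carrier_el] e0)
  show "endo (Z j)"
    by (cases "j < n") (simp_all add: Z_def[abs_def] act_endo[OF carrier_el] e0)
  have a0: "act (el b j) 0 = 0" if "j < n" for b j
  proof -
    interpret a: Vector_Spaces.linear scale scale "act (el b j)" by (rule act_endo[OF carrier_el[OF that]])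
    show ?thesis by (rule a.zero)
  qed
  have tr: "act (vp_trunc n (Poly_Mapping.single b (smult a (monom 1 k)))) v = (if k < n then a \<cdot> act (el b k) v else 0)" for a b k
    by (simp add: vp_trunc_el act_scale[OF carrier_el] act_zero)
  show "D i j (D k l v) - D k l (D i j v) = of_int (k - i) \<cdot> D (i + k) (j + l) v +
      (if i = - k then (of_int (i ^ 3 - i) / 12) \<cdot> Z (j + l) v else 0)"
  proof (cases "j < n \<and> l < n")
    case True
    have "D i j (D k l v) - D k l (D i j v) =
        act (vp_trunc n (vtensor (vir_basis_bracket (Dgen i) (Dgen k)) (monom 1 (j + l)))) v"
      using act_el_bracket[of j l "Dgen i" "Dgen k" v] True by (simp add: D_def)
    then show ?thesis
      by (auto simp: vtensor_add vtensor_single vp_trunc_add act_add carrier_trunc tr D_def Z_def vtensor_zero vp_trunc_zero act_zero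
          simp del: of_int_diff of_int_add)
  next
    case False
    then show ?thesis using a0 by (auto simp: D_def Z_def)
  qed
  show "Z j (D k l v) = D k l (Z j v)"
    using act_el_bracket[of j l Cgen "Dgen k" v] a0
    by (auto simp: D_def Z_def vtensor_zero vp_trunc_zero act_zero)
  show "Z j (Z l v) = Z l (Z j v)"
    using act_el_bracket[of j l Cgen Cgen v] a0
    by (auto simp: Z_def vtensor_zero vp_trunc_zero act_zero)
  show "n \<le> j \<Longrightarrow> D i j v = 0" "n \<le> j \<Longrightarrow> Z j v = 0" by (auto simp: D_def Z_def)
qed

lemma vir_incl_D: "vir_incl (Poly_Mapping.single b 1) = el b 0"
  by (simp add: vir_incl_def vtensor_single el_def one_pCons monom_0)

lemma weight_space_W: "weight_space scale act \<mu> = W \<mu>"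
  using n1 by (simp add: weight_space_def W_def vir_incl_D D_def)

lemma act_in_subspace:
  assumes S: "subspace S" and x: "x \<in> \<gg>" and v: "\<And>i j. D i j v \<in> S" "\<And>j. Z j v \<in> S"
  shows "act x v \<in> S"
proof -
  have "act (el b j) v \<in> S" if "j < n" for b j
    using v(1)[of "vir_degree b" j] v(2)[of j] that by (cases b) (simp_all add: D_def Z_def)
  then show ?thesis unfolding act_decomposition[OF x]
    by (intro subspace_sum subspace_scale S) auto
qed

lemma submod_iff: "submod (truncated_Vir n) (full_mod scale act) S \<longleftrightarrow> subspace S \<and> (\<forall>x\<in>\<gg>. \<forall>v\<in>S. act x v \<in> S)"
  by (auto simp: submod_def full_mod_def subspace_def)

lemma tvir_irrI:
  assumes irr: "irreducible_mod (truncated_Vir n) (full_mod scale act)" and hc: "harish_chandra scale act"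
  shows "tvir_irr scale n D Z"
proof
  show "\<exists>v::'v. v \<noteq> 0" using irr by (auto simp: irreducible_mod_def full_mod_def)
  fix S v assume S: "subspace S" "\<And>i j v. v \<in> S \<Longrightarrow> D i j v \<in> S" "\<And>j v. v \<in> S \<Longrightarrow> Z j v \<in> S"
    and v: "v \<in> S" "v \<noteq> (0::'v)"
  have "submod (truncated_Vir n) (full_mod scale act) S"
    unfolding submod_iff using S act_in_subspace[OF S(1)] by blast
  then show "S = UNIV" using irr v by (auto simp: irreducible_mod_def full_mod_def)
next
  show "span (\<Union>\<mu>. W \<mu>) = UNIV" using hc by (simp add: harish_chandra_def weight_module_def weight_space_W)
  show "\<exists>S. finite S \<and> W \<mu> \<subseteq> span S" for \<mu>
    using hc unfolding harish_chandra_def weight_space_W by blast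
qed

end

text \<open>The isomorphism theorem in the direction from the image to the quotient: a vector is
  sent to its fibre under \<open>f\<close>, and by hypothesis the fibres are the cosets. The
  quotient operations are unions over representatives, so each union has to be shown
  constant.\<close>

lemma quotient_iso:
  fixes M :: "('g, 'm) lmod" and f :: "'m \<Rightarrow> 'v::ab_group_add"
    and scale :: "complex \<Rightarrow> 'v \<Rightarrow> 'v"
  assumes add: "\<And>v w. v \<in> mcarrier M \<Longrightarrow> w \<in> mcarrier M \<Longrightarrow> madd M v w \<in> mcarrier M \<and> f (madd M v w) = f v + f w"
    and scl: "\<And>a v. v \<in> mcarrier M \<Longrightarrow> mscale M a v \<in> mcarrier M \<and> f (mscale M a v) = scale a (f v)"
    and act: "\<And>x v. x \<in> lcarrier L \<Longrightarrow> v \<in> mcarrier M \<Longrightarrow> mact M x v \<in> mcarrier M \<and> f (mact M x v) = act x (f v)"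
    and surj: "f ` mcarrier M = UNIV"
    and coset: "\<And>v. v \<in> mcarrier M \<Longrightarrow> mod_coset M N v = {w \<in> mcarrier M. f w = f v}"
  shows "iso_mod L (full_mod scale act) (quotient_mod M N)"
proof -
  define F where "F v = {w \<in> mcarrier M. f w = v}" for v
  have cF: "mod_coset M N v = F (f v)" if "v \<in> mcarrier M" for v using coset[OF that] by (simp add: F_def)
  \<comment> \<open>Fibres are nonempty, so a union of equal sets over a fibre is that set and not
    the empty one.\<close>
  have ne: "\<exists>w. w \<in> F v" for v using surj by (auto simp: F_def image_iff set_eq_iff) metis
  have "bij_betw F UNIV (mod_coset M N ` mcarrier M)"
  proof (intro bij_betw_imageI)
    show "inj_on F UNIV"
    proof (rule inj_onI)
      fix x y assume eq: "F x = F y"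
      obtain w where "w \<in> F x" using ne by blast
      then have "f w = x" "f w = y" using eq by (auto simp: F_def)
      then show "x = y" by simp
    qed
    have "mod_coset M N ` mcarrier M = F ` f ` mcarrier M" using cF by (auto simp: image_image)
    then show "range F = mod_coset M N ` mcarrier M" using surj by simp
  qed
  moreover have "F (v + w) = (\<Union>a\<in>F v. \<Union>b\<in>F w. mod_coset M N (madd M a b))" for v w
  proof -
    have "mod_coset M N (madd M a b) = F (v + w)" if "a \<in> F v" "b \<in> F w" for a b
      using that add cF by (auto simp: F_def)
    then show ?thesis using ne[of v] ne[of w] by auto
  qed
  moreover have "F (scale a v) = (\<Union>w\<in>F v. mod_coset M N (mscale M a w))" for a v
  proof -
    have "mod_coset M N (mscale M a w) = F (scale a v)" if "w \<in> F v" for w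
      using that scl cF by (auto simp: F_def)
    then show ?thesis using ne[of v] by auto
  qed
  moreover have "F (act x v) = (\<Union>w\<in>F v. mod_coset M N (mact M x w))" if "x \<in> lcarrier L" for x v
  proof -
    have "mod_coset M N (mact M x w) = F (act x v)" if "w \<in> F v" for w
      using that \<open>x \<in> lcarrier L\<close> act cF by (auto simp: F_def)
    then show ?thesis using ne[of v] by auto
  qed
  ultimately show ?thesis
    unfolding iso_mod_def by (intro exI[of _ F]) (simp add: full_mod_def quotient_mod_def)
qed

context tv_module
begin

lemma act_vir_incl: "act (vir_incl x) v = lext (\<lambda>b. act (el b 0) v) x"
proof -
  have "vir_incl x = (\<Sum>b\<in>keys x. vp_scale (lookup x b) (el b 0))"
  proof (rule poly_mapping_eqI)
    fix c
    have "lookup (\<Sum>b\<in>keys x. vp_scale (lookup x b) (el b 0)) c = (\<Sum>b\<in>keys x. if b = c then smult (lookup x c) 1 else 0)"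
      by (unfold lookup_sum, rule sum.cong[OF refl])
        (simp add: lookup_vp_scale el_def lookup_single when_def monom_0 one_pCons)
    then show "lookup (vir_incl x) c = lookup (\<Sum>b\<in>keys x. vp_scale (lookup x b) (el b 0)) c"
      by (simp add: vir_incl_def lookup_vtensor in_keys_iff)
  qed
  then show ?thesis
    using n1 by (simp add: act_sum carrier_scale carrier_el act_scale lext_def)
qed

lemma lext_vab_act:
  assumes F: "\<And>i k. lext F (vab_basis_act a b i k) = act (el i 0) (F k)"
  shows "lext F (vab_act a b x p) = act (vir_incl x) (lext F p)"
proof -
  interpret a: Vector_Spaces.linear scale scale "act (el i 0)" for i
    by (rule act_endo[OF carrier_el]) (use n1 in simp)
  show ?thesis
    unfolding vab_act_def act_vir_incl lext_sum lext_fscale F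
    by (simp add: lext_def a.sum a.scale scale_sum_right)
qed

lemma t_part_act_zero:
  assumes D0: "\<And>i j v. j \<ge> 1 \<Longrightarrow> D i j v = 0" and Z0: "\<And>j v. Z j v = 0" and x: "x \<in> t_part"
  shows "act (vp_trunc n x) v = 0"
proof -
  have "coeff (lookup (vp_trunc n x) b) j \<cdot> act (el b j) v = 0" if "j < n" for b j
  proof (cases "j = 0")
    case True
    have "[:0, 1:] dvd lookup x b" using x by (simp add: t_part_def)
    then have "coeff (lookup x b) 0 = 0" by (auto simp: dvd_def)
    then show ?thesis using True that by (simp add: lookup_vp_trunc coeff_mod_monom)
  next
    case False
    have "act (el b j) v = 0"
      using D0[of j "vir_degree b" v] Z0[of j v] that False by (cases b) (simp_all add: D_def Z_def)
    then show ?thesis by simp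
  qed
  then show ?thesis unfolding act_decomposition[OF carrier_trunc] by (simp add: sum.neutral)
qed

text \<open>The summands lie in pairwise different weight spaces. The offset \<open>m\<close> lets
  the basis vector of index 0 sit in degree \<open>m\<close>.\<close>

lemma lext_weight_zero:
  fixes F :: "int \<Rightarrow> 'v"
  assumes F: "\<And>k. F k \<in> W (\<mu> + of_int (m + k))" and p: "lext F p = 0"
  shows "lookup p k \<cdot> F k = 0"
proof -
  define w where "w \<nu> = (let k = (THE k. \<nu> = \<mu> + of_int (m + k)) in lookup p k \<cdot> F k)" for \<nu>
  have w: "w (\<mu> + of_int (m + k)) = lookup p k \<cdot> F k" for k by (simp add: w_def)
  let ?h = "\<lambda>k. \<mu> + of_int (m + k)"
  have inj: "inj_on ?h A" for A by (auto simp: inj_on_def)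
  have "sum w (?h ` insert k (keys p)) = (\<Sum>k\<in>insert k (keys p). lookup p k \<cdot> F k)"
    by (subst sum.reindex[OF inj]) (simp only: o_def w)
  also have "\<dots> = 0" using lext_superset[of "insert k (keys p)" p F] p by auto
  finally have "w (?h k) = 0"
    by (rule weight_sum_zero[rotated 2]) (use w F W_scale in auto)
  then show ?thesis by (simp only: w)
qed

lemma range_lext:
  fixes F :: "int \<Rightarrow> 'v"
  assumes W: "span (\<Union>m::int. W (\<mu> + of_int m)) = UNIV"
    and F: "\<And>m u. u \<in> W (\<mu> + of_int m) \<Longrightarrow> \<exists>p. u = lext F p"
  shows "range (lext F) = UNIV"
proof -
  have "subspace (range (lext F))"
    by (rule subspaceI) (auto simp flip: lext_add lext_fscale lext_zero[of F])
  then have "span (\<Union>m::int. W (\<mu> + of_int m)) \<subseteq> range (lext F)"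
    by (intro span_minimal) (use F in blast)
  then show ?thesis using W by blast
qed

lemma intermediate_series:
  assumes irr: "tvir_irr scale n D Z"
    and W: "span (\<Union>m::int. W (\<mu> + of_int m)) = UNIV"
    and e: "\<forall>m\<in>S. e m \<in> W (\<mu> + of_int m) \<and> e m \<noteq> 0"
    and W0: "\<forall>m. m \<notin> S \<longrightarrow> W (\<mu> + of_int m) = {0}"
    and W1: "\<forall>m\<in>S. \<forall>u\<in>W (\<mu> + of_int m). \<exists>a. u = a \<cdot> e m"
    and De: "\<forall>m\<in>S. \<forall>k. D k 0 (e m) = (if m + k \<in> S then (\<mu> + of_int m + of_int k * b) \<cdot> e (m + k) else 0)"
    and D0: "\<forall>i j v. j \<ge> 1 \<longrightarrow> D i j v = 0" and Z0: "\<forall>j v. Z j v = 0"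
    and S: "S = UNIV \<or> (\<exists>m0. S = - {m0} \<and> b = 1 \<and> \<mu> = - of_int m0)"
  shows "\<exists>a b. iso_Vab' (full_mod scale (\<lambda>x. act (vir_incl x))) a b"
proof -
  have actC: "act (el Cgen 0) v = 0" for v using Z0[rule_format, of 0 v] n1 by (simp add: Z_def)
  have actD: "act (el (Dgen i) 0) v = D i 0 v" for i v using n1 by (simp add: D_def)
  from S show ?thesis
  proof
    assume S: "S = UNIV"
    have F: "lext e (vab_basis_act \<mu> b i k) = act (el i 0) (e k)" for i k
      using De S by (cases i) (simp_all add: actC actD lext_zero lext_single)
    note int = lext_vab_act[of e \<mu> b, OF F]
    have inj: "inj (lext e)"
    proof (rule injI)
      fix p q assume eq: "lext e p = lext e q"
      have "lookup (p - q) k \<cdot> e k = 0" for k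
        by (rule lext_weight_zero[of e \<mu> 0]) (use e S eq in \<open>auto simp: lext_diff\<close>)
      then have "lookup p k = lookup q k" for k using e S by (auto simp: lookup_minus)
      then show "p = q" by (rule poly_mapping_eqI)
    qed
    have surj: "range (lext e) = UNIV"
    proof (rule range_lext[OF W])
      fix m u assume "u \<in> W (\<mu> + of_int m)"
      then obtain a where "u = a \<cdot> e m" using W1 S by blast
      then show "\<exists>p. u = lext e p" by (metis lext_single)
    qed
    define f where "f = inv (lext e)"
    have fe: "f (lext e p) = p" for p using inj by (simp add: f_def)
    have ef: "lext e (f v) = v" for v using surj by (simp add: f_def surj_f_inv_f)
    have "iso_mod Vir (full_mod scale (\<lambda>x. act (vir_incl x))) (Vab \<mu> b)"
      unfolding iso_mod_def
    proof (intro exI[of _ f] conjI ballI allI)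
      show "bij_betw f (mcarrier (full_mod scale (\<lambda>x. act (vir_incl x)))) (mcarrier (Vab \<mu> b))"
        using bij_imp_bij_inv[OF bijI[OF inj surj]] by (simp add: full_mod_def Vab_def f_def)
    qed (simp_all add: full_mod_def Vab_def fe flip: int, (metis ef fe lext_add lext_fscale int)+)
    \<comment> \<open>\<open>iso_Vab'\<close> asks for irreducibility of V(a,b) itself;
      \<open>lext e\<close> carries a submodule of it to a subspace closed under \<open>D\<close>
      and \<open>Z\<close>.\<close>
    moreover have "irreducible_mod Vir (Vab \<mu> b)"
      unfolding irreducible_mod_def
    proof (intro conjI allI impI)
      have "Poly_Mapping.single (0::int) (1::complex) \<noteq> 0" by simp
      then have "(UNIV :: (int \<Rightarrow>\<^sub>0 complex) set) \<noteq> {0}" by (metis UNIV_I singletonD)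
      then show "mcarrier (Vab \<mu> b) \<noteq> {mzero (Vab \<mu> b)}" by (simp only: Vab_def full_mod_def lmod.simps not_False_eq_True)
      fix N assume N: "submod Vir (Vab \<mu> b) N"
      have N': "0 \<in> N" "\<And>p q. p \<in> N \<Longrightarrow> q \<in> N \<Longrightarrow> p + q \<in> N" "\<And>a p. p \<in> N \<Longrightarrow> fscale a p \<in> N"
          "\<And>x p. p \<in> N \<Longrightarrow> vab_act \<mu> b x p \<in> N"
        using N by (auto simp: submod_def Vab_def full_mod_def Vir_def)
      have sub: "subspace (lext e ` N)"
      proof (rule subspaceI)
        show "0 \<in> lext e ` N" using N'(1) lext_zero[of e] by (metis imageI)
      qed (use N' in \<open>auto simp flip: lext_add lext_fscale\<close>)
      have "lext e ` N = UNIV" if p: "p \<in> N" "p \<noteq> 0" for p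
      proof (rule tvir_irr.irreducible[OF irr sub])
        show "lext e p \<in> lext e ` N" "lext e p \<noteq> 0"
          using p fe[of p] fe[of 0] by (auto simp: lext_zero)
        show "Z j v \<in> lext e ` N" if "v \<in> lext e ` N" for j v using Z0 sub by (simp add: subspace_0)
        fix i j v assume v: "v \<in> lext e ` N"
        show "D i j v \<in> lext e ` N"
        proof (cases "j = 0")
          case True
          obtain q where q: "q \<in> N" "v = lext e q" using v by blast
          have "D i 0 v = lext e (vab_act \<mu> b (Poly_Mapping.single (Dgen i) 1) q)"
            unfolding int by (simp add: vir_incl_D actD q)
          then show ?thesis using N'(4)[OF q(1)] True by auto
        qed (use D0 sub in \<open>simp add: subspace_0\<close>)
      qed
      then have "q \<in> N" if "p \<in> N" "p \<noteq> 0" for p q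
        using that inj by (metis UNIV_I inj_image_mem_iff)
      then have "N = {0} \<or> N = UNIV" using N'(1) by blast
      then show "N = {mzero (Vab \<mu> b)} \<or> N = mcarrier (Vab \<mu> b)"
        by (simp only: Vab_def full_mod_def lmod.simps)
    qed
    ultimately show ?thesis unfolding iso_Vab'_def by blast
  next
    assume "\<exists>m0. S = - {m0} \<and> b = 1 \<and> \<mu> = - of_int m0"
    then obtain m0 where S: "S = - {m0}" and b: "b = 1" and \<mu>: "\<mu> = - of_int m0" by blast
    note single_one [simp del]
    \<comment> \<open>The map from V(0,0) to V(0,1) sending v_k to k times v_k: acting by d_i before
      or after it gives the same factor k (k + i). Its kernel is spanned by v_0, and the coefficient
      0 also removes the unspecified \<open>e m0\<close>.\<close>
    define G where "G k = of_int k \<cdot> e (m0 + k)" for k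
    have G: "lext G (vab_basis_act 0 0 i k) = act (el i 0) (G k)" for i k
    proof (cases i)
      case (Dgen j)
      have "D j 0 (of_int k \<cdot> e (m0 + k)) = (of_int k * of_int (k + j)) \<cdot> e (m0 + k + j)"
        using De[rule_format, of "m0 + k" j] by (cases "k = 0"; cases "k + j = 0") (auto simp: S \<mu> b D_scale D_zero add.assoc)
      then show ?thesis using Dgen by (simp add: lext_single actD G_def add.assoc)
    qed (simp add: actC lext_zero)
    note int = lext_vab_act[of G 0 0, OF G]
    interpret P: complex_vector_space "fscale :: complex \<Rightarrow> (int \<Rightarrow>\<^sub>0 complex) \<Rightarrow> _" by (rule fscale_vector_space)
    have GW: "G k \<in> W (\<mu> + of_int (m0 + k))" for k
    proof (cases "k = 0")
      case False
      then have "e (m0 + k) \<in> W (\<mu> + of_int (m0 + k))" using e S by (simp del: of_int_add)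
      then show ?thesis unfolding G_def by (rule W_scale)
    qed (use W_zero in \<open>simp add: G_def\<close>)
    have ker: "lext G p = 0 \<longleftrightarrow> p \<in> P.span {Poly_Mapping.single 0 1}" for p
    proof
      assume p: "lext G p = 0"
      have "lookup p k \<cdot> G k = 0" for k
        by (rule lext_weight_zero[of G \<mu> m0, OF GW p])
      moreover have "e (m0 + k) \<noteq> 0" if "k \<noteq> 0" for k using e that by (simp add: S)
      ultimately have "lookup p k = 0" if "k \<noteq> 0" for k using that by (auto simp: G_def)
      then have "p = fscale (lookup p 0) (Poly_Mapping.single 0 1)"
        by (intro poly_mapping_eqI) (simp add: lookup_fscale lookup_single when_def)
      then show "p \<in> P.span {Poly_Mapping.single 0 1}" unfolding P.span_singleton by blast
    next
      assume "p \<in> P.span {Poly_Mapping.single 0 1}"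
      then show "lext G p = 0" unfolding P.span_singleton by (auto simp: lext_fscale lext_single G_def)
    qed
    have surj: "range (lext G) = UNIV"
    proof (rule range_lext[OF W])
      fix m u assume u: "u \<in> W (\<mu> + of_int m)"
      show "\<exists>p. u = lext G p"
      proof (cases "m = m0")
        case True
        then have "u = 0" using W0 S u by auto
        then show ?thesis by (metis lext_zero)
      next
        case False
        then obtain a where "u = a \<cdot> e m" using W1 S u by blast
        then have "u = lext G (Poly_Mapping.single (m - m0) (a / of_int (m - m0)))"
          using False by (simp add: lext_single G_def)
        then show ?thesis ..
      qed
    qed
    have "iso_mod Vir (full_mod scale (\<lambda>x. act (vir_incl x)))
        (quotient_mod (Vab 0 0) (P.span {Poly_Mapping.single 0 1}))"
    proof (rule quotient_iso[where f = "lext G"])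
      fix v
      show "mod_coset (Vab 0 0) (P.span {Poly_Mapping.single 0 1}) v = {w \<in> mcarrier (Vab 0 0). lext G w = lext G v}"
      proof safe
        fix w assume "w \<in> mod_coset (Vab 0 0) (P.span {Poly_Mapping.single 0 1}) v"
        then obtain q where "q \<in> P.span {Poly_Mapping.single 0 1}" "w = v + q"
          by (auto simp: mod_coset_def Vab_def full_mod_def)
        then show "lext G w = lext G v" by (simp add: lext_add ker[symmetric])
      next
        fix w assume "lext G w = lext G v"
        then have "w - v \<in> P.span {Poly_Mapping.single 0 1}" by (simp add: ker[symmetric] lext_diff)
        then have "v + (w - v) \<in> (+) v ` P.span {Poly_Mapping.single 0 1}" by (rule imageI)
        then show "w \<in> mod_coset (Vab 0 0) (P.span {Poly_Mapping.single 0 1}) v"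
          by (simp add: mod_coset_def Vab_def full_mod_def)
      qed (simp add: Vab_def full_mod_def)
    qed (simp_all add: Vab_def full_mod_def lext_add lext_fscale int surj)
    then show ?thesis unfolding iso_Vab'_def by blast
  qed
qed

end

section \<open>Simple quotients of Verma modules\<close>

lemma fscale_left: "fscale a p = Poly_Mapping.single 0 a * (p :: 'k::monoid_add \<Rightarrow>\<^sub>0 complex)"
  and fscale_right: "fscale a p = p * Poly_Mapping.single 0 a"
proof -
  have *: "(\<Sum>k\<in>keys p. Poly_Mapping.single k (lookup p k * a)) = fscale a p"
      "(\<Sum>k\<in>keys p. Poly_Mapping.single k (a * lookup p k)) = fscale a p"
    by (rule poly_mapping_eqI; simp add: lookup_sum lookup_single when_def lookup_fscale in_keys_iff)+
  have "Poly_Mapping.single 0 a * p = Poly_Mapping.single 0 a * (\<Sum>k\<in>keys p. Poly_Mapping.single k (lookup p k))"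
    by (simp flip: sum_singles)
  then show "fscale a p = Poly_Mapping.single 0 a * p"
    by (simp add: sum_distrib_left mult_single *)
  have "p * Poly_Mapping.single 0 a = (\<Sum>k\<in>keys p. Poly_Mapping.single k (lookup p k)) * Poly_Mapping.single 0 a"
    by (simp flip: sum_singles)
  then show "fscale a p = p * Poly_Mapping.single 0 a"
    by (simp add: sum_distrib_right mult_single *)
qed

lemma fscale_mult_left: "fscale a p * q = fscale a (p * q :: 'k::monoid_add \<Rightarrow>\<^sub>0 complex)"
  by (simp only: fscale_left mult.assoc)

lemma mult_fscale_right: "p * fscale a q = fscale a (p * q :: 'k::monoid_add \<Rightarrow>\<^sub>0 complex)"
  by (simp only: fscale_right mult.assoc)

definition mon :: "'g list \<Rightarrow> 'g free_alg" where
  "mon xs = Poly_Mapping.single (Word xs) 1"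

lemma mon_Nil: "mon [] = 1"
  by (simp add: mon_def flip: zero_word_def)

lemma mon_Cons: "mon (x # xs) = gen x * mon xs"
  by (simp add: mon_def gen_def mult_single plus_word_def)

lemma free_carrier_add: "p \<in> free_carrier L \<Longrightarrow> q \<in> free_carrier L \<Longrightarrow> p + q \<in> free_carrier L"
  using keys_add[of p q] unfolding free_carrier_def by blast

lemma free_carrier_fscale: "p \<in> free_carrier L \<Longrightarrow> fscale a p \<in> free_carrier L"
  by (auto simp: free_carrier_def in_keys_iff lookup_fscale)

lemma free_carrier_mult: "p \<in> free_carrier L \<Longrightarrow> q \<in> free_carrier L \<Longrightarrow> p * q \<in> free_carrier L"
  using keys_mult[of p q] by (fastforce simp: free_carrier_def plus_word_def)

lemma free_carrier_mon: "set xs \<subseteq> lcarrier L \<Longrightarrow> mon xs \<in> free_carrier L"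
  by (simp add: free_carrier_def mon_def)

lemma free_carrier_one: "1 \<in> free_carrier L"
  using free_carrier_mon[of "[]" L] by (simp add: mon_Nil)

lemma free_carrier_gen: "x \<in> lcarrier L \<Longrightarrow> gen x \<in> free_carrier L"
  by (simp add: free_carrier_def gen_def)

lemma free_carrier_zero: "0 \<in> free_carrier L"
  by (simp add: free_carrier_def)

interpretation free: complex_vector_space "fscale :: complex \<Rightarrow> 'g free_alg \<Rightarrow> 'g free_alg"
  by (rule fscale_vector_space)

lemma free_subspace_carrier: "free.subspace (free_carrier L)"
  by (intro free.subspaceI free_carrier_zero free_carrier_add free_carrier_fscale)

lemma free_carrier_minimal:
  assumes N: "free.subspace N" "1 \<in> N" and gen: "\<And>x p. x \<in> lcarrier L \<Longrightarrow> p \<in> N \<Longrightarrow> gen x * p \<in> N"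
  shows "free_carrier L \<subseteq> N"
proof
  fix p assume p: "p \<in> free_carrier L"
  have mon: "set xs \<subseteq> lcarrier L \<Longrightarrow> mon xs \<in> N" for xs
    by (induction xs) (simp_all add: mon_Nil mon_Cons N(2) gen)
  have "fscale (lookup p w) (mon (letters w)) \<in> N" if "w \<in> keys p" for w
    using p that by (intro free.subspace_scale N(1) mon) (auto simp: free_carrier_def)
  then have "(\<Sum>w\<in>keys p. fscale (lookup p w) (mon (letters w))) \<in> N"
    by (rule free.subspace_sum[OF N(1)])
  moreover have "(\<Sum>w\<in>keys p. fscale (lookup p w) (mon (letters w))) = p"
    by (simp add: mon_def fscale_single flip: sum_singles)
  ultimately show "p \<in> N" by simp
qed

definition one_sided :: "nat \<Rightarrow> int \<Rightarrow> vir_poly set" where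
  "one_sided n s = {x \<in> lcarrier (truncated_Vir n). \<forall>i\<in>keys x. s * vir_degree i > 0}"

text \<open>\<open>s = 1\<close> for highest and \<open>s = - 1\<close> for lowest weight vectors.\<close>

locale hw_vector = tv_module scale n act
  for scale :: "complex \<Rightarrow> 'v::ab_group_add \<Rightarrow> 'v" (infixr \<open>\<cdot>\<close> 75) and n act +
  fixes s :: int and v0 :: 'v
  assumes irr: "tvir_irr scale n D Z" and s: "s = 1 \<or> s = - 1"
    and v0: "v0 \<noteq> 0" and v0_D: "\<And>i j. s * i > 0 \<Longrightarrow> D i j v0 = 0"
    and v0_D0: "\<And>j. \<exists>\<kappa>. D 0 j v0 = \<kappa> \<cdot> v0" and v0_Z: "\<And>j. \<exists>\<kappa>. Z j v0 = \<kappa> \<cdot> v0"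
begin

abbreviation "FC \<equiv> free_carrier (truncated_Vir n)"

definition \<phi> :: "vir_poly \<Rightarrow> complex" where
  "\<phi> x = (THE c. act x v0 = c \<cdot> v0)"

definition B :: "vir_poly set" where
  "B = {x + y | x y. x \<in> tv_zero n \<and> y \<in> one_sided n s}"

text \<open>The relators of \<open>induced_mod\<close> for the character read off from
  \<open>v0\<close>, so that the Verma module is the free algebra modulo their span
  \<open>J\<close>.\<close>

definition R :: "vir_poly free_alg set" where
  "R = {u * r * v | u r v. u \<in> FC \<and> r \<in> env_relations (truncated_Vir n) \<and> v \<in> FC} \<union>
       {u * gen x - fscale (\<phi> (zero_part x)) u | u x. u \<in> FC \<and> x \<in> B}"

definition J :: "vir_poly free_alg set" where
  "J = free.span R"

definition Ev :: "vir_poly free_alg \<Rightarrow> 'v \<Rightarrow> 'v" where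
  "Ev p v = lext (\<lambda>w. foldr act (letters w) v) p"

lemma \<phi>I: "act x v0 = c \<cdot> v0 \<Longrightarrow> \<phi> x = c"
  unfolding \<phi>_def by (rule the_equality) (use v0 in \<open>auto simp: scale_cancel_right\<close>)

lemma tv_zero_act: "x \<in> tv_zero n \<Longrightarrow> act x v0 = \<phi> x \<cdot> v0"
proof -
  assume x: "x \<in> tv_zero n"
  then have xg: "x \<in> \<gg>" by (simp add: tv_zero_def)
  have "\<exists>\<kappa>. act (el b j) v0 = \<kappa> \<cdot> v0" if "b \<in> keys x" "j < n" for b j
  proof -
    have "vir_degree b = 0" using x that by (simp add: tv_zero_def)
    then show ?thesis using v0_D0[of j] v0_Z[of j] that by (cases b) (simp_all add: D_def Z_def)
  qed
  then obtain \<kappa> where \<kappa>: "\<And>b j. b \<in> keys x \<Longrightarrow> j < n \<Longrightarrow> act (el b j) v0 = \<kappa> b j \<cdot> v0" by metis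
  have "act x v0 = (\<Sum>b\<in>keys x. \<Sum>j<n. (coeff (lookup x b) j * \<kappa> b j) \<cdot> v0)"
    unfolding act_decomposition[OF xg] by (intro sum.cong refl) (simp add: \<kappa>)
  then have "act x v0 = (\<Sum>b\<in>keys x. \<Sum>j<n. coeff (lookup x b) j * \<kappa> b j) \<cdot> v0"
    by (simp add: scale_sum_left)
  then show ?thesis by (metis \<phi>I)
qed

lemma one_sided_act: "x \<in> one_sided n s \<Longrightarrow> act x v0 = 0"
proof -
  assume x: "x \<in> one_sided n s"
  then have xg: "x \<in> \<gg>" by (simp add: one_sided_def)
  have "act (el b j) v0 = 0" if "b \<in> keys x" "j < n" for b j
  proof (cases b)
    case (Dgen i)
    then have "s * i > 0" using x that by (force simp: one_sided_def)
    then show ?thesis using v0_D[of i j] that Dgen by (simp add: D_def)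
  qed (use x that in \<open>force simp: one_sided_def\<close>)
  then show ?thesis unfolding act_decomposition[OF xg] by simp
qed

lemma B_carrier: "x \<in> B \<Longrightarrow> x \<in> \<gg>"
  by (auto simp: B_def tv_zero_def one_sided_def carrier_add)

lemma B_act: assumes "x \<in> B" shows "act x v0 = \<phi> (zero_part x) \<cdot> v0"
proof -
  obtain y z where yz: "x = y + z" "y \<in> tv_zero n" "z \<in> one_sided n s" using assms by (auto simp: B_def)
  have "zero_part x = y"
  proof (rule poly_mapping_eqI)
    fix c
    have "lookup (zero_part x) c = (if vir_degree c = 0 then lookup x c else 0)"
      by (simp add: zero_part_def lookup_sum lookup_single when_def in_keys_iff)
    moreover have "lookup y c = 0" if "vir_degree c \<noteq> 0" using yz(2) that by (auto simp: tv_zero_def in_keys_iff)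
    moreover have "lookup z c = 0" if "vir_degree c = 0" using yz(3) that by (force simp: one_sided_def in_keys_iff)
    ultimately show "lookup (zero_part x) c = lookup y c" by (simp add: yz(1) lookup_add)
  qed
  then show ?thesis
    using yz by (simp add: act_add tv_zero_act one_sided_act) (simp add: act_add tv_zero_def one_sided_def tv_zero_act one_sided_act)
qed

lemma el_B: assumes "j < n" "\<not> s * vir_degree b < 0" shows "el b j \<in> B"
proof (cases "vir_degree b = 0")
  case True
  then have "el b j \<in> tv_zero n" using assms(1) carrier_el[of j b] by (simp add: tv_zero_def el_def)
  moreover have "0 \<in> one_sided n s" using carrier_zero by (simp add: one_sided_def)
  ultimately show ?thesis unfolding B_def by force
next
  case False
  then have "s * vir_degree b > 0" using assms(2) s by auto
  then have "el b j \<in> one_sided n s" using assms(1) carrier_el[of j b] by (simp add: one_sided_def el_def)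
  moreover have "0 \<in> tv_zero n" using carrier_zero by (simp add: tv_zero_def)
  ultimately show ?thesis unfolding B_def by force
qed

lemma \<phi>_linear: "linear_functional_on (tv_zero n) \<phi>"
  unfolding linear_functional_on_def
proof (intro conjI ballI allI)
  fix x y assume x: "x \<in> tv_zero n" and y: "y \<in> tv_zero n"
  show "\<phi> (x + y) = \<phi> x + \<phi> y"
    by (rule \<phi>I, subst act_add)
      (use x y in \<open>auto simp: tv_zero_act scale_left_distrib\<close>, auto simp: tv_zero_def)
next
  fix a x assume x: "x \<in> tv_zero n"
  show "\<phi> (vp_scale a x) = a * \<phi> x"
    by (rule \<phi>I, subst act_scale) (use x in \<open>auto simp: tv_zero_act\<close>, auto simp: tv_zero_def)
qed

lemma Ev_add: "Ev (p + q) v = Ev p v + Ev q v"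
  and Ev_diff: "Ev (p - q) v = Ev p v - Ev q v"
  and Ev_fscale: "Ev (fscale a p) v = a \<cdot> Ev p v"
  and Ev_zero: "Ev 0 v = 0"
  and Ev_one: "Ev 1 v = v"
  and Ev_gen: "Ev (gen x) v = act x v"
  using lext_single[of "\<lambda>w. foldr act (letters w) v" 0 1]
  by (simp_all add: Ev_def lext_add lext_diff lext_fscale lext_zero gen_def lext_single)
    (simp add: zero_word_def)

lemma foldr_act_endo: "set xs \<subseteq> \<gg> \<Longrightarrow> endo (\<lambda>v. foldr act xs v)"
proof (induction xs)
  case Nil
  then show ?case by (simp add: Vector_Spaces.linear_iff vector_space_axioms)
next
  case (Cons x xs)
  then have "endo (act x)" "endo (foldr act xs)" by (simp_all add: act_endo)
  then show ?case by (simp add: Vector_Spaces.linear_iff)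
qed

lemma Ev_mult: assumes "p \<in> FC" shows "Ev (p * q) v = Ev p (Ev q v)"
proof -
  let ?e = "\<lambda>w v. foldr act (letters w) v"
  have lin: "?e w (\<Sum>w'\<in>A. f w' \<cdot> ?e w' v) = (\<Sum>w'\<in>A. f w' \<cdot> ?e w (?e w' v))" if "w \<in> keys p" for w A f
  proof -
    interpret e: Vector_Spaces.linear scale scale "?e w"
      by (rule foldr_act_endo) (use assms that in \<open>auto simp: free_carrier_def\<close>)
    show ?thesis by (simp add: e.sum e.scale)
  qed
  have "p * q = (\<Sum>w\<in>keys p. Poly_Mapping.single w (lookup p w)) * (\<Sum>w\<in>keys q. Poly_Mapping.single w (lookup q w))"
    by (simp flip: sum_singles)
  also have "\<dots> = (\<Sum>w\<in>keys p. \<Sum>w'\<in>keys q. Poly_Mapping.single (w + w') (lookup p w * lookup q w'))"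
    by (simp add: sum_product mult_single)
  finally have "Ev (p * q) v = (\<Sum>w\<in>keys p. \<Sum>w'\<in>keys q. lookup p w \<cdot> lookup q w' \<cdot> ?e w (?e w' v))"
    by (simp add: Ev_def lext_sum lext_single plus_word_def)
  also have "\<dots> = Ev p (Ev q v)"
    by (simp add: Ev_def lext_def lin scale_sum_right)
  finally show ?thesis .
qed

lemma carrier_lscale: "x \<in> \<gg> \<Longrightarrow> lscale (truncated_Vir n) a x \<in> \<gg>"
  using carrier_scale[of x a] by (simp add: truncated_Vir_def)

lemma env_relations_carrier: "env_relations (truncated_Vir n) \<subseteq> FC"
  unfolding env_relations_def
  by (auto intro!: free.subspace_diff[OF free_subspace_carrier] free_carrier_gen free_carrier_mult free_carrier_fscale
      carrier_add carrier_bracket carrier_lscale)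

lemma Ev_env: assumes "r \<in> env_relations (truncated_Vir n)" shows "Ev r v = 0"
proof -
  have sc: "lscale (truncated_Vir n) = vp_scale" "lbracket (truncated_Vir n) x y = vp_trunc n (vp_bracket x y)" for x y
    by (simp_all add: truncated_Vir_def)
  show ?thesis
    using assms unfolding env_relations_def
    by (auto simp: Ev_diff Ev_gen Ev_fscale Ev_mult free_carrier_gen act_add act_scale act_bracket sc)
qed

lemma R_carrier: "R \<subseteq> FC"
  unfolding R_def using env_relations_carrier B_carrier
  by (auto intro!: free.subspace_diff[OF free_subspace_carrier] free_carrier_gen free_carrier_mult free_carrier_fscale)

lemma J_carrier: "J \<subseteq> FC"
  unfolding J_def by (rule free.span_minimal[OF R_carrier free_subspace_carrier])

lemma subspace_J: "free.subspace J"
  by (simp add: J_def free.subspace_span)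

text \<open>This makes evaluation at \<open>v0\<close> well defined on the Verma module. Enveloping
  relators vanish since \<open>act\<close> is a module action, the others since \<open>B\<close>
  acts on \<open>v0\<close> by the character.\<close>

lemma Ev_R: assumes "r \<in> R" shows "Ev r v0 = 0"
  using assms unfolding R_def
proof
  assume "r \<in> {u * r * v | u r v. u \<in> FC \<and> r \<in> env_relations (truncated_Vir n) \<and> v \<in> FC}"
  then obtain u r' w where "r = u * r' * w" "u \<in> FC" "r' \<in> env_relations (truncated_Vir n)" "w \<in> FC" by blast
  moreover from this have "r' \<in> FC" using env_relations_carrier by blast
  ultimately show ?thesis using Ev_env Ev_mult[of _ 0] by (simp add: Ev_mult mult.assoc Ev_zero)
next
  assume "r \<in> {u * gen x - fscale (\<phi> (zero_part x)) u | u x. u \<in> FC \<and> x \<in> B}"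
  then obtain u x where r: "r = u * gen x - fscale (\<phi> (zero_part x)) u" "u \<in> FC" "x \<in> B" by blast
  have "Ev (u * gen x) v0 = Ev u (Ev (fscale (\<phi> (zero_part x)) 1) v0)"
    using r by (simp add: Ev_mult Ev_gen B_act Ev_fscale Ev_one)
  also have "\<dots> = Ev (fscale (\<phi> (zero_part x)) u) v0"
    using r(2) by (simp flip: Ev_mult add: mult_fscale_right)
  finally show ?thesis using r by (simp add: Ev_diff)
qed

lemma Ev_J: assumes "r \<in> J" shows "Ev r v0 = 0"
proof -
  have "free.subspace {r. Ev r v0 = 0}"
    by (rule free.subspaceI) (simp_all add: Ev_zero Ev_add Ev_fscale)
  then have "J \<subseteq> {r. Ev r v0 = 0}"
    unfolding J_def by (intro free.span_minimal) (auto simp: Ev_R)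
  then show ?thesis using assms by blast
qed

lemma J_mult: assumes u: "u \<in> FC" and "r \<in> J" shows "u * r \<in> J"
proof -
  have "free.subspace {r. u * r \<in> J}"
    by (rule free.subspaceI)
      (simp_all add: free.subspace_0[OF subspace_J] distrib_left free.subspace_add[OF subspace_J] mult_fscale_right
        free.subspace_scale[OF subspace_J])
  moreover have "u * r \<in> R" if "r \<in> R" for r
    using that unfolding R_def
  proof (rule UnE)
    assume "r \<in> {u * r * v | u r v. u \<in> FC \<and> r \<in> env_relations (truncated_Vir n) \<and> v \<in> FC}"
    then obtain u' r' w where "r = u' * r' * w" "u' \<in> FC" "r' \<in> env_relations (truncated_Vir n)" "w \<in> FC" by blast
    moreover from this have "u * r = (u * u') * r' * w" by (simp add: mult.assoc)
    ultimately show "u * r \<in> {u * r * v | u r v. u \<in> FC \<and> r \<in> env_relations (truncated_Vir n) \<and> v \<in> FC} \<union>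
       {u * gen x - fscale (\<phi> (zero_part x)) u | u x. u \<in> FC \<and> x \<in> B}"
      using free_carrier_mult[OF u] by blast
  next
    assume "r \<in> {u * gen x - fscale (\<phi> (zero_part x)) u | u x. u \<in> FC \<and> x \<in> B}"
    then obtain u' x where "r = u' * gen x - fscale (\<phi> (zero_part x)) u'" "u' \<in> FC" "x \<in> B" by blast
    moreover from this have "u * r = (u * u') * gen x - fscale (\<phi> (zero_part x)) (u * u')"
      by (simp add: mult.assoc right_diff_distrib mult_fscale_right)
    ultimately show "u * r \<in> {u * r * v | u r v. u \<in> FC \<and> r \<in> env_relations (truncated_Vir n) \<and> v \<in> FC} \<union>
       {u * gen x - fscale (\<phi> (zero_part x)) u | u x. u \<in> FC \<and> x \<in> B}"
      using free_carrier_mult[OF u] by blast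
  qed
  ultimately have "J \<subseteq> {r. u * r \<in> J}"
    unfolding J_def by (intro free.span_minimal) (auto intro: free.span_base)
  then show ?thesis using assms by blast
qed

lemma J_env: assumes r: "r \<in> env_relations (truncated_Vir n)" and w: "w \<in> FC" shows "r * w \<in> J"
proof -
  have "1 * r * w \<in> R" unfolding R_def using r w free_carrier_one by blast
  then show ?thesis by (simp add: J_def free.span_base)
qed

lemma J_gen_add: "x \<in> \<gg> \<Longrightarrow> y \<in> \<gg> \<Longrightarrow> w \<in> FC \<Longrightarrow> gen (x + y) * w - gen x * w - gen y * w \<in> J"
proof -
  assume xy: "x \<in> \<gg>" "y \<in> \<gg>" and w: "w \<in> FC"
  have "gen (x + y) - gen x - gen y \<in> env_relations (truncated_Vir n)"
    unfolding env_relations_def using xy by blast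
  from J_env[OF this w] show ?thesis by (simp add: left_diff_distrib)
qed

lemma J_gen_scale: "x \<in> \<gg> \<Longrightarrow> w \<in> FC \<Longrightarrow> gen (vp_scale a x) * w - fscale a (gen x * w) \<in> J"
proof -
  assume x: "x \<in> \<gg>" and w: "w \<in> FC"
  have "gen (lscale (truncated_Vir n) a x) - fscale a (gen x) \<in> env_relations (truncated_Vir n)"
    unfolding env_relations_def using x by blast
  from J_env[OF this w] show ?thesis by (simp add: left_diff_distrib fscale_mult_left truncated_Vir_def)
qed

lemma J_gen_bracket: "x \<in> \<gg> \<Longrightarrow> y \<in> \<gg> \<Longrightarrow> w \<in> FC \<Longrightarrow>
    gen x * (gen y * w) - gen y * (gen x * w) - gen (vp_trunc n (vp_bracket x y)) * w \<in> J"
proof -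
  assume xy: "x \<in> \<gg>" "y \<in> \<gg>" and w: "w \<in> FC"
  have "gen x * gen y - gen y * gen x - gen (lbracket (truncated_Vir n) x y) \<in> env_relations (truncated_Vir n)"
    unfolding env_relations_def using xy by blast
  from J_env[OF this w] show ?thesis by (simp add: left_diff_distrib mult.assoc truncated_Vir_def)
qed

lemma J_gen_B: "x \<in> B \<Longrightarrow> gen x - fscale (\<phi> (zero_part x)) 1 \<in> J"
proof -
  assume "x \<in> B"
  then have "1 * gen x - fscale (\<phi> (zero_part x)) 1 \<in> R" unfolding R_def using free_carrier_one by blast
  then show ?thesis by (simp add: J_def free.span_base)
qed

end

lemma vp_scale_zero: "vp_scale 0 x = 0"
  by (rule poly_mapping_eqI) (simp add: lookup_vp_scale)

context tv_module
begin

text \<open>\<open>gen\<close> is linear only modulo the enveloping relations, so claims about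
  \<open>gen x\<close> are proved for basis elements and carried over to sums and multiples
  separately.\<close>

lemma carrier_induct [consumes 1, case_names el add scale]:
  assumes x: "x \<in> \<gg>" and el: "\<And>b j. j < n \<Longrightarrow> P (el b j)"
    and add: "\<And>x y. x \<in> \<gg> \<Longrightarrow> y \<in> \<gg> \<Longrightarrow> P x \<Longrightarrow> P y \<Longrightarrow> P (x + y)"
    and scl: "\<And>a x. x \<in> \<gg> \<Longrightarrow> P x \<Longrightarrow> P (vp_scale a x)"
  shows "P x"
proof -
  have "P (vp_scale 0 (el Cgen 0))" using el[of 0 Cgen] scl carrier_el n1 by simp
  then have P0: "P 0" by (simp add: vp_scale_zero)
  have sum: "sum f A \<in> \<gg> \<and> P (sum f A)" if "\<And>i. i \<in> A \<Longrightarrow> f i \<in> \<gg> \<and> P (f i)" for A and f :: "'i \<Rightarrow> vir_poly"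
    using that by (induction A rule: infinite_finite_induct) (auto intro: P0 carrier_zero add carrier_add)
  have "vp_scale a (el b j) \<in> \<gg> \<and> P (vp_scale a (el b j))" if "j < n" for a b j
    using that el scl carrier_el carrier_scale by blast
  then have inner: "(\<Sum>j<n. vp_scale (coeff (lookup x b) j) (el b j)) \<in> \<gg> \<and> P (\<Sum>j<n. vp_scale (coeff (lookup x b) j) (el b j))" for b
    by (intro sum) auto
  have "(\<Sum>b\<in>keys x. \<Sum>j<n. vp_scale (coeff (lookup x b) j) (el b j)) \<in> \<gg> \<and>
      P (\<Sum>b\<in>keys x. \<Sum>j<n. vp_scale (coeff (lookup x b) j) (el b j))"
    by (rule sum) (rule inner)
  then show ?thesis using decomposition[OF x] by simp
qed

end

lemma diff_add_in:
  assumes "free.subspace N" "p - q \<in> N" "q \<in> N" shows "p \<in> N"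
  using free.subspace_add[OF assms] by simp

section \<open>Triangular decomposition and weights of the Verma module\<close>

context hw_vector
begin

definition neg :: "vir_poly set" where
  "neg = {el (Dgen i) j | i j. s * i < 0 \<and> j < n}"

text \<open>The span in a triangular decomposition: it will turn out to contain every element of the
  free algebra over the carrier. The empty word is listed apart from the others so that the top
  component can be separated.\<close>

definition T :: "vir_poly free_alg set" where
  "T = free.span (insert 1 (J \<union> {mon ys | ys. ys \<noteq> [] \<and> set ys \<subseteq> neg}))"

lemma subspace_T: "free.subspace T"
  by (simp add: T_def free.subspace_span)

lemma neg_carrier: "neg \<subseteq> \<gg>"
  by (auto simp: neg_def carrier_el)

lemma mon_T: assumes "set ys \<subseteq> neg" shows "mon ys \<in> T"
proof (cases "ys = []")
  case False
  then show ?thesis unfolding T_def using assms by (intro free.span_base) blast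
qed (simp add: T_def mon_Nil free.span_base)

lemma J_T: "J \<subseteq> T"
  unfolding T_def by (auto intro: free.span_base)

lemma gen_T_if_mon:
  assumes x: "x \<in> \<gg>" and mon: "\<And>ys. set ys \<subseteq> neg \<Longrightarrow> gen x * mon ys \<in> T" and p: "p \<in> T"
  shows "gen x * p \<in> T"
proof -
  have sub: "free.subspace {p. gen x * p \<in> T}"
    by (rule free.subspaceI)
      (simp_all add: free.subspace_0[OF subspace_T] distrib_left free.subspace_add[OF subspace_T] mult_fscale_right
        free.subspace_scale[OF subspace_T])
  have J: "gen x * r \<in> T" if "r \<in> J" for r
    using J_mult[OF free_carrier_gen[OF x] that] J_T by (rule rev_subsetD)
  have one: "gen x * 1 \<in> T" using mon[of "[]"] by (simp add: mon_Nil)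
  have "free.span (insert 1 (J \<union> {mon ys | ys. ys \<noteq> [] \<and> set ys \<subseteq> neg})) \<subseteq> {p. gen x * p \<in> T}"
    by (rule free.span_minimal[OF _ sub]) (use J one mon in blast)
  then show ?thesis using p by (auto simp flip: T_def)
qed

lemma gen_neg_T: "y \<in> neg \<Longrightarrow> p \<in> T \<Longrightarrow> gen y * p \<in> T"
  using gen_T_if_mon[of y p] mon_T[of "y # _"] neg_carrier by (auto simp: mon_Cons)

text \<open>Move \<open>x\<close> past the first letter \<open>y\<close>. The bracket of
  \<open>x\<close> and \<open>y\<close> is again an element of the algebra in front of a shorter
  word, so induction on the word with \<open>x\<close> arbitrary works without ordering the letters.
  In front of the empty word a basis element is either a letter of \<open>neg\<close> or a scalar
  modulo \<open>J\<close>.\<close>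

lemma gen_mon_T: "set ys \<subseteq> neg \<Longrightarrow> x \<in> \<gg> \<Longrightarrow> gen x * mon ys \<in> T"
proof (induction ys arbitrary: x)
  case Nil
  from Nil(2) show ?case
  proof (induction rule: carrier_induct)
    case (el b j)
    show ?case
    proof (cases "s * vir_degree b < 0")
      case True
      then have "el b j \<in> neg" using el by (cases b) (auto simp: neg_def)
      then show ?thesis using mon_T[of "[]"] by (simp add: gen_neg_T)
    next
      case False
      have "gen (el b j) - fscale (\<phi> (zero_part (el b j))) 1 \<in> T"
        using J_gen_B[OF el_B[OF el False]] J_T by blast
      moreover have "fscale (\<phi> (zero_part (el b j))) 1 \<in> T"
        using mon_T[of "[]"] by (intro free.subspace_scale subspace_T) (simp add: mon_Nil)
      ultimately show ?thesis using diff_add_in[OF subspace_T] by (simp add: mon_Nil)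
    qed
  next
    case (add x y)
    have "gen (x + y) * mon [] - gen x * mon [] - gen y * mon [] \<in> T"
      using J_gen_add[OF add(1,2), of "mon []"] J_T by (auto simp: mon_Nil free_carrier_one)
    from diff_add_in[OF subspace_T diff_add_in[OF subspace_T this add(4)] add(3)] show ?case .
  next
    case (scale a x)
    have "gen (vp_scale a x) * mon [] - fscale a (gen x * mon []) \<in> T"
      using J_gen_scale[OF scale(1), of "mon []"] J_T by (auto simp: mon_Nil free_carrier_one)
    from diff_add_in[OF subspace_T this free.subspace_scale[OF subspace_T scale(2)]] show ?case .
  qed
next
  case (Cons y ys)
  have y: "y \<in> neg" and ys: "set ys \<subseteq> neg" using Cons.prems by auto
  have FC: "mon ys \<in> FC" using ys neg_carrier by (intro free_carrier_mon) auto
  have yg: "y \<in> \<gg>" using y neg_carrier by blast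
  have "gen x * (gen y * mon ys) - gen y * (gen x * mon ys) - gen (vp_trunc n (vp_bracket x y)) * mon ys \<in> T"
    using J_gen_bracket[OF Cons.prems(2) yg FC] J_T by blast
  from diff_add_in[OF subspace_T diff_add_in[OF subspace_T this Cons.IH[OF ys carrier_trunc]]
      gen_neg_T[OF y Cons.IH[OF ys Cons.prems(2)]]]
  show ?case by (simp add: mon_Cons)
qed

lemma FC_T: "FC \<subseteq> T"
proof (rule free_carrier_minimal[OF subspace_T])
  show "1 \<in> T" using mon_T[of "[]"] by (simp add: mon_Nil)
qed (blast intro: gen_T_if_mon gen_mon_T)

abbreviation "d0 \<equiv> el (Dgen 0) 0"

definition hw :: complex where
  "hw = \<phi> (zero_part d0)"

text \<open>Elements whose class in the Verma module has weight \<open>k\<close> steps away from the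
  top, downwards for \<open>s = 1\<close> and upwards for \<open>s = - 1\<close>. The level is not
  unique: \<open>J\<close> lies in all of them.\<close>

definition Wt :: "nat \<Rightarrow> vir_poly free_alg set" where
  "Wt k = {q \<in> FC. gen d0 * q - fscale (hw - of_int s * of_nat k) q \<in> J}"

lemma d0_carrier: "d0 \<in> \<gg>"
  using n1 by (simp add: carrier_el)

lemma subspace_Wt: "free.subspace (Wt k)"
proof (rule free.subspaceI)
  show "0 \<in> Wt k" using free.subspace_0[OF subspace_J] by (simp add: Wt_def free_carrier_zero)
  fix p q assume "p \<in> Wt k" "q \<in> Wt k"
  then show "p + q \<in> Wt k"
    using free.subspace_add[OF subspace_J]
    by (fastforce simp: Wt_def free_carrier_add distrib_left free.scale_right_distrib add_diff_add)
next
  fix c p assume "p \<in> Wt k"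
  then show "fscale c p \<in> Wt k"
    using free.subspace_scale[OF subspace_J, of _ c]
    by (fastforce simp: Wt_def free_carrier_fscale mult_fscale_right free.scale_right_diff_distrib mult.commute)
qed

lemma J_Wt: "J \<subseteq> Wt k"
  using J_carrier J_mult[OF free_carrier_gen[OF d0_carrier]] free.subspace_diff[OF subspace_J] free.subspace_scale[OF subspace_J]
  by (auto simp: Wt_def)

lemma one_Wt: "1 \<in> Wt 0"
  using J_gen_B[of d0] el_B[of 0 "Dgen 0"] n1 by (simp add: Wt_def free_carrier_one hw_def)

lemma bracket_d0: "j < n \<Longrightarrow> vp_trunc n (vp_bracket d0 (el (Dgen i) j)) = vp_scale (of_int i) (el (Dgen i) j)"
  by (simp add: el_def vp_bracket_single vtensor_add vtensor_single mult_monom vtensor_zero vp_trunc_el[unfolded el_def]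
      vp_trunc_zero vp_scale_zero)

text \<open>Each letter moves the weight by at least one step, so nonempty words lie strictly away
  from the top.\<close>

lemma mon_Wt: "set ys \<subseteq> neg \<Longrightarrow> \<exists>k\<ge>length ys. mon ys \<in> Wt k"
proof (induction ys)
  case Nil
  then show ?case using one_Wt by (auto simp: mon_Nil)
next
  case (Cons y ys)
  then obtain k where k: "k \<ge> length ys" "mon ys \<in> Wt k" by auto
  have "y \<in> neg" using Cons.prems by simp
  then obtain i j where y: "y = el (Dgen i) j" "s * i < 0" "j < n" unfolding neg_def by blast
  define m where "m = nat (- s * i)"
  have m: "m \<ge> 1" "of_int i = - (of_int s * of_nat m :: complex)" using y(2) s by (auto simp: m_def)
  have yg: "y \<in> \<gg>" using y carrier_el by simp
  let ?w = "mon ys" and ?\<mu> = "hw - of_int s * of_nat k"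
  have w: "?w \<in> FC" "gen d0 * ?w - fscale ?\<mu> ?w \<in> J" using k by (auto simp: Wt_def)
  have 1: "gen d0 * (gen y * ?w) - gen y * (gen d0 * ?w) - gen (vp_scale (of_int i) y) * ?w \<in> J"
    using J_gen_bracket[OF d0_carrier yg w(1)] bracket_d0[OF y(3)] y(1) by simp
  have 2: "gen y * (gen d0 * ?w - fscale ?\<mu> ?w) \<in> J" by (rule J_mult[OF free_carrier_gen[OF yg] w(2)])
  have 3: "gen (vp_scale (of_int i) y) * ?w - fscale (of_int i) (gen y * ?w) \<in> J" by (rule J_gen_scale[OF yg w(1)])
  have "?\<mu> + of_int i = hw - of_int s * of_nat (k + m)" using m(2) by (simp add: algebra_simps)
  moreover have "gen d0 * (gen y * ?w) - fscale (?\<mu> + of_int i) (gen y * ?w) \<in> J"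
    using free.subspace_add[OF subspace_J free.subspace_add[OF subspace_J 1 2] 3]
    by (simp add: right_diff_distrib mult_fscale_right free.scale_left_distrib diff_diff_eq)
  ultimately have "mon (y # ys) \<in> Wt (k + m)"
    using free_carrier_mult[OF free_carrier_gen[OF yg] w(1)]
    by (simp only: Wt_def mon_Cons mem_Collect_eq simp_thms)
  then show ?case using k m by (intro exI[of _ "k + m"]) auto
qed

lemma FC_decomposition:
  assumes "p \<in> FC"
  shows "\<exists>c F q. finite F \<and> 0 \<notin> F \<and> (\<forall>k\<in>F. q k \<in> Wt k) \<and> p = fscale c 1 + sum q F"
proof -
  have "p \<in> free.span (insert 1 (J \<union> {mon ys | ys. ys \<noteq> [] \<and> set ys \<subseteq> neg}))"
    using assms FC_T unfolding T_def by blast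
  then have "\<exists>c. p - fscale c 1 \<in> free.span (J \<union> {mon ys | ys. ys \<noteq> [] \<and> set ys \<subseteq> neg})"
    by (simp only: free.span_breakdown_eq)
  then obtain c where "p - fscale c 1 \<in> free.span (J \<union> {mon ys | ys. ys \<noteq> [] \<and> set ys \<subseteq> neg})" ..
  moreover have "J \<union> {mon ys | ys. ys \<noteq> [] \<and> set ys \<subseteq> neg} \<subseteq> (\<Union>k\<in>{1..}. Wt k)"
  proof -
    have "\<exists>k\<ge>1. mon ys \<in> Wt k" if "ys \<noteq> []" "set ys \<subseteq> neg" for ys
    proof -
      from mon_Wt[OF that(2)] obtain k where "length ys \<le> k \<and> mon ys \<in> Wt k" ..
      moreover have "1 \<le> length ys" using that(1) by (cases ys) simp_all
      ultimately show ?thesis by (intro exI[of _ k]) auto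
    qed
    \<comment> \<open>\<open>J\<close> is contained in every \<open>Wt k\<close>, so its elements
      may be counted as level 1.\<close>
    moreover have "\<exists>k\<ge>1. r \<in> Wt k" if "r \<in> J" for r using J_Wt[of 1] that by (intro exI[of _ 1]) auto
    ultimately show ?thesis by fastforce
  qed
  ultimately have "p - fscale c 1 \<in> free.span (\<Union>k\<in>{1..}. Wt k)"
    by (rule rev_subsetD[OF _ free.span_mono])
  from free.span_UN_sum[OF subspace_Wt this] obtain F q
    where "finite F \<and> F \<subseteq> {1..} \<and> (\<forall>k\<in>F. q k \<in> Wt k) \<and> p - fscale c 1 = sum q F" by (elim exE)
  then show ?thesis by (intro exI[of _ c] exI[of _ F] exI[of _ q]) (auto simp: algebra_simps)
qed

text \<open>Applying d_0 minus the weight of level k removes \<open>q k\<close> modulo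
  \<open>J\<close> and multiplies the top component by \<open>s * k\<close>, which is nonzero as 0
  is not in \<open>F\<close>.\<close>

lemma top_component:
  assumes N: "free.subspace N" "J \<subseteq> N" "\<And>p. p \<in> N \<Longrightarrow> gen d0 * p \<in> N"
  shows "finite F \<Longrightarrow> 0 \<notin> F \<Longrightarrow> (\<And>k. k \<in> F \<Longrightarrow> q k \<in> Wt k) \<Longrightarrow> fscale c 1 + sum q F \<in> N \<Longrightarrow> fscale c 1 \<in> N"
proof (induction F arbitrary: c q rule: finite_induct)
  case (insert k F)
  let ?\<mu> = "\<lambda>i. hw - of_int s * of_nat i :: complex" and ?a = "\<lambda>i. of_int s * (of_nat k - of_nat i) :: complex"
  define h where "h p = gen d0 * p - fscale (?\<mu> k) p" for p
  have h: "h p - fscale (?a i) p \<in> J" if "p \<in> Wt i" for p i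
  proof -
    have "h p - fscale (?a i) p = gen d0 * p - fscale (?\<mu> k + ?a i) p"
      by (simp add: h_def free.scale_left_distrib)
    also have "?\<mu> k + ?a i = ?\<mu> i" by (simp add: algebra_simps)
    finally show ?thesis using that by (simp add: Wt_def)
  qed
  have h_lin: "h (p + r) = h p + h r" "h (fscale b p) = fscale b (h p)" for p r b
    by (simp_all add: h_def distrib_left free.scale_right_distrib mult_fscale_right free.scale_right_diff_distrib mult.commute)
  have h_sum: "h (sum q F) = (\<Sum>i\<in>F. h (q i))"
    by (simp add: h_def sum_distrib_left free.scale_sum_right sum_subtractf)
  let ?r = "fscale c 1 + sum q (insert k F)"
  have hr: "h ?r \<in> N" unfolding h_def using N insert.prems(3) free.subspace_diff free.subspace_scale by blast
  have "h ?r = fscale c (h 1) + h (q k) + (\<Sum>i\<in>F. h (q i))"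
    using insert.hyps by (simp add: h_lin h_sum)
  then have eq: "h ?r - (fscale (c * ?a 0) 1 + (\<Sum>i\<in>F. fscale (?a i) (q i))) =
      fscale c (h 1 - fscale (?a 0) 1) + (h (q k) - fscale (?a k) (q k)) + (\<Sum>i\<in>F. h (q i) - fscale (?a i) (q i))"
    by (simp add: free.scale_right_diff_distrib sum_subtractf)
  have "h ?r - (fscale (c * ?a 0) 1 + (\<Sum>i\<in>F. fscale (?a i) (q i))) \<in> J"
    unfolding eq
    by (intro free.subspace_add[OF subspace_J] free.subspace_scale[OF subspace_J] free.subspace_sum[OF subspace_J] h one_Wt)
      (use insert.prems in auto)
  then have "h ?r - (h ?r - (fscale (c * ?a 0) 1 + (\<Sum>i\<in>F. fscale (?a i) (q i)))) \<in> N"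
    using hr N(2) free.subspace_diff[OF N(1)] by blast
  then have "fscale (c * ?a 0) 1 + (\<Sum>i\<in>F. fscale (?a i) (q i)) \<in> N" by (simp add: add.commute)
  then have "fscale (c * ?a 0) 1 \<in> N"
    by (rule insert.IH[rotated 2]) (use insert.prems free.subspace_scale[OF subspace_Wt] in auto)
  then have "fscale (1 / ?a 0) (fscale (c * ?a 0) 1) \<in> N" by (rule free.subspace_scale[OF N(1)])
  moreover have "?a 0 \<noteq> 0" using s insert.prems(1) by auto
  ultimately show ?case by simp
qed simp

lemma Ev_at_zero: "p \<in> FC \<Longrightarrow> Ev p 0 = 0"
  using Ev_mult[of p 0] by (simp add: Ev_zero)

text \<open>The kernel of evaluation at \<open>v0\<close>; its image in the Verma module will be the
  maximal submodule.\<close>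

definition K :: "vir_poly free_alg set" where
  "K = {p \<in> FC. Ev p v0 = 0}"

lemma subspace_K: "free.subspace K"
  by (rule free.subspaceI)
    (simp_all add: K_def free_carrier_zero free_carrier_add free_carrier_fscale Ev_zero Ev_add Ev_fscale)

lemma gen_K: "x \<in> \<gg> \<Longrightarrow> p \<in> K \<Longrightarrow> gen x * p \<in> K"
  by (simp add: K_def free_carrier_mult free_carrier_gen Ev_mult Ev_at_zero)

lemma J_K: "J \<subseteq> K"
  using J_carrier Ev_J by (auto simp: K_def)

lemma cyclic:
  assumes w: "w \<noteq> 0" shows "\<exists>u\<in>FC. Ev u w = v"
proof -
  let ?S = "(\<lambda>u. Ev u w) ` FC"
  have act: "act x y \<in> ?S" if "x \<in> \<gg>" "y \<in> ?S" for x y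
  proof -
    from that(2) obtain u where u: "y = Ev u w" "u \<in> FC" by (rule imageE)
    then have "act x y = Ev (gen x * u) w" using that(1) by (simp add: Ev_mult free_carrier_gen Ev_gen)
    then show ?thesis using free_carrier_mult[OF free_carrier_gen[OF that(1)] u(2)] by (rule image_eqI)
  qed
  have zero: "0 \<in> ?S" using Ev_zero[of w] free_carrier_zero by (metis imageI)
  have "?S = UNIV"
  proof (rule tvir_irr.irreducible[OF irr])
    show "subspace ?S"
      by (rule subspaceI) (use zero in \<open>auto simp flip: Ev_add Ev_fscale intro: free_carrier_add free_carrier_fscale\<close>)
    show "D i j y \<in> ?S" "Z j y \<in> ?S" if "y \<in> ?S" for i j y
      using act[OF carrier_el that] zero by (simp_all add: D_def Z_def)
    show "w \<in> ?S" using Ev_one[of w] free_carrier_one by (metis imageI)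
  qed (rule w)
  then obtain u where "v = Ev u w" "u \<in> FC" by (metis UNIV_I imageE)
  then show ?thesis by auto
qed

text \<open>By irreducibility some \<open>u\<close> carries the nonzero vector
  \<open>Ev p v0\<close> back to \<open>v0\<close>. Then \<open>u * p - 1\<close> lies in
  \<open>K\<close>, which contains no nonzero multiple of 1, so the top component of
  \<open>u * p\<close> is 1. Taking the top component inside \<open>N\<close> puts 1 into
  \<open>N\<close>.\<close>

lemma left_ideal_top:
  assumes N: "free.subspace N" "J \<subseteq> N" "\<And>x p. x \<in> \<gg> \<Longrightarrow> p \<in> N \<Longrightarrow> gen x * p \<in> N"
    and p: "p \<in> N" "p \<in> FC" "p \<notin> K"
  shows "FC \<subseteq> N"
proof -
  obtain u where u: "u \<in> FC" "Ev u (Ev p v0) = v0" using cyclic[of "Ev p v0" v0] p by (auto simp: K_def)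
  have "FC \<subseteq> {u. u * p \<in> N}"
  proof (rule free_carrier_minimal)
    show "free.subspace {u. u * p \<in> N}"
      by (rule free.subspaceI)
        (simp_all add: free.subspace_0[OF N(1)] distrib_right free.subspace_add[OF N(1)] fscale_mult_left
          free.subspace_scale[OF N(1)])
  qed (use N(3) p(1) in \<open>simp_all add: mult.assoc\<close>)
  then have up: "u * p \<in> N" using u by blast
  have Eup: "Ev (u * p) v0 = v0" using u by (simp add: Ev_mult)
  have upF: "u * p \<in> FC" by (rule free_carrier_mult[OF u(1) p(2)])
  from FC_decomposition[OF upF] obtain c F q
    where d: "finite F" "0 \<notin> F" "\<forall>k\<in>F. q k \<in> Wt k" "u * p = fscale c 1 + sum q F" by blast
  have "u * p - 1 \<in> K" using upF Eup free.subspace_diff[OF free_subspace_carrier upF free_carrier_one]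
    by (simp add: K_def Ev_diff Ev_one)
  also have "u * p - 1 = fscale (c - 1) 1 + sum q F" by (simp add: d(4) free.scale_left_diff_distrib)
  finally have K1: "fscale (c - 1) 1 + sum q F \<in> K" .
  have "fscale (c - 1) 1 \<in> K"
    by (rule top_component[OF subspace_K J_K gen_K[OF d0_carrier] d(1,2) _ K1]) (use d(3) in auto)
  then have "(c - 1) \<cdot> v0 = 0" by (simp add: K_def Ev_fscale Ev_one)
  then have c: "c = 1" using v0 by simp
  have "fscale c 1 \<in> N"
    by (rule top_component[OF N(1,2) N(3)[OF d0_carrier] d(1,2), of q]) (use d(3,4) up in auto)
  then have "1 \<in> N" using c by simp
  then show ?thesis by (rule free_carrier_minimal[OF N(1) _ N(3)])
qed

end

section \<open>The Verma module and its maximal submodule\<close>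

context hw_vector
begin

abbreviation Q :: "(vir_poly, vir_poly free_alg set) lmod" where
  "Q \<equiv> quotient_mod (free_mod (truncated_Vir n)) J"

definition cs :: "vir_poly free_alg \<Rightarrow> vir_poly free_alg set" where
  "cs p = (+) p ` J"

lemma mod_coset_J: "mod_coset (free_mod (truncated_Vir n)) J p = cs p"
  by (simp add: mod_coset_def free_mod_def cs_def)

lemma in_cs: "q \<in> cs p \<longleftrightarrow> q - p \<in> J"
  by (force simp: cs_def image_iff)

lemma cs_self: "p \<in> cs p"
  using free.subspace_0[OF subspace_J] by (simp add: in_cs)

lemma cs_eq: "cs p = cs q \<longleftrightarrow> p - q \<in> J"
proof
  assume "cs p = cs q"
  then show "p - q \<in> J" using cs_self[of p] by (simp add: in_cs)
next
  assume pq: "p - q \<in> J"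
  have "r - p \<in> J \<longleftrightarrow> r - q \<in> J" for r
    using free.subspace_add[OF subspace_J, of "r - p" "p - q"] free.subspace_diff[OF subspace_J, of "r - q" "p - q"] pq
    by auto
  then show "cs p = cs q" by (auto simp: in_cs)
qed

lemma cs_J: "p \<in> J \<Longrightarrow> cs p = J"
  using cs_eq[of p 0] by (simp add: cs_def)

lemma Q_carrier: "mcarrier Q = cs ` FC"
  by (simp add: quotient_mod_def mod_coset_J) (simp add: free_mod_def)

lemma Q_zero: "mzero Q = cs 0"
  using cs_J free.subspace_0[OF subspace_J] by (simp add: quotient_mod_def)

lemma Q_add: "madd Q (cs p) (cs q) = cs (p + q)"
proof -
  have "cs (v + w) = cs (p + q)" if "v \<in> cs p" "w \<in> cs q" for v w
    using free.subspace_add[OF subspace_J, of "v - p" "w - q"] that by (simp add: cs_eq in_cs algebra_simps)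
  then have "(\<Union>v\<in>cs p. \<Union>w\<in>cs q. cs (v + w)) = cs (p + q)" using cs_self by blast
  then show ?thesis by (simp add: quotient_mod_def mod_coset_J) (simp add: free_mod_def)
qed

lemma Q_scale: "mscale Q a (cs p) = cs (fscale a p)"
proof -
  have "cs (fscale a v) = cs (fscale a p)" if "v \<in> cs p" for v
    using free.subspace_scale[OF subspace_J, of "v - p" a] that by (simp add: cs_eq in_cs free.scale_right_diff_distrib)
  then have "(\<Union>v\<in>cs p. cs (fscale a v)) = cs (fscale a p)" using cs_self by blast
  then show ?thesis by (simp add: quotient_mod_def mod_coset_J) (simp add: free_mod_def)
qed

lemma Q_act: assumes x: "x \<in> \<gg>" shows "mact Q x (cs p) = cs (gen x * p)"
proof -
  have "cs (gen x * v) = cs (gen x * p)" if "v \<in> cs p" for v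
    using J_mult[OF free_carrier_gen[OF x], of "v - p"] that by (simp add: cs_eq in_cs right_diff_distrib)
  then have "(\<Union>v\<in>cs p. cs (gen x * v)) = cs (gen x * p)" using cs_self by blast
  then show ?thesis by (simp add: quotient_mod_def mod_coset_J) (simp add: free_mod_def)
qed

lemma cs_in_image: assumes M: "free.subspace M" "J \<subseteq> M" shows "cs p \<in> cs ` M \<longleftrightarrow> p \<in> M"
proof
  assume "cs p \<in> cs ` M"
  then obtain q where "cs p = cs q" "q \<in> M" by (rule imageE)
  then show "p \<in> M" using diff_add_in[OF M(1), of p q] M(2) by (auto simp: cs_eq)
qed (rule imageI)

lemma submod_K: "submod (truncated_Vir n) Q (cs ` K)"
  unfolding submod_def
proof (intro conjI ballI allI)
  show "cs ` K \<subseteq> mcarrier Q" unfolding Q_carrier by (rule image_mono) (auto simp: K_def)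
  show "mzero Q \<in> cs ` K" unfolding Q_zero using free.subspace_0[OF subspace_K] by (rule imageI)
next
  fix v w assume "v \<in> cs ` K" "w \<in> cs ` K"
  then obtain p q where "v = cs p" "p \<in> K" "w = cs q" "q \<in> K" by blast
  then show "madd Q v w \<in> cs ` K" using free.subspace_add[OF subspace_K, of p q] by (simp add: Q_add imageI)
next
  fix a v assume "v \<in> cs ` K"
  then obtain p where "v = cs p" "p \<in> K" by blast
  then show "mscale Q a v \<in> cs ` K" using free.subspace_scale[OF subspace_K, of p a] by (simp add: Q_scale imageI)
next
  fix x v assume x: "x \<in> \<gg>" and "v \<in> cs ` K"
  then obtain p where "v = cs p" "p \<in> K" by blast
  then show "mact Q x v \<in> cs ` K" using gen_K[OF x, of p] by (simp add: Q_act[OF x] imageI)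
qed

lemma proper_submod:
  assumes P: "submod (truncated_Vir n) Q P" "P \<noteq> mcarrier Q"
  shows "P \<subseteq> cs ` K"
proof (rule ccontr)
  define N where "N = {p \<in> FC. cs p \<in> P}"
  have sub: "free.subspace N"
  proof (rule free.subspaceI)
    show "0 \<in> N" using P(1) by (simp add: N_def submod_def free_carrier_zero flip: Q_zero)
    show "p + q \<in> N" if "p \<in> N" "q \<in> N" for p q
      using P(1) that by (simp add: N_def submod_def free_carrier_add flip: Q_add)
    show "fscale c p \<in> N" if "p \<in> N" for c p
      using P(1) that by (simp add: N_def submod_def free_carrier_fscale flip: Q_scale)
  qed
  have J: "J \<subseteq> N"
  proof
    fix p assume p: "p \<in> J"
    then have "cs p = mzero Q" by (simp add: cs_J Q_zero free.subspace_0[OF subspace_J])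
    then show "p \<in> N" using p P(1) J_carrier by (auto simp: N_def submod_def)
  qed
  have gen: "gen x * p \<in> N" if x: "x \<in> \<gg>" and "p \<in> N" for x p
    using P(1) that by (simp add: N_def submod_def free_carrier_mult free_carrier_gen flip: Q_act[OF x])
  assume "\<not> P \<subseteq> cs ` K"
  then obtain A where A: "A \<in> P" "A \<notin> cs ` K" by blast
  then obtain p where "A = cs p" "p \<in> FC" using P(1) unfolding submod_def Q_carrier by blast
  then have "FC \<subseteq> N" using A by (intro left_ideal_top[OF sub J gen, of p]) (auto simp: N_def)
  then have "mcarrier Q \<subseteq> P" unfolding Q_carrier N_def by blast
  then show False using P by (auto simp: submod_def)
qed

text \<open>Evaluates the definite description in \<open>simple_quotient\<close>: every proper
  submodule lies in \<open>cs\<close> followed by the image of \<open>K\<close>, and that image is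
  itself proper because \<open>v0\<close> is nonzero.\<close>

lemma maximal_submod_iff: "maximal_submod (truncated_Vir n) Q P \<longleftrightarrow> P = cs ` K"
proof -
  have "1 \<notin> K" using v0 by (simp add: K_def Ev_one)
  then have "cs 1 \<notin> cs ` K" by (simp add: cs_in_image[OF subspace_K J_K])
  then have proper: "cs ` K \<noteq> mcarrier Q" unfolding Q_carrier using free_carrier_one by (metis imageI)
  show ?thesis
  proof
    assume P: "maximal_submod (truncated_Vir n) Q P"
    then have "P \<subseteq> cs ` K" by (intro proper_submod) (auto simp: maximal_submod_def)
    then show "P = cs ` K" using P submod_K proper unfolding maximal_submod_def by metis
  next
    assume "P = cs ` K"
    then show "maximal_submod (truncated_Vir n) Q P"
      using submod_K proper proper_submod unfolding maximal_submod_def by (metis subset_antisym)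
  qed
qed

theorem iso_simple_quotient:
  "iso_mod (truncated_Vir n) (full_mod scale act) (simple_quotient (truncated_Vir n) (verma n (one_sided n s) \<phi>))"
proof -
  have V: "verma n (one_sided n s) \<phi> = Q"
    by (simp add: verma_def induced_mod_def J_def R_def B_def)
  have "(THE P. maximal_submod (truncated_Vir n) Q P) = cs ` K"
    by (simp add: maximal_submod_iff)
  then have S: "simple_quotient (truncated_Vir n) (verma n (one_sided n s) \<phi>) = quotient_mod Q (cs ` K)"
    by (simp add: simple_quotient_def V)
  \<comment> \<open>Any representative will do, because evaluation at \<open>v0\<close> kills
    \<open>J\<close>.\<close>
  define f where "f A = Ev (SOME p. p \<in> A) v0" for A
  have f: "f (cs p) = Ev p v0" for p
  proof -
    have "(SOME q. q \<in> cs p) \<in> cs p" using cs_self by (rule someI)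
    then have "Ev ((SOME q. q \<in> cs p) - p) v0 = 0" unfolding in_cs by (rule Ev_J)
    then show ?thesis by (simp add: f_def Ev_diff)
  qed
  show ?thesis unfolding S
  proof (rule quotient_iso[where f = f])
    fix A C assume "A \<in> mcarrier Q" "C \<in> mcarrier Q"
    then obtain p q where "A = cs p" "p \<in> FC" "C = cs q" "q \<in> FC" unfolding Q_carrier by blast
    then show "madd Q A C \<in> mcarrier Q \<and> f (madd Q A C) = f A + f C"
      unfolding Q_carrier by (simp add: Q_add f Ev_add free_carrier_add)
  next
    fix a A assume "A \<in> mcarrier Q"
    then obtain p where "A = cs p" "p \<in> FC" unfolding Q_carrier by blast
    then show "mscale Q a A \<in> mcarrier Q \<and> f (mscale Q a A) = a \<cdot> f A"
      unfolding Q_carrier by (simp add: Q_scale f Ev_fscale free_carrier_fscale)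
  next
    fix x A assume x: "x \<in> \<gg>" and "A \<in> mcarrier Q"
    then obtain p where "A = cs p" "p \<in> FC" unfolding Q_carrier by blast
    then show "mact Q x A \<in> mcarrier Q \<and> f (mact Q x A) = act x (f A)"
      unfolding Q_carrier using x by (simp add: Q_act f Ev_mult Ev_gen free_carrier_mult free_carrier_gen)
  next
    show "f ` mcarrier Q = UNIV"
    proof -
      have "v \<in> f ` mcarrier Q" for v
      proof -
        obtain u where "u \<in> FC" "Ev u v0 = v" using cyclic[OF v0] by blast
        then show ?thesis unfolding Q_carrier image_image f by blast
      qed
      then show ?thesis by blast
    qed
  next
    fix A assume "A \<in> mcarrier Q"
    then obtain p where p: "A = cs p" "p \<in> FC" unfolding Q_carrier by blast
    have "mod_coset Q (cs ` K) A = cs ` (+) p ` K"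
      by (simp add: mod_coset_def p(1) image_image Q_add)
    also have "(+) p ` K = {q \<in> FC. Ev q v0 = Ev p v0}"
    proof (intro equalityI subsetI)
      fix q assume "q \<in> (+) p ` K"
      then show "q \<in> {q \<in> FC. Ev q v0 = Ev p v0}" using p(2) by (auto simp: K_def free_carrier_add Ev_add)
    next
      fix q assume "q \<in> {q \<in> FC. Ev q v0 = Ev p v0}"
      then have "q - p \<in> K" using p(2) free.subspace_diff[OF free_subspace_carrier, of q _ p] by (simp add: K_def Ev_diff)
      then have "p + (q - p) \<in> (+) p ` K" by (rule imageI)
      then show "q \<in> (+) p ` K" by simp
    qed
    also have "cs ` {q \<in> FC. Ev q v0 = Ev p v0} = {C \<in> mcarrier Q. f C = f A}"
      unfolding Q_carrier p(1) by (auto simp: f)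
    finally show "mod_coset Q (cs ` K) A = {C \<in> mcarrier Q. f C = f A}" .
  qed
qed

end

section \<open>Extremal vectors give highest and lowest weight modules\<close>

context tv_module
begin

lemma highest_weight:
  assumes irr: "tvir_irr scale n D Z" and v: "v \<noteq> 0" "\<forall>i\<ge>m. \<forall>j. D i j v = 0"
  shows "highest_weight_module n (full_mod scale act)"
proof -
  obtain w where w: "w \<noteq> 0" "killed 1 w" "\<forall>j. \<exists>\<kappa>. D 0 j w = \<kappa> \<cdot> w" "\<forall>j. \<exists>\<kappa>. Z j w = \<kappa> \<cdot> w"
    using tvir_irr.highest_vector[OF irr, of v m] v by (auto simp: killed_def)
  interpret hw_vector scale n act 1 w
    by (rule hw_vector.intro[OF tv_module_axioms hw_vector_axioms.intro[OF irr _ w(1)]])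
      (use w in \<open>auto simp: killed_def\<close>)
  have "tv_pos n = one_sided n 1" by (simp add: tv_pos_def one_sided_def)
  then show ?thesis unfolding highest_weight_module_def using iso_simple_quotient \<phi>_linear by metis
qed

text \<open>A highest weight vector of the twisted module is a lowest weight vector of the given
  one; only the signs of the eigenvalues change.\<close>

lemma lowest_weight:
  assumes irr: "tvir_irr scale n D Z" and v: "v \<noteq> 0" "\<forall>i\<le>m. \<forall>j. D i j v = 0"
  shows "lowest_weight_module n (full_mod scale act)"
proof -
  interpret t: tvir_irr scale n "\<lambda>i j v. - D (- i) j v" "\<lambda>j v. - Z j v" by (rule tvir_irr.twist[OF irr])
  have "t.killed (- m) v" using v(2) by (simp add: t.killed_def)
  from t.highest_vector[OF v(1) this] obtain w
    where w: "w \<noteq> 0" "t.killed 1 w" "\<forall>j. \<exists>\<kappa>. - D 0 j w = \<kappa> \<cdot> w" "\<forall>j. \<exists>\<kappa>. - Z j w = \<kappa> \<cdot> w"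
    by auto
  have neg: "\<exists>\<kappa>. u = \<kappa> \<cdot> w" if ex: "\<exists>\<kappa>. - u = \<kappa> \<cdot> w" for u
  proof -
    from ex obtain \<kappa> where "- u = \<kappa> \<cdot> w" ..
    then have "u = (- \<kappa>) \<cdot> w" by (metis minus_minus scale_minus_left)
    then show ?thesis ..
  qed
  have w0: "D i j w = 0" if "- 1 * i > 0" for i j
    using w(2)[unfolded t.killed_def, rule_format, of "- i" j] that by simp
  interpret hw_vector scale n act "- 1" w
    by (rule hw_vector.intro[OF tv_module_axioms hw_vector_axioms.intro[OF irr _ w(1)]])
      (use w0 neg w(3,4) in blast)+
  have "tv_neg n = one_sided n (- 1)" by (simp add: tv_neg_def one_sided_def)
  then show ?thesis unfolding lowest_weight_module_def using iso_simple_quotient \<phi>_linear by metis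
qed

end

theorem theorem4p6:
  fixes n :: nat
    and scale :: "complex \<Rightarrow> 'v::ab_group_add \<Rightarrow> 'v"
    and act :: "vir_poly \<Rightarrow> 'v \<Rightarrow> 'v"
  assumes "n \<ge> 1"
    and "lie_module (truncated_Vir n) scale act"
    and "irreducible_mod (truncated_Vir n) (full_mod scale act)"
    and "harish_chandra scale act"
  shows "highest_weight_module n (full_mod scale act) \<or>
         lowest_weight_module n (full_mod scale act) \<or>
         (\<exists>a b. iso_Vab' (full_mod scale (\<lambda>x. act (vir_incl x))) a b \<and>
                (\<forall>x\<in>t_part. \<forall>v. act (vp_trunc n x) v = 0))"
proof -
  interpret tv_module scale n act
    using assms(1,2) by (intro tv_module.intro complex_vector_space.intro tv_module_axioms.intro) (simp_all add: lie_module_def)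
  have irr: "tvir_irr scale n D Z" by (rule tvir_irrI[OF assms(3,4)])
  consider (highest) v m where "v \<noteq> 0 \<and> (\<forall>i\<ge>m. \<forall>j. D i j v = 0)"
    | (lowest) v m where "v \<noteq> 0 \<and> (\<forall>i\<le>m. \<forall>j. D i j v = 0)"
    | (intermediate) \<mu> b e S where "span (\<Union>m::int. W (\<mu> + of_int m)) = UNIV \<and>
      (\<forall>m\<in>S. e m \<in> W (\<mu> + of_int m) \<and> e m \<noteq> 0) \<and>
      (\<forall>m. m \<notin> S \<longrightarrow> W (\<mu> + of_int m) = {0}) \<and> (\<forall>m\<in>S. \<forall>u\<in>W (\<mu> + of_int m). \<exists>a. u = scale a (e m)) \<and>
      (\<forall>m\<in>S. \<forall>k. D k 0 (e m) = (if m + k \<in> S then scale (\<mu> + of_int m + of_int k * b) (e (m + k)) else 0)) \<and>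
      (\<forall>i j v. j \<ge> 1 \<longrightarrow> D i j v = 0) \<and> (\<forall>j v. Z j v = 0) \<and>
      (S = UNIV \<or> (\<exists>m0. S = - {m0} \<and> b = 1 \<and> \<mu> = - of_int m0))"
    using tvir_irr.classification[OF irr]
    by (elim disjE exE) (rule that(1), assumption | rule that(2), assumption | rule that(3), assumption)+
  then show ?thesis
  proof cases
    case highest
    then show ?thesis using highest_weight[OF irr, of v m] by simp
  next
    case lowest
    then show ?thesis using lowest_weight[OF irr, of v m] by simp
  next
    case intermediate
    then have "\<exists>a b. iso_Vab' (full_mod scale (\<lambda>x. act (vir_incl x))) a b"
      by (elim conjE) (rule intermediate_series[OF irr, where \<mu> = \<mu> and b = b and e = e and S = S]; assumption)
    moreover have "act (vp_trunc n x) v = 0" if "x \<in> t_part" for x v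
      by (rule t_part_act_zero[OF _ _ that]) (use intermediate in \<open>(elim conjE, simp)+\<close>)
    ultimately show ?thesis by blast
  qed
qed

end
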